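(* Let $A\mathcal{H}$ be the operator on $X=L^2([0,\infty);\mathbb{F}^d)$ given by $$A\mathcal{H}x=P_0\mathcal{H}x+P_1\frac{\partial}{\partial\zeta}(\mathcal{H}x),\qquad D(A\mathcal{H})=\{x\in L^2([0,\infty);\mathbb{F}^d)\mid \mathcal{H}x\in\mathcal{W}^{1,2}([0,\infty);\mathbb{F}^d),\ \hat W_B(\mathcal{H}x)(0)=0\},$$ where $\hat W_B\in\mathbb{F}^{k\times d}$ with $k\le n_2$ has full row rank. Then the following statements are equivalent: 1. $A\mathcal{H}$ generates a contraction semigroup on $(X,\langle\cdot,\mathcal{H}\cdot\rangle)$; 2. $\operatorname{Re}\langle Ax,x\rangle\le 0$ for every $x\in D(A)$; 3. $\operatorname{Re}P_0\le 0$ and $y^*P_1y\ge 0$ for every $y\in\ker\hat W_B$; 4. $\operatorname{Re}P_0\le 0$, $k=n_2$ and $\hat W_B=B\begin{bmatrix}U&I\end{bmatrix}S$ with $B\in\mathbb{F}^{n_2\times n_2}$ invertible, $U\in\mathbb{F}^{n_2\times n_1}$ and $\Lambda+U^*\Theta U\ge 0$.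
   Context: $\mathbb{F}=\mathbb{R}$ or $\mathbb{F}=\mathbb{C}$. $P_1$ is an invertible Hermitian $d\times d$ matrix over $\mathbb{F}$, $P_0\in\mathbb{F}^{d\times d}$, and $k\in\{0,1,\dots,d\}$. For a.e. $\zeta\in[0,\infty)$, $\mathcal{H}(\zeta)\in\mathbb{F}^{d\times d}$ is positive definite, and $\mathcal{H},\mathcal{H}^{-1}\in L^\infty([0,\infty);\mathbb{F}^{d\times d})$; $\mathcal{H}$ also denotes the induced multiplication operator. $\langle\cdot,\cdot\rangle$ is the standard inner product of $L^2([0,\infty);\mathbb{F}^d)$ and $(X,\langle\cdot,\mathcal{H}\cdot\rangle)$ is $X$ with inner product $(x,z)\mapsto\langle x,\mathcal{H}z\rangle$. The operator $A$ is $Ax=P_0x+P_1\frac{\partial x}{\partial\zeta}$ with $D(A)=\{x\in\mathcal{W}^{1,2}([0,\infty);\mathbb{F}^d)\mid\hat W_Bx(0)=0\}$, where $\mathcal{W}^{1,2}$ is the Sobolev space of order one. $n_1$ is the number of positive and $n_2=d-n_1$ the number of negative eigenvalues of $P_1$ (counted with multiplicity), and one fixes a factorization $P_1=S^{-1}\begin{bmatrix}\Lambda&0\\0&\Theta\end{bmatrix}S$ with $S\in\mathbb{F}^{d\times d}$ unitary, $\Lambda\in\mathbb{R}^{n_1\times n_1}$ a positive definite diagonal matrix and $\Theta\in\mathbb{R}^{n_2\times n_2}$ a negative definite diagonal matrix. $\operatorname{Re}P_0=\frac12(P_0+P_0^* )$; $\le0$, $\ge0$ for matrices mean negative, respectively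 positive, semi-definite. A contraction semigroup is a $C_0$-semigroup of contractions. *)

theory Defs
  imports
    "HOL-Analysis.Analysis"
    "Jordan_Normal_Form.Schur_Decomposition"
    "Jordan_Normal_Form.DL_Rank"
    "Jordan_Normal_Form.Matrix_Kernel"
begin

(* HOL-Analysis and Jordan_Normal_Form share some notation and names. *)
unbundle no inner_syntax
unbundle no vec_syntax
hide_type (open) Finite_Cartesian_Product.vec
hide_const (open) Finite_Cartesian_Product.vec Finite_Cartesian_Product.row
  Determinants.det Cartesian_Space.rank Coset.order


section \<open>The scalar field: real or complex numbers\<close>

text \<open>
  Up to isomorphism, the instances of this class are exactly \<open>real\<close> and \<open>complex\<close>, with
  their conjugation, modulus and real part \<open>inner z 1\<close> (see the instances and
  \<open>real_or_complex_cases\<close> below). As usual, \<open>a \<le> b\<close> means that \<open>b - a\<close> is a nonnegative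
  real number.
\<close>

class real_or_complex = conjugatable_ordered_field + real_normed_field + euclidean_space +
  assumes mult_conjugate': "z * conjugate z = (norm z)\<^sup>2 *\<^sub>R 1"
    and add_conjugate': "z + conjugate z = (2 * inner z 1) *\<^sub>R 1"
    and less_eq_iff': "a \<le> b \<longleftrightarrow> (\<exists>r\<ge>0. b - a = r *\<^sub>R 1)"

lemma
  fixes z a b :: "'f::real_or_complex"
  shows mult_conjugate: "z * conjugate z = of_real ((norm z)\<^sup>2)"
    and add_conjugate: "z + conjugate z = of_real (2 * inner z 1)"
    and less_eq_iff_of_real: "a \<le> b \<longleftrightarrow> (\<exists>r\<ge>0. b - a = of_real r)"
  by (simp_all add: of_real_def mult_conjugate' add_conjugate' less_eq_iff'[of a b])

definition re :: "'f::real_or_complex \<Rightarrow> real" where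
  "re z = inner z 1"

instance real :: real_or_complex
  by standard (auto simp: power2_eq_square intro: exI[of _ "_ - _"])

instance complex :: real_or_complex
proof
  fix z a b :: complex
  show "z * conjugate z = (norm z)\<^sup>2 *\<^sub>R 1"
    by (simp add: complex_norm_square[symmetric] scaleR_conv_of_real)
  show "z + conjugate z = (2 * inner z 1) *\<^sub>R 1"
    by (simp add: complex_add_cnj inner_complex_def scaleR_conv_of_real)
  show "a \<le> b \<longleftrightarrow> (\<exists>r\<ge>0. b - a = r *\<^sub>R 1)"
    by (auto simp: less_eq_complex_def complex_eq_iff intro!: exI[of _ "Re b - Re a"])
qed

lemma re_real [simp]: "re (x::real) = x"
  by (simp add: re_def)

lemma re_complex [simp]: "re (z::complex) = Re z"
  by (simp add: re_def inner_complex_def)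

lemma real_or_complex_cases:
  "(\<forall>z::'f::real_or_complex. \<exists>a. z = of_real a) \<or>
   (\<exists>i::'f. i * i = -1 \<and> (\<forall>z. \<exists>a b. z = of_real a + of_real b * i))"
proof -
  have im: "(z - of_real (re z)) * (z - of_real (re z)) = - of_real (norm (z - of_real (re z))^2)"
    for z :: 'f
  proof -
    let ?w = "z - of_real (re z)"
    have "inner ?w 1 = 0"
      by (simp add: re_def inner_diff_left of_real_def power2_norm_eq_inner[symmetric])
    with add_conjugate[of ?w] have "conjugate ?w = - ?w"
      by (simp add: add_eq_0_iff)
    with mult_conjugate[of ?w] show ?thesis
      by (metis minus_minus mult_minus_right)
  qed
  show ?thesis
  proof (cases "\<forall>z::'f. \<exists>a. z = of_real a")
    case False
    then obtain z :: 'f where z: "\<And>a. z \<noteq> of_real a" by blast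
    define w where "w = z - of_real (re z)"
    define i where "i = w / of_real (norm w)"
    have "w \<noteq> 0" using z by (simp add: w_def)
    then have ii: "i * i = -1"
      using im[of z] unfolding w_def[symmetric] i_def
      by (simp add: power2_eq_square divide_simps)
    have "\<exists>a b. y = of_real a + of_real b * i" for y :: 'f
    proof -
      let ?v = "y - of_real (re y)"
      have "(?v - of_real (norm ?v) * i) * (?v + of_real (norm ?v) * i)
          = ?v * ?v - of_real (norm ?v) * of_real (norm ?v) * (i * i)"
        by (simp add: algebra_simps)
      also have "\<dots> = 0"
        using im[of y] ii by (simp add: power2_eq_square)
      finally have "?v = of_real (norm ?v) * i \<or> ?v = of_real (- norm ?v) * i"
        by (auto simp: add_eq_0_iff)
      then show ?thesis
        by (metis add_diff_cancel_left' diff_add_cancel add.commute)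
    qed
    with ii show ?thesis by blast
  qed blast
qed


section \<open>Matrices\<close>

definition hermitian_mat :: "nat \<Rightarrow> 'f::real_or_complex mat \<Rightarrow> bool" where
  "hermitian_mat n M \<longleftrightarrow> M \<in> carrier_mat n n \<and> mat_adjoint M = M"

definition unitary_mat :: "nat \<Rightarrow> 'f::real_or_complex mat \<Rightarrow> bool" where
  "unitary_mat n M \<longleftrightarrow> M \<in> carrier_mat n n \<and> mat_adjoint M * M = 1\<^sub>m n \<and> M * mat_adjoint M = 1\<^sub>m n"

(* The scalar  y^* M y  is (M *\<^sub>v y) \<bullet>c y. *)
definition pos_def_mat :: "nat \<Rightarrow> 'f::real_or_complex mat \<Rightarrow> bool" where
  "pos_def_mat n M \<longleftrightarrow> hermitian_mat n M \<and> (\<forall>v\<in>carrier_vec n. v \<noteq> 0\<^sub>v n \<longrightarrow> 0 < (M *\<^sub>v v) \<bullet>c v)"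

definition neg_def_mat :: "nat \<Rightarrow> 'f::real_or_complex mat \<Rightarrow> bool" where
  "neg_def_mat n M \<longleftrightarrow> hermitian_mat n M \<and> (\<forall>v\<in>carrier_vec n. v \<noteq> 0\<^sub>v n \<longrightarrow> (M *\<^sub>v v) \<bullet>c v < 0)"

definition pos_semidef_mat :: "nat \<Rightarrow> 'f::real_or_complex mat \<Rightarrow> bool" where
  "pos_semidef_mat n M \<longleftrightarrow> hermitian_mat n M \<and> (\<forall>v\<in>carrier_vec n. 0 \<le> (M *\<^sub>v v) \<bullet>c v)"

definition neg_semidef_mat :: "nat \<Rightarrow> 'f::real_or_complex mat \<Rightarrow> bool" where
  "neg_semidef_mat n M \<longleftrightarrow> hermitian_mat n M \<and> (\<forall>v\<in>carrier_vec n. (M *\<^sub>v v) \<bullet>c v \<le> 0)"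

definition Re_mat :: "'f::real_or_complex mat \<Rightarrow> 'f mat" where
  "Re_mat M = (1/2) \<cdot>\<^sub>m (M + mat_adjoint M)"

definition num_pos_eigenvalues :: "'f::real_or_complex mat \<Rightarrow> nat" where
  "num_pos_eigenvalues M = (\<Sum>l\<in>{l. eigenvalue M l \<and> 0 < l}. Polynomial.order l (char_poly M))"

definition num_neg_eigenvalues :: "'f::real_or_complex mat \<Rightarrow> nat" where
  "num_neg_eigenvalues M = (\<Sum>l\<in>{l. eigenvalue M l \<and> l < 0}. Polynomial.order l (char_poly M))"

(* the block matrices [M N] and diag(M, N) *)
definition append_cols :: "'f::zero mat \<Rightarrow> 'f mat \<Rightarrow> 'f mat" where
  "append_cols M N = four_block_mat M N (0\<^sub>m 0 (dim_col M)) (0\<^sub>m 0 (dim_col N))"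

definition block_diag :: "'f::zero mat \<Rightarrow> 'f mat \<Rightarrow> 'f mat" where
  "block_diag M N =
    four_block_mat M (0\<^sub>m (dim_row M) (dim_col N)) (0\<^sub>m (dim_row N) (dim_col M)) N"


section \<open>Function spaces on the half-line\<close>

text \<open>
  Elements of the function spaces are represented by functions on \<open>real\<close>, of which only the
  values on \<open>{0..}\<close> matter; two functions represent the same element iff they are related by
  \<open>ae_eq\<close>.
\<close>

abbreviation half_line :: "real measure" where
  "half_line \<equiv> lebesgue_on {0..}"

definition ae_eq :: "(real \<Rightarrow> 'f::real_or_complex vec) \<Rightarrow> (real \<Rightarrow> 'f vec) \<Rightarrow> bool" where
  "ae_eq x z \<longleftrightarrow> (AE \<zeta> in half_line. x \<zeta> = z \<zeta>)"

definition L2 :: "nat \<Rightarrow> (real \<Rightarrow> 'f::real_or_complex vec) set" where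
  "L2 d = {x. (\<forall>\<zeta>\<ge>0. x \<zeta> \<in> carrier_vec d) \<and>
    (\<forall>i<d. (\<lambda>\<zeta>. x \<zeta> $ i) \<in> borel_measurable half_line \<and>
           integrable half_line (\<lambda>\<zeta>. (norm (x \<zeta> $ i))\<^sup>2))}"

definition L2_inner :: "(real \<Rightarrow> 'f::real_or_complex vec) \<Rightarrow> (real \<Rightarrow> 'f vec) \<Rightarrow> 'f" where
  "L2_inner x z = (LINT \<zeta>|half_line. x \<zeta> \<bullet>c z \<zeta>)"

definition Linf_mat :: "nat \<Rightarrow> (real \<Rightarrow> 'f::real_or_complex mat) \<Rightarrow> bool" where
  "Linf_mat d M \<longleftrightarrow> (\<forall>\<zeta>\<ge>0. M \<zeta> \<in> carrier_mat d d) \<and>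
    (\<forall>i<d. \<forall>j<d. (\<lambda>\<zeta>. M \<zeta> $$ (i, j)) \<in> borel_measurable half_line \<and>
                 (\<exists>C. AE \<zeta> in half_line. norm (M \<zeta> $$ (i, j)) \<le> C))"

definition mult_op ::
    "(real \<Rightarrow> 'f::real_or_complex mat) \<Rightarrow> (real \<Rightarrow> 'f vec) \<Rightarrow> real \<Rightarrow> 'f vec" where
  "mult_op M x = (\<lambda>\<zeta>. M \<zeta> *\<^sub>v x \<zeta>)"

text \<open>\<open>C\<^sup>1\<close> functions with compact support in the open half-line, with their derivatives.\<close>

definition test_function :: "(real \<Rightarrow> real) \<Rightarrow> (real \<Rightarrow> real) \<Rightarrow> bool" where
  "test_function \<phi> \<phi>' \<longleftrightarrow>
    (\<forall>\<zeta>. (\<phi> has_real_derivative \<phi>' \<zeta>) (at \<zeta>)) \<and> continuous_on UNIV \<phi>' \<and>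
    (\<exists>a b. 0 < a \<and> (\<forall>\<zeta>. \<zeta> \<notin> {a..b} \<longrightarrow> \<phi> \<zeta> = 0))"

definition is_weak_deriv ::
    "nat \<Rightarrow> (real \<Rightarrow> 'f::real_or_complex vec) \<Rightarrow> (real \<Rightarrow> 'f vec) \<Rightarrow> bool" where
  "is_weak_deriv d x g \<longleftrightarrow> (\<forall>\<phi> \<phi>'. test_function \<phi> \<phi>' \<longrightarrow>
    (\<forall>i<d. (LINT \<zeta>|half_line. \<phi>' \<zeta> *\<^sub>R (x \<zeta> $ i)) = - (LINT \<zeta>|half_line. \<phi> \<zeta> *\<^sub>R (g \<zeta> $ i))))"

definition W12 :: "nat \<Rightarrow> (real \<Rightarrow> 'f::real_or_complex vec) set" where
  "W12 d = {x \<in> L2 d. \<exists>g \<in> L2 d. is_weak_deriv d x g}"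

(* For x in W12 d, this is determined up to ae_eq. *)
definition weak_deriv :: "nat \<Rightarrow> (real \<Rightarrow> 'f::real_or_complex vec) \<Rightarrow> real \<Rightarrow> 'f vec" where
  "weak_deriv d x = (SOME g. g \<in> L2 d \<and> is_weak_deriv d x g)"

text \<open>
  For \<open>x \<in> W12 d\<close>, the value \<open>x(0)\<close> is the value at 0 of the continuous representative of \<open>x\<close>.
\<close>

definition trace0 :: "nat \<Rightarrow> (real \<Rightarrow> 'f::real_or_complex vec) \<Rightarrow> 'f vec" where
  "trace0 d x = Matrix.vec d (\<lambda>i. THE c. \<exists>u. continuous_on {0..} u \<and>
    (AE \<zeta> in half_line. x \<zeta> $ i = u \<zeta>) \<and> u 0 = c)"


section \<open>Semigroups on \<open>L2 d\<close> and their generators\<close>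

text \<open>
  The parameter \<open>ip\<close> is an inner product on \<open>L2 d\<close> for which \<open>ip x x = 0\<close> iff \<open>x\<close> is null
  almost everywhere.
\<close>

definition ip_norm ::
    "((real \<Rightarrow> 'f::real_or_complex vec) \<Rightarrow> (real \<Rightarrow> 'f vec) \<Rightarrow> 'f) \<Rightarrow> (real \<Rightarrow> 'f vec) \<Rightarrow> real" where
  "ip_norm ip x = sqrt (re (ip x x))"

definition C0_semigroup ::
    "nat \<Rightarrow> ((real \<Rightarrow> 'f::real_or_complex vec) \<Rightarrow> (real \<Rightarrow> 'f vec) \<Rightarrow> 'f) \<Rightarrow>
     (real \<Rightarrow> (real \<Rightarrow> 'f vec) \<Rightarrow> (real \<Rightarrow> 'f vec)) \<Rightarrow> bool" where
  "C0_semigroup d ip T \<longleftrightarrow>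
    (\<forall>t\<ge>0. \<forall>x\<in>L2 d. T t x \<in> L2 d) \<and>
    (\<forall>t\<ge>0. \<forall>x\<in>L2 d. \<forall>z\<in>L2 d. ae_eq x z \<longrightarrow> ae_eq (T t x) (T t z)) \<and>
    (\<forall>t\<ge>0. \<forall>x\<in>L2 d. \<forall>z\<in>L2 d. \<forall>a.
      ae_eq (T t (\<lambda>\<zeta>. a \<cdot>\<^sub>v x \<zeta> + z \<zeta>)) (\<lambda>\<zeta>. a \<cdot>\<^sub>v T t x \<zeta> + T t z \<zeta>)) \<and>
    (\<forall>t\<ge>0. \<exists>C. \<forall>x\<in>L2 d. ip_norm ip (T t x) \<le> C * ip_norm ip x) \<and>
    (\<forall>x\<in>L2 d. ae_eq (T 0 x) x) \<and>
    (\<forall>s\<ge>0. \<forall>t\<ge>0. \<forall>x\<in>L2 d. ae_eq (T (s + t) x) (T s (T t x))) \<and>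
    (\<forall>x\<in>L2 d. ((\<lambda>t. ip_norm ip (\<lambda>\<zeta>. T t x \<zeta> - x \<zeta>)) \<longlongrightarrow> 0) (at_right 0))"

definition contraction_semigroup ::
    "nat \<Rightarrow> ((real \<Rightarrow> 'f::real_or_complex vec) \<Rightarrow> (real \<Rightarrow> 'f vec) \<Rightarrow> 'f) \<Rightarrow>
     (real \<Rightarrow> (real \<Rightarrow> 'f vec) \<Rightarrow> (real \<Rightarrow> 'f vec)) \<Rightarrow> bool" where
  "contraction_semigroup d ip T \<longleftrightarrow>
    C0_semigroup d ip T \<and> (\<forall>t\<ge>0. \<forall>x\<in>L2 d. ip_norm ip (T t x) \<le> ip_norm ip x)"

text \<open>\<open>(T(t) x - x) / t\<close> tends to \<open>y\<close> as \<open>t\<close> decreases to 0.\<close>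

definition semigroup_deriv ::
    "((real \<Rightarrow> 'f::real_or_complex vec) \<Rightarrow> (real \<Rightarrow> 'f vec) \<Rightarrow> 'f) \<Rightarrow>
     (real \<Rightarrow> (real \<Rightarrow> 'f vec) \<Rightarrow> (real \<Rightarrow> 'f vec)) \<Rightarrow> (real \<Rightarrow> 'f vec) \<Rightarrow> (real \<Rightarrow> 'f vec) \<Rightarrow> bool" where
  "semigroup_deriv ip T x y \<longleftrightarrow>
    ((\<lambda>t. ip_norm ip (\<lambda>\<zeta>. of_real (1 / t) \<cdot>\<^sub>v (T t x \<zeta> - x \<zeta>) - y \<zeta>)) \<longlongrightarrow> 0) (at_right 0)"

definition is_generator ::
    "nat \<Rightarrow> ((real \<Rightarrow> 'f::real_or_complex vec) \<Rightarrow> (real \<Rightarrow> 'f vec) \<Rightarrow> 'f) \<Rightarrow>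
     (real \<Rightarrow> (real \<Rightarrow> 'f vec) \<Rightarrow> (real \<Rightarrow> 'f vec)) \<Rightarrow>
     (real \<Rightarrow> 'f vec) set \<Rightarrow> ((real \<Rightarrow> 'f vec) \<Rightarrow> (real \<Rightarrow> 'f vec)) \<Rightarrow> bool" where
  "is_generator d ip T D A \<longleftrightarrow>
    D = {x \<in> L2 d. \<exists>y \<in> L2 d. semigroup_deriv ip T x y} \<and>
    (\<forall>x\<in>D. A x \<in> L2 d \<and> semigroup_deriv ip T x (A x))"

definition generates_contraction_semigroup ::
    "nat \<Rightarrow> ((real \<Rightarrow> 'f::real_or_complex vec) \<Rightarrow> (real \<Rightarrow> 'f vec) \<Rightarrow> 'f) \<Rightarrow>
     (real \<Rightarrow> 'f vec) set \<Rightarrow> ((real \<Rightarrow> 'f vec) \<Rightarrow> (real \<Rightarrow> 'f vec)) \<Rightarrow> bool" where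
  "generates_contraction_semigroup d ip D A \<longleftrightarrow>
    (\<exists>T. contraction_semigroup d ip T \<and> is_generator d ip T D A)"


section \<open>The port-Hamiltonian operators\<close>

definition A_dom :: "nat \<Rightarrow> nat \<Rightarrow> 'f::real_or_complex mat \<Rightarrow> (real \<Rightarrow> 'f vec) set" where
  "A_dom d k WB = {x \<in> W12 d. WB *\<^sub>v trace0 d x = 0\<^sub>v k}"

definition A_op ::
    "nat \<Rightarrow> 'f::real_or_complex mat \<Rightarrow> 'f mat \<Rightarrow> (real \<Rightarrow> 'f vec) \<Rightarrow> real \<Rightarrow> 'f vec" where
  "A_op d P0 P1 x = (\<lambda>\<zeta>. P0 *\<^sub>v x \<zeta> + P1 *\<^sub>v weak_deriv d x \<zeta>)"

definition AH_dom ::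
    "nat \<Rightarrow> nat \<Rightarrow> 'f::real_or_complex mat \<Rightarrow> (real \<Rightarrow> 'f mat) \<Rightarrow> (real \<Rightarrow> 'f vec) set" where
  "AH_dom d k WB H =
    {x \<in> L2 d. mult_op H x \<in> W12 d \<and> WB *\<^sub>v trace0 d (mult_op H x) = 0\<^sub>v k}"

definition AH_op ::
    "nat \<Rightarrow> 'f::real_or_complex mat \<Rightarrow> 'f mat \<Rightarrow> (real \<Rightarrow> 'f mat) \<Rightarrow> (real \<Rightarrow> 'f vec) \<Rightarrow> real \<Rightarrow> 'f vec"
  where
  "AH_op d P0 P1 H x =
    (\<lambda>\<zeta>. P0 *\<^sub>v mult_op H x \<zeta> + P1 *\<^sub>v weak_deriv d (mult_op H x) \<zeta>)"

definition all_equivalent :: "bool list \<Rightarrow> bool" where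
  "all_equivalent Ps \<longleftrightarrow> (\<forall>P\<in>set Ps. \<forall>Q\<in>set Ps. P \<longleftrightarrow> Q)"

end

theory Submission imports Defs
begin

text \<open>
  Everything rests on the identity \<open>Re \<langle>A x, x\<rangle> = \<integral> Re (x\<^sup>* P\<^sub>0 x) - x(0)\<^sup>* P\<^sub>1 x(0) / 2\<close>, which
  is integration by parts in the term with \<open>P\<^sub>1\<close> (\<open>dissipation_identity\<close>).

  If \<open>A\<close> is dissipative, the identity is tested on functions \<open>f y\<close> with a fixed vector \<open>y\<close> and
  a scalar function \<open>f\<close>. For \<open>f(\<zeta>) = exp (- n \<zeta>)\<close> and \<open>y\<close> in the kernel of \<open>W\<^sub>B\<close> the integral
  vanishes as \<open>n\<close> grows and the boundary term stays; for \<open>f\<close> with \<open>f(0) = 0\<close> only the integral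
  is present. This gives the two pointwise conditions on \<open>P\<^sub>0\<close> and \<open>P\<^sub>1\<close>
  (\<open>boundary_form_nonneg_if_dissipative\<close>).

  In the coordinates \<open>S y = (v, w)\<close> the form of \<open>P\<^sub>1\<close> is \<open>v\<^sup>* \<Lambda> v + w\<^sup>* \<Theta> w\<close>, and it is negative definite
  in \<open>w\<close>. So it can be nonnegative on the kernel of \<open>W\<^sub>B\<close>, whose dimension is at least \<open>n\<^sub>1\<close>, only
  if that kernel is the graph of a map \<open>w = - U v\<close>, and there it is the form of \<open>\<Lambda> + U\<^sup>* \<Theta> U\<close>.
  This is the equivalence of the conditions on \<open>P\<^sub>1\<close> and on \<open>U\<close>
  (\<open>boundary_matrix_of_nonneg_form\<close>, \<open>nonneg_form_of_boundary_matrix\<close>).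

  For generation, take first \<open>P\<^sub>0 = 0\<close> and \<open>H\<close> the identity. The resolvent equation
  \<open>\<mu> u - P\<^sub>1 u' = f\<close> decouples in the same coordinates. The components of \<open>v\<close> grow exponentially
  except for one initial value, and those of \<open>w\<close> are square integrable for every initial value, so
  the boundary condition \<open>w(0) = - U v(0)\<close> selects exactly one solution in \<open>L\<^sup>2\<close>
  (\<open>resolvent_equation\<close>). A bounded dissipative \<open>P\<^sub>0\<close> and the weight \<open>H\<close> keep the resolvent
  surjective by a fixed point argument (\<open>dissipative_operator_weighted\<close>), and a dissipative operator
  whose resolvents are everywhere defined generates a contraction semigroup, by the theorem of Hille
  and Yosida (locale \<open>dissipative_operator\<close>). Conversely, differentiating \<open>\<parallel>T(t) z\<parallel>\<^sup>2 \<le> \<parallel>z\<parallel>\<^sup>2\<close> at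
  \<open>t = 0\<close> for \<open>z = H\<^sup>-\<^sup>1 x\<close> shows that \<open>A\<close> is dissipative (\<open>dissipative_if_generates\<close>).

  The Hilbert space is a real one, and the same for all \<open>d\<close>: \<open>L\<^sup>2\<close> of countably many half-lines.
  The functions in \<open>L2 d\<close> form a closed subspace of it, to whose complement all operators are
  extended in a trivial way, and linearity over the field is recovered from commutation with the
  multiplications by scalars.
\<close>

section \<open>Bounded endomorphisms as a Banach algebra\<close>

text \<open>A copy of the type of bounded linear maps with composition as its product, so that the
  exponential series of a Banach algebra and its derivative apply to bounded operators.\<close>

typedef (overloaded) 'a endo = "UNIV :: ('a::real_normed_vector \<Rightarrow>\<^sub>L 'a) set"
  morphisms blin Endo ..

setup_lifting type_definition_endo

instantiation endo :: (real_normed_vector) real_vector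
begin
lift_definition zero_endo :: "'a endo" is 0 .
lift_definition plus_endo :: "'a endo \<Rightarrow> 'a endo \<Rightarrow> 'a endo" is "(+)" .
lift_definition minus_endo :: "'a endo \<Rightarrow> 'a endo \<Rightarrow> 'a endo" is "(-)" .
lift_definition uminus_endo :: "'a endo \<Rightarrow> 'a endo" is uminus .
lift_definition scaleR_endo :: "real \<Rightarrow> 'a endo \<Rightarrow> 'a endo" is scaleR .
instance
  by standard (transfer; simp add: algebra_simps)+
end

instantiation endo :: (real_normed_vector) real_normed_vector
begin
lift_definition norm_endo :: "'a endo \<Rightarrow> real" is norm .
definition dist_endo :: "'a endo \<Rightarrow> 'a endo \<Rightarrow> real" where "dist_endo f g = norm (f - g)"
definition sgn_endo :: "'a endo \<Rightarrow> 'a endo" where "sgn_endo f = f /\<^sub>R norm f"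
definition uniformity_endo :: "('a endo \<times> 'a endo) filter" where
  "uniformity_endo = (INF e\<in>{0<..}. principal {(x, y). dist x y < e})"
definition open_endo :: "'a endo set \<Rightarrow> bool" where
  "open_endo U = (\<forall>x\<in>U. \<forall>\<^sub>F (x', y) in uniformity. x' = x \<longrightarrow> y \<in> U)"
instance
  by standard
    (simp_all only: dist_endo_def sgn_endo_def uniformity_endo_def open_endo_def,
     (transfer; simp add: norm_triangle_ineq)+)
end

instantiation endo :: (real_normed_vector) real_normed_algebra
begin
lift_definition times_endo :: "'a endo \<Rightarrow> 'a endo \<Rightarrow> 'a endo" is "(o\<^sub>L)" .
instance
  by standard (transfer; auto intro!: blinfun_eqI norm_blinfun_compose
      simp: blinfun.add_left blinfun.add_right blinfun.scaleR_left blinfun.scaleR_right)+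
end

text \<open>On the trivial space \<open>0\<close> and \<open>1\<close> coincide; for normed spaces, \<open>perfect_space\<close> excludes it.\<close>

instantiation endo :: ("{real_normed_vector, perfect_space}") real_normed_algebra_1
begin
lift_definition one_endo :: "'a endo" is id_blinfun .
instance
proof
  show "(0::'a endo) \<noteq> 1"
  proof
    assume "(0::'a endo) = 1"
    then have "norm (0 :: 'a \<Rightarrow>\<^sub>L 'a) = norm (id_blinfun :: 'a \<Rightarrow>\<^sub>L 'a)"
      by transfer simp
    then show False by simp
  qed
qed (transfer; auto intro!: blinfun_eqI)+
end

instance endo :: (banach) banach
proof
  fix X :: "nat \<Rightarrow> 'a endo"
  assume "Cauchy X"
  moreover have blin_dist: "dist (blin f) (blin g) = dist f g" for f g :: "'a endo"
    unfolding dist_endo_def dist_norm by transfer simp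
  ultimately have "Cauchy (\<lambda>n. blin (X n))"
    by (simp add: Cauchy_def)
  then obtain L where "(\<lambda>n. blin (X n)) \<longlonglongrightarrow> L"
    using Cauchy_convergent convergent_def by blast
  then have "X \<longlonglongrightarrow> Endo L"
    by (simp add: lim_sequentially Endo_inverse flip: blin_dist)
  then show "convergent X"
    unfolding convergent_def by blast
qed

definition ap :: "'a::real_normed_vector endo \<Rightarrow> 'a \<Rightarrow> 'a" where
  "ap f x = blinfun_apply (blin f) x"

lemma bounded_bilinear_ap: "bounded_bilinear (ap :: 'a::real_normed_vector endo \<Rightarrow> 'a \<Rightarrow> 'a)"
proof
  show "\<exists>K. \<forall>a (b::'a). norm (ap a b) \<le> norm a * norm b * K"
    by (rule exI[of _ 1]) (auto simp: ap_def norm_endo.rep_eq norm_blinfun)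
qed (simp_all add: ap_def plus_endo.rep_eq scaleR_endo.rep_eq blinfun.add_left
      blinfun.add_right blinfun.scaleR_left blinfun.scaleR_right)

interpretation ap: bounded_bilinear ap by (rule bounded_bilinear_ap)

lemma ap_times [simp]: "ap (f * g) x = ap f (ap g x)"
  by (simp add: ap_def times_endo.rep_eq)

lemma ap_one [simp]: "ap 1 x = x"
  by (simp add: ap_def one_endo.rep_eq)

lemma endo_eqI: "(\<And>x. ap f x = ap g x) \<Longrightarrow> f = g"
  by (simp add: ap_def blinfun_eqI blin_inject[symmetric])

lemma ap_Endo_Blinfun: "bounded_linear f \<Longrightarrow> ap (Endo (Blinfun f)) x = f x"
  by (simp add: ap_def Endo_inverse bounded_linear_Blinfun_apply)

lemma exp_commute:
  fixes L B :: "'a::{real_normed_algebra_1,banach}"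
  assumes "L * B = B * L"
  shows "L * exp (t *\<^sub>R B) = exp (t *\<^sub>R B) * L"
proof -
  have pow: "L * (t *\<^sub>R B) ^ n = (t *\<^sub>R B) ^ n * L" for n
    by (rule power_commuting_commutes[symmetric]) (simp add: assms)
  have "L * exp (t *\<^sub>R B) = (\<Sum>n. L * ((t *\<^sub>R B) ^ n /\<^sub>R fact n))"
    unfolding exp_def by (rule suminf_mult[symmetric]) (rule summable_exp_generic)
  also have "\<dots> = (\<Sum>n. ((t *\<^sub>R B) ^ n /\<^sub>R fact n) * L)"
    by (simp only: mult_scaleR_right mult_scaleR_left pow)
  also have "\<dots> = exp (t *\<^sub>R B) * L"
    unfolding exp_def by (rule suminf_mult2[symmetric]) (rule summable_exp_generic)
  finally show ?thesis .
qed

lemma vector_derivative_bound: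
  fixes f :: "real \<Rightarrow> 'a::real_normed_vector"
  assumes f: "\<And>s. s \<in> {0..t} \<Longrightarrow> (f has_vector_derivative f' s) (at s within {0..t})"
    and C: "\<And>s. s \<in> {0..t} \<Longrightarrow> norm (f' s) \<le> C" and "0 \<le> t"
  shows "norm (f t - f 0) \<le> C * t"
proof -
  have "norm (f t - f 0) \<le> C * norm (t - 0)"
  proof (rule differentiable_bound[where S = "{0..t}" and f' = "\<lambda>s h. h *\<^sub>R f' s"])
    fix s assume s: "s \<in> {0..t}"
    show "onorm (\<lambda>h. h *\<^sub>R f' s) \<le> C"
      by (rule onorm_le) (use C[OF s] in \<open>simp add: mult.commute[of C] mult_left_mono\<close>)
  qed (use f assms(3) in \<open>auto simp: has_vector_derivative_def\<close>)
  with assms(3) show ?thesis by simp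
qed

section \<open>Generation by dissipative operators\<close>

text \<open>The situation of the theorem of Hille and Yosida in a Hilbert space. The inner product \<open>b\<close> only
  has to be equivalent to the norm of the space: the semigroups are contractive for a weighted
  inner product, while the norm of the space is the one without the weight.\<close>

locale dissipative_operator =
  fixes b :: "'a::{banach,perfect_space} \<Rightarrow> 'a \<Rightarrow> real" and D :: "'a set" and A :: "'a \<Rightarrow> 'a" and c :: real
  assumes bilinear: "bounded_bilinear b"
    and sym: "b x y = b y x"
    and c_pos: "0 < c" and coercive: "c * (norm x)\<^sup>2 \<le> b x x"
    and D_subspace: "Real_Vector_Spaces.subspace D"
    and A_add: "x \<in> D \<Longrightarrow> y \<in> D \<Longrightarrow> A (x + y) = A x + A y"
    and A_scale: "x \<in> D \<Longrightarrow> A (r *\<^sub>R x) = r *\<^sub>R A x"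
    and dissipative: "x \<in> D \<Longrightarrow> b (A x) x \<le> 0"
    and surjective: "0 < l \<Longrightarrow> \<exists>x\<in>D. l *\<^sub>R x - A x = y"
begin

interpretation b: bounded_bilinear b by (rule bilinear)

lemma b_nonneg: "0 \<le> b x x"
  using coercive[of x] c_pos by (meson order_trans mult_nonneg_nonneg less_imp_le zero_le_power2)

lemma b_eq_0: "b x x \<le> 0 \<Longrightarrow> x = 0"
  using coercive[of x] c_pos
  by (smt (verit) mult_pos_pos norm_eq_zero zero_less_power2)

lemma A_0: "A 0 = 0"
  using A_scale[of 0 0] D_subspace by (simp add: real_vector.subspace_0)

lemma D_diff: "x \<in> D \<Longrightarrow> y \<in> D \<Longrightarrow> x - y \<in> D" and D_add: "x \<in> D \<Longrightarrow> y \<in> D \<Longrightarrow> x + y \<in> D"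
  and D_scale: "x \<in> D \<Longrightarrow> r *\<^sub>R x \<in> D" and D_0: "0 \<in> D"
  using D_subspace by (auto simp: real_vector.subspace_diff real_vector.subspace_add real_vector.subspace_scale real_vector.subspace_0)

lemma A_diff: "x \<in> D \<Longrightarrow> y \<in> D \<Longrightarrow> A (x - y) = A x - A y"
  using A_add[of x "(-1) *\<^sub>R y"] A_scale[of y "-1"] D_scale[of y "-1"] by simp

text \<open>A contraction for the form \<open>b\<close> is bounded for the norm by this constant, whatever
  the contraction.\<close>

definition K :: real where
  "K = (SOME K. 0 < K \<and> (\<forall>x y. b x x \<le> b y y \<longrightarrow> norm x \<le> K * norm y))"

lemma K: "0 < K" "b x x \<le> b y y \<Longrightarrow> norm x \<le> K * norm y"
proof -
  obtain C where C: "0 < C" "\<And>x y. norm (b x y) \<le> norm x * norm y * C"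
    using b.pos_bounded by blast
  have "norm x \<le> sqrt (C / c) * norm y" if "b x x \<le> b y y" for x y
  proof -
    have "c * (norm x)\<^sup>2 \<le> (norm y)\<^sup>2 * C"
      using coercive[of x] that C(2)[of y y] by (simp add: power2_eq_square)
    then have "(norm x)\<^sup>2 \<le> C / c * (norm y)\<^sup>2"
      using c_pos by (simp add: field_simps)
    then have "sqrt ((norm x)\<^sup>2) \<le> sqrt (C / c * (norm y)\<^sup>2)"
      by (rule real_sqrt_le_mono)
    then show ?thesis unfolding real_sqrt_mult by simp
  qed
  then have "\<exists>K. 0 < K \<and> (\<forall>x y. b x x \<le> b y y \<longrightarrow> norm x \<le> K * norm y)"
    using C(1) c_pos by (intro exI[of _ "sqrt (C / c)"]) auto
  from someI_ex[OF this] show "0 < K" "b x x \<le> b y y \<Longrightarrow> norm x \<le> K * norm y"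
    unfolding K_def by blast+
qed

text \<open>In the expansion of the right hand side, the mixed term \<open>- 2 l b (A x) x\<close> is nonnegative.\<close>

lemma resolvent_bound:
  assumes "x \<in> D" "0 < l"
  shows "b (l *\<^sub>R x) (l *\<^sub>R x) \<le> b (l *\<^sub>R x - A x) (l *\<^sub>R x - A x)"
proof -
  have "b (l *\<^sub>R x - A x) (l *\<^sub>R x - A x) = b (l *\<^sub>R x) (l *\<^sub>R x) - 2 * l * b (A x) x + b (A x) (A x)"
    by (simp add: b.diff_left b.diff_right b.scaleR_left b.scaleR_right algebra_simps sym[of x "A x"])
  moreover have "l * b (A x) x \<le> 0"
    using dissipative[OF assms(1)] assms(2) by (simp add: mult_le_0_iff)
  ultimately show ?thesis using b_nonneg[of "A x"] by linarith
qed

text \<open>The resolvent \<open>(l - A)\<^sup>-\<^sup>1\<close>.\<close>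

definition R :: "real \<Rightarrow> 'a \<Rightarrow> 'a" where
  "R l y = (SOME x. x \<in> D \<and> l *\<^sub>R x - A x = y)"

lemma R: assumes "0 < l" shows R_in_D: "R l y \<in> D" and R_eq: "l *\<^sub>R R l y - A (R l y) = y"
  using someI_ex[of "\<lambda>x. x \<in> D \<and> l *\<^sub>R x - A x = y"] surjective[OF assms, of y]
  unfolding R_def by blast+

lemma R_unique:
  assumes "0 < l" "x \<in> D" "l *\<^sub>R x - A x = y"
  shows "R l y = x"
proof -
  let ?z = "R l y - x"
  have z: "?z \<in> D" by (simp add: D_diff R_in_D assms)
  have "l *\<^sub>R ?z - A ?z = 0"
    using R_eq[OF assms(1), of y] assms
    by (simp add: A_diff R_in_D algebra_simps)
  with resolvent_bound[OF z assms(1)] have "b (l *\<^sub>R ?z) (l *\<^sub>R ?z) \<le> 0"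
    by (simp add: b.zero_left)
  then have "l *\<^sub>R ?z = 0" by (rule b_eq_0)
  with assms(1) show ?thesis by simp
qed

lemma R_add: "0 < l \<Longrightarrow> R l (x + y) = R l x + R l y"
  using R_eq[of l x] R_eq[of l y]
  by (intro R_unique) (auto simp: R_in_D D_add A_add algebra_simps)

lemma R_scale: "0 < l \<Longrightarrow> R l (r *\<^sub>R x) = r *\<^sub>R R l x"
  using arg_cong[OF R_eq[of l x], of "scaleR r"]
  by (intro R_unique) (auto simp: R_in_D D_scale A_scale scaleR_diff_right mult.commute)

lemma R_contraction: "0 < l \<Longrightarrow> b (l *\<^sub>R R l y) (l *\<^sub>R R l y) \<le> b y y"
  using resolvent_bound[of "R l y" l] by (simp add: R_in_D R_eq)

text \<open>These are contractions for \<open>b\<close> that approximate the identity as \<open>l\<close> tends to infinity.\<close>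

definition J :: "real \<Rightarrow> 'a endo" where
  "J l = Endo (Blinfun (\<lambda>y. l *\<^sub>R R l y))"

lemma ap_J: assumes "0 < l" shows "ap (J l) y = l *\<^sub>R R l y"
  unfolding J_def
proof (rule ap_Endo_Blinfun, rule bounded_linear_intro)
  show "norm (l *\<^sub>R R l x) \<le> norm x * K" for x
    using K(2)[OF R_contraction[OF assms, of x]] by (simp add: mult.commute)
qed (use assms in \<open>simp_all add: R_add R_scale algebra_simps\<close>)

lemma J_contraction: "0 < l \<Longrightarrow> b (ap (J l) y) (ap (J l) y) \<le> b y y"
  by (simp only: ap_J R_contraction)

lemma J_in_D: "0 < l \<Longrightarrow> ap (J l) y \<in> D"
  by (simp add: ap_J R_in_D D_scale)

lemma A_J: "0 < l \<Longrightarrow> A (ap (J l) y) = l *\<^sub>R (ap (J l) y - y)"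
proof -
  assume "0 < l"
  then have "A (R l y) = l *\<^sub>R R l y - y"
    using R_eq[of l y] by (simp add: algebra_simps)
  with \<open>0 < l\<close> show ?thesis by (simp add: ap_J A_scale R_in_D)
qed

lemma J_D: assumes "0 < l" "x \<in> D" shows "l *\<^sub>R (ap (J l) x - x) = ap (J l) (A x)"
proof -
  have "R l (l *\<^sub>R x - A x) = x" by (rule R_unique) (use assms in auto)
  then have "ap (J l) (l *\<^sub>R x - A x) = l *\<^sub>R x" using assms by (simp add: ap_J)
  then show ?thesis by (simp add: ap.diff_right ap.scaleR_right algebra_simps)
qed

lemma J_commute: assumes "0 < l" "0 < m" shows "J l * J m = J m * J l"
proof (cases "l = m")
  case False
  have resolvent_identity: "R l y - R m y = (m - l) *\<^sub>R R l (R m y)" if "0 < l" "0 < m" for l m y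
  proof -
    have "R l ((m - l) *\<^sub>R R m y) = R l y - R m y"
      using R_eq[OF that(1), of y] R_eq[OF that(2), of y]
      by (intro R_unique) (auto simp: that R_in_D D_diff A_diff algebra_simps)
    then show ?thesis using that by (simp add: R_scale)
  qed
  have "R l (R m y) = R m (R l y)" for y
  proof -
    have "(m - l) *\<^sub>R R l (R m y) = (m - l) *\<^sub>R R m (R l y)"
      using resolvent_identity[OF assms, of y] resolvent_identity[OF assms(2,1), of y]
      by (metis minus_diff_eq scaleR_minus_left)
    with False show ?thesis by simp
  qed
  then show ?thesis using assms
    by (intro endo_eqI) (simp add: ap_J R_scale)
qed simp

text \<open>On the domain, \<open>J l x - x = R l (A x)\<close> is of order \<open>1 / l\<close>.\<close>

lemma ap_J_tendsto: "(\<lambda>n. ap (J (real n + 1)) x) \<longlonglongrightarrow> x" if "x \<in> D" for x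
proof -
  have bound: "norm (ap (J (real n + 1)) x - x) \<le> K * norm (A x) * inverse (real (Suc n))" for n
  proof -
    have "(real n + 1) * norm (ap (J (real n + 1)) x - x) = norm (ap (J (real n + 1)) (A x))"
      using arg_cong[OF J_D[of "real n + 1" x], of norm] that by simp
    also have "\<dots> \<le> K * norm (A x)"
      by (rule K(2)) (rule J_contraction, simp)
    finally show ?thesis by (simp add: field_simps)
  qed
  have "(\<lambda>n. ap (J (real n + 1)) x - x) \<longlonglongrightarrow> 0"
  proof (rule Lim_null_comparison)
    show "\<forall>\<^sub>F n in sequentially. norm (ap (J (real n + 1)) x - x) \<le> K * norm (A x) * inverse (real (Suc n))"
      using bound by simp
    show "(\<lambda>n. K * norm (A x) * inverse (real (Suc n))) \<longlonglongrightarrow> 0"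
      by (rule tendsto_mult_right_zero) (rule LIMSEQ_inverse_real_of_nat)
  qed
  then show ?thesis by (simp add: LIM_zero_iff)
qed

text \<open>The domain is dense. Write \<open>J n\<close> for \<open>J (n + 1)\<close>. Dissipativity at \<open>J n x - J m x\<close> says for \<open>v n = x - J n x\<close> and
  \<open>q n = b (v n) (v n)\<close> that \<open>b (v n - v m) (v n - v m) \<le> q n - q m\<close> if \<open>n \<le> m\<close>. So \<open>q\<close> decreases and
  \<open>v\<close> converges. Since \<open>J 1\<close> maps into the domain, where the claim is known, it maps the limit of
  \<open>v\<close> to \<open>0\<close>; and \<open>J 1\<close> is injective.\<close>

lemma J_tendsto: "(\<lambda>n. ap (J (real n + 1)) x) \<longlonglongrightarrow> x"
proof -
  let ?J = "\<lambda>n. ap (J (real n + 1))"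
  define v where "v n = x - ?J n x" for n
  define q where "q n = b (v n) (v n)" for n
  have AJ: "A (?J n x) = - ((real n + 1) *\<^sub>R v n)" for n
    unfolding v_def using A_J[of "real n + 1" x]
    by (simp flip: scaleR_minus_right)
  have key: "(real n + real m + 2) * b (v n - v m) (v n - v m) \<le> (real m - real n) * (q n - q m)" for n m
  proof -
    have "b (A (?J n x - ?J m x)) (?J n x - ?J m x) \<le> 0"
      by (intro dissipative D_diff J_in_D) auto
    also have "A (?J n x - ?J m x) = (real m + 1) *\<^sub>R v m - (real n + 1) *\<^sub>R v n"
      by (subst A_diff) (simp_all only: J_in_D AJ, simp_all add: J_in_D)
    also have "?J n x - ?J m x = v m - v n" by (simp add: v_def)
    finally show ?thesis unfolding q_def
      by (simp add: b.diff_left b.diff_right b.add_left b.add_right b.scaleR_left b.scaleR_right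
          sym[of "v m" "v n"] algebra_simps)
  qed
  have diff: "b (v n - v m) (v n - v m) \<le> q n - q m" if "n \<le> m" for n m
  proof -
    have "0 \<le> (real m - real n) * (q n - q m)"
      using key[of n m] b_nonneg[of "v n - v m"]
      by (smt (verit) mult_nonneg_nonneg of_nat_0_le_iff)
    have le: "q m \<le> q n"
    proof (cases "n = m")
      case False
      with that have "0 < real m - real n" by simp
      with \<open>0 \<le> _ * _\<close> show ?thesis by (simp add: zero_le_mult_iff)
    qed simp
    have "(real n + real m + 2) * b (v n - v m) (v n - v m) \<le> (real n + real m + 2) * (q n - q m)"
      using key[of n m] mult_right_mono[of "real m - real n" "real n + real m + 2" "q n - q m"] le by linarith
    then show ?thesis by (simp add: mult_le_cancel_left_pos)
  qed
  have "decseq q"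
    unfolding decseq_def
  proof (intro allI impI)
    fix m n :: nat assume "m \<le> n"
    with diff[of m n] b_nonneg[of "v m - v n"] show "q n \<le> q m" by linarith
  qed
  then have "convergent q"
    using decseq_convergent[of q 0] b_nonneg by (metis convergentI q_def)
  then have Cq: "Cauchy q" by (rule convergent_Cauchy)
  have "Cauchy v"
  proof (rule metric_CauchyI)
    fix e :: real assume "0 < e"
    then obtain M where M: "\<And>n m. n \<ge> M \<Longrightarrow> m \<ge> M \<Longrightarrow> dist (q n) (q m) < c * e\<^sup>2"
      using metric_CauchyD[OF Cq, of "c * e\<^sup>2"] c_pos by fastforce
    have *: "dist (v n) (v m) < e" if "n \<ge> M" "m \<ge> M" "n \<le> m" for n m
    proof -
      have "c * (norm (v n - v m))\<^sup>2 < c * e\<^sup>2"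
        using coercive[of "v n - v m"] diff[OF that(3)] M[OF that(1,2)] by (simp add: dist_real_def)
      then show ?thesis using c_pos \<open>0 < e\<close>
        by (simp add: dist_norm) (meson power2_less_imp_less less_imp_le)
    qed
    have "dist (v n) (v m) < e" if "n \<ge> M" "m \<ge> M" for n m
      using *[of n m] *[of m n] that by (cases "n \<le> m") (auto simp: dist_commute)
    then show "\<exists>M. \<forall>n\<ge>M. \<forall>m\<ge>M. dist (v n) (v m) < e" by blast
  qed
  then obtain w where w: "v \<longlonglongrightarrow> w"
    using Cauchy_convergent convergent_def by blast
  have "(\<lambda>n. ap (J 1) (v n)) \<longlonglongrightarrow> ap (J 1) w"
    by (intro ap.tendsto tendsto_const w)
  moreover have "(\<lambda>n. ap (J 1) (v n)) \<longlonglongrightarrow> 0"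
  proof -
    have "ap (J 1) (v n) = ap (J 1) x - ?J n (ap (J 1) x)" for n
      using J_commute[of 1 "real n + 1"]
      by (simp add: v_def ap.diff_right flip: ap_times)
    moreover have "(\<lambda>n. ap (J 1) x - ?J n (ap (J 1) x)) \<longlonglongrightarrow> ap (J 1) x - ap (J 1) x"
      by (intro tendsto_intros ap_J_tendsto J_in_D) simp
    ultimately show ?thesis by simp
  qed
  ultimately have "ap (J 1) w = 0" by (rule LIMSEQ_unique)
  with A_J[of 1 w] have "w = 0" by (simp add: A_0)
  with w have "(\<lambda>n. x - v n) \<longlonglongrightarrow> x - 0" by (intro tendsto_intros) simp
  then show ?thesis by (simp add: v_def)
qed

text \<open>The Yosida approximations of \<open>A\<close>, which are bounded, and the groups that they generate.\<close>

definition B :: "nat \<Rightarrow> 'a endo" where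
  "B n = (real n + 1) *\<^sub>R (J (real n + 1) - 1)"

definition S :: "nat \<Rightarrow> real \<Rightarrow> 'a endo" where
  "S n t = exp (t *\<^sub>R B n)"

lemma B_commute: "B n * B m = B m * B n"
  using J_commute[of "real n + 1" "real m + 1"]
  by (simp add: B_def algebra_simps)

lemma B_dissipative: "b (ap (B n) u) u \<le> 0"
proof -
  let ?J = "ap (J (real n + 1))"
  have "0 \<le> b (?J u - u) (?J u - u)" by (rule b_nonneg)
  also have "\<dots> = b (?J u) (?J u) - 2 * b (?J u) u + b u u"
    by (simp add: b.diff_left b.diff_right sym[of u "?J u"])
  finally have "b (?J u) u \<le> b u u"
    using J_contraction[of "real n + 1" u] by simp
  then show ?thesis
    by (simp add: B_def ap.scaleR_left ap.diff_left b.scaleR_left b.diff_left mult_le_0_iff)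
qed

lemma B_tendsto: "x \<in> D \<Longrightarrow> (\<lambda>n. ap (B n) x) \<longlonglongrightarrow> A x"
  using J_tendsto[of "A x"] J_D[of "real _ + 1" x]
  by (simp add: B_def ap.scaleR_left ap.diff_left)

text \<open>The derivative of \<open>b u u\<close> along \<open>u = S n t x\<close> is \<open>2 b (B\<^sub>n u) u\<close>.\<close>

lemma S_contraction:
  assumes "0 \<le> t" shows "b (ap (S n t) x) (ap (S n t) x) \<le> b x x"
proof -
  let ?u = "\<lambda>t. ap (S n t) x"
  have u: "(?u has_vector_derivative ap (B n) (?u t)) (at t)" for t
    using ap.has_vector_derivative[OF exp_scaleR_has_vector_derivative_left has_vector_derivative_const]
    by (simp add: S_def ap.zero_right)
  have "((\<lambda>t. b (?u t) (?u t)) has_vector_derivative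
      b (?u t) (ap (B n) (?u t)) + b (ap (B n) (?u t)) (?u t)) (at t)" for t
    by (rule b.has_vector_derivative[OF u u])
  then have "((\<lambda>t. b (?u t) (?u t)) has_real_derivative 2 * b (ap (B n) (?u t)) (?u t)) (at t)" for t
    by (simp add: has_real_derivative_iff_has_vector_derivative sym[of _ "ap (B n) _"])
  then have "b (?u t) (?u t) \<le> b (?u 0) (?u 0)"
    using B_dissipative assms
    by (intro DERIV_nonpos_imp_nonincreasing[of 0 t "\<lambda>t. b (?u t) (?u t)"])
      (auto intro!: exI simp: mult_le_0_iff)
  then show ?thesis by (simp add: S_def)
qed

lemma S_bound: "0 \<le> t \<Longrightarrow> norm (ap (S n t) x) \<le> K * norm x"
  by (rule K(2)) (rule S_contraction)

lemma S_add: "S n (s + t) = S n s * S n t"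
  unfolding S_def scaleR_add_left by (rule exp_add_commuting) simp

text \<open>The path \<open>exp (t B\<^sub>n) exp (s (B\<^sub>m - B\<^sub>n))\<close> leads from \<open>S n t\<close> to \<open>S m t\<close> as \<open>s\<close> runs from \<open>0\<close> to
  \<open>t\<close>, and it has the derivative \<open>S n (t - s) S m s (B\<^sub>m - B\<^sub>n)\<close>, because the approximations commute.\<close>

lemma S_diff:
  assumes "0 \<le> t"
  shows "norm (ap (S n t) x - ap (S m t) x) \<le> K * K * norm (ap (B n) x - ap (B m) x) * t"
proof -
  let ?E = "\<lambda>s. exp (t *\<^sub>R B n) * exp (s *\<^sub>R (B m - B n))"
  have E: "?E s = S n (t - s) * S m s" for s
  proof -
    have "?E s = exp (t *\<^sub>R B n + s *\<^sub>R (B m - B n))"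
      by (rule exp_add_commuting[symmetric]) (simp add: algebra_simps B_commute)
    also have "\<dots> = exp ((t - s) *\<^sub>R B n + s *\<^sub>R B m)"
      by (simp add: algebra_simps)
    also have "\<dots> = S n (t - s) * S m s"
      unfolding S_def by (rule exp_add_commuting) (simp add: B_commute)
    finally show ?thesis .
  qed
  have deriv: "((\<lambda>s. ap (?E s) x) has_vector_derivative ap (?E s) (ap (B m - B n) x)) (at s within {0..t})" for s
  proof -
    have "(?E has_vector_derivative exp (t *\<^sub>R B n) * (exp (s *\<^sub>R (B m - B n)) * (B m - B n)))
        (at s within {0..t})"
      by (rule bounded_linear.has_vector_derivative[OF bounded_linear_mult_right
            exp_scaleR_has_vector_derivative_right])
    from ap.has_vector_derivative[OF this has_vector_derivative_const[of x]]
    show ?thesis by (simp add: ap.zero_right)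
  qed
  have "norm (ap (?E t) x - ap (?E 0) x) \<le> K * (K * norm (ap (B m - B n) x)) * t"
  proof (rule vector_derivative_bound[OF deriv _ assms])
    fix s assume s: "s \<in> {0..t}"
    have "norm (ap (?E s) (ap (B m - B n) x)) = norm (ap (S n (t - s)) (ap (S m s) (ap (B m - B n) x)))"
      by (simp only: E ap_times)
    also have "\<dots> \<le> K * norm (ap (S m s) (ap (B m - B n) x))"
      using s by (intro S_bound) auto
    also have "\<dots> \<le> K * (K * norm (ap (B m - B n) x))"
      using s K(1) by (intro mult_left_mono S_bound) auto
    finally show "norm (ap (?E s) (ap (B m - B n) x)) \<le> K * (K * norm (ap (B m - B n) x))" .
  qed
  then have "norm (ap (S m t) x - ap (S n t) x) \<le> K * K * norm (ap (B m - B n) x) * t"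
    by (simp add: E) (simp add: S_def mult.assoc)
  then show ?thesis
    by (simp add: norm_minus_commute[of "ap (S n t) x"] ap.diff_left norm_minus_commute[of "ap (B n) x"])
qed

text \<open>The bound on \<open>S n t x - S m t x\<close> gives convergence for \<open>x\<close> in \<open>D\<close>, locally uniform in
  \<open>t\<close>; since the operators \<open>S n t\<close> are bounded by \<open>K\<close>, it extends to the closure of \<open>D\<close>.\<close>

lemma S_uniformly_Cauchy: "uniformly_Cauchy_on {0..t0} (\<lambda>n t. ap (S n t) x)"
  unfolding uniformly_Cauchy_on_def
proof (intro allI impI)
  fix e :: real assume "0 < e"
  have "(\<lambda>n. K * norm (x - ap (J (real n + 1)) x)) \<longlonglongrightarrow> K * norm (x - x)"
    by (intro tendsto_intros J_tendsto)
  then have "\<forall>\<^sub>F n in sequentially. K * norm (x - ap (J (real n + 1)) x) < e / 3"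
    using \<open>0 < e\<close> by (intro order_tendstoD) auto
  then obtain n where "K * norm (x - ap (J (real n + 1)) x) < e / 3"
    using eventually_happens'[OF sequentially_bot] by blast
  then obtain y where y: "y \<in> D" "K * norm (x - y) < e / 3"
    using J_in_D[of "real n + 1" x] by auto
  define C where "C = K * K * (\<bar>t0\<bar> + 1)"
  have C: "C > 0" using K(1) by (simp add: C_def)
  have "Cauchy (\<lambda>n. ap (B n) y)"
    using B_tendsto[OF y(1)] by (rule LIMSEQ_imp_Cauchy)
  from metric_CauchyD[OF this, of "e / 3 / C"] C \<open>0 < e\<close>
  obtain M where M: "\<And>n m. n \<ge> M \<Longrightarrow> m \<ge> M \<Longrightarrow> norm (ap (B n) y - ap (B m) y) < e / 3 / C"
    by (auto simp: dist_norm)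
  have "dist (ap (S m t) x) (ap (S n t) x) < e" if "t \<in> {0..t0}" "m \<ge> M" "n \<ge> M" for t m n
  proof -
    have t: "0 \<le> t" "t \<le> \<bar>t0\<bar> + 1" using that by auto
    have "norm (ap (S m t) y - ap (S n t) y) \<le> K * K * norm (ap (B m) y - ap (B n) y) * t"
      by (rule S_diff) (rule t)
    also have "\<dots> \<le> K * K * norm (ap (B m) y - ap (B n) y) * (\<bar>t0\<bar> + 1)"
      using t K(1) by (intro mult_left_mono) auto
    also have "\<dots> = C * norm (ap (B m) y - ap (B n) y)" by (simp add: C_def)
    also have "\<dots> < e / 3"
      using M[OF that(2,3)] C by (simp add: field_simps)
    finally have "norm (ap (S m t) y - ap (S n t) y) < e / 3" .
    moreover have "norm (ap (S k t) x - ap (S k t) y) < e / 3" for k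
      using S_bound[OF t(1), of k "x - y"] y(2) by (simp add: ap.diff_right)
    note this[of m] this[of n]
    moreover have "norm (ap (S m t) x - ap (S n t) x) \<le> norm (ap (S m t) x - ap (S m t) y)
      + norm (ap (S m t) y - ap (S n t) y) + norm (ap (S n t) x - ap (S n t) y)"
      by norm
    ultimately show ?thesis by (simp add: dist_norm)
  qed
  then show "\<exists>M. \<forall>t\<in>{0..t0}. \<forall>m\<ge>M. \<forall>n\<ge>M. dist (ap (S m t) x) (ap (S n t) x) < e"
    by blast
qed

definition T :: "real \<Rightarrow> 'a \<Rightarrow> 'a" where
  "T t x = lim (\<lambda>n. ap (S n t) x)"

lemma T_uniform_limit: "uniform_limit {0..t0} (\<lambda>n t. ap (S n t) x) (\<lambda>t. T t x) sequentially"
  using uniformly_convergent_uniform_limit_iff[of "{0..t0}" "\<lambda>n t. ap (S n t) x"]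
    uniformly_convergent_eq_Cauchy S_uniformly_Cauchy
  unfolding T_def by blast

lemma T_tendsto: "0 \<le> t \<Longrightarrow> (\<lambda>n. ap (S n t) x) \<longlonglongrightarrow> T t x"
  by (rule tendsto_uniform_limitI[OF T_uniform_limit[where ?t0.0 = t]]) simp

lemma T_add: assumes "0 \<le> t" shows "T t (x + y) = T t x + T t y"
proof (rule LIMSEQ_unique[OF T_tendsto[OF assms]])
  show "(\<lambda>n. ap (S n t) (x + y)) \<longlonglongrightarrow> T t x + T t y"
    unfolding ap.add_right by (intro tendsto_intros T_tendsto assms)
qed

text \<open>For \<open>L\<close> the multiplication by a complex number, this makes the semigroup complex linear.\<close>

lemma T_commute:
  assumes "0 \<le> t" "bounded_linear L" "\<And>x. x \<in> D \<Longrightarrow> L x \<in> D" "\<And>x. x \<in> D \<Longrightarrow> A (L x) = L (A x)"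
  shows "T t (L x) = L (T t x)"
proof -
  interpret L: bounded_linear L by fact
  have J: "ap (J l) (L y) = L (ap (J l) y)" if "0 < l" for l y
  proof -
    have "R l (L y) = L (R l y)"
      using that arg_cong[OF R_eq[OF that, of y], of L]
      by (intro R_unique) (auto simp: assms R_in_D L.diff L.scaleR)
    with that show ?thesis by (simp add: ap_J L.scaleR)
  qed
  have "Endo (Blinfun L) * B n = B n * Endo (Blinfun L)" for n
    by (rule endo_eqI)
      (simp add: ap_Endo_Blinfun[OF assms(2)] B_def ap.scaleR_left ap.diff_left J L.scaleR L.diff)
  then have *: "Endo (Blinfun L) * S n t = S n t * Endo (Blinfun L)" for n
    unfolding S_def by (rule exp_commute)
  have "ap (S n t) (L x) = L (ap (S n t) x)" for n
    using arg_cong[OF *, of "\<lambda>f. ap f x" n] by (simp add: ap_Endo_Blinfun[OF assms(2)])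
  with L.tendsto[OF T_tendsto[OF assms(1)], of x] have "(\<lambda>n. ap (S n t) (L x)) \<longlonglongrightarrow> L (T t x)"
    by simp
  with T_tendsto[OF assms(1)] show ?thesis by (rule LIMSEQ_unique)
qed

lemma T_contraction: assumes "0 \<le> t" shows "b (T t x) (T t x) \<le> b x x"
proof (rule LIMSEQ_le_const2)
  show "(\<lambda>n. b (ap (S n t) x) (ap (S n t) x)) \<longlonglongrightarrow> b (T t x) (T t x)"
    by (intro b.tendsto T_tendsto assms)
qed (use S_contraction assms in blast)

lemma T_0: "T 0 x = x"
  using T_tendsto[of 0 x] by (simp add: S_def LIMSEQ_const_iff)

lemma T_semigroup: assumes "0 \<le> s" "0 \<le> t" shows "T (s + t) x = T s (T t x)"
proof (rule LIMSEQ_unique)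
  show "(\<lambda>n. ap (S n (s + t)) x) \<longlonglongrightarrow> T (s + t) x"
    using assms by (intro T_tendsto) auto
  have "(\<lambda>n. ap (S n s) (ap (S n t) x - T t x)) \<longlonglongrightarrow> 0"
  proof (rule Lim_null_comparison)
    show "\<forall>\<^sub>F n in sequentially. norm (ap (S n s) (ap (S n t) x - T t x)) \<le> K * norm (ap (S n t) x - T t x)"
      using S_bound assms by simp
    have "(\<lambda>n. K * norm (ap (S n t) x - T t x)) \<longlonglongrightarrow> K * norm (T t x - T t x)"
      by (intro tendsto_intros T_tendsto assms)
    then show "(\<lambda>n. K * norm (ap (S n t) x - T t x)) \<longlonglongrightarrow> 0" by simp
  qed
  from tendsto_add[OF this T_tendsto[OF assms(1), of "T t x"]]
  show "(\<lambda>n. ap (S n (s + t)) x) \<longlonglongrightarrow> T s (T t x)"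
    by (simp add: S_add ap.diff_right)
qed

lemma T_continuous: "continuous_on {0..t0} (\<lambda>t. T t x)"
proof (rule uniform_limit_theorem[OF _ T_uniform_limit])
  have "continuous_on {0..t0} (\<lambda>t. ap (S n t) x)" for n
    unfolding S_def
    by (rule ap.continuous_on[OF continuous_on_vector_derivative[OF
            exp_scaleR_has_vector_derivative_right] continuous_on_const])
  then show "\<forall>\<^sub>F n in sequentially. continuous_on {0..t0} (\<lambda>t. ap (S n t) x)" by simp
qed simp

lemma T_tendsto_0: "((\<lambda>t. T t x) \<longlongrightarrow> x) (at_right 0)"
proof -
  have "((\<lambda>t. T t x) \<longlongrightarrow> T 0 x) (at 0 within {0..1})"
    using T_continuous[of 1 x] by (simp add: continuous_on_def)
  then show ?thesis
    by (simp add: T_0 at_within_Icc_at_right)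
qed

text \<open>The derivative of \<open>S n t x - t B\<^sub>n x\<close> is \<open>S n t (B\<^sub>n x) - B\<^sub>n x\<close>, and \<open>B\<^sub>n x\<close> tends to
  \<open>A x\<close>. So the error of the first order expansion of \<open>T t x\<close> is at most \<open>t\<close> times the
  oscillation of \<open>T s (A x)\<close> for \<open>s \<le> t\<close>.\<close>

lemma T_expansion:
  assumes x: "x \<in> D" and "0 \<le> t" and e: "\<And>s. s \<in> {0..t} \<Longrightarrow> norm (T s (A x) - A x) \<le> e"
  shows "norm (T t x - x - t *\<^sub>R A x) \<le> e * t"
proof -
  have *: "norm (T t x - x - t *\<^sub>R A x) \<le> (e + \<delta>) * t" if "0 < \<delta>" for \<delta>
  proof (rule tendsto_upperbound)
    show "(\<lambda>n. norm (ap (S n t) x - x - t *\<^sub>R ap (B n) x)) \<longlonglongrightarrow> norm (T t x - x - t *\<^sub>R A x)"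
      by (intro tendsto_intros T_tendsto B_tendsto assms)
    have "(\<lambda>n. (K + 1) * norm (ap (B n) x - A x)) \<longlonglongrightarrow> (K + 1) * norm (A x - A x)"
      by (intro tendsto_intros B_tendsto x)
    then have "\<forall>\<^sub>F n in sequentially. (K + 1) * norm (ap (B n) x - A x) < \<delta> / 2"
      using that by (intro order_tendstoD) auto
    moreover have "\<forall>\<^sub>F n in sequentially. \<forall>s\<in>{0..t}. dist (ap (S n s) (A x)) (T s (A x)) < \<delta> / 2"
      using uniform_limitD[OF T_uniform_limit[where ?t0.0 = t and ?x = "A x"], of "\<delta> / 2"] that by simp
    ultimately show "\<forall>\<^sub>F n in sequentially. norm (ap (S n t) x - x - t *\<^sub>R ap (B n) x) \<le> (e + \<delta>) * t"
    proof eventually_elim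
      case (elim n)
      let ?f = "\<lambda>s. ap (S n s) x - s *\<^sub>R ap (B n) x"
      have "norm (?f t - ?f 0) \<le> (e + \<delta>) * t"
      proof (rule vector_derivative_bound[OF _ _ \<open>0 \<le> t\<close>])
        fix s assume s: "s \<in> {0..t}"
        have "((\<lambda>s. ap (S n s) x) has_vector_derivative ap (S n s) (ap (B n) x)) (at s within {0..t})"
          using ap.has_vector_derivative[OF exp_scaleR_has_vector_derivative_right has_vector_derivative_const]
          by (simp add: S_def ap.zero_right)
        then show "(?f has_vector_derivative ap (S n s) (ap (B n) x) - ap (B n) x) (at s within {0..t})"
          by (auto intro!: derivative_eq_intros)
        have split: "ap (S n s) (ap (B n) x) - ap (B n) x = ap (S n s) (ap (B n) x - A x)
            + (ap (S n s) (A x) - T s (A x)) + (T s (A x) - A x) - (ap (B n) x - A x)"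
          by (simp add: ap.diff_right)
        have triangle: "norm (u + v + w - z) \<le> norm u + norm v + norm w + norm z" for u v w z :: 'a
          by norm
        have "norm (ap (S n s) (ap (B n) x - A x)) \<le> K * norm (ap (B n) x - A x)"
          using s by (intro S_bound) auto
        moreover have "norm (ap (S n s) (A x) - T s (A x)) < \<delta> / 2"
          using elim(2) s by (simp add: dist_norm)
        moreover have "K * norm (ap (B n) x - A x) + norm (ap (B n) x - A x) < \<delta> / 2"
          using elim(1) by (simp add: distrib_right)
        ultimately show "norm (ap (S n s) (ap (B n) x) - ap (B n) x) \<le> e + \<delta>"
          using e[OF s] triangle[of "ap (S n s) (ap (B n) x - A x)" "ap (S n s) (A x) - T s (A x)"
              "T s (A x) - A x" "ap (B n) x - A x"]
          unfolding split by linarith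
      qed
      then show ?case by (simp add: S_def algebra_simps)
    qed
  qed simp
  show ?thesis
  proof (cases "t = 0")
    case False
    have "norm (T t x - x - t *\<^sub>R A x) \<le> e * t + d" if "0 < d" for d
      using *[of "d / t"] that False \<open>0 \<le> t\<close> by (simp add: algebra_simps)
    then show ?thesis by (rule field_le_epsilon)
  qed (simp add: T_0)
qed

lemma T_derivative:
  assumes x: "x \<in> D"
  shows "((\<lambda>t. (1 / t) *\<^sub>R (T t x - x)) \<longlongrightarrow> A x) (at_right 0)"
proof (rule tendstoI)
  fix e :: real assume "0 < e"
  have "\<forall>\<^sub>F t in at_right 0. dist (T t (A x)) (A x) < e / 2"
    using T_tendsto_0[of "A x"] \<open>0 < e\<close> by (intro tendstoD) auto
  then obtain d where d: "0 < d" "\<And>t. 0 < t \<Longrightarrow> t < d \<Longrightarrow> dist (T t (A x)) (A x) < e / 2"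
    by (auto simp: eventually_at_right_field)
  have "dist ((1 / t) *\<^sub>R (T t x - x)) (A x) < e" if "0 < t" "t < d" for t
  proof -
    have "norm (T t x - x - t *\<^sub>R A x) \<le> e / 2 * t"
    proof (rule T_expansion[OF x])
      show "norm (T s (A x) - A x) \<le> e / 2" if "s \<in> {0..t}" for s
        using d(2)[of s] that \<open>t < d\<close> \<open>0 < e\<close> by (cases "s = 0") (auto simp: T_0 dist_norm less_imp_le)
    qed (use that in simp)
    moreover have "(1 / t) *\<^sub>R (T t x - x) - A x = (1 / t) *\<^sub>R (T t x - x - t *\<^sub>R A x)"
      using that by (simp add: scaleR_diff_right)
    ultimately show ?thesis
      using that mult_pos_pos[OF \<open>0 < e\<close> \<open>0 < t\<close>]
      by (simp only: dist_norm norm_scaleR) (simp add: field_simps)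
  qed
  then show "\<forall>\<^sub>F t in at_right 0. dist ((1 / t) *\<^sub>R (T t x - x)) (A x) < e"
    using d(1) unfolding eventually_at_right_field by blast
qed

text \<open>If \<open>T\<close> has the right derivative \<open>y\<close> at \<open>x\<close>, let \<open>z\<close> in \<open>D\<close> solve \<open>z - A z = x - y\<close>.
  The derivative of \<open>T\<close> at \<open>z - x\<close> is then \<open>z - x\<close> itself, which contractivity only allows
  for \<open>z = x\<close>.\<close>

lemma T_generator:
  assumes y: "((\<lambda>t. (1 / t) *\<^sub>R (T t x - x)) \<longlongrightarrow> y) (at_right 0)"
  shows "x \<in> D \<and> y = A x"
proof -
  define z where "z = R 1 (x - y)"
  have z: "z \<in> D" "z - A z = x - y"
    using R_in_D[of 1 "x - y"] R_eq[of 1 "x - y"] by (auto simp: z_def)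
  let ?w = "z - x"
  have T_diff: "T t ?w = T t z - T t x" if "0 \<le> t" for t
    using T_add[OF that, of "z - x" x] by simp
  have "((\<lambda>t. (1 / t) *\<^sub>R (T t z - z) - (1 / t) *\<^sub>R (T t x - x)) \<longlongrightarrow> A z - y) (at_right 0)"
    by (intro tendsto_diff T_derivative z y)
  also have "A z - y = ?w" using z(2) by (simp add: algebra_simps)
  finally have "((\<lambda>t. b ((1 / t) *\<^sub>R (T t z - z) - (1 / t) *\<^sub>R (T t x - x)) ?w) \<longlongrightarrow> b ?w ?w) (at_right 0)"
    by (intro b.tendsto tendsto_const)
  then have "b ?w ?w \<le> 0"
  proof (rule tendsto_upperbound)
    have "b ((1 / t) *\<^sub>R (T t z - z) - (1 / t) *\<^sub>R (T t x - x)) ?w \<le> 0" if "0 < t" for t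
    proof -
      have "b (v - u) u \<le> 0" if "b v v \<le> b u u" for u v
        using b_nonneg[of "v - u"] that by (simp add: b.diff_left b.diff_right sym[of u v])
      from this[OF T_contraction] that have "b (T t ?w - ?w) ?w \<le> 0" by simp
      then have "(1 / t) * b (T t ?w - ?w) ?w \<le> 0"
        using that by (simp add: divide_le_0_iff)
      also have "(1 / t) * b (T t ?w - ?w) ?w = b ((1 / t) *\<^sub>R (T t ?w - ?w)) ?w"
        by (simp add: b.scaleR_left)
      also have "(1 / t) *\<^sub>R (T t ?w - ?w) = (1 / t) *\<^sub>R (T t z - z) - (1 / t) *\<^sub>R (T t x - x)"
        using that by (simp add: T_diff flip: scaleR_diff_right)
      finally show ?thesis .
    qed
    then show "\<forall>\<^sub>F t in at_right 0. b ((1 / t) *\<^sub>R (T t z - z) - (1 / t) *\<^sub>R (T t x - x)) ?w \<le> 0"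
      by (intro eventually_at_rightI[of 0 1]) simp_all
  qed simp
  then have "z = x" using b_eq_0 by fastforce
  with z show ?thesis by simp
qed

end

section \<open>Bounded perturbations and weights\<close>

text \<open>With the resolvent \<open>R\<close> of \<open>A\<close> at \<open>\<mu>\<close>, the equation says \<open>x = R (\<mu> x - G x + f)\<close>. The norm of
  \<open>R\<close> is at most \<open>1 / \<mu>\<close>, and coercivity makes the norm of \<open>\<mu> - G\<close> smaller than \<open>\<mu>\<close> for a suitable \<open>\<mu>\<close>,
  so the right hand side is a contraction.\<close>

lemma coercive_perturbation_surjective:
  fixes G A :: "'a::{real_inner,banach,perfect_space} \<Rightarrow> 'a"
  assumes A: "dissipative_operator inner D A 1" and G: "bounded_linear G"
    and c: "0 < c" "\<And>x. c * (norm x)\<^sup>2 \<le> inner (G x) x"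
  shows "\<exists>x\<in>D. G x - A x = f"
proof -
  interpret dissipative_operator inner D A 1 by fact
  interpret G: bounded_linear G by fact
  obtain M where M: "0 < M" "\<And>x. norm (G x) \<le> norm x * M"
    using G.pos_bounded by blast
  \<comment> \<open>This makes \<open>\<mu> - G\<close> smaller than \<open>\<mu>\<close>: \<open>\<mu>\<^sup>2 - 2 \<mu> c + M\<^sup>2 = \<mu>\<^sup>2 - \<mu> c\<close>.\<close>
  define \<mu> where "\<mu> = M\<^sup>2 / c"
  have \<mu>: "0 < \<mu>" "M\<^sup>2 = \<mu> * c" using M(1) c(1) by (simp_all add: \<mu>_def)
  have shift: "(norm (\<mu> *\<^sub>R v - G v))\<^sup>2 \<le> (\<mu>\<^sup>2 - \<mu> * c) * (norm v)\<^sup>2" for v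
  proof -
    have "(norm (\<mu> *\<^sub>R v - G v))\<^sup>2 = \<mu>\<^sup>2 * (norm v)\<^sup>2 - 2 * \<mu> * inner (G v) v + (norm (G v))\<^sup>2"
      unfolding power2_norm_eq_inner
      by (simp add: inner_diff inner_commute[of v "G v"] power2_eq_square algebra_simps)
    moreover have "(norm (G v))\<^sup>2 \<le> \<mu> * c * (norm v)\<^sup>2"
      using power_mono[OF M(2)[of v], of 2] by (simp add: power_mult_distrib \<mu>(2) mult.commute)
    moreover have "2 * \<mu> * (c * (norm v)\<^sup>2) \<le> 2 * \<mu> * inner (G v) v"
      using c(2)[of v] \<mu>(1) by (intro mult_left_mono) auto
    ultimately show ?thesis by (simp add: algebra_simps)
  qed
  have pos: "0 \<le> \<mu>\<^sup>2 - \<mu> * c"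
  proof -
    obtain v :: 'a where "v \<noteq> 0" using perfect_choose_dist[of 1 "0::'a"] by auto
    have "0 \<le> (\<mu>\<^sup>2 - \<mu> * c) * (norm v)\<^sup>2" using shift[of v] zero_le_power2 order_trans by blast
    with \<open>v \<noteq> 0\<close> show ?thesis by (simp add: zero_le_mult_iff)
  qed
  define q where "q = sqrt (\<mu>\<^sup>2 - \<mu> * c) / \<mu>"
  have q: "0 \<le> q" "q < 1"
  proof -
    have "sqrt (\<mu>\<^sup>2 - \<mu> * c) < sqrt (\<mu>\<^sup>2)" using \<mu>(1) c(1) by (intro real_sqrt_less_mono) simp
    then show "q < 1" using \<mu>(1) by (simp add: q_def)
  qed (use pos \<mu>(1) in \<open>simp add: q_def\<close>)
  let ?\<Phi> = "\<lambda>u. R \<mu> (\<mu> *\<^sub>R u - G u + f)"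
  have contraction: "dist (?\<Phi> u) (?\<Phi> v) \<le> q * dist u v" for u v
  proof -
    let ?w = "\<mu> *\<^sub>R (u - v) - G (u - v)"
    have "?\<Phi> u = R \<mu> (?w + (\<mu> *\<^sub>R v - G v + f))"
      by (simp add: G.diff algebra_simps)
    then have eq: "?\<Phi> u - ?\<Phi> v = R \<mu> ?w"
      by (simp only: R_add[OF \<mu>(1)]) simp
    have "(norm (\<mu> *\<^sub>R R \<mu> ?w))\<^sup>2 \<le> (norm ?w)\<^sup>2"
      using R_contraction[OF \<mu>(1), of ?w] by (simp only: power2_norm_eq_inner)
    also have "\<dots> \<le> (\<mu>\<^sup>2 - \<mu> * c) * (norm (u - v))\<^sup>2" by (rule shift)
    finally have "norm (\<mu> *\<^sub>R R \<mu> ?w) \<le> sqrt ((\<mu>\<^sup>2 - \<mu> * c) * (norm (u - v))\<^sup>2)"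
      by (rule real_le_rsqrt)
    then have "\<mu> * norm (R \<mu> ?w) \<le> sqrt (\<mu>\<^sup>2 - \<mu> * c) * norm (u - v)"
      using \<mu>(1) unfolding real_sqrt_mult by simp
    then show ?thesis using \<mu>(1) unfolding dist_norm eq q_def by (simp add: field_simps)
  qed
  obtain x where x: "?\<Phi> x = x"
    using banach_fix_type[OF q, of ?\<Phi>] contraction by blast
  show ?thesis
  proof
    show "x \<in> D" using R_in_D[OF \<mu>(1)] x by metis
    show "G x - A x = f"
      using R_eq[OF \<mu>(1), of "\<mu> *\<^sub>R x - G x + f"] unfolding x by (simp add: algebra_simps)
  qed
qed

text \<open>Expanding \<open>0 \<le> \<langle>z, E z\<rangle>\<close> for \<open>z = x - F x / k\<close> gives
  \<open>2 |x|\<^sup>2 / k \<le> \<langle>x, E x\<rangle> + \<langle>F x, x\<rangle> / k\<^sup>2\<close>, and the last term is at most \<open>|x|\<^sup>2 / k\<close>.\<close>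

lemma coercive_if_bounded_inverse:
  fixes E F :: "'a::real_inner \<Rightarrow> 'a"
  assumes E: "bounded_linear E" "\<And>x y. inner (E x) y = inner x (E y)" "\<And>x. 0 \<le> inner x (E x)"
    and F: "bounded_linear F" "\<And>x. E (F x) = x"
  shows "\<exists>k>0. (\<forall>x. norm (F x) \<le> norm x * k) \<and> (\<forall>x. 1 / k * (norm x)\<^sup>2 \<le> inner x (E x))"
proof -
  interpret E: bounded_linear E by fact
  obtain k where k: "0 < k" "\<And>x. norm (F x) \<le> norm x * k" using bounded_linear.pos_bounded[OF F(1)] by blast
  have "1 / k * (norm x)\<^sup>2 \<le> inner x (E x)" for x
  proof -
    let ?t = "1 / k"
    have "0 \<le> inner (x - ?t *\<^sub>R F x) (E (x - ?t *\<^sub>R F x))" by (rule E(3))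
    also have "\<dots> = inner x (E x) - 2 * ?t * (norm x)\<^sup>2 + ?t\<^sup>2 * inner (F x) x"
      unfolding power2_norm_eq_inner
      by (simp add: E.diff E.scaleR F inner_diff power2_eq_square
          E(2)[symmetric, of "F x" x] algebra_simps)
    finally have *: "0 \<le> inner x (E x) - 2 * ?t * (norm x)\<^sup>2 + ?t\<^sup>2 * inner (F x) x" .
    have "inner (F x) x \<le> norm (F x) * norm x" by (rule norm_cauchy_schwarz)
    also have "\<dots> \<le> (norm x * k) * norm x" by (intro mult_right_mono k) simp
    finally have "?t\<^sup>2 * inner (F x) x \<le> ?t\<^sup>2 * (norm x * k * norm x)" by (rule mult_left_mono) simp
    with * have "0 \<le> inner x (E x) - 2 * ?t * (norm x)\<^sup>2 + ?t\<^sup>2 * (norm x * k * norm x)" by linarith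
    then show ?thesis using k(1) by (simp add: power2_eq_square field_simps)
  qed
  with k show ?thesis by blast
qed

text \<open>The inner product \<open>\<langle>x, E y\<rangle>\<close> turns dissipativity of \<open>(A + P) E\<close> at \<open>x\<close> into that of \<open>A + P\<close> at
  \<open>E x\<close>. In terms of \<open>u = E x\<close>, the resolvent equation is \<open>(l F - P) u - A u = y\<close>, where \<open>l F - P\<close> is
  bounded and coercive.\<close>

lemma dissipative_operator_weighted:
  fixes E F P A :: "'a::{real_inner,banach,perfect_space} \<Rightarrow> 'a"
  assumes A: "dissipative_operator inner D A 1"
    and E: "bounded_linear E" "\<And>x y. inner (E x) y = inner x (E y)" "\<And>x. 0 \<le> inner x (E x)"
    and F: "bounded_linear F" "\<And>x. E (F x) = x" "\<And>x. F (E x) = x"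
    and P: "bounded_linear P" "\<And>x. inner (P x) x \<le> 0"
  shows "\<exists>c. dissipative_operator (\<lambda>x y. inner x (E y)) {x. E x \<in> D} (\<lambda>x. A (E x) + P (E x)) c"
proof -
  interpret A: dissipative_operator inner D A 1 by fact
  interpret E: bounded_linear E by fact
  interpret F: bounded_linear F by fact
  interpret P: bounded_linear P by fact
  obtain k where k: "0 < k" "\<forall>x. norm (F x) \<le> norm x * k" "\<forall>x. 1 / k * (norm x)\<^sup>2 \<le> inner x (E x)"
    using coercive_if_bounded_inverse[OF E F(1,2)] by blast
  then have coercive: "1 / k * (norm x)\<^sup>2 \<le> inner x (E x)" for x by blast
  obtain e where e: "0 < e" "\<And>x. norm (E x) \<le> norm x * e" using E.pos_bounded by blast
  have bilinear: "bounded_bilinear (\<lambda>x y. inner x (E y))"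
    by (rule bounded_bilinear.comp[OF bounded_bilinear_inner bounded_linear_ident E(1)])
  have surj: "\<exists>x\<in>{x. E x \<in> D}. l *\<^sub>R x - (A (E x) + P (E x)) = y" if l: "0 < l" for l y
  proof -
    have "\<exists>u\<in>D. (l *\<^sub>R F u - P u) - A u = y"
    proof (rule coercive_perturbation_surjective[OF A])
      show "bounded_linear (\<lambda>u. l *\<^sub>R F u - P u)"
        by (intro bounded_linear_sub bounded_linear_const_scaleR F(1) P(1))
      show "0 < l / (k * e\<^sup>2)" using l k e by simp
      fix u
      have "(norm u)\<^sup>2 \<le> (norm (F u) * e)\<^sup>2"
        using e(2)[of "F u"] by (intro power_mono) (simp_all add: F)
      then have "(norm u)\<^sup>2 / e\<^sup>2 \<le> (norm (F u))\<^sup>2"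
        using e(1) by (simp add: field_simps power_mult_distrib)
      then have "1 / k * ((norm u)\<^sup>2 / e\<^sup>2) \<le> 1 / k * (norm (F u))\<^sup>2"
        using k(1) by (intro mult_left_mono) auto
      also have "\<dots> \<le> inner (F u) u" using coercive[of "F u"] by (simp add: F)
      finally have "l * (1 / k * ((norm u)\<^sup>2 / e\<^sup>2)) \<le> l * inner (F u) u"
        using l by (intro mult_left_mono) auto
      then show "l / (k * e\<^sup>2) * (norm u)\<^sup>2 \<le> inner (l *\<^sub>R F u - P u) u"
        using P(2)[of u] by (simp add: inner_diff)
    qed
    then obtain u where u: "u \<in> D" "(l *\<^sub>R F u - P u) - A u = y" by blast
    show ?thesis
      by (rule bexI[of _ "F u"]) (use u in \<open>simp_all add: F algebra_simps\<close>)
  qed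
  have "dissipative_operator (\<lambda>x y. inner x (E y)) {x. E x \<in> D} (\<lambda>x. A (E x) + P (E x)) (1 / k)"
  proof (unfold_locales)
    show "inner x (E y) = inner y (E x)" for x y
      using E(2)[of y x] by (simp add: inner_commute)
    show "Real_Vector_Spaces.subspace {x. E x \<in> D}"
      by (auto simp: real_vector.subspace_def E.zero E.add E.scaleR A.D_0 A.D_add A.D_scale)
    show "inner (A (E x) + P (E x)) (E x) \<le> 0" if "x \<in> {x. E x \<in> D}" for x
      using A.dissipative[of "E x"] P(2)[of "E x"] that by (simp add: inner_add)
  qed (use k coercive surj bilinear in \<open>auto simp: A.A_add A.A_scale E.add E.scaleR P.add P.scaleR
        scaleR_add_right bounded_bilinear_def\<close>)
  then show ?thesis by blast
qed

section \<open>Square integrable functions as a Hilbert space\<close>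

definition sq_integrable :: "'b measure \<Rightarrow> ('b \<Rightarrow> 'a::euclidean_space) \<Rightarrow> bool" where
  "sq_integrable M f \<longleftrightarrow> f \<in> borel_measurable M \<and> integrable M (\<lambda>x. (norm (f x))\<^sup>2)"

lemma sq_integrable_measurable [measurable_dest]: "sq_integrable M f \<Longrightarrow> f \<in> borel_measurable M"
  by (simp add: sq_integrable_def)

lemma sq_integrable_norm: "sq_integrable M f \<Longrightarrow> integrable M (\<lambda>x. (norm (f x))\<^sup>2)"
  by (simp add: sq_integrable_def)

lemma sq_integrable_bound:
  assumes "sq_integrable M f" "sq_integrable M g" "h \<in> borel_measurable M"
    and "AE x in M. (norm (h x))\<^sup>2 \<le> C * ((norm (f x))\<^sup>2 + (norm (g x))\<^sup>2)"
  shows "sq_integrable M h"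
  unfolding sq_integrable_def
proof (intro conjI assms)
  have "integrable M (\<lambda>x. C * ((norm (f x))\<^sup>2 + (norm (g x))\<^sup>2))"
    using assms by (intro integrable_mult_right Bochner_Integration.integrable_add sq_integrable_norm)
  then show "integrable M (\<lambda>x. (norm (h x))\<^sup>2)"
    by (rule Bochner_Integration.integrable_bound)
      (use assms(3,4) in \<open>auto elim!: eventually_mono intro: order_trans[OF _ abs_ge_self]\<close>)
qed

lemma sq_integrable_add:
  assumes "sq_integrable M f" "sq_integrable M g"
  shows "sq_integrable M (\<lambda>x. f x + g x)"
proof (rule sq_integrable_bound[OF assms, where C = 2])
  show "AE x in M. (norm (f x + g x))\<^sup>2 \<le> 2 * ((norm (f x))\<^sup>2 + (norm (g x))\<^sup>2)"
  proof (rule AE_I2)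
    fix x
    have "(norm (f x + g x))\<^sup>2 \<le> (norm (f x) + norm (g x))\<^sup>2"
      by (intro power_mono norm_triangle_ineq) simp
    also have "\<dots> \<le> 2 * ((norm (f x))\<^sup>2 + (norm (g x))\<^sup>2)"
      using sum_squares_bound[of "norm (f x)" "norm (g x)"] by (simp add: power2_sum)
    finally show "(norm (f x + g x))\<^sup>2 \<le> 2 * ((norm (f x))\<^sup>2 + (norm (g x))\<^sup>2)" .
  qed
qed (use assms in measurable)

lemma sq_integrable_scaleR:
  assumes "sq_integrable M f"
  shows "sq_integrable M (\<lambda>x. c *\<^sub>R f x)"
  using assms by (auto simp: sq_integrable_def power_mult_distrib)

lemma sq_integrable_minus: "sq_integrable M f \<Longrightarrow> sq_integrable M (\<lambda>x. - f x)"
  using sq_integrable_scaleR[of M f "-1"] by simp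

lemma sq_integrable_diff:
  "sq_integrable M f \<Longrightarrow> sq_integrable M g \<Longrightarrow> sq_integrable M (\<lambda>x. f x - g x)"
  using sq_integrable_add[OF _ sq_integrable_minus, of M f g] by simp

lemma sq_integrable_0: "sq_integrable M (\<lambda>x. 0)"
  by (simp add: sq_integrable_def)

lemma sq_integrable_cong_AE:
  assumes "sq_integrable M f" "g \<in> borel_measurable M" "AE x in M. g x = f x"
  shows "sq_integrable M g"
  by (rule sq_integrable_bound[OF assms(1,1,2), where C = 1]) (use assms(3) in auto)

lemma integrable_inner:
  assumes "sq_integrable M f" "sq_integrable M g"
  shows "integrable M (\<lambda>x. inner (f x) (g x))"
proof (rule Bochner_Integration.integrable_bound)
  show "integrable M (\<lambda>x. (norm (f x))\<^sup>2 + (norm (g x))\<^sup>2)"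
    using assms by (intro Bochner_Integration.integrable_add sq_integrable_norm)
  show "AE x in M. norm (inner (f x) (g x)) \<le> norm ((norm (f x))\<^sup>2 + (norm (g x))\<^sup>2)"
  proof (rule AE_I2)
    fix x
    have "\<bar>inner (f x) (g x)\<bar> \<le> norm (f x) * norm (g x)" by (rule Cauchy_Schwarz_ineq2)
    also have "\<dots> \<le> (norm (f x))\<^sup>2 + (norm (g x))\<^sup>2"
      using sum_squares_bound[of "norm (f x)" "norm (g x)"]
        mult_nonneg_nonneg[OF norm_ge_zero norm_ge_zero, of "f x" "g x"] by linarith
    finally show "norm (inner (f x) (g x)) \<le> norm ((norm (f x))\<^sup>2 + (norm (g x))\<^sup>2)" by simp
  qed
  show "(\<lambda>x. inner (f x) (g x)) \<in> borel_measurable M" using assms by measurable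
qed

text \<open>Riesz--Fischer: along a subsequence with \<open>\<integral>|f\<^sub>k\<^sub>+\<^sub>1 - f\<^sub>k|\<^sup>2 < 4\<^sup>-\<^sup>k\<close> the sum of
  \<open>2\<^sup>k |f\<^sub>k\<^sub>+\<^sub>1 - f\<^sub>k|\<^sup>2\<close> has a finite integral, so the subsequence converges almost everywhere,
  and Fatou's lemma bounds the distance to the limit.\<close>

lemma L2_complete:
  fixes f :: "nat \<Rightarrow> 'b \<Rightarrow> 'a::euclidean_space"
  assumes f: "\<And>n. sq_integrable M (f n)"
    and Cauchy: "\<And>e. 0 < e \<Longrightarrow> \<exists>N. \<forall>n\<ge>N. \<forall>m\<ge>N. (LINT x|M. (norm (f n x - f m x))\<^sup>2) < e"
  obtains g where "sq_integrable M g"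
    "(\<lambda>n. LINT x|M. (norm (f n x - g x))\<^sup>2) \<longlonglongrightarrow> 0"
proof -
  have fm [measurable]: "f n \<in> borel_measurable M" for n
    using f by (simp add: sq_integrable_def)
  have int: "integrable M (\<lambda>x. (norm (f n x - f m x))\<^sup>2)" for n m
    by (intro sq_integrable_norm sq_integrable_diff f)
  obtain r :: "nat \<Rightarrow> nat" where r: "strict_mono r"
    "\<And>k n m. n \<ge> r k \<Longrightarrow> m \<ge> r k \<Longrightarrow> (LINT x|M. (norm (f n x - f m x))\<^sup>2) < 1 / 4 ^ k"
  proof -
    have "\<forall>k. \<exists>N. \<forall>n\<ge>N. \<forall>m\<ge>N. (LINT x|M. (norm (f n x - f m x))\<^sup>2) < 1 / 4 ^ k"
      by (intro allI Cauchy) simp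
    from choice[OF this] obtain N where
      N: "\<And>k n m. n \<ge> N k \<Longrightarrow> m \<ge> N k \<Longrightarrow> (LINT x|M. (norm (f n x - f m x))\<^sup>2) < 1 / 4 ^ k"
      by blast
    define r where "r k = (\<Sum>i\<le>k. Suc (N i))" for k
    have "strict_mono r" unfolding strict_mono_Suc_iff by (simp add: r_def)
    moreover have "N k \<le> r k" for k
      unfolding r_def using member_le_sum[of k "{..k}" "\<lambda>i. Suc (N i)"] by simp
    ultimately show ?thesis using N that[of r] order_trans[of "N _" "r _"] by blast
  qed
  define d where "d k x = f (r (Suc k)) x - f (r k) x" for k x
  have dm [measurable]: "d k \<in> borel_measurable M" for k unfolding d_def by measurable
  have "(\<integral>\<^sup>+x. (\<Sum>k. ennreal (2 ^ k * (norm (d k x))\<^sup>2)) \<partial>M) = (\<Sum>k. \<integral>\<^sup>+x. ennreal (2 ^ k * (norm (d k x))\<^sup>2) \<partial>M)"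
    by (rule nn_integral_suminf) measurable
  also have "\<dots> \<le> (\<Sum>k. ennreal ((1/2) ^ k))"
  proof (rule suminf_le)
    fix k
    have "(\<integral>\<^sup>+x. ennreal (2 ^ k * (norm (d k x))\<^sup>2) \<partial>M) = ennreal (LINT x|M. 2 ^ k * (norm (d k x))\<^sup>2)"
      unfolding d_def by (intro nn_integral_eq_integral integrable_mult_right int) auto
    also have "\<dots> = ennreal (2 ^ k * (LINT x|M. (norm (d k x))\<^sup>2))" by simp
    also have "\<dots> \<le> ennreal (2 ^ k * (1 / 4 ^ k))"
      unfolding d_def using r(2)[of k "r (Suc k)" "r k"] strict_mono_less_eq[OF r(1)]
      by (intro ennreal_leI mult_left_mono less_imp_le) auto
    also have "2 ^ k * (1 / 4 ^ k) = ((1/2) ^ k :: real)"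
      by (simp add: power_divide flip: power_mult_distrib) (simp add: field_simps flip: power_mult_distrib)
    finally show "(\<integral>\<^sup>+x. ennreal (2 ^ k * (norm (d k x))\<^sup>2) \<partial>M) \<le> ennreal ((1/2) ^ k)" .
  qed auto
  also have "\<dots> = ennreal (\<Sum>k. (1/2) ^ k)"
    by (rule suminf_ennreal2) (auto intro: summable_geometric)
  finally have "(\<integral>\<^sup>+x. (\<Sum>k. ennreal (2 ^ k * (norm (d k x))\<^sup>2)) \<partial>M) \<noteq> \<infinity>"
    by (metis ennreal_neq_top infinity_ennreal_def neq_top_trans)
  then have "AE x in M. (\<Sum>k. ennreal (2 ^ k * (norm (d k x))\<^sup>2)) \<noteq> \<infinity>"
    by (rule nn_integral_PInf_AE[rotated]) measurable
  then have conv: "AE x in M. convergent (\<lambda>k. f (r k) x)"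
  proof eventually_elim
    case (elim x)
    have s: "summable (\<lambda>k. 2 ^ k * (norm (d k x))\<^sup>2)"
      using elim by (intro summable_suminf_not_top) auto
    have "summable (\<lambda>k. norm (d k x))"
    proof (rule summable_comparison_test')
      show "summable (\<lambda>k. (1/2) ^ k + 2 ^ k * (norm (d k x))\<^sup>2)"
        by (intro summable_add s summable_geometric) simp
      fix k
      have "0 \<le> ((1 / 2 ^ k) - norm (d k x)) * ((1 / 2 ^ k) - norm (d k x)) * 2 ^ k" by simp
      also have "\<dots> = (1/2) ^ k - 2 * norm (d k x) + 2 ^ k * (norm (d k x))\<^sup>2"
        by (simp add: field_simps power2_eq_square)
      finally show "norm (norm (d k x)) \<le> (1/2) ^ k + 2 ^ k * (norm (d k x))\<^sup>2"
        using norm_ge_zero[of "d k x"] by (simp only: real_norm_def abs_norm_cancel)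
    qed
    then have "summable (\<lambda>k. d k x)" by (rule summable_norm_cancel)
    then have "(\<lambda>n. \<Sum>k<n. f (r (Suc k)) x - f (r k) x) \<longlonglongrightarrow> (\<Sum>k. d k x)"
      unfolding d_def by (rule summable_LIMSEQ)
    then have "(\<lambda>n. f (r n) x - f (r 0) x) \<longlonglongrightarrow> (\<Sum>k. d k x)"
      by (simp only: sum_lessThan_telescope[where f = "\<lambda>n. f (r n) x"])
    from tendsto_add[OF this tendsto_const[of "f (r 0) x"]] show ?case
      by (auto simp: convergent_def)
  qed
  define g where "g x = lim (\<lambda>k. f (r k) x)" for x
  have gm [measurable]: "g \<in> borel_measurable M"
    unfolding g_def by (rule borel_measurable_lim_metric) measurable
  have Fatou: "(\<integral>\<^sup>+x. ennreal ((norm (f n x - g x))\<^sup>2) \<partial>M) \<le> ennreal e"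
    if N: "\<And>n m. n \<ge> N \<Longrightarrow> m \<ge> N \<Longrightarrow> (LINT x|M. (norm (f n x - f m x))\<^sup>2) \<le> e" and n: "n \<ge> N" for e N n
  proof -
    have "(\<integral>\<^sup>+x. ennreal ((norm (f n x - g x))\<^sup>2) \<partial>M)
        = (\<integral>\<^sup>+x. liminf (\<lambda>k. ennreal ((norm (f n x - f (r k) x))\<^sup>2)) \<partial>M)"
    proof (rule nn_integral_cong_AE)
      show "AE x in M. ennreal ((norm (f n x - g x))\<^sup>2) = liminf (\<lambda>k. ennreal ((norm (f n x - f (r k) x))\<^sup>2))"
        using conv
      proof eventually_elim
        case (elim x)
        then have "(\<lambda>k. f (r k) x) \<longlonglongrightarrow> g x"
          unfolding g_def by (simp add: convergent_LIMSEQ_iff)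
        then have "(\<lambda>k. ennreal ((norm (f n x - f (r k) x))\<^sup>2)) \<longlonglongrightarrow> ennreal ((norm (f n x - g x))\<^sup>2)"
          by (intro tendsto_intros)
        then show ?case by (intro lim_imp_Liminf[symmetric]) auto
      qed
    qed
    also have "\<dots> \<le> liminf (\<lambda>k. \<integral>\<^sup>+x. ennreal ((norm (f n x - f (r k) x))\<^sup>2) \<partial>M)"
      by (rule nn_integral_liminf) measurable
    also have "\<dots> \<le> liminf (\<lambda>k. ennreal e)"
    proof (rule Liminf_mono)
      show "\<forall>\<^sub>F k in sequentially. (\<integral>\<^sup>+x. ennreal ((norm (f n x - f (r k) x))\<^sup>2) \<partial>M) \<le> ennreal e"
      proof (rule eventually_sequentiallyI)
        fix k assume "N \<le> k"
        then have "N \<le> r k" using seq_suble[OF r(1), of k] by simp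
        have "(\<integral>\<^sup>+x. ennreal ((norm (f n x - f (r k) x))\<^sup>2) \<partial>M) = ennreal (LINT x|M. (norm (f n x - f (r k) x))\<^sup>2)"
          by (intro nn_integral_eq_integral int) auto
        also have "\<dots> \<le> ennreal e" using N[OF n \<open>N \<le> r k\<close>] by (rule ennreal_leI)
        finally show "(\<integral>\<^sup>+x. ennreal ((norm (f n x - f (r k) x))\<^sup>2) \<partial>M) \<le> ennreal e" .
      qed
    qed
    finally show ?thesis by (simp add: Liminf_const)
  qed
  have sq: "sq_integrable M (\<lambda>x. f n x - g x) \<and> (LINT x|M. (norm (f n x - g x))\<^sup>2) \<le> e"
    if N: "\<And>n m. n \<ge> N \<Longrightarrow> m \<ge> N \<Longrightarrow> (LINT x|M. (norm (f n x - f m x))\<^sup>2) \<le> e" and n: "n \<ge> N" for e N n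
  proof -
    have "0 \<le> e" using N[OF n n] by simp
    have "integrable M (\<lambda>x. (norm (f n x - g x))\<^sup>2)"
      using Fatou[OF N n] by (intro integrableI_bounded) (auto simp: le_less_trans)
    moreover have "(LINT x|M. (norm (f n x - g x))\<^sup>2) \<le> e"
      using Fatou[OF N n] \<open>0 \<le> e\<close> nn_integral_eq_integral[OF calculation] by (simp add: ennreal_le_iff)
    ultimately show ?thesis by (simp add: sq_integrable_def)
  qed
  obtain N where N: "\<forall>n\<ge>N. \<forall>m\<ge>N. (LINT x|M. (norm (f n x - f m x))\<^sup>2) < 1"
    using Cauchy[of 1] by auto
  have "sq_integrable M (\<lambda>x. f N x - g x)"
    using sq[of N 1 N] N by (simp add: less_imp_le)
  from sq_integrable_diff[OF f[of N] this] have "sq_integrable M g" by simp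
  moreover have "(\<lambda>n. LINT x|M. (norm (f n x - g x))\<^sup>2) \<longlonglongrightarrow> 0"
  proof (rule LIMSEQ_I)
    fix e :: real assume e: "0 < e"
    then obtain N where N: "\<forall>n\<ge>N. \<forall>m\<ge>N. (LINT x|M. (norm (f n x - f m x))\<^sup>2) < e / 2"
      using Cauchy[of "e / 2"] by auto
    then have "(LINT x|M. (norm (f n x - g x))\<^sup>2) \<le> e / 2" if "n \<ge> N" for n
      using sq[of N "e / 2" n] that by (simp add: less_imp_le)
    then show "\<exists>N. \<forall>n\<ge>N. norm ((LINT x|M. (norm (f n x - g x))\<^sup>2) - 0) < e"
      using e by (intro exI[of _ N]) fastforce
  qed
  ultimately show ?thesis by (rule that)
qed

text \<open>The functions on countably many copies of the half-line. For every \<open>d\<close>, the functions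
  that vanish on all but the first \<open>d\<close> copies are a closed subspace, which is \<open>L\<^sup>2\<close> of the
  half-line with values in the space of dimension \<open>d\<close>; so one type serves all dimensions.\<close>

abbreviation half_lines :: "(nat \<times> real) measure" where
  "half_lines \<equiv> count_space UNIV \<Otimes>\<^sub>M half_line"

definition L2_rel :: "(nat \<times> real \<Rightarrow> 'a::euclidean_space) \<Rightarrow> (nat \<times> real \<Rightarrow> 'a) \<Rightarrow> bool" where
  "L2_rel f g \<longleftrightarrow> sq_integrable half_lines f \<and> sq_integrable half_lines g \<and> (AE p in half_lines. f p = g p)"

quotient_type (overloaded) 'a hilbert = "nat \<times> real \<Rightarrow> 'a::euclidean_space" / partial: L2_rel
proof (rule part_equivpI)
  show "\<exists>f::nat \<times> real \<Rightarrow> 'a. L2_rel f f"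
    using sq_integrable_0 unfolding L2_rel_def by blast
  show "symp (L2_rel :: (nat \<times> real \<Rightarrow> 'a) \<Rightarrow> _)"
    unfolding symp_def L2_rel_def by (auto simp: eq_commute)
  show "transp (L2_rel :: (nat \<times> real \<Rightarrow> 'a) \<Rightarrow> _)"
    unfolding transp_def L2_rel_def by (auto elim: eventually_elim2)
qed

instantiation hilbert :: (euclidean_space) real_vector
begin
lift_definition zero_hilbert :: "'a hilbert" is "\<lambda>_. 0"
  by (simp add: L2_rel_def sq_integrable_0)
lift_definition plus_hilbert :: "'a hilbert \<Rightarrow> 'a hilbert \<Rightarrow> 'a hilbert" is "\<lambda>f g p. f p + g p"
  unfolding L2_rel_def by (auto intro!: sq_integrable_add)
lift_definition minus_hilbert :: "'a hilbert \<Rightarrow> 'a hilbert \<Rightarrow> 'a hilbert" is "\<lambda>f g p. f p - g p"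
  unfolding L2_rel_def by (auto intro!: sq_integrable_diff)
lift_definition uminus_hilbert :: "'a hilbert \<Rightarrow> 'a hilbert" is "\<lambda>f p. - f p"
  unfolding L2_rel_def by (auto intro!: sq_integrable_minus)
lift_definition scaleR_hilbert :: "real \<Rightarrow> 'a hilbert \<Rightarrow> 'a hilbert" is "\<lambda>c f p. c *\<^sub>R f p"
  unfolding L2_rel_def by (auto intro!: sq_integrable_scaleR)
instance
  by standard
    (transfer; auto simp: L2_rel_def algebra_simps
      intro!: sq_integrable_add sq_integrable_scaleR sq_integrable_0 sq_integrable_diff sq_integrable_minus)+
end

instantiation hilbert :: (euclidean_space) real_inner
begin
lift_definition inner_hilbert :: "'a hilbert \<Rightarrow> 'a hilbert \<Rightarrow> real" is
  "\<lambda>f g. LINT p|half_lines. inner (f p) (g p)"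
  unfolding L2_rel_def
  by (intro integral_cong_AE) (auto dest!: sq_integrable_measurable)
definition norm_hilbert :: "'a hilbert \<Rightarrow> real" where "norm_hilbert f = sqrt (inner f f)"
definition dist_hilbert :: "'a hilbert \<Rightarrow> 'a hilbert \<Rightarrow> real" where "dist_hilbert f g = norm (f - g)"
definition sgn_hilbert :: "'a hilbert \<Rightarrow> 'a hilbert" where "sgn_hilbert f = f /\<^sub>R norm f"
definition uniformity_hilbert :: "('a hilbert \<times> 'a hilbert) filter" where
  "uniformity_hilbert = (INF e\<in>{0<..}. principal {(x, y). dist x y < e})"
definition open_hilbert :: "'a hilbert set \<Rightarrow> bool" where
  "open_hilbert U = (\<forall>x\<in>U. \<forall>\<^sub>F (x', y) in uniformity. x' = x \<longrightarrow> y \<in> U)"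
instance
proof
  fix x y z :: "'a hilbert" and r :: real
  show "inner x y = inner y x"
    by transfer (simp add: inner_commute)
  show "inner (x + y) z = inner x z + inner y z"
    by transfer (auto simp: L2_rel_def inner_add integrable_inner intro!: Bochner_Integration.integral_add)
  show "inner (r *\<^sub>R x) y = r * inner x y"
    by transfer simp
  show "0 \<le> inner x x"
    by transfer simp
  show "(inner x x = 0) = (x = 0)"
  proof transfer
    fix f :: "nat \<times> real \<Rightarrow> 'a" assume "L2_rel f f"
    then have f: "sq_integrable half_lines f" by (simp add: L2_rel_def)
    have "(LINT p|half_lines. inner (f p) (f p)) = 0 \<longleftrightarrow> (AE p in half_lines. inner (f p) (f p) = 0)"
      using integrable_inner[OF f f] by (intro integral_nonneg_eq_0_iff_AE) auto
    then show "(LINT p|half_lines. inner (f p) (f p)) = 0 \<longleftrightarrow> L2_rel f (\<lambda>_. 0)"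
      using f by (simp add: L2_rel_def sq_integrable_0)
  qed
qed (simp_all add: norm_hilbert_def dist_hilbert_def sgn_hilbert_def uniformity_hilbert_def open_hilbert_def)
end

lift_definition to_hilbert :: "(nat \<times> real \<Rightarrow> 'a::euclidean_space) \<Rightarrow> 'a hilbert" is
  "\<lambda>f. if sq_integrable half_lines f then f else (\<lambda>_. 0)"
  by (auto simp: L2_rel_def sq_integrable_0)

definition of_hilbert :: "'a::euclidean_space hilbert \<Rightarrow> nat \<times> real \<Rightarrow> 'a" where
  "of_hilbert x = (SOME f. sq_integrable half_lines f \<and> to_hilbert f = x)"

lemma of_hilbert: "sq_integrable half_lines (of_hilbert x)" "to_hilbert (of_hilbert x) = x"
proof -
  have "\<exists>f. sq_integrable half_lines f \<and> to_hilbert f = x"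
    by transfer (auto simp: L2_rel_def)
  from someI_ex[OF this] show "sq_integrable half_lines (of_hilbert x)" "to_hilbert (of_hilbert x) = x"
    unfolding of_hilbert_def by auto
qed

lemma to_hilbert_eq_iff:
  "sq_integrable half_lines f \<Longrightarrow> sq_integrable half_lines g \<Longrightarrow>
    to_hilbert f = to_hilbert g \<longleftrightarrow> (AE p in half_lines. f p = g p)"
  by transfer (simp add: L2_rel_def)

lemma of_to_hilbert:
  "sq_integrable half_lines f \<Longrightarrow> AE p in half_lines. of_hilbert (to_hilbert f) p = f p"
  using of_hilbert[of "to_hilbert f"] by (simp add: to_hilbert_eq_iff)

lemma to_hilbert_add: "sq_integrable half_lines f \<Longrightarrow> sq_integrable half_lines g \<Longrightarrow>
    to_hilbert (\<lambda>p. f p + g p) = to_hilbert f + to_hilbert g"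
  by transfer (simp add: L2_rel_def sq_integrable_add)

lemma to_hilbert_diff: "sq_integrable half_lines f \<Longrightarrow> sq_integrable half_lines g \<Longrightarrow>
    to_hilbert (\<lambda>p. f p - g p) = to_hilbert f - to_hilbert g"
  by transfer (simp add: L2_rel_def sq_integrable_diff)

lemma to_hilbert_scaleR: "sq_integrable half_lines f \<Longrightarrow> to_hilbert (\<lambda>p. c *\<^sub>R f p) = c *\<^sub>R to_hilbert f"
  by transfer (simp add: L2_rel_def sq_integrable_scaleR)

lemma inner_to_hilbert: "sq_integrable half_lines f \<Longrightarrow> sq_integrable half_lines g \<Longrightarrow>
    inner (to_hilbert f) (to_hilbert g) = (LINT p|half_lines. inner (f p) (g p))"
  by transfer simp

instance hilbert :: (euclidean_space) banach
proof
  fix X :: "nat \<Rightarrow> 'a hilbert" assume X: "Cauchy X"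
  define f where "f n = of_hilbert (X n)" for n
  have f: "sq_integrable half_lines (f n)" "to_hilbert (f n) = X n" for n
    by (simp_all add: f_def of_hilbert)
  have dist: "(dist (to_hilbert f) (to_hilbert g))\<^sup>2 = (LINT p|half_lines. (norm (f p - g p))\<^sup>2)"
    if "sq_integrable half_lines f" "sq_integrable half_lines g" for f g :: "nat \<times> real \<Rightarrow> 'a"
    using that by (simp add: dist_norm to_hilbert_diff[symmetric] power2_norm_eq_inner[of "to_hilbert _"]
        inner_to_hilbert sq_integrable_diff) (simp add: power2_norm_eq_inner)
  obtain g where g: "sq_integrable half_lines g"
    "(\<lambda>n. LINT p|half_lines. (norm (f n p - g p))\<^sup>2) \<longlonglongrightarrow> 0"
  proof (rule L2_complete[OF f(1)])
    fix e :: real assume "0 < e"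
    then obtain N where N: "\<forall>n\<ge>N. \<forall>m\<ge>N. dist (X n) (X m) < sqrt e"
      using metric_CauchyD[OF X, of "sqrt e"] by auto
    have "(LINT p|half_lines. (norm (f n p - f m p))\<^sup>2) < e" if "n \<ge> N" "m \<ge> N" for n m
    proof -
      have "(dist (X n) (X m))\<^sup>2 < (sqrt e)\<^sup>2" using N that by (intro power_strict_mono) auto
      then show ?thesis using \<open>0 < e\<close> dist[OF f(1) f(1), of n m] by (simp add: f(2))
    qed
    then show "\<exists>N. \<forall>n\<ge>N. \<forall>m\<ge>N. (LINT p|half_lines. (norm (f n p - f m p))\<^sup>2) < e" by blast
  qed
  have "(\<lambda>n. (dist (X n) (to_hilbert g))\<^sup>2) \<longlonglongrightarrow> 0"
    using g(2) dist[OF f(1) g(1)] by (simp add: f(2))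
  from tendsto_real_sqrt[OF this] have "(\<lambda>n. dist (X n) (to_hilbert g)) \<longlonglongrightarrow> 0" by simp
  then have "X \<longlonglongrightarrow> to_hilbert g" by (rule tendsto_dist_iff[THEN iffD2])
  then show "convergent X" by (rule convergentI)
qed

lemma sigma_finite_half_line: "sigma_finite_measure half_line"
proof
  have "emeasure half_line {0..real n} \<noteq> \<infinity>" for n
    by (subst emeasure_restrict_space) auto
  moreover have "\<Union> (range (\<lambda>n. {0..real n})) = space half_line"
    unfolding set_eq_iff by (simp add: space_restrict_space real_arch_simple)
  ultimately show "\<exists>A. countable A \<and> A \<subseteq> sets half_line \<and> \<Union>A = space half_line \<and> (\<forall>a\<in>A. emeasure half_line a \<noteq> \<infinity>)"
    by (intro exI[of _ "range (\<lambda>n. {0..real n})"]) (auto simp: sets_restrict_space_iff)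
qed

interpretation half_line: sigma_finite_measure half_line
  by (rule sigma_finite_half_line)

interpretation half_lines: pair_sigma_finite "count_space (UNIV :: nat set)" half_line
  by (intro pair_sigma_finite.intro sigma_finite_half_line sigma_finite_measure_count_space)

instance hilbert :: (euclidean_space) perfect_space
proof
  fix x :: "'a hilbert"
  obtain b :: 'a where b: "b \<in> Basis" using nonempty_Basis by blast
  define S :: "(nat \<times> real) set" where "S = {0} \<times> {0..1}"
  have S: "S \<in> sets half_lines" unfolding S_def
    by (intro pair_measureI) (auto simp: sets_restrict_space_iff)
  have "emeasure half_lines S = 1"
    unfolding S_def
    by (subst half_line.emeasure_pair_measure_Times)
      (auto simp: sets_restrict_space_iff emeasure_restrict_space)
  define f where "f p = indicat_real S p *\<^sub>R b" for p
  have f: "sq_integrable half_lines f"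
    unfolding sq_integrable_def f_def
  proof
    show "(\<lambda>p. indicat_real S p *\<^sub>R b) \<in> borel_measurable half_lines"
      using S by measurable
    have "integrable half_lines (indicat_real S)"
      using S \<open>emeasure half_lines S = 1\<close> by simp
    moreover have "(\<lambda>p. (norm (indicat_real S p *\<^sub>R b))\<^sup>2) = indicat_real S"
      using b by (auto simp: fun_eq_iff indicator_def)
    ultimately show "integrable half_lines (\<lambda>p. (norm (indicat_real S p *\<^sub>R b))\<^sup>2)" by simp
  qed
  have "to_hilbert f \<noteq> 0"
  proof
    assume "to_hilbert f = 0"
    also have "0 = to_hilbert (\<lambda>_. 0 :: 'a)" by transfer (simp add: L2_rel_def sq_integrable_0)
    finally have "AE p in half_lines. f p = 0"
      by (rule to_hilbert_eq_iff[OF f sq_integrable_0, THEN iffD1])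
    then have "AE p in half_lines. p \<notin> S"
      by eventually_elim (use b in \<open>auto simp: f_def indicator_def split: if_splits\<close>)
    then have "emeasure half_lines S = 0"
      using S by (subst (asm) AE_iff_measurable[of S]) (auto dest: sets.sets_into_space)
    with \<open>emeasure half_lines S = 1\<close> show False by simp
  qed
  then have v: "norm (to_hilbert f) > 0" by simp
  show "\<not> open {x}"
  proof
    assume "open {x}"
    then obtain e where e: "0 < e" "ball x e \<subseteq> {x}" by (auto simp: open_contains_ball)
    let ?y = "x + (e / (2 * norm (to_hilbert f))) *\<^sub>R to_hilbert f"
    have "dist x ?y < e" using e v by (simp add: dist_norm)
    with e(2) have "?y = x" by (auto simp: mem_ball)
    with e v show False by simp
  qed
qed

section \<open>Vector-valued square integrable functions on the half-line\<close>

text \<open>By polarisation of \<open>|z|\<^sup>2 = z z\<^sup>*\<close>.\<close>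

lemma inner_eq_re: "inner (a::'f::real_or_complex) b = re (a * conjugate b)"
proof -
  have norm_sq: "of_real ((norm z)\<^sup>2) = z * conjugate z" for z :: 'f
    by (simp add: mult_conjugate)
  have conj_add: "conjugate (x + y) = conjugate x + conjugate y" for x y :: 'f
    by (rule conjugate_dist_add)
  have "of_real (2 * inner a b) = (of_real ((norm (a + b))\<^sup>2 - (norm a)\<^sup>2 - (norm b)\<^sup>2) :: 'f)"
    unfolding power2_norm_eq_inner by (simp add: inner_add inner_commute[of b a])
  also have "\<dots> = a * conjugate b + b * conjugate a"
    by (simp add: norm_sq conj_add algebra_simps del: of_real_power)
  also have "b * conjugate a = conjugate (a * conjugate b)"
    by (simp add: conjugate_dist_mul)
  also have "a * conjugate b + conjugate (a * conjugate b) = of_real (2 * re (a * conjugate b))"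
    by (simp add: add_conjugate re_def)
  finally show ?thesis by (simp only: of_real_eq_iff)
qed

lemma bounded_linear_re: "bounded_linear (re :: 'f::real_or_complex \<Rightarrow> real)"
  unfolding re_def by (rule bounded_linear_inner_left)

lemma re_sum: "re (sum f I) = (\<Sum>i\<in>I. re (f i))"
  and re_scaleR: "re (r *\<^sub>R z) = r * re z"
  and re_add: "re (x + y) = re x + re y"
  and re_of_real: "re (of_real r :: 'f::real_or_complex) = r"
  by (simp_all add: re_def inner_sum_left inner_add of_real_def power2_norm_eq_inner[symmetric])

lemma bounded_linear_conjugate: "bounded_linear (conjugate :: 'f::real_or_complex \<Rightarrow> 'f)"
proof
  fix x y :: 'f and r :: real
  show "conjugate (x + y) = conjugate x + conjugate y" by (rule conjugate_dist_add)
  have eq: "conjugate z = of_real (2 * re z) - z" for z :: 'f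
    using add_conjugate[of z] by (simp add: re_def algebra_simps)
  show "conjugate (r *\<^sub>R x) = r *\<^sub>R conjugate x"
    unfolding eq re_scaleR scaleR_diff_right by (simp add: scaleR_conv_of_real)
  show "\<exists>K. \<forall>x::'f. norm (conjugate x) \<le> norm x * K"
  proof (intro exI allI)
    fix x :: 'f
    have "norm (x * conjugate x) = (norm x)\<^sup>2" by (simp only: mult_conjugate norm_of_real) simp
    then show "norm (conjugate x) \<le> norm x * 1"
      by (cases "x = 0") (auto simp: norm_mult power2_eq_square)
  qed
qed

lemma re_scalar_prod: "x \<in> carrier_vec d \<Longrightarrow> z \<in> carrier_vec d \<Longrightarrow>
    re (x \<bullet>c (z :: 'f::real_or_complex vec)) = (\<Sum>i<d. inner (x $ i) (z $ i))"
  by (auto simp: scalar_prod_def re_sum inner_eq_re atLeast0LessThan intro!: sum.cong)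

lemma L2_carrier: "x \<in> L2 d \<Longrightarrow> 0 \<le> \<zeta> \<Longrightarrow> x \<zeta> \<in> carrier_vec d"
  by (simp add: L2_def)

lemma L2_dim: "x \<in> L2 d \<Longrightarrow> 0 \<le> \<zeta> \<Longrightarrow> dim_vec (x \<zeta>) = d"
  by (rule carrier_vecD[OF L2_carrier])

lemma L2_component: "x \<in> L2 d \<Longrightarrow> i < d \<Longrightarrow> sq_integrable half_line (\<lambda>\<zeta>. x \<zeta> $ i)"
  by (simp add: L2_def sq_integrable_def)

lemma L2I: "(\<And>\<zeta>. 0 \<le> \<zeta> \<Longrightarrow> x \<zeta> \<in> carrier_vec d) \<Longrightarrow>
    (\<And>i. i < d \<Longrightarrow> sq_integrable half_line (\<lambda>\<zeta>. x \<zeta> $ i)) \<Longrightarrow> x \<in> L2 d"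
  by (auto simp: L2_def sq_integrable_def)

lemma AE_half_line_nonneg: "AE \<zeta> in half_line. 0 \<le> \<zeta>"
  by (rule AE_I2) (simp add: space_restrict_space)

lemma sq_integrable_cong_half_line:
  "(\<And>\<zeta>. 0 \<le> \<zeta> \<Longrightarrow> f \<zeta> = g \<zeta>) \<Longrightarrow> sq_integrable half_line f \<longleftrightarrow> sq_integrable half_line g"
  unfolding sq_integrable_def
  by (intro arg_cong2[where f = "(\<and>)"] measurable_cong Bochner_Integration.integrable_cong)
    (auto simp: space_restrict_space)

lemma L2_lincomb:
  assumes "x \<in> L2 d" "z \<in> L2 d"
  shows "(\<lambda>\<zeta>. a \<cdot>\<^sub>v x \<zeta> + b \<cdot>\<^sub>v z \<zeta>) \<in> L2 d"
proof (rule L2I)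
  fix i assume i: "i < d"
  have mult: "sq_integrable half_line (\<lambda>\<zeta>. c * f \<zeta>)" if "sq_integrable half_line f" for c :: 'a and f
    using that by (auto simp: sq_integrable_def norm_mult power_mult_distrib)
  have "sq_integrable half_line (\<lambda>\<zeta>. a * x \<zeta> $ i + b * z \<zeta> $ i)"
    using assms i by (intro sq_integrable_add mult L2_component)
  also have "?this \<longleftrightarrow> sq_integrable half_line (\<lambda>\<zeta>. (a \<cdot>\<^sub>v x \<zeta> + b \<cdot>\<^sub>v z \<zeta>) $ i)"
    using i assms L2_carrier[of _ d] by (intro sq_integrable_cong_half_line) (force dest: L2_carrier)
  finally show "sq_integrable half_line (\<lambda>\<zeta>. (a \<cdot>\<^sub>v x \<zeta> + b \<cdot>\<^sub>v z \<zeta>) $ i)" .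
qed (rule carrier_vecI, simp add: L2_dim[OF assms(2)])

lemma integrable_L2_inner:
  assumes "x \<in> L2 d" "z \<in> L2 d" "i < d"
  shows "integrable half_line (\<lambda>\<zeta>. x \<zeta> $ i * conjugate (z \<zeta> $ i) :: 'f::real_or_complex)"
proof (rule Bochner_Integration.integrable_bound)
  have [measurable]: "(\<lambda>\<zeta>. x \<zeta> $ i) \<in> borel_measurable half_line" "(\<lambda>\<zeta>. z \<zeta> $ i) \<in> borel_measurable half_line"
    using assms by (auto simp: L2_def)
  have [measurable]: "(\<lambda>\<zeta>. conjugate (z \<zeta> $ i)) \<in> borel_measurable half_line"
    by (rule measurable_compose[OF _ borel_measurable_continuous_onI[OF
            linear_continuous_on[OF bounded_linear_conjugate]]]) measurable
  show "(\<lambda>\<zeta>. x \<zeta> $ i * conjugate (z \<zeta> $ i)) \<in> borel_measurable half_line" by measurable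
  show "integrable half_line (\<lambda>\<zeta>. (norm (x \<zeta> $ i))\<^sup>2 + (norm (z \<zeta> $ i))\<^sup>2)"
    using assms by (intro Bochner_Integration.integrable_add sq_integrable_norm L2_component)
  have "norm (a * conjugate b) \<le> (norm a)\<^sup>2 + (norm b)\<^sup>2" for a b :: 'f
  proof -
    have "norm (b * conjugate b) = (norm b)\<^sup>2" by (simp only: mult_conjugate norm_of_real) simp
    then have "norm (conjugate b) = norm b"
      by (cases "b = 0") (auto simp: norm_mult power2_eq_square)
    then show ?thesis
      using sum_squares_bound[of "norm a" "norm b"] mult_nonneg_nonneg[OF norm_ge_zero norm_ge_zero, of a b]
      by (simp only: norm_mult \<open>norm (conjugate b) = norm b\<close>)
  qed
  then show "AE \<zeta> in half_line. norm (x \<zeta> $ i * conjugate (z \<zeta> $ i)) \<le> norm ((norm (x \<zeta> $ i))\<^sup>2 + (norm (z \<zeta> $ i))\<^sup>2)"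
    by simp
qed

lemma re_L2_inner:
  assumes x: "x \<in> L2 d" and z: "z \<in> L2 d"
  shows "re (L2_inner x z) = (\<Sum>i<d. LINT \<zeta>|half_line. inner (x \<zeta> $ i) (z \<zeta> $ i :: 'f::real_or_complex))"
proof -
  have "L2_inner x z = (LINT \<zeta>|half_line. (\<Sum>i<d. x \<zeta> $ i * conjugate (z \<zeta> $ i)))"
    unfolding L2_inner_def
    by (rule Bochner_Integration.integral_cong)
      (use x z in \<open>auto simp: space_restrict_space scalar_prod_def atLeast0LessThan dest!: L2_carrier intro!: sum.cong\<close>)
  also have "\<dots> = (\<Sum>i<d. LINT \<zeta>|half_line. x \<zeta> $ i * conjugate (z \<zeta> $ i))"
    using assms by (intro Bochner_Integration.integral_sum integrable_L2_inner) auto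
  also have "re \<dots> = (\<Sum>i<d. re (LINT \<zeta>|half_line. x \<zeta> $ i * conjugate (z \<zeta> $ i)))"
    by (rule re_sum)
  also have "\<dots> = (\<Sum>i<d. LINT \<zeta>|half_line. inner (x \<zeta> $ i) (z \<zeta> $ i))"
    using assms
    by (intro sum.cong refl) (simp add: inner_eq_re integral_bounded_linear[OF bounded_linear_re] integrable_L2_inner)
  finally show ?thesis .
qed

text \<open>The functions in \<open>L2 d\<close> as elements of the Hilbert space, and back. Since \<open>proj d\<close> ignores
  the copies of the half-line from the one with number \<open>d\<close> on, \<open>embed d (proj d q)\<close> is the
  orthogonal projection of \<open>q\<close> onto \<open>L2 d\<close>.\<close>

definition embed :: "nat \<Rightarrow> (real \<Rightarrow> 'f::real_or_complex vec) \<Rightarrow> 'f hilbert" where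
  "embed d x = to_hilbert (\<lambda>(i, \<zeta>). if i < d then x \<zeta> $ i else 0)"

definition proj :: "nat \<Rightarrow> 'f::real_or_complex hilbert \<Rightarrow> real \<Rightarrow> 'f vec" where
  "proj d q \<zeta> = Matrix.vec d (\<lambda>i. of_hilbert q (i, \<zeta>))"

lemma half_lines_integral:
  fixes F :: "nat \<times> real \<Rightarrow> 'a::euclidean_space"
  assumes F: "\<And>i. i < d \<Longrightarrow> integrable half_line (\<lambda>\<zeta>. F (i, \<zeta>))" and 0: "\<And>i \<zeta>. d \<le> i \<Longrightarrow> F (i, \<zeta>) = 0"
  shows "integrable half_lines F" "(LINT p|half_lines. F p) = (\<Sum>i<d. LINT \<zeta>|half_line. F (i, \<zeta>))"
proof -
  have int: "integrable half_line (\<lambda>\<zeta>. F (i, \<zeta>))" for i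
    using F[of i] 0[of i] by (cases "i < d") auto
  have meas: "F \<in> borel_measurable half_lines"
    by (rule measurable_pair_measure_countable1) (use int in auto)
  have supp: "integrable (count_space UNIV) g" "(LINT i|count_space UNIV. g i) = sum g {..<d}"
    if "\<And>i. d \<le> i \<Longrightarrow> g i = 0" for g :: "nat \<Rightarrow> 'b::euclidean_space"
  proof -
    have sub: "{i. g i \<noteq> 0} \<subseteq> {..<d}" using that by (auto simp: not_le[symmetric])
    show "integrable (count_space UNIV) g"
      unfolding integrable_count_space_nat_iff
      by (rule summable_finite[of "{..<d}"]) (use that in auto)
    show "(LINT i|count_space UNIV. g i) = sum g {..<d}"
      using lebesgue_integral_count_space_finite_support[of UNIV g] finite_subset[OF sub]
      by (simp add: sum.mono_neutral_left[OF _ sub])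
  qed
  show I: "integrable half_lines F"
  proof (rule half_lines.Fubini_integrable[OF meas])
    show "integrable (count_space UNIV) (\<lambda>i. LINT \<zeta>|half_line. norm (F (i, \<zeta>)))"
      by (rule supp) (simp add: 0)
  qed (use int in simp)
  show "(LINT p|half_lines. F p) = (\<Sum>i<d. LINT \<zeta>|half_line. F (i, \<zeta>))"
    using half_lines.integral_fst'[OF I] supp(2)[of "\<lambda>i. LINT \<zeta>|half_line. F (i, \<zeta>)"] by (simp add: 0)
qed

definition cut :: "nat \<Rightarrow> (nat \<times> real \<Rightarrow> 'a::zero) \<Rightarrow> nat \<times> real \<Rightarrow> 'a" where
  "cut d f p = (if fst p < d then f p else 0)"

lemma sq_integrable_cut:
  assumes f: "sq_integrable half_lines f"
  shows "sq_integrable half_lines (cut d f)"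
proof (rule sq_integrable_bound[OF f f, where C = 1])
  have [measurable]: "f \<in> borel_measurable half_lines" using f by measurable
  show "cut d f \<in> borel_measurable half_lines" unfolding cut_def by measurable
qed (simp add: cut_def)

lemma sq_integrable_section:
  assumes "sq_integrable half_lines f"
  shows "sq_integrable half_line (\<lambda>\<zeta>. f (i, \<zeta>))"
proof -
  have [measurable]: "f \<in> borel_measurable half_lines" using assms by measurable
  have "AE i in count_space UNIV. integrable half_line (\<lambda>\<zeta>. (norm (f (i, \<zeta>)))\<^sup>2)"
    using half_lines.AE_integrable_fst'[OF sq_integrable_norm[OF assms]] .
  then show ?thesis
    unfolding sq_integrable_def by (auto simp: AE_count_space)
qed

lemma sq_integrable_sections:
  assumes "\<And>i. i < d \<Longrightarrow> sq_integrable half_line (\<lambda>\<zeta>. f (i, \<zeta>))" "\<And>i \<zeta>. d \<le> i \<Longrightarrow> f (i, \<zeta>) = 0"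
  shows "sq_integrable half_lines f"
  unfolding sq_integrable_def
proof
  have "(\<lambda>\<zeta>. f (i, \<zeta>)) \<in> borel_measurable half_line" for i
    using assms(1)[of i] assms(2)[of i] by (cases "i < d") (auto simp: sq_integrable_def)
  then show "f \<in> borel_measurable half_lines" by (intro measurable_pair_measure_countable1) auto
  show "integrable half_lines (\<lambda>p. (norm (f p))\<^sup>2)"
    by (rule half_lines_integral(1)[where d = d]) (use assms in \<open>auto simp: sq_integrable_def\<close>)
qed

lemma sq_integrable_embed:
  "x \<in> L2 d \<Longrightarrow> sq_integrable half_lines (\<lambda>(i, \<zeta>). if i < d then x \<zeta> $ i else 0)"
  by (rule sq_integrable_sections[where d = d]) (auto dest: L2_component)

lemma proj_L2: "proj d q \<in> L2 d"
  by (rule L2I) (auto simp: proj_def intro: sq_integrable_section[OF of_hilbert(1)])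

lemma inner_embed:
  assumes "x \<in> L2 d" "z \<in> L2 d"
  shows "inner (embed d x) (embed d z) = re (L2_inner x z)"
  unfolding re_L2_inner[OF assms] embed_def inner_to_hilbert[OF assms[THEN sq_integrable_embed]]
  using assms
  by (subst half_lines_integral(2)[where d = d]) (auto intro: integrable_inner L2_component)

lemma to_hilbert_cong:
  assumes "sq_integrable half_lines f" "\<And>i \<zeta>. 0 \<le> \<zeta> \<Longrightarrow> f (i, \<zeta>) = g (i, \<zeta>)"
  shows "to_hilbert f = to_hilbert g"
proof -
  have eq: "f p = g p" if "p \<in> space half_lines" for p
    using that assms(2) by (cases p) (auto simp: space_pair_measure space_restrict_space)
  then have "sq_integrable half_lines g"
    using assms(1) measurable_cong[of half_lines f g borel]
      Bochner_Integration.integrable_cong[of half_lines half_lines "\<lambda>p. (norm (f p))\<^sup>2" "\<lambda>p. (norm (g p))\<^sup>2"]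
    by (simp add: sq_integrable_def)
  then show ?thesis using assms(1) eq by (simp add: to_hilbert_eq_iff AE_I2)
qed

lemma embed_add:
  assumes "x \<in> L2 d" "z \<in> L2 d"
  shows "embed d (\<lambda>\<zeta>. x \<zeta> + z \<zeta>) = embed d x + embed d z"
proof -
  have "embed d x + embed d z = to_hilbert (\<lambda>p. (case p of (i, \<zeta>) \<Rightarrow> if i < d then x \<zeta> $ i else 0)
      + (case p of (i, \<zeta>) \<Rightarrow> if i < d then z \<zeta> $ i else 0))"
    unfolding embed_def by (rule to_hilbert_add[symmetric]; rule sq_integrable_embed; rule assms)
  also have "\<dots> = embed d (\<lambda>\<zeta>. x \<zeta> + z \<zeta>)"
    unfolding embed_def
    by (rule to_hilbert_cong[OF sq_integrable_add[OF assms[THEN sq_integrable_embed]]])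
      (auto simp: assms[THEN L2_dim])
  finally show ?thesis ..
qed

lemma embed_scaleR:
  assumes "x \<in> L2 d"
  shows "embed d (\<lambda>\<zeta>. of_real c \<cdot>\<^sub>v x \<zeta>) = c *\<^sub>R embed d x"
proof -
  have "c *\<^sub>R embed d x = to_hilbert (\<lambda>p. c *\<^sub>R (case p of (i, \<zeta>) \<Rightarrow> if i < d then x \<zeta> $ i else 0))"
    unfolding embed_def by (rule to_hilbert_scaleR[symmetric]; rule sq_integrable_embed; rule assms)
  also have "\<dots> = embed d (\<lambda>\<zeta>. of_real c \<cdot>\<^sub>v x \<zeta>)"
    unfolding embed_def
    by (rule to_hilbert_cong[OF sq_integrable_scaleR[OF sq_integrable_embed[OF assms]]])
      (auto simp: scaleR_conv_of_real L2_dim[OF assms])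
  finally show ?thesis ..
qed

lemma L2_cong:
  assumes "x \<in> L2 d" "\<And>\<zeta>. 0 \<le> \<zeta> \<Longrightarrow> z \<zeta> = x \<zeta>"
  shows "z \<in> L2 d"
proof (rule L2I)
  fix i assume "i < d"
  then show "sq_integrable half_line (\<lambda>\<zeta>. z \<zeta> $ i)"
    using L2_component[OF assms(1)] assms(2)
    by (simp cong: sq_integrable_cong_half_line)
qed (use assms L2_carrier in force)

lemma L2_add: "x \<in> L2 d \<Longrightarrow> z \<in> L2 d \<Longrightarrow> (\<lambda>\<zeta>. x \<zeta> + z \<zeta>) \<in> L2 d"
  and L2_diff: "x \<in> L2 d \<Longrightarrow> z \<in> L2 d \<Longrightarrow> (\<lambda>\<zeta>. x \<zeta> - z \<zeta>) \<in> L2 d"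
  and L2_smult: "x \<in> L2 d \<Longrightarrow> (\<lambda>\<zeta>. a \<cdot>\<^sub>v x \<zeta>) \<in> L2 d"
  for x :: "real \<Rightarrow> 'f::real_or_complex vec"
proof -
  show "x \<in> L2 d \<Longrightarrow> z \<in> L2 d \<Longrightarrow> (\<lambda>\<zeta>. x \<zeta> + z \<zeta>) \<in> L2 d"
    by (rule L2_cong[OF L2_lincomb[of x d z 1 1]]) auto
  show "x \<in> L2 d \<Longrightarrow> z \<in> L2 d \<Longrightarrow> (\<lambda>\<zeta>. x \<zeta> - z \<zeta>) \<in> L2 d"
    by (rule L2_cong[OF L2_lincomb[of x d z 1 "-1"]]) (auto simp: vec_eq_iff L2_dim)
  show "x \<in> L2 d \<Longrightarrow> (\<lambda>\<zeta>. a \<cdot>\<^sub>v x \<zeta>) \<in> L2 d"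
    by (rule L2_cong[OF L2_lincomb[of x d x a 0]]) (auto simp: vec_eq_iff L2_dim)
qed

lemma embed_diff:
  assumes "x \<in> L2 d" "z \<in> L2 d"
  shows "embed d (\<lambda>\<zeta>. x \<zeta> - z \<zeta>) = embed d x - embed d z"
proof -
  have "embed d x - embed d z = to_hilbert (\<lambda>p. (case p of (i, \<zeta>) \<Rightarrow> if i < d then x \<zeta> $ i else 0)
      - (case p of (i, \<zeta>) \<Rightarrow> if i < d then z \<zeta> $ i else 0))"
    unfolding embed_def by (rule to_hilbert_diff[symmetric]; rule sq_integrable_embed; rule assms)
  also have "\<dots> = embed d (\<lambda>\<zeta>. x \<zeta> - z \<zeta>)"
    unfolding embed_def
    by (rule to_hilbert_cong[OF sq_integrable_diff[OF assms[THEN sq_integrable_embed]]])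
      (auto simp: assms[THEN L2_dim])
  finally show ?thesis ..
qed

lemma norm_embed:
  assumes "x \<in> L2 d"
  shows "(norm (embed d x))\<^sup>2 = (\<Sum>i<d. LINT \<zeta>|half_line. (norm (x \<zeta> $ i))\<^sup>2)"
  by (simp add: power2_norm_eq_inner inner_embed assms re_L2_inner)

lemma embed_eq_iff:
  fixes x z :: "real \<Rightarrow> 'f::real_or_complex vec"
  assumes x: "x \<in> L2 d" and z: "z \<in> L2 d"
  shows "embed d x = embed d z \<longleftrightarrow> ae_eq x z"
proof -
  let ?w = "\<lambda>\<zeta>. x \<zeta> - z \<zeta>"
  have w: "?w \<in> L2 d" by (rule L2_diff[OF x z])
  have "embed d x = embed d z \<longleftrightarrow> (norm (embed d ?w))\<^sup>2 = 0"
    by (simp add: embed_diff x z)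
  also have "\<dots> \<longleftrightarrow> (\<forall>i<d. (LINT \<zeta>|half_line. (norm (?w \<zeta> $ i))\<^sup>2) = 0)"
    unfolding norm_embed[OF w] by (subst sum_nonneg_eq_0_iff) auto
  also have "\<dots> \<longleftrightarrow> (\<forall>i<d. AE \<zeta> in half_line. ?w \<zeta> $ i = 0)"
    using integral_nonneg_eq_0_iff_AE[OF sq_integrable_norm[OF L2_component[OF w]]] by simp
  also have "\<dots> \<longleftrightarrow> (\<forall>i\<in>{..<d}. AE \<zeta> in half_line. ?w \<zeta> $ i = 0)" by auto
  also have "\<dots> \<longleftrightarrow> (AE \<zeta> in half_line. \<forall>i\<in>{..<d}. ?w \<zeta> $ i = 0)"
    by (rule AE_ball_countable[symmetric]) simp
  also have "\<dots> \<longleftrightarrow> ae_eq x z"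
    unfolding ae_eq_def
  proof (rule AE_cong)
    fix \<zeta> assume "\<zeta> \<in> space half_line"
    then have "x \<zeta> \<in> carrier_vec d" "z \<zeta> \<in> carrier_vec d"
      using x z by (auto simp: space_restrict_space dest: L2_carrier)
    then show "(\<forall>i\<in>{..<d}. ?w \<zeta> $ i = 0) \<longleftrightarrow> x \<zeta> = z \<zeta>" by (auto simp: vec_eq_iff)
  qed
  finally show ?thesis .
qed

lemma embed_proj_to_hilbert:
  assumes f: "sq_integrable half_lines f"
  shows "embed d (proj d (to_hilbert f)) = to_hilbert (cut d f)"
proof -
  have "(\<lambda>(i, \<zeta>). if i < d then proj d (to_hilbert f) \<zeta> $ i else 0) = cut d (of_hilbert (to_hilbert f))"
    by (auto simp: proj_def cut_def)
  then have "embed d (proj d (to_hilbert f)) = to_hilbert (cut d (of_hilbert (to_hilbert f)))"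
    by (simp add: embed_def)
  also have "\<dots> = to_hilbert (cut d f)"
    using of_to_hilbert[OF f] by (simp add: to_hilbert_eq_iff sq_integrable_cut f of_hilbert) (auto simp: cut_def elim!: eventually_mono)
  finally show ?thesis .
qed

lemma hilbert_cases: obtains f where "sq_integrable half_lines f" "q = to_hilbert f"
  using of_hilbert by metis

lemma embed_proj_embed: "x \<in> L2 d \<Longrightarrow> embed d (proj d (embed d x)) = embed d x"
  unfolding embed_def[of d x]
  by (subst embed_proj_to_hilbert) (auto intro!: sq_integrable_embed arg_cong[of _ _ to_hilbert] simp: cut_def)

lemma proj_embed: "x \<in> L2 d \<Longrightarrow> ae_eq (proj d (embed d x)) x"
  using embed_proj_embed[of x d] by (simp add: embed_eq_iff[OF proj_L2])

lemma embed_proj_add: "embed d (proj d (q + r)) = embed d (proj d q) + embed d (proj d r)"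
proof -
  obtain f g where f: "sq_integrable half_lines f" "q = to_hilbert f" and g: "sq_integrable half_lines g" "r = to_hilbert g"
    by (metis hilbert_cases)
  have "cut d (\<lambda>p. f p + g p) = (\<lambda>p. cut d f p + cut d g p)" by (auto simp: cut_def)
  then show ?thesis using f g
    by (simp add: embed_proj_to_hilbert sq_integrable_add sq_integrable_cut flip: to_hilbert_add)
qed

lemma embed_proj_scaleR: "embed d (proj d (c *\<^sub>R q)) = c *\<^sub>R embed d (proj d q)"
proof -
  obtain f where f: "sq_integrable half_lines f" "q = to_hilbert f" by (rule hilbert_cases)
  have "cut d (\<lambda>p. c *\<^sub>R f p) = (\<lambda>p. c *\<^sub>R cut d f p)" by (auto simp: cut_def)
  then show ?thesis using f
    by (simp add: embed_proj_to_hilbert sq_integrable_scaleR sq_integrable_cut flip: to_hilbert_scaleR)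
qed

lemma inner_embed_proj: "inner (embed d (proj d q)) r = inner (embed d (proj d q)) (embed d (proj d r))"
proof -
  obtain f g where f: "sq_integrable half_lines f" "q = to_hilbert f" and g: "sq_integrable half_lines g" "r = to_hilbert g"
    by (metis hilbert_cases)
  have "inner (cut d f p) (g p) = inner (cut d f p) (cut d g p)" for p by (simp add: cut_def)
  then show ?thesis using f g
    by (simp add: embed_proj_to_hilbert inner_to_hilbert sq_integrable_cut)
qed

lemma norm_embed_proj: "norm (embed d (proj d q)) \<le> norm q"
proof -
  have "(norm (embed d (proj d q)))\<^sup>2 = inner (embed d (proj d q)) q"
    unfolding inner_embed_proj[of d q q] by (simp add: power2_norm_eq_inner)
  also have "\<dots> \<le> norm (embed d (proj d q)) * norm q" by (rule norm_cauchy_schwarz)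
  finally show ?thesis
    by (cases "embed d (proj d q) = 0") (auto simp: power2_eq_square)
qed

lemma bounded_linear_embed_proj: "bounded_linear (\<lambda>q. embed d (proj d q))"
  by (rule bounded_linear_intro[where K = 1])
    (simp_all add: embed_proj_add embed_proj_scaleR norm_embed_proj)

section \<open>Indefinite integrals on the half-line\<close>

text \<open>Absolute continuity on every bounded interval with derivative \<open>g\<close>, in the form of the fundamental
  theorem of calculus.\<close>

definition primitive :: "(real \<Rightarrow> 'a::euclidean_space) \<Rightarrow> (real \<Rightarrow> 'a) \<Rightarrow> bool" where
  "primitive u g \<longleftrightarrow> (\<forall>b\<ge>0. integrable (lebesgue_on {0..b}) g \<and>
    u b = u 0 + (LINT s|lebesgue_on {0..b}. g s))"

lemma integral_lebesgue_on_subset: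
  fixes g :: "real \<Rightarrow> 'a::euclidean_space"
  assumes "S \<in> sets lebesgue" "T \<in> sets lebesgue" "S \<subseteq> T"
  shows "(LINT s|lebesgue_on T. indicator S s *\<^sub>R g s) = (LINT s|lebesgue_on S. g s)"
proof -
  have "(\<lambda>x. indicator T x *\<^sub>R indicator S x *\<^sub>R g x) = (\<lambda>x. indicator S x *\<^sub>R g x)"
    using assms(3) by (auto simp: fun_eq_iff indicator_def)
  then show ?thesis using assms by (simp add: integral_restrict_space del: scaleR_scaleR)
qed

lemma integrable_lebesgue_on_subset:
  fixes g :: "real \<Rightarrow> 'a::euclidean_space"
  assumes "S \<in> sets lebesgue" "T \<in> sets lebesgue" "S \<subseteq> T"
  shows "integrable (lebesgue_on T) (\<lambda>s. indicator S s *\<^sub>R g s) \<longleftrightarrow> integrable (lebesgue_on S) g"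
proof -
  have "(\<lambda>x. indicator T x *\<^sub>R indicator S x *\<^sub>R g x) = (\<lambda>x. indicator S x *\<^sub>R g x)"
    using assms(3) by (auto simp: fun_eq_iff indicator_def)
  then show ?thesis using assms by (simp add: integrable_restrict_space del: scaleR_scaleR)
qed

lemma primitive_integrable: "primitive u g \<Longrightarrow> integrable (lebesgue_on {0..b}) g"
  unfolding primitive_def by (cases "0 \<le> b") auto

lemma primitive_eq: "primitive u g \<Longrightarrow> 0 \<le> b \<Longrightarrow> u b = u 0 + (LINT s|lebesgue_on {0..b}. g s)"
  unfolding primitive_def by blast

lemma primitive_continuous_Icc:
  assumes "primitive u g"
  shows "continuous_on {0..b} u"
proof -
  have "continuous_on {0..b} (\<lambda>x. u 0 + (LINT s|lebesgue_on {0..x}. g s))"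
    by (intro continuous_intros indefinite_integral_continuous_real primitive_integrable[OF assms])
  then show ?thesis
    by (rule continuous_on_eq) (simp add: primitive_eq[OF assms, symmetric])
qed

lemma primitive_continuous:
  assumes "primitive u g"
  shows "continuous_on {0..} u"
  unfolding continuous_on_eq_continuous_within
proof
  fix x :: real assume x: "x \<in> {0..}"
  have "continuous (at x within {0..x + 1}) u"
    using primitive_continuous_Icc[OF assms, of "x + 1"] x by (auto simp: continuous_on_eq_continuous_within)
  moreover have "at x within {0..x + 1} = at x within {0..}"
    by (rule at_within_nhd[of _ "{x - 1<..<x + 1}"]) auto
  ultimately show "continuous (at x within {0..}) u" by simp
qed

lemma indefinite_integral_primitive:
  assumes "\<And>b. integrable (lebesgue_on {0..b}) g"
  shows "primitive (\<lambda>x. c + (LINT s|lebesgue_on {0..x}. g s)) g"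
proof -
  have "(LINT s|lebesgue_on {0..0}. g s) = 0"
    using integral_restrict_space[of "{0::real}" lebesgue g]
    by (simp add: integral_eq_zero_AE) (rule integral_eq_zero_AE, rule AE_I'[of "{0}"], auto simp: indicator_def null_sets_completionI)
  then show ?thesis using assms by (simp add: primitive_def)
qed

text \<open>On the square \<open>[0, b]\<^sup>2\<close>, Fubini's theorem splits the product of the integrals of \<open>g\<close> and
  \<open>h\<close> along the diagonal. This is integration by parts for functions without a continuous
  derivative.\<close>

lemma integral_by_triangles:
  fixes g :: "real \<Rightarrow> 'a::euclidean_space" and h :: "real \<Rightarrow> 'b::euclidean_space"
    and prod :: "'a \<Rightarrow> 'b \<Rightarrow> 'c::euclidean_space"
  assumes prod: "bounded_bilinear prod"
    and g: "integrable (lebesgue_on {0..b}) g" and h: "integrable (lebesgue_on {0..b}) h"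
  defines "M \<equiv> lebesgue_on {0..b}"
  defines "G \<equiv> \<lambda>t. LINT s|lebesgue_on {0..t}. g s" and "H \<equiv> \<lambda>t. LINT s|lebesgue_on {0..t}. h s"
  shows "integrable M (\<lambda>t. prod (g t) (H t))" "integrable M (\<lambda>t. prod (G t) (h t))"
    and "prod (LINT s|M. g s) (LINT s|M. h s) = (LINT t|M. prod (g t) (H t)) + (LINT t|M. prod (G t) (h t))"
proof -
  interpret prod: bounded_bilinear prod by fact
  interpret finite_measure M unfolding M_def by (rule finite_measure_lebesgue_on) simp
  interpret P: pair_sigma_finite M M ..
  have space: "space M = {0..b}" by (simp add: M_def space_restrict_space)
  have gM: "integrable M g" and hM: "integrable M h" using g h by (simp_all add: M_def)
  have [measurable]: "g \<in> borel_measurable M" "h \<in> borel_measurable M" using gM hM by auto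
  have id [measurable]: "(\<lambda>x. x) \<in> borel_measurable M"
    using id_borel_measurable_lebesgue_on[of "{0..b}"] by (simp add: M_def id_def)
  have [measurable]: "fst \<in> borel_measurable (M \<Otimes>\<^sub>M M)" "snd \<in> borel_measurable (M \<Otimes>\<^sub>M M)"
    using measurable_compose[OF measurable_fst id] measurable_compose[OF measurable_snd id] by auto
  have pm: "(\<lambda>x. prod (f x) (f' x)) \<in> borel_measurable N"
    if "f \<in> borel_measurable N" "f' \<in> borel_measurable N" for f f' and N :: "'z measure"
  proof -
    have "(\<lambda>x. (f x, f' x)) \<in> N \<rightarrow>\<^sub>M borel" using that by measurable
    from measurable_compose[OF this borel_measurable_continuous_onI, of "\<lambda>p. prod (fst p) (snd p)"]
    show ?thesis by (simp add: prod.continuous_on continuous_on_fst continuous_on_snd continuous_on_id)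
  qed
  obtain K where K: "0 < K" "\<And>x y. norm (prod x y) \<le> norm x * norm y * K" using prod.pos_bounded by blast
  define F where "F p = prod (g (fst p)) (h (snd p))" for p
  have Fm [measurable]: "F \<in> borel_measurable (M \<Otimes>\<^sub>M M)"
    unfolding F_def by (rule pm) measurable
  have F: "integrable (M \<Otimes>\<^sub>M M) F"
  proof (rule P.Fubini_integrable[OF Fm])
    show "integrable M (\<lambda>s. LINT t|M. norm (F (s, t)))"
    proof (rule Bochner_Integration.integrable_bound)
      show "integrable M (\<lambda>s. norm (g s) * (LINT t|M. norm (h t)) * K)"
        using gM by simp
      show "(\<lambda>s. LINT t|M. norm (F (s, t))) \<in> borel_measurable M" by measurable
      have "(LINT t|M. norm (F (s, t))) \<le> (LINT t|M. norm (g s) * norm (h t) * K)" for s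
        unfolding F_def using hM K by (intro integral_mono' ) auto
      then show "AE s in M. norm (LINT t|M. norm (F (s, t))) \<le> norm (norm (g s) * (LINT t|M. norm (h t)) * K)"
        using K(1) by (intro AE_I2) (simp add: order_trans[OF _ abs_ge_self])
    qed
    show "AE s in M. integrable M (\<lambda>t. F (s, t))"
      unfolding F_def using integrable_bounded_linear[OF prod.bounded_linear_right hM] by simp
  qed
  define L where "L p = indicat_real {p. snd p \<le> fst p} p *\<^sub>R F p" for p
  define U where "U p = indicat_real {p. fst p < snd p} p *\<^sub>R F p" for p
  have L: "integrable (M \<Otimes>\<^sub>M M) L"
  proof (rule Bochner_Integration.integrable_bound[OF F])
    show "L \<in> borel_measurable (M \<Otimes>\<^sub>M M)" unfolding L_def by measurable
  qed (auto simp: L_def indicator_def)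
  have U: "integrable (M \<Otimes>\<^sub>M M) U"
  proof (rule Bochner_Integration.integrable_bound[OF F])
    show "U \<in> borel_measurable (M \<Otimes>\<^sub>M M)" unfolding U_def by measurable
  qed (auto simp: U_def indicator_def)
  have FLU: "F p = L p + U p" for p by (auto simp: L_def U_def indicator_def)
  have Hs: "(LINT t|M. L (s, t)) = prod (g s) (H s)" if "s \<in> {0..b}" for s
  proof -
    have "(LINT t|M. L (s, t)) = (LINT t|M. prod (g s) (indicator {0..s} t *\<^sub>R h t))"
      by (rule Bochner_Integration.integral_cong)
        (auto simp: L_def F_def space indicator_def prod.zero_right)
    also have "\<dots> = prod (g s) (LINT t|M. indicator {0..s} t *\<^sub>R h t)"
      by (intro integral_bounded_linear[OF prod.bounded_linear_right] integrable_mult_indicator hM)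
        (use that in \<open>auto simp: M_def sets_restrict_space_iff\<close>)
    also have "(LINT t|M. indicator {0..s} t *\<^sub>R h t) = H s"
      unfolding M_def H_def using that by (intro integral_lebesgue_on_subset) auto
    finally show ?thesis .
  qed
  have Gt: "(LINT s|M. U (s, t)) = prod (G t) (h t)" if "t \<in> {0..b}" for t
  proof -
    have "(LINT s|M. U (s, t)) = (LINT s|M. prod (indicator {0..t} s *\<^sub>R g s) (h t))"
    proof (rule integral_cong_AE)
      have "AE s in M. s \<noteq> t"
        using that unfolding M_def
        by (intro AE_I'[of "{t}"]) (auto simp: null_sets_restrict_space)
      then show "AE s in M. U (s, t) = prod (indicator {0..t} s *\<^sub>R g s) (h t)"
        using AE_space by eventually_elim (auto simp: U_def F_def space indicator_def prod.zero_left)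
      have [measurable]: "{0..t} \<inter> space M \<in> sets M" using that by (auto simp: M_def sets_restrict_space_iff)
      have [measurable]: "(\<lambda>s. indicat_real {0..t} s) \<in> borel_measurable M"
        by (simp add: borel_measurable_indicator_iff)
      show "(\<lambda>s. prod (indicator {0..t} s *\<^sub>R g s) (h t)) \<in> borel_measurable M"
        by (rule pm) measurable
      show "(\<lambda>s. U (s, t)) \<in> borel_measurable M"
        unfolding U_def F_def by (intro borel_measurable_scaleR pm) (simp_all, measurable)
    qed
    also have "\<dots> = prod (LINT s|M. indicator {0..t} s *\<^sub>R g s) (h t)"
      by (intro integral_bounded_linear[OF prod.bounded_linear_left] integrable_mult_indicator gM)
        (use that in \<open>auto simp: M_def sets_restrict_space_iff\<close>)
    also have "(LINT s|M. indicator {0..t} s *\<^sub>R g s) = G t"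
      unfolding M_def G_def using that by (intro integral_lebesgue_on_subset) auto
    finally show ?thesis .
  qed
  have "integrable M (\<lambda>s. LINT t|M. L (s, t))" by (rule P.integrable_fst'[OF L])
  then show "integrable M (\<lambda>t. prod (g t) (H t))"
    by (rule Bochner_Integration.integrable_cong[THEN iffD1, rotated -1]) (auto simp: Hs space)
  have U': "integrable (M \<Otimes>\<^sub>M M) (case_prod (\<lambda>s t. U (s, t)))" using U by simp
  have "integrable M (\<lambda>t. LINT s|M. U (s, t))" by (rule P.integrable_snd[OF U'])
  then show "integrable M (\<lambda>t. prod (G t) (h t))"
    by (rule Bochner_Integration.integrable_cong[THEN iffD1, rotated -1]) (auto simp: Gt space)
  have "prod (LINT s|M. g s) (LINT t|M. h t) = (LINT s|M. prod (g s) (LINT t|M. h t))"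
    by (rule integral_bounded_linear[OF prod.bounded_linear_left gM, symmetric])
  also have "\<dots> = (LINT s|M. LINT t|M. F (s, t))"
    unfolding F_def by (simp add: integral_bounded_linear[OF prod.bounded_linear_right hM])
  also have "\<dots> = integral\<^sup>L (M \<Otimes>\<^sub>M M) F" by (rule P.integral_fst'[OF F])
  also have "\<dots> = integral\<^sup>L (M \<Otimes>\<^sub>M M) L + integral\<^sup>L (M \<Otimes>\<^sub>M M) U"
    using Bochner_Integration.integral_add[OF L U] by (simp add: FLU[abs_def])
  also have "integral\<^sup>L (M \<Otimes>\<^sub>M M) L = (LINT s|M. LINT t|M. L (s, t))" by (rule P.integral_fst'[OF L, symmetric])
  also have "\<dots> = (LINT t|M. prod (g t) (H t))"
    by (rule Bochner_Integration.integral_cong) (auto simp: Hs space)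
  also have "integral\<^sup>L (M \<Otimes>\<^sub>M M) U = (LINT t|M. LINT s|M. U (s, t))" using P.integral_snd[OF U'] by simp
  also have "\<dots> = (LINT t|M. prod (G t) (h t))"
    by (rule Bochner_Integration.integral_cong) (auto simp: Gt space)
  finally show "prod (LINT s|M. g s) (LINT s|M. h s) = (LINT t|M. prod (g t) (H t)) + (LINT t|M. prod (G t) (h t))" .
qed

lemma primitive_prod:
  fixes prod :: "'a::euclidean_space \<Rightarrow> 'b::euclidean_space \<Rightarrow> 'c::euclidean_space"
  assumes prod: "bounded_bilinear prod" and u: "primitive u g" and v: "primitive v h"
  shows "primitive (\<lambda>x. prod (u x) (v x)) (\<lambda>x. prod (g x) (v x) + prod (u x) (h x))"
  unfolding primitive_def
proof (intro allI impI)
  interpret prod: bounded_bilinear prod by fact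
  fix b :: real assume "0 \<le> b"
  let ?M = "lebesgue_on {0..b}"
  let ?G = "\<lambda>t. LINT s|lebesgue_on {0..t}. g s" and ?H = "\<lambda>t. LINT s|lebesgue_on {0..t}. h s"
  note g = primitive_integrable[OF u, of b] and h = primitive_integrable[OF v, of b]
  note tri = integral_by_triangles[OF prod g h]
  have int: "integrable ?M (\<lambda>x. prod (g x) (v 0))" "integrable ?M (\<lambda>x. prod (u 0) (h x))"
    by (rule integrable_bounded_linear[OF prod.bounded_linear_left g] integrable_bounded_linear[OF prod.bounded_linear_right h])+
  have eq: "prod (g x) (v x) + prod (u x) (h x)
      = (prod (g x) (v 0) + prod (g x) (?H x)) + (prod (u 0) (h x) + prod (?G x) (h x))" if "x \<in> space ?M" for x
    using that primitive_eq[OF u, of x] primitive_eq[OF v, of x]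
    by (simp add: space_restrict_space prod.add_left prod.add_right)
  have "integrable ?M (\<lambda>x. (prod (g x) (v 0) + prod (g x) (?H x)) + (prod (u 0) (h x) + prod (?G x) (h x)))"
    by (intro Bochner_Integration.integrable_add int tri)
  then have "integrable ?M (\<lambda>x. prod (g x) (v x) + prod (u x) (h x))"
    by (rule Bochner_Integration.integrable_cong[THEN iffD1, rotated -1]) (auto simp: eq)
  moreover have "(LINT x|?M. prod (g x) (v x) + prod (u x) (h x))
      = (LINT x|?M. (prod (g x) (v 0) + prod (g x) (?H x)) + (prod (u 0) (h x) + prod (?G x) (h x)))"
    by (rule Bochner_Integration.integral_cong) (auto simp: eq)
  moreover have "\<dots> = (prod (LINT x|?M. g x) (v 0) + (LINT x|?M. prod (g x) (?H x)))
      + (prod (u 0) (LINT x|?M. h x) + (LINT x|?M. prod (?G x) (h x)))"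
    by (simp add: int tri integral_bounded_linear[OF prod.bounded_linear_left g]
        integral_bounded_linear[OF prod.bounded_linear_right h])
  moreover have "prod (u b) (v b) = prod (u 0) (v 0) + prod (LINT x|?M. g x) (v 0)
      + prod (u 0) (LINT x|?M. h x) + prod (LINT x|?M. g x) (LINT x|?M. h x)"
    using primitive_eq[OF u \<open>0 \<le> b\<close>] primitive_eq[OF v \<open>0 \<le> b\<close>]
    by (simp add: prod.add_left prod.add_right)
  ultimately show "integrable ?M (\<lambda>x. prod (g x) (v x) + prod (u x) (h x)) \<and>
      prod (u b) (v b) = prod (u 0) (v 0) + (LINT x|?M. prod (g x) (v x) + prod (u x) (h x))"
    using tri(3) by simp
qed

section \<open>Weak derivatives and the lemma of du Bois-Reymond\<close>

lemma sigma_finite_lebesgue: "sigma_finite_measure (lebesgue :: real measure)"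
proof
  have "\<exists>n. - real n \<le> x \<and> x \<le> real n" for x
  proof -
    obtain n where "\<bar>x\<bar> \<le> real n" using real_arch_simple by blast
    then have "- real n \<le> x \<and> x \<le> real n" by linarith
    then show ?thesis by blast
  qed
  then have "\<Union> (range (\<lambda>n. {- real n..real n})) = space lebesgue"
    unfolding set_eq_iff by simp
  then show "\<exists>A. countable A \<and> A \<subseteq> sets lebesgue \<and> \<Union>A = space lebesgue \<and>
      (\<forall>a\<in>A. emeasure lebesgue (a :: real set) \<noteq> \<infinity>)"
    by (intro exI[of _ "range (\<lambda>n. {- real n..real n})"]) auto
qed

text \<open>The Borel sets over which the integral of \<open>f\<close> is 0 form a Dynkin system that contains the compact
  intervals, and every Lebesgue measurable set is a Borel set up to a null set.\<close>

lemma AE_zero_of_Icc_integrals: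
  fixes f :: "real \<Rightarrow> 'a::euclidean_space"
  assumes f: "integrable lebesgue f"
    and Icc: "\<And>a b. a \<le> b \<Longrightarrow> (LINT x|lebesgue. indicator {a..b} x *\<^sub>R f x) = 0"
  shows "AE x in lebesgue. f x = 0"
proof (rule sigma_finite_measure.density_zero[OF sigma_finite_lebesgue f])
  have int: "integrable lebesgue (\<lambda>x. indicator A x *\<^sub>R f x)" if "A \<in> sets lebesgue" for A
    using that by (intro integrable_mult_indicator f) simp
  have whole: "(LINT x|lebesgue. f x) = 0"
  proof (rule LIMSEQ_unique)
    show "(\<lambda>n. LINT x|lebesgue. indicator {- real n..real n} x *\<^sub>R f x) \<longlonglongrightarrow> (LINT x|lebesgue. f x)"
    proof (rule integral_dominated_convergence[where w = "\<lambda>x. norm (f x)"])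
      show "AE x in lebesgue. (\<lambda>n. indicat_real {- real n..real n} x *\<^sub>R f x) \<longlonglongrightarrow> f x"
      proof (rule AE_I2, rule tendsto_eventually)
        fix x :: real
        obtain N where "\<bar>x\<bar> \<le> real N" using real_arch_simple by blast
        then show "\<forall>\<^sub>F n in sequentially. indicat_real {- real n..real n} x *\<^sub>R f x = f x"
          by (intro eventually_sequentiallyI[of N]) (auto simp: indicator_def)
      qed
      fix n
      show "(\<lambda>x. indicator {- real n..real n} x *\<^sub>R f x) \<in> borel_measurable lebesgue"
        by (rule borel_measurable_integrable[OF int]) simp
      show "AE x in lebesgue. norm (indicat_real {- real n..real n} x *\<^sub>R f x) \<le> norm (f x)"
        by (rule AE_I2) (auto simp: indicator_def)
    qed (use f in auto)
  qed (simp add: Icc)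
  have borel: "(LINT x|lebesgue. indicator A x *\<^sub>R f x) = 0" if "A \<in> sets borel" for A
    using that
  proof (induction rule: borel_set_induct)
    case (interval a b)
    then show ?case by (rule Icc)
  next
    case (compl A)
    have "(\<lambda>x. indicat_real (- A) x *\<^sub>R f x) = (\<lambda>x. f x - indicator A x *\<^sub>R f x)"
      by (auto simp: fun_eq_iff indicator_def)
    then show ?case using compl int[of A] f whole by (simp add: compl.IH)
  next
    case (union F)
    have sets: "F i \<in> sets lebesgue" for i using union.hyps by auto
    have "(LINT x:(\<Union>i. F i)|lebesgue. f x) = (\<Sum>i. LINT x:F i|lebesgue. f x)"
      using union.hyps sets int[of "\<Union>i. F i"]
      by (intro lebesgue_integral_countable_add) (auto simp: disjoint_family_on_def set_integrable_def)
    then show ?case by (simp add: set_lebesgue_integral_def union.IH)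
  qed simp
  fix A :: "real set" assume "A \<in> sets lebesgue"
  then obtain C N where C: "C \<in> sets borel" "negligible N" "C \<union> N = A"
    by (rule sets_lebesgue_almost_borel)
  have "(LINT x|lebesgue. indicator A x *\<^sub>R f x) = (LINT x|lebesgue. indicator C x *\<^sub>R f x)"
  proof (rule integral_cong_AE)
    have "AE x in lebesgue. x \<notin> N"
      using C(2) by (intro AE_not_in) (simp add: negligible_iff_null_sets)
    then show "AE x in lebesgue. indicat_real A x *\<^sub>R f x = indicator C x *\<^sub>R f x"
      by eventually_elim (use C(3) in \<open>auto simp: indicator_def\<close>)
  qed (use \<open>A \<in> sets lebesgue\<close> C(1) int in \<open>auto intro!: borel_measurable_integrable\<close>)
  also have "\<dots> = 0" by (rule borel[OF C(1)])
  finally show "set_lebesgue_integral lebesgue A f = 0"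
    by (simp add: set_lebesgue_integral_def)
qed

lemma half_line_indicator:
  fixes f :: "real \<Rightarrow> 'a::euclidean_space"
  shows "(LINT x|half_line. f x) = (LINT x|lebesgue. indicator {0..} x *\<^sub>R f x)"
    and "integrable half_line f \<longleftrightarrow> integrable lebesgue (\<lambda>x. indicator {0..} x *\<^sub>R f x)"
  by (simp_all add: integral_restrict_space integrable_restrict_space)

lemma Icc_indicator:
  fixes f :: "real \<Rightarrow> 'a::euclidean_space"
  shows "(LINT x|lebesgue_on {a..b}. f x) = (LINT x|lebesgue. indicator {a..b} x *\<^sub>R f x)"
    and "integrable (lebesgue_on {a..b}) f \<longleftrightarrow> integrable lebesgue (\<lambda>x. indicator {a..b} x *\<^sub>R f x)"
  by (simp_all add: integral_restrict_space integrable_restrict_space)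

lemma half_line_integral_Icc:
  fixes f :: "real \<Rightarrow> 'a::euclidean_space"
  assumes "\<And>x. 0 \<le> x \<Longrightarrow> x \<notin> {a..b} \<Longrightarrow> f x = 0" "0 \<le> a"
  shows "(LINT x|half_line. f x) = (LINT x|lebesgue_on {a..b}. f x)"
    and "integrable half_line f \<longleftrightarrow> integrable (lebesgue_on {a..b}) f"
proof -
  have "(\<lambda>x. indicat_real {0..} x *\<^sub>R f x) = (\<lambda>x. indicator {a..b} x *\<^sub>R f x)"
    using assms by (auto simp: fun_eq_iff indicator_def)
  then show "(LINT x|half_line. f x) = (LINT x|lebesgue_on {a..b}. f x)"
    and "integrable half_line f \<longleftrightarrow> integrable (lebesgue_on {a..b}) f"
    unfolding half_line_indicator Icc_indicator by simp_all
qed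

lemma integral_Icc_tendsto_half_line:
  fixes f :: "real \<Rightarrow> 'a::euclidean_space"
  assumes "integrable half_line f"
  shows "((\<lambda>b. LINT x|lebesgue_on {0..b}. f x) \<longlongrightarrow> (LINT x|half_line. f x)) at_top"
  unfolding half_line_indicator Icc_indicator
proof (rule integral_dominated_convergence_at_top[where w = "\<lambda>x. norm (indicator {0..} x *\<^sub>R f x)"])
  have f: "integrable lebesgue (\<lambda>x. indicat_real {0..} x *\<^sub>R f x)"
    using assms unfolding half_line_indicator .
  then show "integrable lebesgue (\<lambda>x. norm (indicat_real {0..} x *\<^sub>R f x))" by (rule integrable_norm)
  show "(\<lambda>x. indicat_real {0..} x *\<^sub>R f x) \<in> borel_measurable lebesgue"
    using borel_measurable_integrable[OF f] .
  show "AE x in lebesgue. ((\<lambda>b. indicat_real {0..b} x *\<^sub>R f x) \<longlongrightarrow> indicat_real {0..} x *\<^sub>R f x) at_top"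
  proof (rule AE_I2, rule tendsto_eventually)
    fix x :: real
    show "\<forall>\<^sub>F b in at_top. indicat_real {0..b} x *\<^sub>R f x = indicat_real {0..} x *\<^sub>R f x"
      using eventually_ge_at_top[of x] by eventually_elim (auto simp: indicator_def)
  qed
  fix b :: real
  have "(\<lambda>x. indicat_real {0..b} x *\<^sub>R f x) = (\<lambda>x. indicator {0..b} x *\<^sub>R indicat_real {0..} x *\<^sub>R f x)"
    by (auto simp: fun_eq_iff indicator_def)
  then show "(\<lambda>x. indicat_real {0..b} x *\<^sub>R f x) \<in> borel_measurable lebesgue"
    using borel_measurable_integrable[OF integrable_mult_indicator[OF _ f, of "{0..b}"]] by simp
next
  show "\<forall>\<^sub>F b in at_top. AE x in lebesgue. norm (indicat_real {0..b} x *\<^sub>R f x) \<le> norm (indicat_real {0..} x *\<^sub>R f x)"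
    by (intro always_eventually allI AE_I2) (auto simp: indicator_def)
qed

lemma integrable_half_line_Icc:
  fixes f :: "real \<Rightarrow> 'a::euclidean_space"
  assumes "integrable half_line f" "0 \<le> a"
  shows "integrable (lebesgue_on {a..b}) f"
proof -
  have "integrable lebesgue (\<lambda>x. indicator {a..b} x *\<^sub>R indicat_real {0..} x *\<^sub>R f x)"
    using assms(1) unfolding half_line_indicator by (rule integrable_mult_indicator[rotated]) simp
  also have "(\<lambda>x. indicator {a..b} x *\<^sub>R indicat_real {0..} x *\<^sub>R f x) = (\<lambda>x. indicat_real {a..b} x *\<^sub>R f x)"
    using assms(2) by (auto simp: fun_eq_iff indicator_def)
  finally show ?thesis unfolding Icc_indicator .
qed

lemma sq_integrable_Icc:
  fixes f :: "real \<Rightarrow> 'a::euclidean_space"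
  assumes "sq_integrable half_line f"
  shows "integrable (lebesgue_on {0..b}) f"
proof (rule Bochner_Integration.integrable_bound)
  interpret finite_measure "lebesgue_on {0..b}" by (rule finite_measure_lebesgue_on) simp
  show "integrable (lebesgue_on {0..b}) (\<lambda>x. 1 + (norm (f x))\<^sup>2)"
    using integrable_half_line_Icc[OF sq_integrable_norm[OF assms], of 0 b] by simp
  have "f \<in> borel_measurable half_line" using assms by measurable
  then show "f \<in> borel_measurable (lebesgue_on {0..b})"
    by (rule measurable_restrict_mono) auto
  have "norm v \<le> 1 + (norm v)\<^sup>2" for v :: 'a
    using zero_le_power2[of "norm v - 1"] norm_ge_zero[of v] unfolding power2_diff
    by (simp, linarith)
  then show "AE x in lebesgue_on {0..b}. norm (f x) \<le> norm (1 + (norm (f x))\<^sup>2)" by simp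
qed

text \<open>The antiderivative that vanishes at 0 vanishes to the left of the support, and to the right of it
  because the integral of \<open>\<chi>\<close> is 0.\<close>

lemma compact_support_antiderivative:
  fixes \<chi> :: "real \<Rightarrow> real"
  assumes \<chi>: "continuous_on UNIV \<chi>" and supp: "\<And>x. x \<notin> {a..b} \<Longrightarrow> \<chi> x = 0" and "0 < a" "a \<le> b"
    and 0: "(LINT x|half_line. \<chi> x) = 0"
  obtains \<phi> where "test_function \<phi> \<chi>"
proof -
  define \<phi> where "\<phi> t = integral {0..t} \<chi>" for t
  have cont: "continuous_on S \<chi>" for S using \<chi> by (rule continuous_on_subset) simp
  have zero: "\<phi> t = 0" if "t < a" for t
  proof -
    have "\<phi> t = integral {0..t} (\<lambda>x. 0)" unfolding \<phi>_def
      by (rule integral_cong) (use that supp in auto)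
    then show ?thesis by simp
  qed
  have "(\<phi> has_real_derivative \<chi> t) (at t)" for t
  proof (cases "t < a")
    case True
    have "((\<lambda>_. 0) has_real_derivative \<chi> t) (at t)" using supp[of t] True by simp
    then show ?thesis
      by (rule has_field_derivative_transform_within_open[of _ _ _ "{..<a}"]) (use True zero in auto)
  next
    case False
    then have t: "0 < t" using \<open>0 < a\<close> by simp
    have "(\<phi> has_real_derivative \<chi> t) (at t within {0..t + 1})"
      unfolding \<phi>_def by (rule integral_has_real_derivative) (use cont t in auto)
    then have "(\<phi> has_real_derivative \<chi> t) (at t within {0<..<t + 1})"
      by (rule DERIV_subset) auto
    then show ?thesis using t by (simp add: at_within_open[of t "{0<..<t + 1}"])
  qed
  moreover have "\<phi> t = 0" if "t > b" for t
  proof -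
    have "\<phi> t = (LINT x|lebesgue_on {0..t}. \<chi> x)"
      unfolding \<phi>_def by (rule lebesgue_integral_eq_integral[symmetric])
        (auto intro!: continuous_imp_integrable_real cont)
    also have "\<dots> = (LINT x|half_line. \<chi> x)"
      by (rule half_line_integral_Icc(1)[symmetric]) (use supp that in auto)
    finally show ?thesis by (simp add: 0)
  qed
  ultimately have "test_function \<phi> \<chi>"
    unfolding test_function_def using zero \<chi> \<open>0 < a\<close> by (intro conjI exI[of _ a] exI[of _ b]) auto
  then show ?thesis by (rule that)
qed

lemma integrable_continuous_scaleR:
  fixes v :: "real \<Rightarrow> 'a::euclidean_space"
  assumes cont: "continuous_on {a..b} \<psi>" and v: "integrable (lebesgue_on {a..b}) v"
  shows "integrable (lebesgue_on {a..b}) (\<lambda>x. \<psi> x *\<^sub>R v x)"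
proof -
  have "bounded (\<psi> ` {a..b})"
    by (intro compact_imp_bounded compact_continuous_image cont) auto
  then obtain C where C: "\<And>x. x \<in> {a..b} \<Longrightarrow> norm (\<psi> x) \<le> C" unfolding bounded_iff by blast
  show ?thesis
proof (rule Bochner_Integration.integrable_bound)
  show "integrable (lebesgue_on {a..b}) (\<lambda>x. C * norm (v x))" using v by simp
  have "\<psi> \<in> borel_measurable (lebesgue_on {a..b})"
    by (rule continuous_imp_measurable_on_sets_lebesgue[OF cont]) simp
  then show "(\<lambda>x. \<psi> x *\<^sub>R v x) \<in> borel_measurable (lebesgue_on {a..b})"
    using borel_measurable_integrable[OF v] by measurable
  show "AE x in lebesgue_on {a..b}. norm (\<psi> x *\<^sub>R v x) \<le> norm (C * norm (v x))"
  proof (rule AE_I2)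
    fix x assume "x \<in> space (lebesgue_on {a..b})"
    then have "norm (\<psi> x) * norm (v x) \<le> C * norm (v x)"
      by (intro mult_right_mono C) (auto simp: space_restrict_space)
    then show "norm (\<psi> x *\<^sub>R v x) \<le> norm (C * norm (v x))" by simp
  qed
qed
qed

lemma integrable_compact_support:
  fixes v :: "real \<Rightarrow> 'a::euclidean_space"
  assumes \<psi>: "continuous_on UNIV \<psi>" and supp: "\<And>x. x \<notin> {a..b} \<Longrightarrow> \<psi> x = 0" and a: "0 < a"
    and v: "\<And>b. integrable (lebesgue_on {0..b}) v"
  shows "integrable half_line (\<lambda>x. \<psi> x *\<^sub>R v x)"
proof -
  have "integrable (lebesgue_on {0..b}) (\<lambda>x. \<psi> x *\<^sub>R v x)"
    using \<psi> by (intro integrable_continuous_scaleR v) (rule continuous_on_subset, auto)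
  then show ?thesis
    by (subst half_line_integral_Icc(2)[where b = b and a = 0]) (use supp a in auto)
qed

lemma integrable_const_Icc: "integrable (lebesgue_on {0..b::real}) (\<lambda>x. c :: 'a::euclidean_space)"
  by (rule finite_measure.integrable_const[OF finite_measure_lebesgue_on]) simp

text \<open>Continuous approximations of the indicator function of \<open>[a, b]\<close>: trapezoids with vertices at \<open>a - 1/n\<close>, \<open>a\<close>, \<open>b\<close>, \<open>b + 1/n\<close>.\<close>

definition trapezoid :: "real \<Rightarrow> real \<Rightarrow> nat \<Rightarrow> real \<Rightarrow> real" where
  "trapezoid a b n x = max 0 (1 - real n * max 0 (max (a - x) (x - b)))"

lemma continuous_trapezoid: "continuous_on S (trapezoid a b n)"
  unfolding trapezoid_def by (intro continuous_intros)

lemma trapezoid_support: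
  assumes "0 < n" "x \<notin> {a - 1 / real n..b + 1 / real n}"
  shows "trapezoid a b n x = 0"
proof -
  have "1 / real n \<le> max 0 (max (a - x) (x - b))"
  proof -
    have "0 < 1 / real n" using assms(1) by simp
    then show ?thesis using assms(2) by auto
  qed
  then have "1 \<le> real n * max 0 (max (a - x) (x - b))"
    using assms(1) by (simp add: field_simps)
  then show ?thesis by (simp add: trapezoid_def)
qed

lemma trapezoid_bounds: "0 \<le> trapezoid a b n x" "trapezoid a b n x \<le> 1"
  by (auto simp: trapezoid_def)

lemma trapezoid_tendsto:
  assumes "a \<le> b" shows "(\<lambda>n. trapezoid a b n x) \<longlonglongrightarrow> indicator {a..b} x"
proof (cases "x \<in> {a..b}")
  case True
  then have "trapezoid a b n x = 1" for n by (auto simp: trapezoid_def max_def)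
  then show ?thesis using True by simp
next
  case False
  define m where "m = max 0 (max (a - x) (x - b))"
  have "0 < m" using False by (auto simp: m_def)
  obtain N :: nat where N: "1 / m < real N" using reals_Archimedean2 by blast
  have "trapezoid a b n x = 0" if "n \<ge> N" for n
  proof -
    have "1 / m \<le> real n" using N that by linarith
    then have "1 \<le> real n * m" using \<open>0 < m\<close> by (simp add: field_simps)
    then show ?thesis by (simp add: trapezoid_def m_def)
  qed
  then show ?thesis using False
    by (intro tendsto_eventually eventually_sequentiallyI[of N]) auto
qed

text \<open>The lemma of du Bois-Reymond: if \<open>w\<close> annihilates all derivatives of test functions, it
  annihilates the continuous functions with compact support and integral 0, so for some constant
  \<open>c\<close> the function \<open>w - c\<close> annihilates all continuous functions with compact support, hence in
  the limit all intervals.\<close>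

lemma du_Bois_Reymond:
  fixes w :: "real \<Rightarrow> 'a::euclidean_space"
  assumes w: "\<And>b. integrable (lebesgue_on {0..b}) w"
    and test: "\<And>\<phi> \<phi>'. test_function \<phi> \<phi>' \<Longrightarrow> (LINT x|half_line. \<phi>' x *\<^sub>R w x) = 0"
  obtains c where "AE x in half_line. w x = c"
proof -
  have w': "integrable (lebesgue_on {a..b}) w" if "0 \<le> a" for a b
    by (rule integrable_subinterval[OF w[of b]]) (use that in auto)
  \<comment> \<open>A function with known non-zero integral, used to correct the integral of other functions to 0.\<close>
  define \<psi>\<^sub>0 :: "real \<Rightarrow> real" where "\<psi>\<^sub>0 x = max 0 ((x - 1) * (2 - x))" for x
  have \<psi>0: "continuous_on UNIV \<psi>\<^sub>0" "\<And>x. x \<notin> {1..2} \<Longrightarrow> \<psi>\<^sub>0 x = 0"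
    unfolding \<psi>\<^sub>0_def by (intro continuous_intros) (auto simp: max_def zero_le_mult_iff)
  have int0: "(LINT x|half_line. \<psi>\<^sub>0 x) = 1 / 6"
  proof -
    have "(LINT x|half_line. \<psi>\<^sub>0 x) = integral {1..2} \<psi>\<^sub>0"
      using \<psi>0 by (subst half_line_integral_Icc(1)[where a = 1 and b = 2])
        (auto intro!: lebesgue_integral_eq_integral continuous_imp_integrable_real continuous_on_subset[OF \<psi>0(1)])
    also have "\<dots> = 1 / 6"
    proof (rule integral_unique)
      let ?F = "\<lambda>x::real. 3 / 2 * x\<^sup>2 - 1 / 3 * x ^ 3 - 2 * x"
      have "((\<lambda>x. (x - 1) * (2 - x)) has_integral (?F 2 - ?F 1)) {1..2}"
        by (rule fundamental_theorem_of_calculus)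
          (auto simp: has_real_derivative_iff_has_vector_derivative[symmetric] power2_eq_square
            intro!: derivative_eq_intros, simp add: algebra_simps)
      then show "(\<psi>\<^sub>0 has_integral 1 / 6) {1..2}"
        by (rule has_integral_eq_rhs[OF has_integral_eq[rotated]]) (auto simp: \<psi>\<^sub>0_def max_def mult_le_0_iff)
    qed
    finally show ?thesis .
  qed
  define c where "c = 6 *\<^sub>R (LINT x|half_line. \<psi>\<^sub>0 x *\<^sub>R w x)"
  have key: "(LINT x|half_line. \<psi> x *\<^sub>R (w x - c)) = 0"
    if \<psi>: "continuous_on UNIV \<psi>" "\<And>x. x \<notin> {a..b} \<Longrightarrow> \<psi> x = 0" and a: "0 < a" for \<psi> a b
  proof -
    define m where "m = (LINT x|half_line. \<psi> x)"
    define \<chi> where "\<chi> x = \<psi> x - 6 * m * \<psi>\<^sub>0 x" for x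
    have i1: "integrable half_line \<psi>" using integrable_compact_support[OF \<psi> a integrable_const_Icc[where c = "1::real"]] by simp
    have i2: "integrable half_line \<psi>\<^sub>0" using integrable_compact_support[of \<psi>\<^sub>0 1 2 "\<lambda>_. 1::real"] \<psi>0 integrable_const_Icc by simp
    have iw1: "integrable half_line (\<lambda>x. \<psi> x *\<^sub>R w x)" by (rule integrable_compact_support[OF \<psi> a w])
    have iw2: "integrable half_line (\<lambda>x. \<psi>\<^sub>0 x *\<^sub>R w x)" using integrable_compact_support[of \<psi>\<^sub>0 1 2 w] \<psi>0 w by simp
    have "(LINT x|half_line. \<chi> x) = 0"
      unfolding \<chi>_def using i1 i2 by (simp add: int0 m_def)
    moreover have "continuous_on UNIV \<chi>" unfolding \<chi>_def by (intro continuous_intros \<psi> \<psi>0)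
    moreover have "\<chi> x = 0" if "x \<notin> {min a 1..max b 2}" for x
    proof -
      have "x \<notin> {a..b}" "x \<notin> {1..2}" using that by (auto simp: min_le_iff_disj le_max_iff_disj)
      then show ?thesis using \<psi>(2) \<psi>0(2) by (simp add: \<chi>_def)
    qed
    moreover have "0 < min a 1" using a by simp
    moreover have "min a 1 \<le> max b 2"
      using min.cobounded2[of a 1] max.cobounded2[of 2 b] by linarith
    ultimately obtain \<phi> where "test_function \<phi> \<chi>"
      using compact_support_antiderivative[of \<chi> "min a 1" "max b 2"] by blast
    note \<phi> = test[OF this]
    have split: "(\<lambda>x. \<chi> x *\<^sub>R w x) = (\<lambda>x. \<psi> x *\<^sub>R w x - (6 * m) *\<^sub>R (\<psi>\<^sub>0 x *\<^sub>R w x))"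
      by (simp add: \<chi>_def scaleR_diff_left)
    have "(LINT x|half_line. \<psi> x *\<^sub>R w x) - (6 * m) *\<^sub>R (LINT x|half_line. \<psi>\<^sub>0 x *\<^sub>R w x) = 0"
      using \<phi> Bochner_Integration.integral_diff[OF iw1 integrable_scaleR_right[OF iw2, of "6 * m"]]
      unfolding split integral_scaleR_right by simp
    then have "(LINT x|half_line. \<psi> x *\<^sub>R w x) = m *\<^sub>R c"
      by (simp add: c_def)
    moreover have "(LINT x|half_line. \<psi> x *\<^sub>R c) = m *\<^sub>R c" unfolding m_def by (simp add: i1)
    ultimately show ?thesis
      using iw1 integrable_compact_support[OF \<psi> a integrable_const_Icc[where c = c]] by (simp add: scaleR_diff_right)
  qed
  have wc: "integrable (lebesgue_on {0..b}) (\<lambda>x. w x - c)" for b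
    by (intro Bochner_Integration.integrable_diff w integrable_const_Icc)
  have Icc: "(LINT x|lebesgue_on {a..b}. w x - c) = 0" if "0 < a" "a \<le> b" for a b
  proof -
    obtain N :: nat where N: "2 / a < real N" using reals_Archimedean2 by blast
    have Na: "1 / real n \<le> a / 2" "1 / real n \<le> 1" "0 < n" if "N + 1 \<le> n" for n
    proof -
      have n: "2 / a < real n" using N that by linarith
      show "0 < n" using that by simp
      then show "1 / real n \<le> a / 2" "1 / real n \<le> 1" using n \<open>0 < a\<close> by (auto simp: field_simps)
    qed
    have supp: "trapezoid a b n x = 0" if "N + 1 \<le> n" "x \<notin> {a / 2..b + 1}" for n x
    proof (rule trapezoid_support[OF Na(3)[OF that(1)]])
      show "x \<notin> {a - 1 / real n..b + 1 / real n}"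
        using that(2) Na(1,2)[OF that(1)] unfolding atLeastAtMost_iff by linarith
    qed
    let ?v = "\<lambda>x. w x - c"
    have "(\<lambda>n. LINT x|half_line. trapezoid a b (n + (N + 1)) x *\<^sub>R ?v x) \<longlonglongrightarrow> (LINT x|half_line. indicator {a..b} x *\<^sub>R ?v x)"
    proof (rule integral_dominated_convergence[where w = "\<lambda>x. norm (indicator {a / 2..b + 1} x *\<^sub>R ?v x)"])
      have sub: "{a / 2..b + 1} \<subseteq> {0..b + 1}" using \<open>0 < a\<close> by auto
      have I: "integrable half_line (\<lambda>x. indicat_real {a / 2..b + 1} x *\<^sub>R ?v x)"
        using integrable_lebesgue_on_subset[of "{a / 2..b + 1}" "{0..}" ?v] integrable_subinterval[OF wc sub] \<open>0 < a\<close>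
        by force
      then show "integrable half_line (\<lambda>x. norm (indicat_real {a / 2..b + 1} x *\<^sub>R ?v x))"
        by (rule integrable_norm)
      have "integrable half_line (\<lambda>x. indicat_real {a..b} x *\<^sub>R ?v x)"
        using integrable_lebesgue_on_subset[of "{a..b}" "{0..}" ?v] integrable_subinterval[OF wc[of b], of a b] \<open>0 < a\<close>
        by force
      then show "(\<lambda>x. indicat_real {a..b} x *\<^sub>R ?v x) \<in> borel_measurable half_line"
        by (rule borel_measurable_integrable)
      show "(\<lambda>x. trapezoid a b (n + (N + 1)) x *\<^sub>R ?v x) \<in> borel_measurable half_line" for n
        by (rule borel_measurable_integrable, rule integrable_compact_support[of _ "a / 2" "b + 1"])
          (use \<open>0 < a\<close> in \<open>auto intro: supp wc continuous_trapezoid\<close>)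
      show "AE x in half_line. (\<lambda>n. trapezoid a b (n + (N + 1)) x *\<^sub>R ?v x) \<longlonglongrightarrow> indicat_real {a..b} x *\<^sub>R ?v x"
        using LIMSEQ_ignore_initial_segment[OF trapezoid_tendsto[OF \<open>a \<le> b\<close>], of "N + 1"]
        by (intro AE_I2 tendsto_scaleR tendsto_const) auto
      fix n
      have "norm (trapezoid a b (n + (N + 1)) x *\<^sub>R ?v x) \<le> norm (indicat_real {a / 2..b + 1} x *\<^sub>R ?v x)" for x
        using supp[of "n + (N + 1)" x] trapezoid_bounds[of a b "n + (N + 1)" x]
        by (cases "x \<in> {a / 2..b + 1}") (auto intro: mult_left_le_one_le)
      then show "AE x in half_line. norm (trapezoid a b (n + (N + 1)) x *\<^sub>R ?v x) \<le> norm (indicat_real {a / 2..b + 1} x *\<^sub>R ?v x)"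
        by simp
    qed
    moreover have "(LINT x|half_line. trapezoid a b (n + (N + 1)) x *\<^sub>R ?v x) = 0" for n
      by (rule key[of _ "a / 2" "b + 1"]) (use \<open>0 < a\<close> in \<open>auto intro: supp continuous_trapezoid\<close>)
    ultimately have "(LINT x|half_line. indicator {a..b} x *\<^sub>R ?v x) = 0"
      by (simp add: LIMSEQ_const_iff)
    then show ?thesis
      by (subst (asm) integral_lebesgue_on_subset) (use \<open>0 < a\<close> in auto)
  qed
  have "AE x in lebesgue. indicator {1 / real (Suc n)..real n} x *\<^sub>R (w x - c) = 0" for n
  proof (rule AE_zero_of_Icc_integrals)
    let ?S = "{1 / real (Suc n)..real n}"
    have "integrable (lebesgue_on ?S) (\<lambda>x. w x - c)"
      by (rule integrable_subinterval[OF wc[of "real n"]]) auto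
    then show "integrable lebesgue (\<lambda>x. indicat_real ?S x *\<^sub>R (w x - c))"
      unfolding Icc_indicator .
    fix a b :: real assume "a \<le> b"
    have "(\<lambda>x. indicat_real {a..b} x *\<^sub>R indicat_real ?S x *\<^sub>R (w x - c))
        = (\<lambda>x. indicator {max a (1 / real (Suc n))..min b (real n)} x *\<^sub>R (w x - c))"
      by (auto simp: fun_eq_iff indicator_def)
    moreover have "(LINT x|lebesgue_on {max a (1 / real (Suc n))..min b (real n)}. w x - c) = 0"
    proof (cases "max a (1 / real (Suc n)) \<le> min b (real n)")
      case True
      have "0 < 1 / real (Suc n)" by simp
      then have "0 < max a (1 / real (Suc n))" by linarith
      then show ?thesis using True by (rule Icc)
    next
      case False
      then have "{max a (1 / real (Suc n))..min b (real n)} = {}" by auto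
      then show ?thesis by (simp only: Icc_indicator) simp
    qed
    ultimately show "(LINT x|lebesgue. indicat_real {a..b} x *\<^sub>R indicat_real ?S x *\<^sub>R (w x - c)) = 0"
      by (simp only: Icc_indicator)
  qed
  then have all: "AE x in lebesgue. \<forall>n. indicator {1 / real (Suc n)..real n} x *\<^sub>R (w x - c) = 0"
    unfolding AE_all_countable by blast
  have "AE x in lebesgue. x \<noteq> (0::real)"
    by (rule AE_I'[of "{0}"]) auto
  with all have "AE x in lebesgue. x \<in> {0..} \<longrightarrow> w x = c"
  proof eventually_elim
    case (elim x)
    show ?case
    proof
      assume "x \<in> {0..}"
      with elim have "0 < x" by simp
      obtain m where m: "1 / real (Suc m) < x" using nat_approx_posE[OF \<open>0 < x\<close>] by blast
      obtain k where k: "x \<le> real k" using real_arch_simple by blast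
      define n where "n = max m k"
      have "1 / real (Suc n) \<le> 1 / real (Suc m)" unfolding n_def by (intro divide_left_mono) auto
      then have "x \<in> {1 / real (Suc n)..real n}" using m k by (auto simp: n_def)
      then show "w x = c" using spec[OF elim(1), of n] by simp
    qed
  qed
  then have "AE x in half_line. w x = c"
    by (subst AE_restrict_space_iff) auto
  then show ?thesis by (rule that)
qed

lemma continuous_AE_zero:
  fixes f :: "real \<Rightarrow> 'a::euclidean_space"
  assumes f: "continuous_on {0..} f" and AE: "AE x in half_line. f x = 0" and "0 \<le> x"
  shows "f x = 0"
proof (rule ccontr)
  assume "f x \<noteq> 0"
  then obtain d where d: "0 < d" "\<And>y. 0 \<le> y \<Longrightarrow> dist y x < d \<Longrightarrow> dist (f y) (f x) < norm (f x)"
    using f[unfolded continuous_on_iff] \<open>0 \<le> x\<close> by (metis atLeast_iff zero_less_norm_iff)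
  have "AE y in half_line. y \<notin> {x..x + d / 2}"
    using AE
  proof eventually_elim
    case (elim y)
    show ?case
    proof
      assume y: "y \<in> {x..x + d / 2}"
      then have "dist (f y) (f x) < norm (f x)"
        using d \<open>0 \<le> x\<close> by (intro d(2)) (auto simp: dist_real_def)
      with elim show False by (simp add: dist_norm)
    qed
  qed
  then have "AE y in lebesgue. y \<in> {0..} \<longrightarrow> y \<notin> {x..x + d / 2}"
    by (subst (asm) AE_restrict_space_iff) auto
  then have "AE y in lebesgue. y \<notin> {x..x + d / 2}"
    by eventually_elim (use \<open>0 \<le> x\<close> in auto)
  then have "emeasure lebesgue {x..x + d / 2} = 0"
    by (subst (asm) AE_iff_measurable[of "{x..x + d / 2}"]) auto
  then show False using d(1) by simp
qed

lemma primitive_cong_AE: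
  assumes u: "primitive u g" and v: "primitive v h" and AE: "AE x in half_line. u x = v x"
  shows primitive_AE_eq: "\<And>x. 0 \<le> x \<Longrightarrow> u x = v x" and primitive_AE_deriv: "AE x in half_line. g x = h x"
proof -
  show eq: "u x = v x" if "0 \<le> x" for x
    using continuous_AE_zero[of "\<lambda>x. u x - v x", OF continuous_on_diff] AE that
      primitive_continuous[OF u] primitive_continuous[OF v] by fastforce
  let ?k = "\<lambda>x. g x - h x"
  have int: "integrable (lebesgue_on {0..b}) ?k" for b
    using primitive_integrable[OF u] primitive_integrable[OF v] by (rule Bochner_Integration.integrable_diff)
  have int': "integrable (lebesgue_on {a..b}) ?k" if "0 \<le> a" for a b
    by (rule integrable_subinterval[OF int[of b]]) (use that in auto)
  have I0: "integral {0..b} ?k = 0" if "0 \<le> b" for b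
  proof -
    have "integral {0..b} ?k = (LINT x|lebesgue_on {0..b}. ?k x)"
      by (rule lebesgue_integral_eq_integral[symmetric]) (auto intro: int)
    also have "\<dots> = 0"
      using primitive_eq[OF u that] primitive_eq[OF v that] eq[OF that] eq[of 0]
      by (simp add: primitive_integrable[OF u] primitive_integrable[OF v])
    finally show ?thesis .
  qed
  have I: "(LINT x|lebesgue_on {a..b}. ?k x) = 0" if "0 \<le> a" "a \<le> b" for a b
  proof -
    have "(LINT x|lebesgue_on {a..b}. ?k x) = integral {a..b} ?k"
      by (rule lebesgue_integral_eq_integral) (auto intro: int'[OF that(1)])
    moreover have "integral {0..a} ?k + integral {a..b} ?k = integral {0..b} ?k"
      by (rule Henstock_Kurzweil_Integration.integral_combine)
        (use that in \<open>auto intro: integrable_on_lebesgue_on int\<close>)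
    ultimately show ?thesis using I0[of a] I0[of b] that by simp
  qed
  have "AE x in lebesgue. indicator {0..real n} x *\<^sub>R ?k x = 0" for n
  proof (rule AE_zero_of_Icc_integrals)
    show "integrable lebesgue (\<lambda>x. indicat_real {0..real n} x *\<^sub>R ?k x)"
      using int unfolding Icc_indicator .
    fix a b :: real assume "a \<le> b"
    have "(\<lambda>x. indicat_real {a..b} x *\<^sub>R indicat_real {0..real n} x *\<^sub>R ?k x)
        = (\<lambda>x. indicator {max a 0..min b (real n)} x *\<^sub>R ?k x)"
      by (auto simp: fun_eq_iff indicator_def)
    moreover have "(LINT x|lebesgue_on {max a 0..min b (real n)}. ?k x) = 0"
    proof (cases "max a 0 \<le> min b (real n)")
      case False
      then have "{max a 0..min b (real n)} = {}" by auto
      then show ?thesis by (simp only: Icc_indicator) simp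
    qed (rule I, auto)
    ultimately show "(LINT x|lebesgue. indicat_real {a..b} x *\<^sub>R indicat_real {0..real n} x *\<^sub>R ?k x) = 0"
      by (simp only: Icc_indicator)
  qed
  then have "AE x in lebesgue. \<forall>n. indicator {0..real n} x *\<^sub>R ?k x = 0"
    unfolding AE_all_countable by blast
  then have "AE x in lebesgue. x \<in> {0..} \<longrightarrow> g x = h x"
  proof eventually_elim
    case (elim x)
    obtain n where "x \<le> real n" using real_arch_simple by blast
    with elim[rule_format, of n] show ?case by (auto simp: indicator_def split: if_splits)
  qed
  then show "AE x in half_line. g x = h x"
    by (subst AE_restrict_space_iff) auto
qed

lemma test_function_deriv_support:
  assumes "test_function \<phi> \<phi>'"
  obtains a b where "0 < a" "\<And>x. x \<notin> {a..b} \<Longrightarrow> \<phi> x = 0 \<and> \<phi>' x = 0"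
proof -
  obtain a b where ab: "0 < a" "\<And>x. x \<notin> {a..b} \<Longrightarrow> \<phi> x = 0"
    using assms unfolding test_function_def by blast
  have "\<phi>' x = 0" if "x \<notin> {a..b}" for x
  proof -
    have "(\<phi> has_real_derivative 0) (at x)"
    proof (rule has_field_derivative_transform_within_open[of "\<lambda>_. 0" _ _ "- {a..b}"])
      show "open (- {a..b})" by (simp add: open_Compl)
    qed (use that ab(2) in auto)
    moreover have "(\<phi> has_real_derivative \<phi>' x) (at x)" using assms by (simp add: test_function_def)
    ultimately show ?thesis by (rule DERIV_unique[symmetric])
  qed
  with ab show ?thesis by (intro that[of a b]) auto
qed

lemma primitive_C1:
  fixes \<phi> :: "real \<Rightarrow> 'a::euclidean_space"
  assumes "\<And>x. (\<phi> has_vector_derivative \<phi>' x) (at x)" "continuous_on UNIV \<phi>'"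
  shows "primitive \<phi> \<phi>'"
  unfolding primitive_def
proof (intro allI impI conjI)
  fix b :: real assume "0 \<le> b"
  have cont: "continuous_on {0..b} \<phi>'" using assms(2) by (rule continuous_on_subset) simp
  show int: "integrable (lebesgue_on {0..b}) \<phi>'" by (rule continuous_imp_integrable_real[OF cont])
  have "(\<phi>' has_integral (\<phi> b - \<phi> 0)) {0..b}"
    by (rule fundamental_theorem_of_calculus[OF \<open>0 \<le> b\<close>]) (rule has_vector_derivative_at_within[OF assms(1)])
  then have "\<phi> b = \<phi> 0 + integral {0..b} \<phi>'" by (simp add: integral_unique)
  then show "\<phi> b = \<phi> 0 + (LINT s|lebesgue_on {0..b}. \<phi>' s)"
    using lebesgue_integral_eq_integral[OF int] by simp
qed

lemma primitive_test_function:
  assumes "test_function \<phi> \<phi>'"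
  shows "primitive \<phi> \<phi>'" "continuous_on S \<phi>" "continuous_on S \<phi>'"
proof -
  have *: "(\<phi> has_vector_derivative \<phi>' x) (at x)" "continuous_on UNIV \<phi>'" for x
    using assms by (auto simp: test_function_def has_real_derivative_iff_has_vector_derivative)
  show "primitive \<phi> \<phi>'" by (rule primitive_C1[OF *])
  show "continuous_on S \<phi>'" using *(2) by (rule continuous_on_subset) simp
  show "continuous_on S \<phi>" using *(1)
    by (meson continuous_at_imp_continuous_on has_vector_derivative_continuous)
qed

lemma test_function_integrable:
  fixes v :: "real \<Rightarrow> 'a::euclidean_space"
  assumes \<phi>: "test_function \<phi> \<phi>'" and v: "\<And>b. integrable (lebesgue_on {0..b}) v"
  shows "integrable half_line (\<lambda>x. \<phi> x *\<^sub>R v x)" "integrable half_line (\<lambda>x. \<phi>' x *\<^sub>R v x)"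
proof -
  obtain a b where ab: "0 < a" "\<And>x. x \<notin> {a..b} \<Longrightarrow> \<phi> x = 0 \<and> \<phi>' x = 0"
    by (rule test_function_deriv_support[OF \<phi>]) blast
  show "integrable half_line (\<lambda>x. \<phi> x *\<^sub>R v x)" "integrable half_line (\<lambda>x. \<phi>' x *\<^sub>R v x)"
    using ab by (auto intro!: integrable_compact_support[of _ a b] v primitive_test_function[OF \<phi>])
qed

lemma primitive_weak_derivative:
  fixes v :: "real \<Rightarrow> 'a::euclidean_space"
  assumes v: "primitive v g" and \<phi>: "test_function \<phi> \<phi>'"
  shows "(LINT x|half_line. \<phi>' x *\<^sub>R v x) = - (LINT x|half_line. \<phi> x *\<^sub>R g x)"
proof -
  obtain a b where ab: "0 < a" "\<And>x. x \<notin> {a..b} \<Longrightarrow> \<phi> x = 0 \<and> \<phi>' x = 0"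
    by (rule test_function_deriv_support[OF \<phi>]) blast
  define B where "B = max 0 b + 1"
  have "B \<notin> {a..b}" by (simp add: B_def max_def)
  then have B: "0 \<le> B" "\<phi> B = 0" "\<phi> 0 = 0" using ab(1) ab(2)[of B] ab(2)[of 0] by (auto simp: B_def)
  have vi: "integrable (lebesgue_on {0..c}) v" for c
    by (rule continuous_imp_integrable_real[OF primitive_continuous_Icc[OF v]])
  have "primitive (\<lambda>x. \<phi> x *\<^sub>R v x) (\<lambda>x. \<phi>' x *\<^sub>R v x + \<phi> x *\<^sub>R g x)"
    by (rule primitive_prod[OF bounded_bilinear_scaleR primitive_test_function(1)[OF \<phi>] v])
  from primitive_eq[OF this B(1)]
  have "0 = (LINT x|lebesgue_on {0..B}. \<phi>' x *\<^sub>R v x + \<phi> x *\<^sub>R g x)" using B by simp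
  also have "\<dots> = (LINT x|half_line. \<phi>' x *\<^sub>R v x + \<phi> x *\<^sub>R g x)"
  proof (rule half_line_integral_Icc(1)[symmetric])
    fix x assume "0 \<le> x" "x \<notin> {0..B}"
    then have "x \<notin> {a..b}" by (auto simp: B_def max_def split: if_splits)
    then show "\<phi>' x *\<^sub>R v x + \<phi> x *\<^sub>R g x = 0" using ab(2) by simp
  qed simp
  also have "\<dots> = (LINT x|half_line. \<phi>' x *\<^sub>R v x) + (LINT x|half_line. \<phi> x *\<^sub>R g x)"
    by (intro Bochner_Integration.integral_add test_function_integrable[OF \<phi>] vi primitive_integrable[OF v])
  finally show ?thesis by (simp add: eq_neg_iff_add_eq_0)
qed

text \<open>The indefinite integral \<open>v\<close> of \<open>g\<close> has the weak derivative \<open>g\<close>, too, so \<open>w - v\<close> has the weak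
  derivative 0 and is constant by the lemma of du Bois-Reymond.\<close>

lemma weak_derivative_primitive:
  fixes w :: "real \<Rightarrow> 'a::euclidean_space"
  assumes w: "\<And>b. integrable (lebesgue_on {0..b}) w" and g: "\<And>b. integrable (lebesgue_on {0..b}) g"
    and weak: "\<And>\<phi> \<phi>'. test_function \<phi> \<phi>' \<Longrightarrow> (LINT x|half_line. \<phi>' x *\<^sub>R w x) = - (LINT x|half_line. \<phi> x *\<^sub>R g x)"
  obtains u where "primitive u g" "AE x in half_line. w x = u x"
proof -
  define v where "v x = (LINT s|lebesgue_on {0..x}. g s)" for x
  have v: "primitive v g" using indefinite_integral_primitive[OF g, of 0] by (simp add: v_def[abs_def])
  have vi: "integrable (lebesgue_on {0..c}) v" for c
    by (rule continuous_imp_integrable_real[OF primitive_continuous_Icc[OF v]])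
  obtain c where c: "AE x in half_line. w x - v x = c"
  proof (rule du_Bois_Reymond[of "\<lambda>x. w x - v x"])
    show "integrable (lebesgue_on {0..b}) (\<lambda>x. w x - v x)" for b
      by (intro Bochner_Integration.integrable_diff w vi)
    fix \<phi> \<phi>' assume \<phi>: "test_function \<phi> \<phi>'"
    have "(LINT x|half_line. \<phi>' x *\<^sub>R (w x - v x)) = (LINT x|half_line. \<phi>' x *\<^sub>R w x) - (LINT x|half_line. \<phi>' x *\<^sub>R v x)"
      unfolding scaleR_diff_right
      by (intro Bochner_Integration.integral_diff test_function_integrable[OF \<phi>] w vi)
    also have "\<dots> = 0" using weak[OF \<phi>] primitive_weak_derivative[OF v \<phi>] by simp
    finally show "(LINT x|half_line. \<phi>' x *\<^sub>R (w x - v x)) = 0" .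
  qed
  show ?thesis
  proof
    show "primitive (\<lambda>x. c + v x) g" unfolding v_def by (rule indefinite_integral_primitive[OF g])
    show "AE x in half_line. w x = c + v x" using c by eventually_elim (simp add: algebra_simps)
  qed
qed

text \<open>An integrable function with an integrable derivative tends to 0 at infinity, since it has a
  limit.\<close>

lemma primitive_boundary_term:
  fixes u :: "real \<Rightarrow> 'a::euclidean_space"
  assumes u: "primitive u g" and g: "integrable half_line g" and int: "integrable half_line u"
  shows "(LINT x|half_line. g x) = - u 0"
proof -
  let ?l = "u 0 + (LINT x|half_line. g x)"
  have "((\<lambda>b. u 0 + (LINT x|lebesgue_on {0..b}. g x)) \<longlongrightarrow> ?l) at_top"
    by (intro tendsto_intros integral_Icc_tendsto_half_line g)
  moreover have "\<forall>\<^sub>F b in at_top. u 0 + (LINT x|lebesgue_on {0..b}. g x) = u b"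
    using eventually_ge_at_top[of 0] by eventually_elim (rule primitive_eq[OF u, symmetric])
  ultimately have lim: "(u \<longlongrightarrow> ?l) at_top" by (rule Lim_transform_eventually)
  have "?l = 0"
  proof (rule ccontr)
    assume l: "?l \<noteq> 0"
    have "\<forall>\<^sub>F b in at_top. dist (u b) ?l < norm ?l / 2" using l by (intro tendstoD[OF lim]) simp
    then obtain T where T: "\<And>b. b \<ge> T \<Longrightarrow> dist (u b) ?l < norm ?l / 2" by (auto simp: eventually_at_top_linorder)
    define T' where "T' = max 0 T"
    let ?r = "norm ?l / 2"
    have r: "0 < ?r" using l by simp
    have large: "?r \<le> norm (u x)" if "x \<ge> T'" for x
    proof -
      have "norm l \<le> norm y + dist y l" for y l :: 'a
        using norm_triangle_ineq4[of y "y - l"] by (simp add: dist_norm)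
      from this[of ?l "u x"] have "norm ?l \<le> norm (u x) + dist (u x) ?l" .
      with T[of x] that show ?thesis by (simp add: T'_def)
    qed
    obtain n :: nat where n: "(LINT x|half_line. norm (u x)) / ?r < real n" using reals_Archimedean2 by blast
    have "?r * real n = (LINT x|half_line. indicator {T'..T' + real n} x *\<^sub>R ?r)"
      by (subst integral_lebesgue_on_subset) (auto simp: T'_def measure_restrict_space)
    also have "\<dots> \<le> (LINT x|half_line. norm (u x))"
    proof (rule integral_mono)
      show "integrable half_line (\<lambda>x. indicat_real {T'..T' + real n} x *\<^sub>R ?r)"
        by (subst integrable_lebesgue_on_subset)
          (auto simp: T'_def intro!: finite_measure.integrable_const finite_measure_lebesgue_on)
    qed (use int large r in \<open>auto simp: indicator_def\<close>)
    finally show False using n r by (simp add: field_simps)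
  qed
  then show ?thesis by (simp add: add_eq_0_iff)
qed

section \<open>Quadratic forms\<close>

lemma mat_adjoint_dims [simp]: "dim_row (mat_adjoint A) = dim_col A" "dim_col (mat_adjoint A) = dim_row A"
  by (simp_all add: mat_adjoint_def)

lemma mat_adjoint_carrier [simp]: "A \<in> carrier_mat n m \<Longrightarrow> mat_adjoint A \<in> carrier_mat m n"
  by (rule carrier_matI) simp_all

lemma mat_adjoint_index [simp]:
  "i < dim_col A \<Longrightarrow> j < dim_row A \<Longrightarrow> mat_adjoint A $$ (i, j) = conjugate (A $$ (j, i))"
  by (simp add: mat_adjoint_def mat_of_rows_index)

lemma scalar_prod_adjoint:
  fixes A :: "'f::real_or_complex mat"
  assumes A: "A \<in> carrier_mat n m" and v: "v \<in> carrier_vec m" and w: "w \<in> carrier_vec n"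
  shows "(A *\<^sub>v v) \<bullet>c w = v \<bullet>c (mat_adjoint A *\<^sub>v w)"
proof -
  have "(A *\<^sub>v v) \<bullet>c w = (\<Sum>i<n. (\<Sum>j<m. A $$ (i, j) * v $ j) * conjugate (w $ i))"
    using assms by (auto simp: scalar_prod_def atLeast0LessThan intro!: sum.cong)
  also have "\<dots> = (\<Sum>i<n. \<Sum>j<m. v $ j * (A $$ (i, j) * conjugate (w $ i)))"
    by (simp add: sum_distrib_left sum_distrib_right mult_ac)
  also have "\<dots> = (\<Sum>j<m. \<Sum>i<n. v $ j * (A $$ (i, j) * conjugate (w $ i)))"
    by (rule sum.swap)
  also have "\<dots> = (\<Sum>j<m. v $ j * conjugate (\<Sum>i<n. conjugate (A $$ (i, j)) * w $ i))"
    by (simp add: sum_conjugate conjugate_dist_mul sum_distrib_left)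
  also have "\<dots> = v \<bullet>c (mat_adjoint A *\<^sub>v w)"
    using assms by (auto simp: scalar_prod_def atLeast0LessThan intro!: sum.cong)
  finally show ?thesis .
qed

lemma scalar_prod_conjugate:
  "v \<in> carrier_vec n \<Longrightarrow> w \<in> carrier_vec n \<Longrightarrow> conjugate (v \<bullet>c w) = w \<bullet>c (v :: 'f::real_or_complex vec)"
  by (auto simp: scalar_prod_def sum_conjugate conjugate_dist_mul mult.commute atLeast0LessThan intro!: sum.cong)

lemma re_conjugate: "re (conjugate z) = re (z :: 'f::real_or_complex)"
proof -
  have "re (z + conjugate z) = 2 * re z" unfolding add_conjugate re_of_real by (simp add: re_def)
  then show ?thesis by (simp add: re_add)
qed

lemma conjugate_of_real: "conjugate (of_real r :: 'f::real_or_complex) = of_real r"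
  using add_conjugate[of "of_real r :: 'f"] re_of_real[of r, where 'f = 'f] by (simp add: re_def)

lemma nonneg_iff: "0 \<le> z \<longleftrightarrow> conjugate z = z \<and> 0 \<le> re (z :: 'f::real_or_complex)"
proof
  assume "0 \<le> z"
  then obtain r where r: "r \<ge> 0" "z = of_real r" using less_eq_iff_of_real[of 0 z] by auto
  with r show "conjugate z = z \<and> 0 \<le> re z" by (simp add: re_of_real conjugate_of_real)
next
  assume z: "conjugate z = z \<and> 0 \<le> re z"
  have "2 * z = of_real (2 * re z)" using add_conjugate[of z] z by (simp add: re_def)
  then have "z = of_real (re z)" by simp
  with z show "0 \<le> z" using less_eq_iff_of_real[of 0 z] by auto
qed

lemma nonpos_iff: "z \<le> 0 \<longleftrightarrow> conjugate z = z \<and> re (z :: 'f::real_or_complex) \<le> 0"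
proof -
  have "conjugate (- z) = - z \<longleftrightarrow> conjugate z = z"
    by (simp add: conjugate_neg)
  moreover have "re (- z) = - re z" by (simp add: re_def)
  moreover have "z \<le> 0 \<longleftrightarrow> 0 \<le> - z" by (simp add: less_eq_iff_of_real[of z 0] less_eq_iff_of_real[of 0 "- z"])
  ultimately show ?thesis using nonneg_iff[of "- z"] by simp
qed

lemma hermitian_form:
  assumes "hermitian_mat n M" "v \<in> carrier_vec n" "w \<in> carrier_vec n"
  shows "(M *\<^sub>v v) \<bullet>c w = v \<bullet>c (M *\<^sub>v w)"
  using assms scalar_prod_adjoint[of M n n v w] by (simp add: hermitian_mat_def)

lemma hermitian_form_real:
  assumes "hermitian_mat n M" "v \<in> carrier_vec n"
  shows "conjugate ((M *\<^sub>v v) \<bullet>c v) = (M *\<^sub>v v) \<bullet>c v"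
proof -
  have "M *\<^sub>v v \<in> carrier_vec n" using assms by (auto simp: hermitian_mat_def)
  then show ?thesis
    using scalar_prod_conjugate[of "M *\<^sub>v v" n v] hermitian_form[OF assms assms(2)] assms(2) by simp
qed

lemma mat_adjoint_add:
  "A \<in> carrier_mat n m \<Longrightarrow> B \<in> carrier_mat n m \<Longrightarrow> mat_adjoint (A + B) = mat_adjoint A + mat_adjoint (B :: 'f::real_or_complex mat)"
  by (rule eq_matI) (auto simp: conjugate_dist_add)

lemma mat_adjoint_mult:
  "A \<in> carrier_mat n m \<Longrightarrow> B \<in> carrier_mat m l \<Longrightarrow> mat_adjoint (A * B) = mat_adjoint B * mat_adjoint (A :: 'f::real_or_complex mat)"
  by (rule eq_matI)
    (auto simp: scalar_prod_def sum_conjugate conjugate_dist_mul mult.commute intro!: sum.cong)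

lemma mat_adjoint_adjoint: "mat_adjoint (mat_adjoint A) = (A :: 'f::real_or_complex mat)"
  by (rule eq_matI) auto

lemma hermitian_Re_mat:
  assumes "P \<in> carrier_mat n n" shows "hermitian_mat n (Re_mat P)"
proof -
  have half: "conjugate (1/2 * z) = 1/2 * conjugate z" for z :: 'a
  proof -
    have "conjugate (1/2 :: 'a) = 1/2"
      using conjugate_of_real[of "1/2", where 'f = 'a] by (simp only: of_real_divide of_real_1 of_real_numeral)
    then show ?thesis by (simp only: conjugate_dist_mul)
  qed
  have "mat_adjoint (Re_mat P) = Re_mat P"
    using assms unfolding Re_mat_def
    by (intro eq_matI) (auto simp: half[simplified] conjugate_dist_add add.commute)
  then show ?thesis using assms by (simp add: hermitian_mat_def Re_mat_def)
qed

lemma re_form_Re_mat: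
  assumes P: "P \<in> carrier_mat n n" and v: "v \<in> carrier_vec n"
  shows "re ((Re_mat P *\<^sub>v v) \<bullet>c v) = re ((P *\<^sub>v v) \<bullet>c (v :: 'f::real_or_complex vec))"
proof -
  have "(Re_mat P *\<^sub>v v) = (1/2) \<cdot>\<^sub>v (P *\<^sub>v v + mat_adjoint P *\<^sub>v v)"
  proof -
    let ?Q = "P + mat_adjoint P"
    have Q: "?Q \<in> carrier_mat n n" using P by simp
    have "((1/2) \<cdot>\<^sub>m ?Q) *\<^sub>v v = (1/2) \<cdot>\<^sub>v (?Q *\<^sub>v v)"
      using Q v by (intro eq_vecI) (auto simp: scalar_prod_def sum_distrib_left mult.assoc intro!: sum.cong)
    then show ?thesis unfolding Re_mat_def using P v by (simp add: add_mult_distrib_mat_vec[of _ n n])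
  qed
  then have "(Re_mat P *\<^sub>v v) \<bullet>c v = (1/2) * ((P *\<^sub>v v) \<bullet>c v + (mat_adjoint P *\<^sub>v v) \<bullet>c v)"
    using assms mult_mat_vec_carrier[OF mat_adjoint_carrier[OF P] v] add_scalar_prod_distrib[of "P *\<^sub>v v" n "mat_adjoint P *\<^sub>v v" "conjugate v"] by simp
  also have "(mat_adjoint P *\<^sub>v v) \<bullet>c v = conjugate ((P *\<^sub>v v) \<bullet>c v)"
    using scalar_prod_adjoint[OF P v v] scalar_prod_conjugate[OF v mult_mat_vec_carrier[OF mat_adjoint_carrier[OF P] v]]
    by simp
  finally have "(Re_mat P *\<^sub>v v) \<bullet>c v = (1/2) *\<^sub>R ((P *\<^sub>v v) \<bullet>c v + conjugate ((P *\<^sub>v v) \<bullet>c v))"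
    by (simp add: scaleR_conv_of_real)
  then show ?thesis by (simp only: re_scaleR re_add re_conjugate) simp
qed

text \<open>The forms of \<open>P\<close> and of its Hermitian part have the same real part, and the latter is real.\<close>

lemma neg_semidef_Re_mat_iff:
  assumes "P \<in> carrier_mat n n"
  shows "neg_semidef_mat n (Re_mat P) \<longleftrightarrow> (\<forall>v\<in>carrier_vec n. re ((P *\<^sub>v v) \<bullet>c (v :: 'f::real_or_complex vec)) \<le> 0)"
proof -
  have "(Re_mat P *\<^sub>v v) \<bullet>c v \<le> 0 \<longleftrightarrow> re ((P *\<^sub>v v) \<bullet>c v) \<le> 0" if "v \<in> carrier_vec n" for v
    using nonpos_iff[of "(Re_mat P *\<^sub>v v) \<bullet>c v"] hermitian_form_real[OF hermitian_Re_mat[OF assms] that]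
      re_form_Re_mat[OF assms that] by simp
  then show ?thesis using hermitian_Re_mat[OF assms] by (auto simp: neg_semidef_mat_def)
qed

lemma diagonal_form:
  fixes D :: "real mat" and v :: "'f::real_or_complex vec"
  assumes D: "D \<in> carrier_mat n n" "diagonal_mat D" and v: "v \<in> carrier_vec n"
  shows "(map_mat of_real D *\<^sub>v v) \<bullet>c v = of_real (\<Sum>i<n. D $$ (i, i) * (norm (v $ i))\<^sup>2)"
    and "i < n \<Longrightarrow> (map_mat of_real D *\<^sub>v v) $ i = of_real (D $$ (i, i)) * v $ i"
proof -
  show comp: "(map_mat of_real D *\<^sub>v v) $ i = of_real (D $$ (i, i)) * v $ i" if "i < n" for i
  proof -
    have "(map_mat of_real D *\<^sub>v v) $ i = (\<Sum>j<n. of_real (D $$ (i, j)) * v $ j)"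
      using assms that by (auto simp: scalar_prod_def atLeast0LessThan intro!: sum.cong)
    also have "\<dots> = (\<Sum>j<n. if j = i then of_real (D $$ (i, i)) * v $ i else 0)"
      using assms that by (intro sum.cong) (auto simp: diagonal_mat_def)
    finally show ?thesis using that by simp
  qed
  have "(map_mat of_real D *\<^sub>v v) \<bullet>c v = (\<Sum>i<n. (map_mat of_real D *\<^sub>v v) $ i * conjugate (v $ i))"
    using v D by (simp add: scalar_prod_def atLeast0LessThan)
  also have "\<dots> = (\<Sum>i<n. of_real (D $$ (i, i)) * (v $ i * conjugate (v $ i)))"
    by (intro sum.cong) (simp_all add: comp)
  finally show "(map_mat of_real D *\<^sub>v v) \<bullet>c v = of_real (\<Sum>i<n. D $$ (i, i) * (norm (v $ i))\<^sup>2)"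
    by (simp add: mult_conjugate)
qed

lemma definite_diagonal:
  fixes D :: "real mat"
  assumes D: "D \<in> carrier_mat n n" "diagonal_mat D" and i: "i < n"
  shows "pos_def_mat n D \<Longrightarrow> 0 < D $$ (i, i)" and "neg_def_mat n D \<Longrightarrow> D $$ (i, i) < 0"
proof -
  have id: "map_mat (\<lambda>x. x) D = D" by (rule eq_matI) auto
  have "((map_mat of_real D :: real mat) *\<^sub>v unit_vec n i) \<bullet>c unit_vec n i = of_real (\<Sum>j<n. D $$ (j, j) * (norm ((unit_vec n i :: real vec) $ j))\<^sup>2)"
    by (rule diagonal_form(1)[OF D unit_vec_carrier])
  then have "(D *\<^sub>v unit_vec n i) \<bullet>c unit_vec n i = (\<Sum>j<n. D $$ (j, j) * (norm ((unit_vec n i :: real vec) $ j))\<^sup>2)"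
    unfolding of_real_eq_id id_def id .
  also have "\<dots> = (\<Sum>j<n. if j = i then D $$ (i, i) else 0)"
    using i by (intro sum.cong) (auto simp: unit_vec_def)
  finally have form: "(D *\<^sub>v unit_vec n i) \<bullet>c unit_vec n i = D $$ (i, i)" using i by simp
  have nz: "unit_vec n i \<noteq> (0\<^sub>v n :: real vec)" using unit_vec_nonzero[OF i] by simp
  show "pos_def_mat n D \<Longrightarrow> 0 < D $$ (i, i)" "neg_def_mat n D \<Longrightarrow> D $$ (i, i) < 0"
    using form nz unit_vec_carrier[of n i] unfolding pos_def_mat_def neg_def_mat_def by metis+
qed

lemma invertible_mat_iff_det:
  fixes A :: "'f::field mat"
  assumes A: "A \<in> carrier_mat n n"
  shows "invertible_mat A \<longleftrightarrow> det A \<noteq> 0"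
    and "invertible_mat A \<Longrightarrow> \<exists>V\<in>carrier_mat n n. A * V = 1\<^sub>m n \<and> V * A = 1\<^sub>m n"
proof -
  have inv: "\<exists>V\<in>carrier_mat n n. A * V = 1\<^sub>m n \<and> V * A = 1\<^sub>m n" if "det A \<noteq> 0"
    using det_non_zero_imp_unit[OF A that, of "()"] by (auto simp: Units_def ring_mat_simps)
  have "det A \<noteq> 0" if "invertible_mat A"
  proof -
    from that obtain V where V: "A * V = 1\<^sub>m n" "V * A = 1\<^sub>m (dim_row V)"
      using A by (auto simp: invertible_mat_def inverts_mat_def)
    have "dim_col V = n" using arg_cong[OF V(1), of dim_col] by simp
    moreover have "dim_row V = n" using arg_cong[OF V(2), of dim_col] A by simp
    ultimately have "V \<in> carrier_mat n n" by auto
    from det_mult[OF A this] V(1) show ?thesis by auto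
  qed
  moreover have "invertible_mat A" if "det A \<noteq> 0"
    using inv[OF that] A by (auto simp: invertible_mat_def inverts_mat_def square_mat.simps)
  ultimately show "invertible_mat A \<longleftrightarrow> det A \<noteq> 0" by blast
  with inv show "invertible_mat A \<Longrightarrow> \<exists>V\<in>carrier_mat n n. A * V = 1\<^sub>m n \<and> V * A = 1\<^sub>m n" by blast
qed

lemma add_form:
  assumes "M \<in> carrier_mat n n" "N \<in> carrier_mat n n" "v \<in> carrier_vec n"
  shows "((M + N) *\<^sub>v v) \<bullet>c v = (M *\<^sub>v v) \<bullet>c v + (N *\<^sub>v v) \<bullet>c (v :: 'f::real_or_complex vec)"
  using add_scalar_prod_distrib[OF mult_mat_vec_carrier[OF assms(1,3)] mult_mat_vec_carrier[OF assms(2,3)], of "conjugate v"]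
    add_mult_distrib_mat_vec[OF assms] assms(3) by simp

lemma mult_mat_vec3:
  assumes "A \<in> carrier_mat n m" "B \<in> carrier_mat m l" "C \<in> carrier_mat l p" "v \<in> carrier_vec p"
  shows "(A * B * C) *\<^sub>v v = A *\<^sub>v (B *\<^sub>v (C *\<^sub>v (v :: 'f::real_or_complex vec)))"
  using assoc_mult_mat_vec[OF mult_carrier_mat[OF assms(1,2)] assms(3,4)]
    assoc_mult_mat_vec[OF assms(1,2) mult_mat_vec_carrier[OF assms(3,4)]] by simp

lemma congruence_form:
  assumes "U \<in> carrier_mat n2 n1" "M \<in> carrier_mat n2 n2" "v \<in> carrier_vec n1"
  shows "((mat_adjoint U * M * U) *\<^sub>v v) \<bullet>c v = (M *\<^sub>v (U *\<^sub>v v)) \<bullet>c (U *\<^sub>v (v :: 'f::real_or_complex vec))"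
proof -
  have Uv: "U *\<^sub>v v \<in> carrier_vec n2" using assms by simp
  have "((mat_adjoint U * M * U) *\<^sub>v v) \<bullet>c v = (mat_adjoint U *\<^sub>v (M *\<^sub>v (U *\<^sub>v v))) \<bullet>c v"
    by (simp only: mult_mat_vec3[OF mat_adjoint_carrier[OF assms(1)] assms(2,1,3)])
  also have "\<dots> = (M *\<^sub>v (U *\<^sub>v v)) \<bullet>c (mat_adjoint (mat_adjoint U) *\<^sub>v v)"
    by (rule scalar_prod_adjoint[OF mat_adjoint_carrier[OF assms(1)] mult_mat_vec_carrier[OF assms(2) Uv] assms(3)])
  finally show ?thesis by (simp only: mat_adjoint_adjoint)
qed

lemma append_cols_carrier: "M \<in> carrier_mat k n \<Longrightarrow> N \<in> carrier_mat k m \<Longrightarrow> append_cols M N \<in> carrier_mat k (n + m)"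
  unfolding append_cols_def by (rule carrier_matI) simp_all

lemma append_cols_mult_vec:
  fixes M N :: "'f::real_or_complex mat"
  assumes "M \<in> carrier_mat k n" "N \<in> carrier_mat k m" "v \<in> carrier_vec n" "w \<in> carrier_vec m"
  shows "append_cols M N *\<^sub>v (v @\<^sub>v w) = M *\<^sub>v v + N *\<^sub>v w"
proof -
  have "append_cols M N *\<^sub>v (v @\<^sub>v w) = (M *\<^sub>v v + N *\<^sub>v w) @\<^sub>v (0\<^sub>m 0 n *\<^sub>v v + 0\<^sub>m 0 m *\<^sub>v w)"
    unfolding append_cols_def using assms by (auto intro!: four_block_mat_mult_vec)
  also have "\<dots> = M *\<^sub>v v + N *\<^sub>v w"
    using assms by (intro eq_vecI) auto
  finally show ?thesis .
qed

lemma block_diag_mult_vec: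
  fixes M N :: "'f::real_or_complex mat"
  assumes "M \<in> carrier_mat n n" "N \<in> carrier_mat m m" "v \<in> carrier_vec n" "w \<in> carrier_vec m"
  shows "block_diag M N *\<^sub>v (v @\<^sub>v w) = (M *\<^sub>v v) @\<^sub>v (N *\<^sub>v w)"
proof -
  have "block_diag M N *\<^sub>v (v @\<^sub>v w) = (M *\<^sub>v v + 0\<^sub>m n m *\<^sub>v w) @\<^sub>v (0\<^sub>m m n *\<^sub>v v + N *\<^sub>v w)"
    unfolding block_diag_def using assms by (auto intro!: four_block_mat_mult_vec)
  moreover have "0\<^sub>m n m *\<^sub>v w = 0\<^sub>v n" "0\<^sub>m m n *\<^sub>v v = 0\<^sub>v m"
    using assms by (auto intro!: eq_vecI)
  ultimately show ?thesis using assms by simp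
qed

lemma scalar_prod_conjugate_append:
  fixes v w :: "'f::real_or_complex vec"
  assumes "a \<in> carrier_vec n" "b \<in> carrier_vec m" "v \<in> carrier_vec n" "w \<in> carrier_vec m"
  shows "(a @\<^sub>v b) \<bullet>c (v @\<^sub>v w) = a \<bullet>c v + b \<bullet>c w"
proof -
  have "conjugate (v @\<^sub>v w) = conjugate v @\<^sub>v conjugate w"
    by (intro eq_vecI) auto
  then show ?thesis using assms by (simp add: scalar_prod_append)
qed

text \<open>Rows of zeros complete \<open>W\<close> to a singular square matrix.\<close>

lemma wide_mat_kernel:
  fixes W :: "'f::real_or_complex mat"
  assumes W: "W \<in> carrier_mat k n" and "k < n"
  shows "\<exists>w\<in>carrier_vec n. w \<noteq> 0\<^sub>v n \<and> W *\<^sub>v w = 0\<^sub>v k"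
proof -
  define M where "M = Matrix.mat n n (\<lambda>(i, j). if i < k then W $$ (i, j) else 0)"
  have M: "M \<in> carrier_mat n n" by (simp add: M_def)
  have "row M k = 0\<^sub>v n" using \<open>k < n\<close> by (intro eq_vecI) (auto simp: M_def)
  then have "transpose_mat M *\<^sub>v unit_vec n k = 0\<^sub>v n"
    using M \<open>k < n\<close> by (intro eq_vecI) (auto simp: vec_eq_iff M_def scalar_prod_right_unit)
  then have "det (transpose_mat M) = 0"
    using det_0_iff_vec_prod_zero[of "transpose_mat M" n] M unit_vec_nonzero[OF \<open>k < n\<close>]
      unit_vec_carrier[of n k] transpose_carrier_mat by blast
  then have "det M = 0" using det_transpose[OF M] by simp
  then obtain w where w: "w \<in> carrier_vec n" "w \<noteq> 0\<^sub>v n" "M *\<^sub>v w = 0\<^sub>v n"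
    using det_0_iff_vec_prod_zero[OF M] by blast
  have "W *\<^sub>v w = 0\<^sub>v k"
  proof (rule eq_vecI)
    fix i assume "i < dim_vec (0\<^sub>v k :: 'f vec)"
    then have i: "i < k" by simp
    have "(W *\<^sub>v w) $ i = (M *\<^sub>v w) $ i"
      using i W w(1) \<open>k < n\<close> by (auto simp: M_def scalar_prod_def)
    then show "(W *\<^sub>v w) $ i = 0\<^sub>v k $ i" unfolding w(3) using i \<open>k < n\<close> by simp
  qed (use W in simp)
  with w show ?thesis by blast
qed

lemma re_nonneg_form_iff:
  assumes "hermitian_mat n M" "v \<in> carrier_vec n"
  shows "0 \<le> (M *\<^sub>v v) \<bullet>c v \<longleftrightarrow> 0 \<le> re ((M *\<^sub>v v) \<bullet>c (v :: 'f::real_or_complex vec))"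
  using hermitian_form_real[OF assms] nonneg_iff[of "(M *\<^sub>v v) \<bullet>c v"] by simp

lemma hermitian_diagonal:
  fixes D :: "real mat"
  assumes "D \<in> carrier_mat n n" "diagonal_mat D"
  shows "hermitian_mat n (map_mat of_real D :: 'f::real_or_complex mat)"
proof -
  have "mat_adjoint (map_mat of_real D) = (map_mat of_real D :: 'f mat)"
  proof (rule eq_matI)
    fix i j assume "i < dim_row (map_mat of_real D :: 'f mat)" "j < dim_col (map_mat of_real D :: 'f mat)"
    then show "mat_adjoint (map_mat of_real D) $$ (i, j) = (map_mat of_real D :: 'f mat) $$ (i, j)"
      using assms by (cases "i = j") (auto simp: diagonal_mat_def conjugate_of_real)
  qed (use assms in auto)
  with assms show ?thesis by (simp add: hermitian_mat_def)
qed

section \<open>The boundary condition in diagonal coordinates\<close>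

locale diagonalised =
  fixes d k n1 n2 :: nat and P1 S WB :: "'f::real_or_complex mat" and \<Lambda> \<Theta> :: "real mat"
  assumes P1: "P1 \<in> carrier_mat d d" and S: "S \<in> carrier_mat d d"
    and unitary: "mat_adjoint S * S = 1\<^sub>m d" "S * mat_adjoint S = 1\<^sub>m d"
    and \<Lambda>: "\<Lambda> \<in> carrier_mat n1 n1" "diagonal_mat \<Lambda>" "\<And>i. i < n1 \<Longrightarrow> 0 < \<Lambda> $$ (i, i)"
    and \<Theta>: "\<Theta> \<in> carrier_mat n2 n2" "diagonal_mat \<Theta>" "\<And>i. i < n2 \<Longrightarrow> \<Theta> $$ (i, i) < 0"
    and d: "d = n1 + n2"
    and P1_eq: "P1 = mat_adjoint S * block_diag (map_mat of_real \<Lambda>) (map_mat of_real \<Theta>) * S"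
    and WB: "WB \<in> carrier_mat k d"
begin

abbreviation \<Lambda>f :: "'f mat" where "\<Lambda>f \<equiv> map_mat of_real \<Lambda>"
abbreviation \<Theta>f :: "'f mat" where "\<Theta>f \<equiv> map_mat of_real \<Theta>"

lemma carriers: "\<Lambda>f \<in> carrier_mat n1 n1" "\<Theta>f \<in> carrier_mat n2 n2" "block_diag \<Lambda>f \<Theta>f \<in> carrier_mat d d"
  "mat_adjoint S \<in> carrier_mat d d"
  using \<Lambda>(1) \<Theta>(1) S by (auto simp: d block_diag_def)

lemma adjoint_S_cancel: "y \<in> carrier_vec d \<Longrightarrow> mat_adjoint S *\<^sub>v (S *\<^sub>v y) = y"
  "y \<in> carrier_vec d \<Longrightarrow> S *\<^sub>v (mat_adjoint S *\<^sub>v y) = y"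
  using S carriers(4) unitary assoc_mult_mat_vec[of "mat_adjoint S" d d S d y] assoc_mult_mat_vec[of S d d "mat_adjoint S" d y]
  by auto

lemma P1_mult_vec: "y \<in> carrier_vec d \<Longrightarrow> P1 *\<^sub>v y = mat_adjoint S *\<^sub>v (block_diag \<Lambda>f \<Theta>f *\<^sub>v (S *\<^sub>v y))"
  unfolding P1_eq by (rule mult_mat_vec3[OF carriers(4,3) S])

lemma P1_form:
  assumes v: "v \<in> carrier_vec n1" and w: "w \<in> carrier_vec n2"
  defines "y \<equiv> mat_adjoint S *\<^sub>v (v @\<^sub>v w)"
  shows "(P1 *\<^sub>v y) \<bullet>c y = (\<Lambda>f *\<^sub>v v) \<bullet>c v + (\<Theta>f *\<^sub>v w) \<bullet>c w"
proof -
  have vw: "v @\<^sub>v w \<in> carrier_vec d" using v w by (simp add: d)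
  have y: "y \<in> carrier_vec d" using carriers(4) vw by (simp add: y_def)
  have Sy: "S *\<^sub>v y = v @\<^sub>v w" unfolding y_def by (rule adjoint_S_cancel(2)[OF vw])
  have "(P1 *\<^sub>v y) \<bullet>c y = (mat_adjoint S *\<^sub>v (block_diag \<Lambda>f \<Theta>f *\<^sub>v (v @\<^sub>v w))) \<bullet>c y"
    by (simp only: P1_mult_vec[OF y] Sy)
  also have "\<dots> = (block_diag \<Lambda>f \<Theta>f *\<^sub>v (v @\<^sub>v w)) \<bullet>c (mat_adjoint (mat_adjoint S) *\<^sub>v y)"
    using carriers vw y by (intro scalar_prod_adjoint) auto
  also have "\<dots> = ((\<Lambda>f *\<^sub>v v) @\<^sub>v (\<Theta>f *\<^sub>v w)) \<bullet>c (v @\<^sub>v w)"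
    using carriers v w by (simp add: mat_adjoint_adjoint Sy block_diag_mult_vec)
  also have "\<dots> = (\<Lambda>f *\<^sub>v v) \<bullet>c v + (\<Theta>f *\<^sub>v w) \<bullet>c w"
    by (rule scalar_prod_conjugate_append[OF _ _ v w]) (use carriers v w in auto)
  finally show ?thesis .
qed

lemma \<Theta>_form: "w \<in> carrier_vec n2 \<Longrightarrow> w \<noteq> 0\<^sub>v n2 \<Longrightarrow> re ((\<Theta>f *\<^sub>v w) \<bullet>c w) < 0"
proof -
  assume w: "w \<in> carrier_vec n2" "w \<noteq> 0\<^sub>v n2"
  then obtain i where i: "i < n2" "w $ i \<noteq> 0" by (metis carrier_vecD eq_vecI index_zero_vec)
  have "(\<Sum>i<n2. \<Theta> $$ (i, i) * (norm (w $ i))\<^sup>2) < 0"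
  proof -
    have "(\<Sum>j<n2. \<Theta> $$ (j, j) * (norm (w $ j))\<^sup>2) < (\<Sum>j<n2. 0)"
      using i \<Theta>(3) by (intro sum_strict_mono_ex1) (auto simp: mult_less_0_iff mult_le_0_iff less_imp_le intro!: bexI[of _ i])
    then show ?thesis by simp
  qed
  then show ?thesis using diagonal_form(1)[OF \<Theta>(1,2) w(1)] by (simp only: re_of_real)
qed

lemma vec_split: "y \<in> carrier_vec d \<Longrightarrow> \<exists>v\<in>carrier_vec n1. \<exists>w\<in>carrier_vec n2. y = v @\<^sub>v w"
  unfolding d using vec_first_last_append vec_first_carrier vec_last_carrier by metis

text \<open>In the coordinates \<open>(v, w)\<close> the boundary condition is \<open>W1 v + W2 w = 0\<close>. The vectors \<open>(0, w)\<close> with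
  \<open>W2 w = 0\<close> satisfy it, and the form of \<open>P\<^sub>1\<close> is negative at those with \<open>w \<noteq> 0\<close>. Hence \<open>W2\<close> is
  injective, and since it has at most \<open>n2\<close> rows, it is square and invertible. The matrices are
  \<open>B = W2\<close> and \<open>U = W2\<^sup>-\<^sup>1 W1\<close>.\<close>

lemma boundary_matrix_of_nonneg_form:
  assumes nonneg: "\<And>y. y \<in> carrier_vec d \<Longrightarrow> WB *\<^sub>v y = 0\<^sub>v k \<Longrightarrow> 0 \<le> re ((P1 *\<^sub>v y) \<bullet>c y)" and "k \<le> n2"
  shows "k = n2" "\<exists>B U. B \<in> carrier_mat n2 n2 \<and> invertible_mat B \<and> U \<in> carrier_mat n2 n1 \<and>
      WB = B * append_cols U (1\<^sub>m n2) * S \<and> pos_semidef_mat n1 (\<Lambda>f + mat_adjoint U * \<Theta>f * U)"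
proof -
  define W where "W = WB * mat_adjoint S"
  have W: "W \<in> carrier_mat k d" using WB carriers(4) by (simp add: W_def)
  define W1 where "W1 = Matrix.mat k n1 (\<lambda>(i, j). W $$ (i, j))"
  define W2 where "W2 = Matrix.mat k n2 (\<lambda>(i, j). W $$ (i, j + n1))"
  have W12: "W1 \<in> carrier_mat k n1" "W2 \<in> carrier_mat k n2" by (simp_all add: W1_def W2_def)
  have W_append: "W = append_cols W1 W2"
    using W unfolding append_cols_def W1_def W2_def by (intro eq_matI) (auto simp: d)
  have form: "0 \<le> re ((\<Lambda>f *\<^sub>v v) \<bullet>c v) + re ((\<Theta>f *\<^sub>v w) \<bullet>c w)"
    if v: "v \<in> carrier_vec n1" and w: "w \<in> carrier_vec n2" and 0: "W1 *\<^sub>v v + W2 *\<^sub>v w = 0\<^sub>v k" for v w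
  proof -
    have vw: "v @\<^sub>v w \<in> carrier_vec d" using v w by (simp add: d)
    have "WB *\<^sub>v (mat_adjoint S *\<^sub>v (v @\<^sub>v w)) = W *\<^sub>v (v @\<^sub>v w)"
      unfolding W_def using WB carriers(4) vw by simp
    also have "\<dots> = 0\<^sub>v k" unfolding W_append using append_cols_mult_vec[OF W12 v w] 0 by simp
    finally have "0 \<le> re ((P1 *\<^sub>v (mat_adjoint S *\<^sub>v (v @\<^sub>v w))) \<bullet>c (mat_adjoint S *\<^sub>v (v @\<^sub>v w)))"
      using carriers(4) vw by (intro nonneg) auto
    then show ?thesis unfolding P1_form[OF v w] by (simp add: re_add)
  qed
  have inj: "w = 0\<^sub>v n2" if w: "w \<in> carrier_vec n2" and 0: "W2 *\<^sub>v w = 0\<^sub>v k" for w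
  proof (rule ccontr)
    assume "w \<noteq> 0\<^sub>v n2"
    have "W1 *\<^sub>v 0\<^sub>v n1 = 0\<^sub>v k" using W12(1) by (intro eq_vecI) (auto simp: W1_def)
    then have "0 \<le> re ((\<Lambda>f *\<^sub>v 0\<^sub>v n1) \<bullet>c 0\<^sub>v n1) + re ((\<Theta>f *\<^sub>v w) \<bullet>c w)"
      using w 0 by (intro form) auto
    moreover have "(\<Lambda>f *\<^sub>v 0\<^sub>v n1) \<bullet>c 0\<^sub>v n1 = of_real 0"
      using diagonal_form(1)[OF \<Lambda>(1,2), of "0\<^sub>v n1"] by simp
    ultimately show False using \<Theta>_form[OF w \<open>w \<noteq> 0\<^sub>v n2\<close>] by (simp only: re_of_real)
  qed
  show k: "k = n2"
    using wide_mat_kernel[OF W12(2)] inj \<open>k \<le> n2\<close> by (metis le_neq_implies_less)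
  note W12 = W12[unfolded k]
  have "det W2 \<noteq> 0"
    using inj k det_0_iff_vec_prod_zero[OF W12(2)] by auto
  then have "invertible_mat W2" using invertible_mat_iff_det[OF W12(2)] by simp
  then obtain V where Vc: "V \<in> carrier_mat n2 n2" and W2V: "W2 * V = 1\<^sub>m n2"
    using invertible_mat_iff_det[OF W12(2)] by blast
  define U where "U = V * W1"
  have U: "U \<in> carrier_mat n2 n1" using Vc W12 by (simp add: U_def)
  have W2U: "W2 * U = W1" unfolding U_def
    using W12 Vc W2V assoc_mult_mat[of W2 n2 n2 V n2 W1 n1] by simp
  have "W2 * append_cols U (1\<^sub>m n2) = append_cols W1 W2"
  proof (rule eq_matI)
    have c: "append_cols U (1\<^sub>m n2) \<in> carrier_mat n2 (n1 + n2)" "append_cols W1 W2 \<in> carrier_mat n2 (n1 + n2)"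
      using append_cols_carrier[OF U, of "1\<^sub>m n2" n2] append_cols_carrier[OF W12] by auto
    then show "dim_row (W2 * append_cols U (1\<^sub>m n2)) = dim_row (append_cols W1 W2)"
      "dim_col (W2 * append_cols U (1\<^sub>m n2)) = dim_col (append_cols W1 W2)" using W12 by auto
    fix i j assume "i < dim_row (append_cols W1 W2)" "j < dim_col (append_cols W1 W2)"
    then have i: "i < n2" and j: "j < n1 + n2" using c by auto
    have "col (append_cols U (1\<^sub>m n2)) j = (if j < n1 then col U j else col (1\<^sub>m n2) (j - n1))"
      using U j unfolding append_cols_def by (intro eq_vecI) (auto simp: four_block_mat_def)
    then have "(W2 * append_cols U (1\<^sub>m n2)) $$ (i, j) = (if j < n1 then (W2 * U) $$ (i, j) else (W2 * 1\<^sub>m n2) $$ (i, j - n1))"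
      using i j c U W12 by auto
    also have "\<dots> = append_cols W1 W2 $$ (i, j)"
      using i j W12 unfolding W2U append_cols_def by (auto simp: right_mult_one_mat[OF W12(2)])
    finally show "(W2 * append_cols U (1\<^sub>m n2)) $$ (i, j) = append_cols W1 W2 $$ (i, j)" .
  qed
  then have "W2 * append_cols U (1\<^sub>m n2) * S = WB * mat_adjoint S * S" by (simp add: W_append[symmetric] W_def)
  also have "\<dots> = WB" using WB S carriers(4) unitary by (simp add: assoc_mult_mat[of _ k d _ d _ d])
  finally have WB_eq: "WB = W2 * append_cols U (1\<^sub>m n2) * S" ..
  let ?Q = "mat_adjoint U * \<Theta>f * U"
  have Q: "?Q \<in> carrier_mat n1 n1"
    by (rule mult_carrier_mat[OF mult_carrier_mat[OF mat_adjoint_carrier[OF U] carriers(2)] U])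
  have "mat_adjoint ?Q = mat_adjoint U * mat_adjoint (mat_adjoint U * \<Theta>f)"
    by (rule mat_adjoint_mult[OF mult_carrier_mat[OF mat_adjoint_carrier[OF U] carriers(2)] U])
  also have "mat_adjoint (mat_adjoint U * \<Theta>f) = mat_adjoint \<Theta>f * mat_adjoint (mat_adjoint U)"
    by (rule mat_adjoint_mult[OF mat_adjoint_carrier[OF U] carriers(2)])
  also have "\<dots> = \<Theta>f * U"
    using hermitian_diagonal[OF \<Theta>(1,2), where 'f = 'f] by (simp add: mat_adjoint_adjoint hermitian_mat_def)
  also have "mat_adjoint U * (\<Theta>f * U) = ?Q"
    by (rule assoc_mult_mat[OF mat_adjoint_carrier[OF U] carriers(2) U, symmetric])
  finally have "mat_adjoint ?Q = ?Q" .
  then have herm: "hermitian_mat n1 (\<Lambda>f + ?Q)"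
    using Q carriers hermitian_diagonal[OF \<Lambda>(1,2), where 'f = 'f]
    using mat_adjoint_add[OF carriers(1) Q] by (simp add: hermitian_mat_def)
  have "0 \<le> re (((\<Lambda>f + ?Q) *\<^sub>v v) \<bullet>c v)" if v: "v \<in> carrier_vec n1" for v
  proof -
    let ?w = "- (U *\<^sub>v v)"
    have Uv: "U *\<^sub>v v \<in> carrier_vec n2" using U v by simp
    have "W1 *\<^sub>v v = W2 *\<^sub>v (U *\<^sub>v v)" using W2U W12 U v by (metis assoc_mult_mat_vec)
    moreover have "W2 *\<^sub>v ?w = - (W2 *\<^sub>v (U *\<^sub>v v))"
      using W12 Uv by (intro eq_vecI) (auto simp: scalar_prod_def sum_negf)
    ultimately have "W1 *\<^sub>v v + W2 *\<^sub>v ?w = 0\<^sub>v k" using W12 Uv k by (intro eq_vecI) auto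
    then have "0 \<le> re ((\<Lambda>f *\<^sub>v v) \<bullet>c v) + re ((\<Theta>f *\<^sub>v ?w) \<bullet>c ?w)" using v Uv by (intro form) auto
    also have "(\<Theta>f *\<^sub>v ?w) \<bullet>c ?w = (\<Theta>f *\<^sub>v (U *\<^sub>v v)) \<bullet>c (U *\<^sub>v v)"
      unfolding diagonal_form(1)[OF \<Theta>(1,2) Uv] diagonal_form(1)[OF \<Theta>(1,2) uminus_carrier_vec[THEN iffD2, OF Uv]]
      by (intro arg_cong[of _ _ of_real] sum.cong) (use U in auto)
    also have "\<dots> = (?Q *\<^sub>v v) \<bullet>c v"
      by (rule congruence_form[OF U carriers(2) v, symmetric])
    also have "re ((\<Lambda>f *\<^sub>v v) \<bullet>c v) + re \<dots> = re (((\<Lambda>f + ?Q) *\<^sub>v v) \<bullet>c v)"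
      by (simp only: add_form[OF carriers(1) Q v] re_add)
    finally show ?thesis .
  qed
  then have "pos_semidef_mat n1 (\<Lambda>f + ?Q)"
    using herm re_nonneg_form_iff[OF herm] by (simp add: pos_semidef_mat_def)
  then show "\<exists>B U. B \<in> carrier_mat n2 n2 \<and> invertible_mat B \<and> U \<in> carrier_mat n2 n1 \<and>
      WB = B * append_cols U (1\<^sub>m n2) * S \<and> pos_semidef_mat n1 (\<Lambda>f + mat_adjoint U * \<Theta>f * U)"
    using W12(2) \<open>invertible_mat W2\<close> U WB_eq by blast
qed

text \<open>The kernel of \<open>W\<^sub>B\<close> is the graph of \<open>- U\<close> in the coordinates \<open>(v, w)\<close>.\<close>

lemma kernel_iff:
  assumes B: "B \<in> carrier_mat n2 n2" "invertible_mat B" and U: "U \<in> carrier_mat n2 n1"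
    and eq: "WB = B * append_cols U (1\<^sub>m n2) * S"
    and v: "v \<in> carrier_vec n1" and w: "w \<in> carrier_vec n2"
  shows "WB *\<^sub>v (mat_adjoint S *\<^sub>v (v @\<^sub>v w)) = 0\<^sub>v n2 \<longleftrightarrow> U *\<^sub>v v + w = 0\<^sub>v n2"
proof -
  have vw: "v @\<^sub>v w \<in> carrier_vec d" using v w by (simp add: d)
  have c: "append_cols U (1\<^sub>m n2) \<in> carrier_mat n2 d"
    using append_cols_carrier[OF U, of "1\<^sub>m n2" n2] by (simp add: d)
  have z: "U *\<^sub>v v + w \<in> carrier_vec n2" using U v w by simp
  have "WB *\<^sub>v (mat_adjoint S *\<^sub>v (v @\<^sub>v w)) = B *\<^sub>v (append_cols U (1\<^sub>m n2) *\<^sub>v (S *\<^sub>v (mat_adjoint S *\<^sub>v (v @\<^sub>v w))))"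
    unfolding eq by (rule mult_mat_vec3[OF B(1) c S mult_mat_vec_carrier[OF carriers(4) vw]])
  also have "\<dots> = B *\<^sub>v (U *\<^sub>v v + w)"
    using append_cols_mult_vec[OF U one_carrier_mat v w] w by (simp only: adjoint_S_cancel(2)[OF vw]) simp
  also have "\<dots> = 0\<^sub>v n2 \<longleftrightarrow> U *\<^sub>v v + w = 0\<^sub>v n2"
  proof
    assume "B *\<^sub>v (U *\<^sub>v v + w) = 0\<^sub>v n2"
    moreover have "det B \<noteq> 0" using B invertible_mat_iff_det by blast
    ultimately show "U *\<^sub>v v + w = 0\<^sub>v n2" using det_0_iff_vec_prod_zero[OF B(1)] z by blast
  next
    assume "U *\<^sub>v v + w = 0\<^sub>v n2"
    then show "B *\<^sub>v (U *\<^sub>v v + w) = 0\<^sub>v n2" using B by (simp only:) (intro eq_vecI, auto)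
  qed
  finally show ?thesis .
qed

lemma nonneg_form_of_boundary_matrix:
  assumes B: "B \<in> carrier_mat n2 n2" "invertible_mat B" and U: "U \<in> carrier_mat n2 n1"
    and eq: "WB = B * append_cols U (1\<^sub>m n2) * S"
    and pos: "pos_semidef_mat n1 (\<Lambda>f + mat_adjoint U * \<Theta>f * U)"
    and y: "y \<in> carrier_vec d" "WB *\<^sub>v y = 0\<^sub>v n2"
  shows "0 \<le> re ((P1 *\<^sub>v y) \<bullet>c y)"
proof -
  have "S *\<^sub>v y \<in> carrier_vec d" using S y by simp
  from vec_split[OF this] obtain v w where vw: "v \<in> carrier_vec n1" "w \<in> carrier_vec n2" "S *\<^sub>v y = v @\<^sub>v w" by blast
  have y_eq: "y = mat_adjoint S *\<^sub>v (v @\<^sub>v w)" using adjoint_S_cancel(1)[OF y(1)] vw(3) by simp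
  have Uv: "U *\<^sub>v v \<in> carrier_vec n2" using U vw by simp
  have 0: "U *\<^sub>v v + w = 0\<^sub>v n2" using kernel_iff[OF B U eq vw(1,2)] y(2) y_eq by simp
  have "w $ i = - (U *\<^sub>v v) $ i" if "i < n2" for i
  proof -
    have "(U *\<^sub>v v + w) $ i = 0" using 0 that by simp
    then show ?thesis using that vw Uv U by (simp add: add_eq_0_iff)
  qed
  then have "(\<Theta>f *\<^sub>v w) \<bullet>c w = (\<Theta>f *\<^sub>v (U *\<^sub>v v)) \<bullet>c (U *\<^sub>v v)"
    unfolding diagonal_form(1)[OF \<Theta>(1,2) vw(2)] diagonal_form(1)[OF \<Theta>(1,2) Uv]
    by (intro arg_cong[of _ _ of_real] sum.cong) (use U vw in auto)
  also have "\<dots> = ((mat_adjoint U * \<Theta>f * U) *\<^sub>v v) \<bullet>c v"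
    by (rule congruence_form[OF U carriers(2) vw(1), symmetric])
  finally have \<Theta>: "(\<Theta>f *\<^sub>v w) \<bullet>c w = ((mat_adjoint U * \<Theta>f * U) *\<^sub>v v) \<bullet>c v" .
  have Q: "mat_adjoint U * \<Theta>f * U \<in> carrier_mat n1 n1"
    by (rule mult_carrier_mat[OF mult_carrier_mat[OF mat_adjoint_carrier[OF U] carriers(2)] U])
  have "(P1 *\<^sub>v y) \<bullet>c y = ((\<Lambda>f + mat_adjoint U * \<Theta>f * U) *\<^sub>v v) \<bullet>c v"
    unfolding y_eq P1_form[OF vw(1,2)] \<Theta> add_form[OF carriers(1) Q vw(1)] ..
  moreover have "0 \<le> ((\<Lambda>f + mat_adjoint U * \<Theta>f * U) *\<^sub>v v) \<bullet>c v"
    using pos vw(1) unfolding pos_semidef_mat_def by blast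
  ultimately show ?thesis using nonneg_iff[of "(P1 *\<^sub>v y) \<bullet>c y"] by simp
qed

end

section \<open>The Sobolev space and the operators\<close>

text \<open>\<open>u\<close> is the continuous representative of \<open>x\<close>, and \<open>g\<close> its weak derivative.\<close>

definition sobolev_rep ::
    "nat \<Rightarrow> (real \<Rightarrow> 'f::real_or_complex vec) \<Rightarrow> (real \<Rightarrow> 'f vec) \<Rightarrow> (real \<Rightarrow> 'f vec) \<Rightarrow> bool" where
  "sobolev_rep d x u g \<longleftrightarrow> x \<in> L2 d \<and> g \<in> L2 d \<and> (\<forall>\<zeta>. u \<zeta> \<in> carrier_vec d) \<and>
    (\<forall>i<d. primitive (\<lambda>\<zeta>. u \<zeta> $ i) (\<lambda>\<zeta>. g \<zeta> $ i) \<and> (AE \<zeta> in half_line. x \<zeta> $ i = u \<zeta> $ i))"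

lemma sobolev_repD:
  assumes "sobolev_rep d x u g"
  shows "x \<in> L2 d" "g \<in> L2 d" "u \<zeta> \<in> carrier_vec d"
    "i < d \<Longrightarrow> primitive (\<lambda>\<zeta>. u \<zeta> $ i) (\<lambda>\<zeta>. g \<zeta> $ i)"
    "i < d \<Longrightarrow> AE \<zeta> in half_line. x \<zeta> $ i = u \<zeta> $ i"
  using assms by (auto simp: sobolev_rep_def)

lemma is_weak_deriv_imp_rep:
  assumes x: "x \<in> L2 d" and g: "g \<in> L2 d" and weak: "is_weak_deriv d x g"
  obtains u where "sobolev_rep d x u g"
proof -
  have "\<forall>i\<in>{..<d}. \<exists>u. primitive u (\<lambda>\<zeta>. g \<zeta> $ i) \<and> (AE \<zeta> in half_line. x \<zeta> $ i = u \<zeta>)"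
  proof
    fix i assume "i \<in> {..<d}"
    then have i: "i < d" by simp
    have "(LINT \<zeta>|half_line. \<phi>' \<zeta> *\<^sub>R (x \<zeta> $ i)) = - (LINT \<zeta>|half_line. \<phi> \<zeta> *\<^sub>R (g \<zeta> $ i))"
      if "test_function \<phi> \<phi>'" for \<phi> \<phi>'
      using weak i that unfolding is_weak_deriv_def by blast
    from weak_derivative_primitive[OF sq_integrable_Icc[OF L2_component[OF x i]]
        sq_integrable_Icc[OF L2_component[OF g i]] this]
    show "\<exists>u. primitive u (\<lambda>\<zeta>. g \<zeta> $ i) \<and> (AE \<zeta> in half_line. x \<zeta> $ i = u \<zeta>)"
      by blast
  qed
  from bchoice[OF this] obtain u where
    u: "\<And>i. i < d \<Longrightarrow> primitive (u i) (\<lambda>\<zeta>. g \<zeta> $ i) \<and> (AE \<zeta> in half_line. x \<zeta> $ i = u i \<zeta>)"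
    by auto
  have "sobolev_rep d x (\<lambda>\<zeta>. Matrix.vec d (\<lambda>i. u i \<zeta>)) g"
    using x g u by (simp add: sobolev_rep_def)
  then show ?thesis by (rule that)
qed

lemma rep_imp_is_weak_deriv:
  assumes "sobolev_rep d x u g"
  shows "is_weak_deriv d x g"
  unfolding is_weak_deriv_def
proof (intro allI impI)
  fix \<phi> \<phi>' i assume \<phi>: "test_function \<phi> \<phi>'" and i: "i < d"
  note rep = sobolev_repD[OF assms]
  have "(LINT \<zeta>|half_line. \<phi>' \<zeta> *\<^sub>R (x \<zeta> $ i)) = (LINT \<zeta>|half_line. \<phi>' \<zeta> *\<^sub>R (u \<zeta> $ i))"
  proof (rule integral_cong_AE)
    have u: "integrable (lebesgue_on {0..b}) (\<lambda>\<zeta>. u \<zeta> $ i)" for b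
      by (rule continuous_imp_integrable_real[OF primitive_continuous_Icc[OF rep(4)[OF i]]])
    show "(\<lambda>\<zeta>. \<phi>' \<zeta> *\<^sub>R (x \<zeta> $ i)) \<in> borel_measurable half_line"
      by (rule borel_measurable_integrable[OF test_function_integrable(2)[OF \<phi>]])
        (rule sq_integrable_Icc[OF L2_component[OF rep(1) i]])
    show "(\<lambda>\<zeta>. \<phi>' \<zeta> *\<^sub>R (u \<zeta> $ i)) \<in> borel_measurable half_line"
      by (rule borel_measurable_integrable[OF test_function_integrable(2)[OF \<phi> u]])
  qed (use rep(5)[OF i] in \<open>auto elim!: eventually_mono\<close>)
  then show "(LINT \<zeta>|half_line. \<phi>' \<zeta> *\<^sub>R (x \<zeta> $ i)) = - (LINT \<zeta>|half_line. \<phi> \<zeta> *\<^sub>R (g \<zeta> $ i))"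
    using primitive_weak_derivative[OF rep(4)[OF i] \<phi>] by simp
qed

lemma W12_rep: "x \<in> W12 d \<Longrightarrow> \<exists>u g. sobolev_rep d x u g"
  unfolding W12_def using is_weak_deriv_imp_rep by blast

lemma rep_W12: "sobolev_rep d x u g \<Longrightarrow> x \<in> W12 d"
  unfolding W12_def using rep_imp_is_weak_deriv sobolev_repD by blast

lemma AE_vecI:
  assumes "\<And>\<zeta>. 0 \<le> \<zeta> \<Longrightarrow> x \<zeta> \<in> carrier_vec d" "\<And>\<zeta>. 0 \<le> \<zeta> \<Longrightarrow> z \<zeta> \<in> carrier_vec d"
    and "\<And>i. i < d \<Longrightarrow> AE \<zeta> in half_line. x \<zeta> $ i = z \<zeta> $ i"
  shows "ae_eq x z"
proof -
  have "AE \<zeta> in half_line. \<forall>i\<in>{..<d}. x \<zeta> $ i = z \<zeta> $ i"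
    using assms(3) by (subst AE_ball_countable) auto
  then show ?thesis
    unfolding ae_eq_def using AE_half_line_nonneg
  proof eventually_elim
    case (elim \<zeta>)
    with assms(1,2)[of \<zeta>] show ?case by (intro eq_vecI) auto
  qed
qed

lemma rep_ae_eq: "sobolev_rep d x u g \<Longrightarrow> ae_eq x u"
  by (rule AE_vecI) (auto dest: sobolev_repD intro: L2_carrier[OF sobolev_repD(1)])

lemma rep_weak_deriv:
  assumes rep: "sobolev_rep d x u g"
  shows "weak_deriv d x \<in> L2 d" "ae_eq (weak_deriv d x) g"
proof -
  have "weak_deriv d x \<in> L2 d \<and> is_weak_deriv d x (weak_deriv d x)"
    unfolding weak_deriv_def
    by (rule someI[of "\<lambda>g. g \<in> L2 d \<and> is_weak_deriv d x g" g]) (use rep_imp_is_weak_deriv[OF rep] sobolev_repD[OF rep] in blast)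
  then have wd: "weak_deriv d x \<in> L2 d" and "is_weak_deriv d x (weak_deriv d x)" by auto
  then show "weak_deriv d x \<in> L2 d" by simp
  obtain v where v: "sobolev_rep d x v (weak_deriv d x)"
    using is_weak_deriv_imp_rep[OF sobolev_repD(1)[OF rep] wd \<open>is_weak_deriv d x (weak_deriv d x)\<close>] by blast
  show "ae_eq (weak_deriv d x) g"
  proof (rule AE_vecI)
    fix i assume i: "i < d"
    have "AE \<zeta> in half_line. v \<zeta> $ i = u \<zeta> $ i"
      using sobolev_repD(5)[OF rep i] sobolev_repD(5)[OF v i] by eventually_elim simp
    then show "AE \<zeta> in half_line. weak_deriv d x \<zeta> $ i = g \<zeta> $ i"
      by (rule primitive_AE_deriv[OF sobolev_repD(4)[OF v i] sobolev_repD(4)[OF rep i]])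
  qed (rule L2_carrier[OF wd] L2_carrier[OF sobolev_repD(2)[OF rep]]; assumption)+
qed

lemma rep_trace0:
  assumes rep: "sobolev_rep d x u g"
  shows "trace0 d x = u 0"
proof (rule eq_vecI)
  fix i assume "i < dim_vec (u 0)"
  then have i: "i < d" using sobolev_repD(3)[OF rep, of 0] by simp
  have cont: "continuous_on {0..} (\<lambda>\<zeta>. u \<zeta> $ i)"
    by (rule primitive_continuous[OF sobolev_repD(4)[OF rep i]])
  have "(THE c. \<exists>v. continuous_on {0..} v \<and> (AE \<zeta> in half_line. x \<zeta> $ i = v \<zeta>) \<and> v 0 = c) = u 0 $ i"
  proof (rule the_equality)
    show "\<exists>v. continuous_on {0..} v \<and> (AE \<zeta> in half_line. x \<zeta> $ i = v \<zeta>) \<and> v 0 = u 0 $ i"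
      using cont sobolev_repD(5)[OF rep i] by blast
    fix c assume "\<exists>v. continuous_on {0..} v \<and> (AE \<zeta> in half_line. x \<zeta> $ i = v \<zeta>) \<and> v 0 = c"
    then obtain v where v: "continuous_on {0..} v" "AE \<zeta> in half_line. x \<zeta> $ i = v \<zeta>" "v 0 = c" by blast
    have "AE \<zeta> in half_line. v \<zeta> - u \<zeta> $ i = 0"
      using v(2) sobolev_repD(5)[OF rep i] by eventually_elim simp
    from continuous_AE_zero[OF continuous_on_diff[OF v(1) cont] this, of 0] show "c = u 0 $ i"
      using v(3) by simp
  qed
  then show "trace0 d x $ i = u 0 $ i" using i by (simp add: trace0_def)
qed (use sobolev_repD(3)[OF rep, of 0] in \<open>simp add: trace0_def\<close>)

lemma rep_cong:
  assumes rep: "sobolev_rep d x u g" and z: "z \<in> L2 d" "ae_eq z x"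
  shows "sobolev_rep d z u g"
  unfolding sobolev_rep_def
proof (intro conjI allI impI)
  fix i assume i: "i < d"
  show "AE \<zeta> in half_line. z \<zeta> $ i = u \<zeta> $ i"
    using z(2) sobolev_repD(5)[OF rep i] unfolding ae_eq_def by eventually_elim simp
qed (use z sobolev_repD[OF rep] in auto)

lemma primitive_linear:
  assumes L: "bounded_linear L" and u: "primitive u g"
  shows "primitive (\<lambda>x. L (u x)) (\<lambda>x. L (g x))"
proof -
  interpret L: bounded_linear L by fact
  show ?thesis
    unfolding primitive_def
  proof (intro allI impI conjI)
    fix b :: real assume "0 \<le> b"
    note int = primitive_integrable[OF u, of b]
    show "integrable (lebesgue_on {0..b}) (\<lambda>x. L (g x))" by (rule integrable_bounded_linear[OF L int])
    show "L (u b) = L (u 0) + (LINT s|lebesgue_on {0..b}. L (g s))"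
      using primitive_eq[OF u \<open>0 \<le> b\<close>] by (simp add: integral_bounded_linear[OF L int] L.add)
  qed
qed

lemma primitive_add: "primitive u g \<Longrightarrow> primitive v h \<Longrightarrow> primitive (\<lambda>x. u x + v x) (\<lambda>x. g x + h x)"
  for u v :: "real \<Rightarrow> 'a::euclidean_space"
proof -
  assume u: "primitive u g" and v: "primitive v h"
  show ?thesis
    unfolding primitive_def
  proof (intro allI impI conjI)
    fix b :: real assume b: "0 \<le> b"
    note int = primitive_integrable[OF u, of b] primitive_integrable[OF v, of b]
    show "integrable (lebesgue_on {0..b}) (\<lambda>x. g x + h x)" by (intro Bochner_Integration.integrable_add int)
    show "u b + v b = u 0 + v 0 + (LINT s|lebesgue_on {0..b}. g s + h s)"
      unfolding Bochner_Integration.integral_add[OF int]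
      using primitive_eq[OF u b] primitive_eq[OF v b] by (simp only: ac_simps)
  qed
qed

lemma primitive_sum:
  assumes "finite I" "\<And>i. i \<in> I \<Longrightarrow> primitive (u i) (g i)"
  shows "primitive (\<lambda>x. \<Sum>i\<in>I. u i x) (\<lambda>x. \<Sum>i\<in>I. g i x)"
  using assms
proof (induction I rule: finite_induct)
  case empty
  then show ?case by (simp add: primitive_def)
next
  case (insert j I)
  then show ?case using primitive_add[of "u j" "g j" "\<lambda>x. \<Sum>i\<in>I. u i x" "\<lambda>x. \<Sum>i\<in>I. g i x"] by simp
qed

lemma primitive_cong: "primitive u g \<Longrightarrow> (\<And>x. 0 \<le> x \<Longrightarrow> u x = u' x) \<Longrightarrow> (\<And>x. 0 \<le> x \<Longrightarrow> g x = g' x) \<Longrightarrow> primitive u' g'"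
proof -
  assume u: "primitive u g" and eq: "\<And>x. 0 \<le> x \<Longrightarrow> u x = u' x" "\<And>x. 0 \<le> x \<Longrightarrow> g x = g' x"
  have "integrable (lebesgue_on {0..b}) g = integrable (lebesgue_on {0..b}) g'" for b
    by (rule Bochner_Integration.integrable_cong) (auto simp: space_restrict_space eq)
  moreover have "(LINT x|lebesgue_on {0..b}. g x) = (LINT x|lebesgue_on {0..b}. g' x)" for b
    by (rule Bochner_Integration.integral_cong) (auto simp: space_restrict_space eq)
  ultimately have g': "integrable (lebesgue_on {0..b}) g'"
      "(LINT x|lebesgue_on {0..b}. g' x) = (LINT x|lebesgue_on {0..b}. g x)" for b
    using primitive_integrable[OF u] by auto
  show ?thesis
    unfolding primitive_def
  proof (intro allI impI conjI g'(1))
    fix b :: real assume b: "0 \<le> b"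
    have "u' b = u 0 + (LINT x|lebesgue_on {0..b}. g x)"
      using primitive_eq[OF u b] eq(1)[OF b] by (rule subst[rotated])
    then show "u' b = u' 0 + (LINT x|lebesgue_on {0..b}. g' x)"
      by (simp only: g'(2) eq(1)[OF order_refl])
  qed
qed

lemma rep_lincomb:
  assumes x: "sobolev_rep d x u g" and z: "sobolev_rep d z v h"
  shows "sobolev_rep d (\<lambda>\<zeta>. a \<cdot>\<^sub>v x \<zeta> + z \<zeta>) (\<lambda>\<zeta>. a \<cdot>\<^sub>v u \<zeta> + v \<zeta>) (\<lambda>\<zeta>. a \<cdot>\<^sub>v g \<zeta> + h \<zeta>)"
proof -
  note X = sobolev_repD[OF x] and Z = sobolev_repD[OF z]
  show ?thesis
    unfolding sobolev_rep_def
  proof (intro conjI allI impI)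
    show "(\<lambda>\<zeta>. a \<cdot>\<^sub>v x \<zeta> + z \<zeta>) \<in> L2 d" "(\<lambda>\<zeta>. a \<cdot>\<^sub>v g \<zeta> + h \<zeta>) \<in> L2 d"
      by (intro L2_add L2_smult X Z)+
    show "a \<cdot>\<^sub>v u \<zeta> + v \<zeta> \<in> carrier_vec d" for \<zeta> using X(3) Z(3) by simp
    fix i assume i: "i < d"
    have "primitive (\<lambda>\<zeta>. a * u \<zeta> $ i + v \<zeta> $ i) (\<lambda>\<zeta>. a * g \<zeta> $ i + h \<zeta> $ i)"
      by (intro primitive_add primitive_linear[OF bounded_linear_mult_right] X(4) Z(4) i)
    then show "primitive (\<lambda>\<zeta>. (a \<cdot>\<^sub>v u \<zeta> + v \<zeta>) $ i) (\<lambda>\<zeta>. (a \<cdot>\<^sub>v g \<zeta> + h \<zeta>) $ i)"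
      by (rule primitive_cong)
        (use i carrier_vecD[OF X(3)] carrier_vecD[OF Z(3)] L2_dim[OF X(2)] L2_dim[OF Z(2)] in auto)
    show "AE \<zeta> in half_line. (a \<cdot>\<^sub>v x \<zeta> + z \<zeta>) $ i = (a \<cdot>\<^sub>v u \<zeta> + v \<zeta>) $ i"
      using X(5)[OF i] Z(5)[OF i] AE_half_line_nonneg
    proof eventually_elim
      case (elim \<zeta>)
      then show ?case using i carrier_vecD[OF X(3)] carrier_vecD[OF Z(3)] L2_dim[OF X(1)] L2_dim[OF Z(1)] by simp
    qed
  qed
qed

lemma Linf_const: "M \<in> carrier_mat d d \<Longrightarrow> Linf_mat d (\<lambda>_. M)"
  unfolding Linf_mat_def by auto

lemma mult_op_component:
  assumes "Linf_mat d M" "x \<in> L2 d" "0 \<le> \<zeta>" "i < d"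
  shows "mult_op M x \<zeta> $ i = (\<Sum>j<d. M \<zeta> $$ (i, j) * x \<zeta> $ j)"
proof -
  have "M \<zeta> \<in> carrier_mat d d" "x \<zeta> \<in> carrier_vec d"
    using assms L2_carrier by (auto simp: Linf_mat_def)
  then show ?thesis using assms(4)
    by (auto simp: mult_op_def scalar_prod_def atLeast0LessThan intro!: sum.cong)
qed

lemma sq_integrable_sum:
  assumes "finite I" "\<And>i. i \<in> I \<Longrightarrow> sq_integrable M (f i)"
  shows "sq_integrable M (\<lambda>x. \<Sum>i\<in>I. f i x)"
  using assms by (induction I rule: finite_induct) (auto simp: sq_integrable_0 sq_integrable_add)

lemma Linf_bound:
  assumes "Linf_mat d M"
  shows "\<exists>C\<ge>0. \<forall>i<d. \<forall>j<d. AE \<zeta> in half_line. norm (M \<zeta> $$ (i, j)) \<le> C"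
proof -
  have "\<forall>p\<in>{..<d}\<times>{..<d}. \<exists>C. AE \<zeta> in half_line. norm (M \<zeta> $$ p) \<le> C"
    using assms by (auto simp: Linf_mat_def)
  from bchoice[OF this] obtain c where c: "\<And>p. p \<in> {..<d}\<times>{..<d} \<Longrightarrow> AE \<zeta> in half_line. norm (M \<zeta> $$ p) \<le> c p"
    by blast
  define C where "C = (\<Sum>p\<in>{..<d}\<times>{..<d}. \<bar>c p\<bar>)"
  have "AE \<zeta> in half_line. norm (M \<zeta> $$ (i, j)) \<le> C" if "i < d" "j < d" for i j
  proof -
    have "\<bar>c (i, j)\<bar> \<le> C" unfolding C_def using that by (intro member_le_sum) auto
    with c[of "(i, j)"] that show ?thesis by (auto elim!: eventually_mono)
  qed
  moreover have "0 \<le> C" by (simp add: C_def sum_nonneg)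
  ultimately show ?thesis by blast
qed

lemma mult_op_entry:
  assumes M: "Linf_mat d M" and x: "x \<in> L2 d" and ij: "i < d" "j < d"
    and C: "AE \<zeta> in half_line. norm (M \<zeta> $$ (i, j)) \<le> C"
  shows "sq_integrable half_line (\<lambda>\<zeta>. M \<zeta> $$ (i, j) * x \<zeta> $ j)"
    and "(LINT \<zeta>|half_line. (norm (M \<zeta> $$ (i, j) * x \<zeta> $ j))\<^sup>2) \<le> C\<^sup>2 * (LINT \<zeta>|half_line. (norm (x \<zeta> $ j))\<^sup>2)"
proof -
  have bound: "AE \<zeta> in half_line. (norm (M \<zeta> $$ (i, j) * x \<zeta> $ j))\<^sup>2 \<le> C\<^sup>2 * (norm (x \<zeta> $ j))\<^sup>2"
    using C
  proof eventually_elim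
    case (elim \<zeta>)
    then have "norm (M \<zeta> $$ (i, j)) ^ 2 \<le> C ^ 2" by (intro power_mono) auto
    then show ?case by (simp add: norm_mult power_mult_distrib mult_right_mono)
  qed
  note xj = L2_component[OF x ij(2)]
  have meas: "(\<lambda>\<zeta>. M \<zeta> $$ (i, j) * x \<zeta> $ j) \<in> borel_measurable half_line"
    using M ij xj unfolding Linf_mat_def sq_integrable_def by (intro borel_measurable_times) auto
  show sq: "sq_integrable half_line (\<lambda>\<zeta>. M \<zeta> $$ (i, j) * x \<zeta> $ j)"
    by (rule sq_integrable_bound[OF xj xj meas, of "C\<^sup>2"])
      (use bound in \<open>auto elim!: eventually_mono intro: order_trans simp: distrib_left\<close>)
  have "(LINT \<zeta>|half_line. (norm (M \<zeta> $$ (i, j) * x \<zeta> $ j))\<^sup>2) \<le> (LINT \<zeta>|half_line. C\<^sup>2 * (norm (x \<zeta> $ j))\<^sup>2)"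
    by (intro integral_mono_AE sq_integrable_norm[OF sq] integrable_mult_right sq_integrable_norm[OF xj] bound)
  then show "(LINT \<zeta>|half_line. (norm (M \<zeta> $$ (i, j) * x \<zeta> $ j))\<^sup>2) \<le> C\<^sup>2 * (LINT \<zeta>|half_line. (norm (x \<zeta> $ j))\<^sup>2)"
    by simp
qed

lemma mult_op_L2:
  assumes M: "Linf_mat d M" and x: "x \<in> L2 d"
  shows "mult_op M x \<in> L2 d"
proof (rule L2I)
  fix \<zeta> :: real assume "0 \<le> \<zeta>"
  then show "mult_op M x \<zeta> \<in> carrier_vec d"
    using M L2_carrier[OF x] by (auto simp: mult_op_def Linf_mat_def)
next
  fix i assume i: "i < d"
  obtain C where "\<forall>i<d. \<forall>j<d. AE \<zeta> in half_line. norm (M \<zeta> $$ (i, j)) \<le> C"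
    using Linf_bound[OF M] by blast
  then have "sq_integrable half_line (\<lambda>\<zeta>. \<Sum>j<d. M \<zeta> $$ (i, j) * x \<zeta> $ j)"
    using i by (intro sq_integrable_sum mult_op_entry(1)[OF M x]) auto
  then show "sq_integrable half_line (\<lambda>\<zeta>. mult_op M x \<zeta> $ i)"
    using mult_op_component[OF M x _ i] by (simp cong: sq_integrable_cong_half_line)
qed

lemma mult_op_bounded:
  assumes M: "Linf_mat d M"
  obtains K where "\<And>x. x \<in> L2 d \<Longrightarrow> norm (embed d (mult_op M x)) \<le> norm (embed d x) * K"
proof -
  obtain C where "0 \<le> C" and C': "\<forall>i<d. \<forall>j<d. AE \<zeta> in half_line. norm (M \<zeta> $$ (i, j)) \<le> C"
    using Linf_bound[OF M] by blast
  then have C: "0 \<le> C" "i < d \<Longrightarrow> j < d \<Longrightarrow> AE \<zeta> in half_line. norm (M \<zeta> $$ (i, j)) \<le> C" for i j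
    by simp_all
  have "norm (embed d (mult_op M x)) \<le> norm (embed d x) * (real d * C)" if x: "x \<in> L2 d" for x
  proof -
    have "(norm (embed d (mult_op M x)))\<^sup>2 \<le> (\<Sum>i<d. real d * C\<^sup>2 * (norm (embed d x))\<^sup>2)"
      unfolding norm_embed[OF mult_op_L2[OF M x]]
    proof (rule sum_mono)
      fix i assume "i \<in> {..<d}"
      then have i: "i < d" by simp
      note sq = mult_op_entry(1)[OF M x i _ C(2)]
      have "(LINT \<zeta>|half_line. (norm (mult_op M x \<zeta> $ i))\<^sup>2)
          \<le> (LINT \<zeta>|half_line. (\<Sum>j<d. real d * (norm (M \<zeta> $$ (i, j) * x \<zeta> $ j))\<^sup>2))"
      proof (rule integral_mono)
        show "integrable half_line (\<lambda>\<zeta>. (norm (mult_op M x \<zeta> $ i))\<^sup>2)"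
          by (rule sq_integrable_norm[OF L2_component[OF mult_op_L2[OF M x] i]])
        show "integrable half_line (\<lambda>\<zeta>. \<Sum>j<d. real d * (norm (M \<zeta> $$ (i, j) * x \<zeta> $ j))\<^sup>2)"
          using i by (intro Bochner_Integration.integrable_sum integrable_mult_right sq_integrable_norm sq) auto
        fix \<zeta> :: real assume "\<zeta> \<in> space half_line"
        then have "0 \<le> \<zeta>" by (simp add: space_restrict_space)
        let ?f = "\<lambda>j. norm (M \<zeta> $$ (i, j) * x \<zeta> $ j)"
        have "(norm (mult_op M x \<zeta> $ i))\<^sup>2 \<le> (\<Sum>j<d. ?f j)\<^sup>2"
          unfolding mult_op_component[OF M x \<open>0 \<le> \<zeta>\<close> i] by (intro power_mono norm_sum) simp
        also have "\<dots> \<le> (\<Sum>j<d. (?f j)\<^sup>2) * real d"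
          using sum_squared_le_sum_of_squares[of ?f "{..<d}"] by (simp add: mult.commute)
        finally show "(norm (mult_op M x \<zeta> $ i))\<^sup>2 \<le> (\<Sum>j<d. real d * (?f j)\<^sup>2)"
          by (simp add: sum_distrib_left mult.commute)
      qed
      also have "\<dots> = (\<Sum>j<d. real d * (LINT \<zeta>|half_line. (norm (M \<zeta> $$ (i, j) * x \<zeta> $ j))\<^sup>2))"
        using i by (subst Bochner_Integration.integral_sum) (auto intro!: sq_integrable_norm sq)
      also have "\<dots> \<le> (\<Sum>j<d. real d * (C\<^sup>2 * (LINT \<zeta>|half_line. (norm (x \<zeta> $ j))\<^sup>2)))"
        using i by (intro sum_mono mult_left_mono mult_op_entry(2)[OF M x i _ C(2)]) auto
      also have "\<dots> = real d * C\<^sup>2 * (norm (embed d x))\<^sup>2"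
        by (simp add: norm_embed[OF x] sum_distrib_left mult.assoc)
      finally show "(LINT \<zeta>|half_line. (norm (mult_op M x \<zeta> $ i))\<^sup>2) \<le> real d * C\<^sup>2 * (norm (embed d x))\<^sup>2" .
    qed
    also have "\<dots> = (norm (embed d x) * (real d * C))\<^sup>2" by (simp add: power_mult_distrib power2_eq_square)
    finally show ?thesis by (rule power2_le_imp_le) (use C(1) in simp)
  qed
  then show ?thesis by (rule that)
qed

lemma re_L2_inner_form:
  assumes "x \<in> L2 d" "z \<in> L2 d"
  shows "re (L2_inner x z) = (LINT \<zeta>|half_line. re (x \<zeta> \<bullet>c z \<zeta>))" "integrable half_line (\<lambda>\<zeta>. re (x \<zeta> \<bullet>c z \<zeta>))"
proof -
  have int: "integrable half_line (\<lambda>\<zeta>. \<Sum>i<d. inner (x \<zeta> $ i) (z \<zeta> $ i))"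
    using assms by (intro Bochner_Integration.integrable_sum integrable_inner L2_component) auto
  have eq: "(\<Sum>i<d. inner (x \<zeta> $ i) (z \<zeta> $ i)) = re (x \<zeta> \<bullet>c z \<zeta>)" if "\<zeta> \<in> space half_line" for \<zeta>
    using that assms by (intro re_scalar_prod[symmetric]) (auto simp: space_restrict_space dest: L2_carrier)
  have "re (L2_inner x z) = (LINT \<zeta>|half_line. (\<Sum>i<d. inner (x \<zeta> $ i) (z \<zeta> $ i)))"
    unfolding re_L2_inner[OF assms] using assms
    by (intro Bochner_Integration.integral_sum[symmetric] integrable_inner L2_component) auto
  also have "\<dots> = (LINT \<zeta>|half_line. re (x \<zeta> \<bullet>c z \<zeta>))"
    by (rule Bochner_Integration.integral_cong) (auto simp: eq)
  finally show "re (L2_inner x z) = (LINT \<zeta>|half_line. re (x \<zeta> \<bullet>c z \<zeta>))" .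
  show "integrable half_line (\<lambda>\<zeta>. re (x \<zeta> \<bullet>c z \<zeta>))"
    using int by (rule Bochner_Integration.integrable_cong[THEN iffD1, rotated -1]) (auto simp: eq)
qed

lemma re_L2_inner_cong:
  assumes "x \<in> L2 d" "z \<in> L2 d" "x' \<in> L2 d" "z' \<in> L2 d" "ae_eq x x'" "ae_eq z z'"
  shows "re (L2_inner x z) = re (L2_inner x' z')"
  using assms embed_eq_iff[of x d x'] embed_eq_iff[of z d z'] inner_embed[of x d z] inner_embed[of x' d z'] by simp

lemma re_form_mult:
  assumes "P \<in> carrier_mat d d" "v \<in> carrier_vec d" "w \<in> carrier_vec d"
  shows "re ((P *\<^sub>v v) \<bullet>c w) = (\<Sum>i<d. \<Sum>j<d. inner (P $$ (i, j) * v $ j) (w $ i :: 'f::real_or_complex))"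
proof -
  have "re ((P *\<^sub>v v) \<bullet>c w) = (\<Sum>i<d. inner ((P *\<^sub>v v) $ i) (w $ i))"
    using assms by (intro re_scalar_prod) auto
  also have "\<dots> = (\<Sum>i<d. \<Sum>j<d. inner (P $$ (i, j) * v $ j) (w $ i))"
    using assms by (intro sum.cong refl) (auto simp: scalar_prod_def atLeast0LessThan inner_sum_left intro!: sum.cong)
  finally show ?thesis .
qed

text \<open>The derivative of \<open>x\<^sup>* P x\<close> is \<open>2 Re x\<^sup>* P x'\<close>, so its integral is the boundary term.\<close>

lemma integration_by_parts_form:
  assumes rep: "sobolev_rep d x u g" and P: "hermitian_mat d P"
  shows "re (L2_inner (\<lambda>\<zeta>. P *\<^sub>v g \<zeta>) x) = - re ((P *\<^sub>v u 0) \<bullet>c u 0) / 2"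
proof -
  note rep' = sobolev_repD[OF rep]
  have Pc: "P \<in> carrier_mat d d" using P by (simp add: hermitian_mat_def)
  let ?q = "\<lambda>\<zeta>. re ((P *\<^sub>v u \<zeta>) \<bullet>c u \<zeta>)" and ?g = "\<lambda>\<zeta>. 2 * re ((P *\<^sub>v g \<zeta>) \<bullet>c u \<zeta>)"
  have "primitive (\<lambda>\<zeta>. \<Sum>i<d. \<Sum>j<d. inner (P $$ (i, j) * u \<zeta> $ j) (u \<zeta> $ i))
      (\<lambda>\<zeta>. \<Sum>i<d. \<Sum>j<d. inner (P $$ (i, j) * g \<zeta> $ j) (u \<zeta> $ i) + inner (P $$ (i, j) * u \<zeta> $ j) (g \<zeta> $ i))"
    by (intro primitive_sum primitive_prod[OF bounded_bilinear_inner] primitive_linear[OF bounded_linear_mult_right] rep'(4)) auto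
  then have prim: "primitive ?q ?g"
  proof (rule primitive_cong)
    fix \<zeta> :: real assume \<zeta>: "0 \<le> \<zeta>"
    have c: "g \<zeta> \<in> carrier_vec d" "u \<zeta> \<in> carrier_vec d" using rep' \<zeta> by (auto dest: L2_carrier)
    show "(\<Sum>i<d. \<Sum>j<d. inner (P $$ (i, j) * u \<zeta> $ j) (u \<zeta> $ i)) = ?q \<zeta>"
      by (rule re_form_mult[OF Pc c(2,2), symmetric])
    have "re ((P *\<^sub>v u \<zeta>) \<bullet>c g \<zeta>) = re ((P *\<^sub>v g \<zeta>) \<bullet>c u \<zeta>)"
    proof -
      have "(P *\<^sub>v u \<zeta>) \<bullet>c g \<zeta> = u \<zeta> \<bullet>c (P *\<^sub>v g \<zeta>)" by (rule hermitian_form[OF P c(2,1)])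
      also have "\<dots> = conjugate ((P *\<^sub>v g \<zeta>) \<bullet>c u \<zeta>)"
        by (rule scalar_prod_conjugate[symmetric]) (use c Pc in auto)
      finally show ?thesis by (simp only: re_conjugate)
    qed
    then show "(\<Sum>i<d. \<Sum>j<d. inner (P $$ (i, j) * g \<zeta> $ j) (u \<zeta> $ i) + inner (P $$ (i, j) * u \<zeta> $ j) (g \<zeta> $ i)) = ?g \<zeta>"
      using re_form_mult[OF Pc c] re_form_mult[OF Pc c(2,1)] by (simp add: sum.distrib)
  qed
  have u: "u \<in> L2 d"
  proof (rule L2I)
    fix i assume i: "i < d"
    have "(\<lambda>\<zeta>. u \<zeta> $ i) \<in> borel_measurable half_line"
      by (rule continuous_imp_measurable_on_sets_lebesgue[OF primitive_continuous[OF rep'(4)[OF i]]]) simp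
    then show "sq_integrable half_line (\<lambda>\<zeta>. u \<zeta> $ i)"
      using rep'(5)[OF i] by (intro sq_integrable_cong_AE[OF L2_component[OF rep'(1) i]]) (auto elim!: eventually_mono)
  qed (rule rep'(3))
  have Pu: "(\<lambda>\<zeta>. P *\<^sub>v u \<zeta>) \<in> L2 d" "(\<lambda>\<zeta>. P *\<^sub>v g \<zeta>) \<in> L2 d"
    using mult_op_L2[OF Linf_const[OF Pc] u] mult_op_L2[OF Linf_const[OF Pc] rep'(2)] by (simp_all add: mult_op_def)
  have "(LINT \<zeta>|half_line. ?g \<zeta>) = - ?q 0"
    by (rule primitive_boundary_term[OF prim]) (use re_L2_inner_form(2)[OF Pu(1) u] re_L2_inner_form(2)[OF Pu(2) u] in auto)
  then have "2 * re (L2_inner (\<lambda>\<zeta>. P *\<^sub>v g \<zeta>) u) = - ?q 0"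
    unfolding re_L2_inner_form(1)[OF Pu(2) u] by simp
  moreover have "re (L2_inner (\<lambda>\<zeta>. P *\<^sub>v g \<zeta>) x) = re (L2_inner (\<lambda>\<zeta>. P *\<^sub>v g \<zeta>) u)"
    by (rule re_L2_inner_cong[OF Pu(2) rep'(1) Pu(2) u _ rep_ae_eq[OF rep]]) (simp add: ae_eq_def)
  ultimately show ?thesis by simp
qed

section \<open>Exponentials and the resolvent equation\<close>

lemma exp_half_line:
  fixes c x :: real
  assumes "0 < c" "0 \<le> x"
  shows "integrable half_line (\<lambda>s. indicator {x..} s *\<^sub>R exp (- c * s))"
    and "(LINT s|half_line. indicator {x..} s *\<^sub>R exp (- c * s)) = exp (- c * x) / c"
proof -
  have int: "((\<lambda>s. exp (- c * s)) has_integral exp (- c * x) / c) {x..}"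
    using has_integral_exp_minus_to_infinity[OF assms(1), of x] by simp
  have "(\<lambda>s. exp (- c * s)) absolutely_integrable_on {x..}"
    by (rule nonnegative_absolutely_integrable_1) (use int in auto)
  then have int': "integrable (lebesgue_on {x..}) (\<lambda>s. exp (- c * s))"
    by (rule absolutely_integrable_imp_integrable) simp
  show "integrable half_line (\<lambda>s. indicator {x..} s *\<^sub>R exp (- c * s))"
    by (subst integrable_lebesgue_on_subset) (use int' assms in auto)
  have "(LINT s|half_line. indicator {x..} s *\<^sub>R exp (- c * s)) = (LINT s|lebesgue_on {x..}. exp (- c * s))"
    by (rule integral_lebesgue_on_subset) (use assms in auto)
  also have "\<dots> = integral {x..} (\<lambda>s. exp (- c * s))"
    by (rule lebesgue_integral_eq_integral[OF int']) simp
  finally show "(LINT s|half_line. indicator {x..} s *\<^sub>R exp (- c * s)) = exp (- c * x) / c"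
    using int by (simp add: integral_unique)
qed

lemma exp_half_line_0:
  fixes c :: real
  assumes "0 < c"
  shows "integrable half_line (\<lambda>s. exp (- c * s))" "(LINT s|half_line. exp (- c * s)) = 1 / c"
proof -
  have eq: "indicator {0..} s *\<^sub>R exp (- c * s) = exp (- c * s)" if "s \<in> space half_line" for s
    using that by (simp add: space_restrict_space)
  show "integrable half_line (\<lambda>s. exp (- c * s))"
    using exp_half_line(1)[OF assms order_refl]
    by (rule Bochner_Integration.integrable_cong[THEN iffD1, rotated -1]) (simp_all only: eq)
  have "(LINT s|half_line. exp (- c * s)) = (LINT s|half_line. indicator {0..} s *\<^sub>R exp (- c * s))"
    by (rule Bochner_Integration.integral_cong) (simp_all only: eq)
  then show "(LINT s|half_line. exp (- c * s)) = 1 / c"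
    using exp_half_line(2)[OF assms order_refl] by simp
qed

lemma integrable_half_line_bounded:
  fixes f :: "real \<Rightarrow> real"
  assumes f: "\<And>b. integrable (lebesgue_on {0..b}) f" and nonneg: "\<And>x. 0 \<le> f x"
    and bound: "\<And>b. 0 \<le> b \<Longrightarrow> (LINT x|lebesgue_on {0..b}. f x) \<le> C" and meas: "f \<in> borel_measurable half_line"
  shows "integrable half_line f"
proof -
  let ?g = "\<lambda>n x. indicator {0..real n} x *\<^sub>R f x"
  have int: "integrable half_line (?g n)" for n
    by (subst integrable_lebesgue_on_subset) (use f in auto)
  have mono: "mono (\<lambda>n. ?g n x)" for x
    using nonneg by (auto simp: mono_def indicator_def)
  have "incseq (\<lambda>n. LINT x|half_line. ?g n x)"
    unfolding incseq_def
  proof (intro allI impI integral_mono int)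
    fix m n :: nat and x assume "m \<le> n"
    then show "?g m x \<le> ?g n x" by (rule monoD[OF mono])
  qed
  moreover have "(LINT x|half_line. ?g n x) \<le> C" for n
    using bound[of "real n"] by (subst integral_lebesgue_on_subset) auto
  ultimately obtain L where L: "(\<lambda>n. LINT x|half_line. ?g n x) \<longlonglongrightarrow> L"
    by (meson incseq_convergent)
  have lim: "AE x in half_line. (\<lambda>n. ?g n x) \<longlonglongrightarrow> f x"
  proof (rule AE_I2, rule tendsto_eventually)
    fix x assume "x \<in> space half_line"
    obtain N where "x \<le> real N" using real_arch_simple by blast
    with \<open>x \<in> space half_line\<close> show "\<forall>\<^sub>F n in sequentially. ?g n x = f x"
      by (intro eventually_sequentiallyI[of N]) (auto simp: indicator_def space_restrict_space)
  qed
  show ?thesis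
    by (rule integrable_monotone_convergence[OF int _ lim L meas]) (rule AE_I2, rule mono)
qed

lemma Icc_integral_le_half_line:
  fixes f :: "real \<Rightarrow> real"
  assumes f: "integrable half_line f" and nonneg: "\<And>x. 0 \<le> f x"
  shows "(LINT x|lebesgue_on {0..b}. f x) \<le> (LINT x|half_line. f x)"
proof -
  have "(LINT x|lebesgue_on {0..b}. f x) = (LINT x|half_line. indicator {0..b} x *\<^sub>R f x)"
    by (rule integral_lebesgue_on_subset[symmetric]) auto
  also have "\<dots> \<le> (LINT x|half_line. f x)"
  proof (rule integral_mono[OF _ f])
    show "integrable half_line (\<lambda>x. indicator {0..b} x *\<^sub>R f x)"
      using integrable_lebesgue_on_subset[of "{0..b}" "{0..}" f] integrable_half_line_Icc[OF f order_refl] by simp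
  qed (use nonneg in \<open>simp add: indicator_def\<close>)
  finally show ?thesis .
qed

lemma primitive_sq_integrable:
  fixes v :: "real \<Rightarrow> 'a::euclidean_space"
  assumes "primitive v g" and bound: "\<And>b. 0 \<le> b \<Longrightarrow> (LINT x|lebesgue_on {0..b}. (norm (v x))\<^sup>2) \<le> C"
  shows "sq_integrable half_line v"
  unfolding sq_integrable_def
proof
  have cont: "continuous_on {0..} v" by (rule primitive_continuous[OF assms(1)])
  show "v \<in> borel_measurable half_line"
    by (rule continuous_imp_measurable_on_sets_lebesgue[OF cont]) simp
  show "integrable half_line (\<lambda>x. (norm (v x))\<^sup>2)"
  proof (rule integrable_half_line_bounded[OF _ _ bound])
    show "integrable (lebesgue_on {0..b}) (\<lambda>x. (norm (v x))\<^sup>2)" for b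
      by (intro continuous_imp_integrable_real continuous_intros primitive_continuous_Icc[OF assms(1)])
    show "(\<lambda>x. (norm (v x))\<^sup>2) \<in> borel_measurable half_line"
      by (intro continuous_imp_measurable_on_sets_lebesgue continuous_intros cont) simp
  qed auto
qed

text \<open>The formula of variation of constants for \<open>v' = a v - h\<close> and \<open>v(0) = c\<close>.\<close>

lemma linear_ode_primitive:
  fixes h :: "real \<Rightarrow> 'a::euclidean_space" and a :: real and c :: 'a
  assumes "\<And>b. integrable (lebesgue_on {0..b}) h"
  defines "v \<equiv> \<lambda>x. exp (a * x) *\<^sub>R (c - (LINT s|lebesgue_on {0..x}. exp (- a * s) *\<^sub>R h s))"
  shows "primitive v (\<lambda>x. a *\<^sub>R v x - h x)" "v 0 = c"
proof -
  have int: "integrable (lebesgue_on {0..b}) (\<lambda>s. - (exp (- a * s) *\<^sub>R h s))" for b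
    by (intro Bochner_Integration.integrable_minus integrable_continuous_scaleR assms continuous_intros)
  have exp: "primitive (\<lambda>x. exp (a * x)) (\<lambda>x. a * exp (a * x))"
    by (rule primitive_C1)
      (auto simp: has_real_derivative_iff_has_vector_derivative[symmetric] intro!: derivative_eq_intros continuous_intros)
  have "primitive v (\<lambda>x. (a * exp (a * x)) *\<^sub>R (c + (LINT s|lebesgue_on {0..x}. - (exp (- a * s) *\<^sub>R h s)))
      + exp (a * x) *\<^sub>R (- (exp (- a * x) *\<^sub>R h x)))"
    using primitive_prod[OF bounded_bilinear_scaleR exp indefinite_integral_primitive[OF int, of c]]
    by (simp add: v_def)
  then show "primitive v (\<lambda>x. a *\<^sub>R v x - h x)"
    by (rule primitive_cong) (simp_all add: v_def exp_minus)
  have "primitive (\<lambda>x. c + (LINT s|lebesgue_on {0..x}. - (exp (- a * s) *\<^sub>R h s))) (\<lambda>s. - (exp (- a * s) *\<^sub>R h s))"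
    by (rule indefinite_integral_primitive[OF int])
  from primitive_eq[OF this, of 0] show "v 0 = c" by (simp add: v_def)
qed

lemma primitive_norm_sq:
  fixes v :: "real \<Rightarrow> 'a::euclidean_space"
  assumes "primitive v g"
  shows "primitive (\<lambda>x. (norm (v x))\<^sup>2) (\<lambda>x. 2 * inner (g x) (v x))"
  using primitive_prod[OF bounded_bilinear_inner assms assms]
  by (rule primitive_cong) (auto simp: power2_norm_eq_inner inner_commute)

lemma young_inner: "0 < \<alpha> \<Longrightarrow> \<bar>2 * inner h v\<bar> \<le> \<alpha> * (norm v)\<^sup>2 + (norm h)\<^sup>2 / \<alpha>"
  for h v :: "'a::real_inner"
proof -
  assume \<alpha>: "0 < \<alpha>"
  have "\<bar>inner h v\<bar> \<le> norm h * norm v" by (rule Cauchy_Schwarz_ineq2)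
  moreover have "0 \<le> (\<alpha> * norm v - norm h)\<^sup>2 / \<alpha>" using \<alpha> by simp
  then have "2 * (norm h * norm v) \<le> \<alpha> * (norm v)\<^sup>2 + (norm h)\<^sup>2 / \<alpha>"
    using \<alpha> by (simp add: power2_diff field_simps power2_eq_square)
  ultimately show ?thesis by simp
qed

text \<open>For \<open>a < 0\<close> every solution of \<open>v' = a v - h\<close> is square integrable, by the energy identity
  \<open>|v|\<^sup>2' = 2 a |v|\<^sup>2 - 2 Re (h v)\<close>; for \<open>a > 0\<close> there is one bounded solution, to which the
  identity applies as well.\<close>

lemma resolvent_ode_stable:
  fixes h :: "real \<Rightarrow> 'a::euclidean_space"
  assumes h: "sq_integrable half_line h" and a: "a < 0"
  shows "\<exists>v. primitive v (\<lambda>x. a *\<^sub>R v x - h x) \<and> v 0 = c \<and> sq_integrable half_line v"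
proof -
  obtain v where v: "primitive v (\<lambda>x. a *\<^sub>R v x - h x)" "v 0 = c"
    using linear_ode_primitive[OF sq_integrable_Icc[OF h]] by blast
  let ?H = "LINT x|half_line. (norm (h x))\<^sup>2"
  have "sq_integrable half_line v"
  proof (rule primitive_sq_integrable[OF v(1)])
    fix b :: real assume b: "0 \<le> b"
    let ?M = "lebesgue_on {0..b}"
    have iv: "integrable ?M (\<lambda>x. (norm (v x))\<^sup>2)"
      by (intro continuous_imp_integrable_real continuous_intros primitive_continuous_Icc[OF v(1)])
    have ih: "integrable ?M (\<lambda>x. (norm (h x))\<^sup>2)"
      by (rule integrable_half_line_Icc[OF sq_integrable_norm[OF h]]) simp
    have hH: "(LINT x|?M. (norm (h x))\<^sup>2) \<le> ?H"
      by (rule Icc_integral_le_half_line[OF sq_integrable_norm[OF h]]) simp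
    note E = primitive_norm_sq[OF v(1)]
    have "0 \<le> (norm (v b))\<^sup>2" by simp
    also have "\<dots> = (norm c)\<^sup>2 + (LINT x|?M. 2 * inner (a *\<^sub>R v x - h x) (v x))"
      using primitive_eq[OF E b] v(2) by simp
    also have "(LINT x|?M. 2 * inner (a *\<^sub>R v x - h x) (v x)) \<le> (LINT x|?M. a * (norm (v x))\<^sup>2 + (norm (h x))\<^sup>2 / (- a))"
    proof (rule integral_mono[OF primitive_integrable[OF E]])
      show "integrable ?M (\<lambda>x. a * (norm (v x))\<^sup>2 + (norm (h x))\<^sup>2 / (- a))" using iv ih by auto
      show "2 * inner (a *\<^sub>R v x - h x) (v x) \<le> a * (norm (v x))\<^sup>2 + (norm (h x))\<^sup>2 / (- a)" for x
        using young_inner[of "- a" "h x" "v x"] a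
        by (simp add: inner_diff power2_norm_eq_inner)
    qed
    also have "\<dots> = a * (LINT x|?M. (norm (v x))\<^sup>2) + (LINT x|?M. (norm (h x))\<^sup>2) / (- a)"
      using iv ih by simp
    finally have "(- a) * (LINT x|?M. (norm (v x))\<^sup>2) \<le> (norm c)\<^sup>2 + (LINT x|?M. (norm (h x))\<^sup>2) / (- a)" by simp
    also have "\<dots> \<le> (norm c)\<^sup>2 + ?H / (- a)" using hH a by (intro add_left_mono divide_right_mono) auto
    finally show "(LINT x|?M. (norm (v x))\<^sup>2) \<le> ((norm c)\<^sup>2 + ?H / (- a)) / (- a)"
      using a by (subst pos_le_divide_eq) (auto simp: mult.commute)
  qed
  with v show ?thesis by blast
qed

lemma resolvent_ode_unstable:
  fixes h :: "real \<Rightarrow> 'a::euclidean_space"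
  assumes h: "sq_integrable half_line h" and a: "0 < a"
  shows "\<exists>v. primitive v (\<lambda>x. a *\<^sub>R v x - h x) \<and> sq_integrable half_line v"
proof -
  let ?F = "\<lambda>s. exp (- a * s) *\<^sub>R h s"
  let ?H = "LINT x|half_line. (norm (h x))\<^sup>2"
  have h2: "integrable half_line (\<lambda>x. (norm (h x))\<^sup>2)" by (rule sq_integrable_norm[OF h])
  have expm: "(\<lambda>s. exp (- a * s)) \<in> borel_measurable half_line"
    by (intro continuous_imp_measurable_on_sets_lebesgue continuous_intros) simp
  have Fm: "?F \<in> borel_measurable half_line"
    using h expm unfolding sq_integrable_def by (intro borel_measurable_scaleR) auto
  have F: "integrable half_line ?F"
  proof (rule Bochner_Integration.integrable_bound[OF _ Fm])
    show "integrable half_line (\<lambda>s. exp (- (2 * a) * s) + (norm (h s))\<^sup>2)"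
      using exp_half_line_0(1)[of "2 * a"] a h2 by (intro Bochner_Integration.integrable_add) auto
    have "exp (- a * s) * norm (h s) \<le> exp (- (2 * a) * s) + (norm (h s))\<^sup>2" for s
    proof -
      have "(exp (- a * s))\<^sup>2 = exp (- (2 * a) * s)" by (simp add: power2_eq_square flip: exp_add)
      moreover have "0 \<le> exp (- a * s) * norm (h s)" by simp
      ultimately show ?thesis using sum_squares_bound[of "exp (- a * s)" "norm (h s)"] by linarith
    qed
    then show "AE s in half_line. norm (?F s) \<le> norm (exp (- (2 * a) * s) + (norm (h s))\<^sup>2)"
      by (simp add: order_trans[OF _ abs_ge_self])
  qed
  \<comment> \<open>With this initial value, \<open>v x\<close> is the integral of \<open>exp (a (x - s)) h s\<close> over \<open>s \<ge> x\<close>.\<close>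
  define c where "c = (LINT s|half_line. ?F s)"
  define v where "v x = exp (a * x) *\<^sub>R (c - (LINT s|lebesgue_on {0..x}. ?F s))" for x
  have v: "primitive v (\<lambda>x. a *\<^sub>R v x - h x)"
    using linear_ode_primitive(1)[OF sq_integrable_Icc[OF h], of a c] by (simp add: v_def[abs_def])
  define K where "K = (1 / (2 * a) + ?H) / 2"
  have bound: "norm (v x) \<le> K" if x: "0 \<le> x" for x
  proof -
    let ?G = "\<lambda>s. (exp (a * x) * (indicator {x..} s *\<^sub>R exp (- (2 * a) * s)) + exp (- a * x) * (norm (h s))\<^sup>2) / 2"
    have Gint: "integrable half_line ?G"
      using exp_half_line(1)[of "2 * a" x] a x h2
      by (intro Bochner_Integration.integrable_divide Bochner_Integration.integrable_add integrable_mult_right) auto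
    have FI: "integrable half_line (\<lambda>s. indicator {0..x} s *\<^sub>R ?F s)"
      using integrable_lebesgue_on_subset[of "{0..x}" "{0..}" ?F] integrable_half_line_Icc[OF F order_refl, of x] by simp
    have pointwise: "norm (?F s - indicator {0..x} s *\<^sub>R ?F s) \<le> ?G s" if s: "0 \<le> s" for s
    proof (cases "s \<le> x")
      case False
      \<comment> \<open>The product \<open>2 p q\<close> below is \<open>2 exp (- a s) |h s|\<close>.\<close>
      let ?p = "exp (a * x / 2) * exp (- a * s)" and ?q = "exp (- a * x / 2) * norm (h s)"
      have "2 * ?p * ?q \<le> ?p\<^sup>2 + ?q\<^sup>2" by (rule sum_squares_bound)
      also have "2 * ?p * ?q = 2 * (exp (- a * s) * norm (h s)) * (exp (a * x / 2) * exp (- a * x / 2))" by simp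
      also have "exp (a * x / 2) * exp (- a * x / 2) = 1" by (simp flip: exp_add)
      also have "?p\<^sup>2 = exp (a * x) * exp (- (2 * a) * s)"
        by (simp add: power2_eq_square flip: exp_add)
      also have "?q\<^sup>2 = exp (- a * x) * (norm (h s))\<^sup>2"
        by (simp add: power_mult_distrib) (simp add: power2_eq_square flip: exp_add)
      finally show ?thesis using False by (simp add: indicator_def)
    qed (use s in simp)
    have "c - (LINT s|lebesgue_on {0..x}. ?F s) = (LINT s|half_line. ?F s - indicator {0..x} s *\<^sub>R ?F s)" (is "?l = ?r")
      unfolding c_def Bochner_Integration.integral_diff[OF F FI]
      by (subst integral_lebesgue_on_subset[of "{0..x}"]) auto
    then have "norm ?l = norm ?r" by (rule arg_cong)
    also have "norm ?r \<le> (LINT s|half_line. ?G s)"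
      by (rule Bochner_Integration.integral_norm_bound_integral[OF Bochner_Integration.integrable_diff[OF F FI] Gint])
        (rule pointwise, simp add: space_restrict_space)
    also have "(LINT s|half_line. ?G s) = (exp (a * x) * (exp (- (2 * a) * x) / (2 * a)) + exp (- a * x) * ?H) / 2"
    proof -
      have I: "integrable half_line (\<lambda>s. exp (a * x) * (indicator {x..} s *\<^sub>R exp (- (2 * a) * s)))"
          "integrable half_line (\<lambda>s. exp (- a * x) * (norm (h s))\<^sup>2)"
        using exp_half_line(1)[of "2 * a" x] a x h2 by (intro integrable_mult_right; simp)+
      have E: "(LINT s|half_line. indicator {x..} s *\<^sub>R exp (- (2 * a) * s)) = exp (- (2 * a) * x) / (2 * a)"
        by (rule exp_half_line(2)) (use a x in auto)
      show ?thesis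
        unfolding Bochner_Integration.integral_divide_zero Bochner_Integration.integral_add[OF I]
          Bochner_Integration.integral_mult_right_zero E ..
    qed
    also have "\<dots> = exp (- a * x) * K"
    proof -
      have "exp (a * x) * exp (- (2 * a) * x) = exp (- a * x)" by (simp flip: exp_add)
      then have "exp (a * x) * (exp (- (2 * a) * x) / (2 * a)) = exp (- a * x) / (2 * a)" by simp
      then show ?thesis unfolding K_def by (simp add: algebra_simps add_divide_distrib)
    qed
    finally have "norm (v x) \<le> exp (a * x) * (exp (- a * x) * K)"
      unfolding v_def norm_scaleR by (intro mult_mono) auto
    also have "\<dots> = K" by (simp add: exp_minus)
    finally show ?thesis .
  qed
  have "sq_integrable half_line v"
  proof (rule primitive_sq_integrable[OF v])
    fix b :: real assume b: "0 \<le> b"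
    let ?M = "lebesgue_on {0..b}"
    have iv: "integrable ?M (\<lambda>x. (norm (v x))\<^sup>2)"
      by (intro continuous_imp_integrable_real continuous_intros primitive_continuous_Icc[OF v])
    have ih: "integrable ?M (\<lambda>x. (norm (h x))\<^sup>2)"
      by (rule integrable_half_line_Icc[OF h2]) simp
    have hH: "(LINT x|?M. (norm (h x))\<^sup>2) \<le> ?H"
      by (rule Icc_integral_le_half_line[OF sq_integrable_norm[OF h]]) simp
    note E = primitive_norm_sq[OF v]
    have "a * (LINT x|?M. (norm (v x))\<^sup>2) - (LINT x|?M. (norm (h x))\<^sup>2) / a = (LINT x|?M. a * (norm (v x))\<^sup>2 - (norm (h x))\<^sup>2 / a)"
      using iv ih by simp
    also have "\<dots> \<le> (LINT x|?M. 2 * inner (a *\<^sub>R v x - h x) (v x))"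
    proof (rule integral_mono[OF _ primitive_integrable[OF E]])
      show "integrable ?M (\<lambda>x. a * (norm (v x))\<^sup>2 - (norm (h x))\<^sup>2 / a)" using iv ih by auto
      show "a * (norm (v x))\<^sup>2 - (norm (h x))\<^sup>2 / a \<le> 2 * inner (a *\<^sub>R v x - h x) (v x)" for x
        using young_inner[of a "h x" "v x"] a
        by (simp add: inner_diff power2_norm_eq_inner)
    qed
    also have "\<dots> = (norm (v b))\<^sup>2 - (norm (v 0))\<^sup>2" using primitive_eq[OF E b] by simp
    also have "\<dots> \<le> K\<^sup>2" using power_mono[OF bound[OF b] norm_ge_zero, of 2] zero_le_power2[of "norm (v 0)"] by linarith
    finally have "a * (LINT x|?M. (norm (v x))\<^sup>2) \<le> K\<^sup>2 + (LINT x|?M. (norm (h x))\<^sup>2) / a" by simp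
    also have "\<dots> \<le> K\<^sup>2 + ?H / a" using hH a by (intro add_left_mono divide_right_mono) auto
    finally show "(LINT x|?M. (norm (v x))\<^sup>2) \<le> (K\<^sup>2 + ?H / a) / a"
      using a by (subst pos_le_divide_eq) (auto simp: mult.commute)
  qed
  with v show ?thesis by blast
qed

lemma rep_mult_mat:
  assumes rep: "sobolev_rep d x u g" and M: "M \<in> carrier_mat d d"
  shows "sobolev_rep d (\<lambda>\<zeta>. M *\<^sub>v x \<zeta>) (\<lambda>\<zeta>. M *\<^sub>v u \<zeta>) (\<lambda>\<zeta>. M *\<^sub>v g \<zeta>)"
  unfolding sobolev_rep_def
proof (intro conjI allI impI)
  note rep' = sobolev_repD[OF rep]
  show "(\<lambda>\<zeta>. M *\<^sub>v x \<zeta>) \<in> L2 d" "(\<lambda>\<zeta>. M *\<^sub>v g \<zeta>) \<in> L2 d"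
    using mult_op_L2[OF Linf_const[OF M]] rep' by (auto simp: mult_op_def)
  show "M *\<^sub>v u \<zeta> \<in> carrier_vec d" for \<zeta> using M rep'(3) by simp
  fix i assume i: "i < d"
  have comp: "(M *\<^sub>v y) $ i = (\<Sum>j<d. M $$ (i, j) * y $ j)" if "y \<in> carrier_vec d" for y
    using M i that by (auto simp: scalar_prod_def atLeast0LessThan intro!: sum.cong)
  have "primitive (\<lambda>\<zeta>. \<Sum>j<d. M $$ (i, j) * u \<zeta> $ j) (\<lambda>\<zeta>. \<Sum>j<d. M $$ (i, j) * g \<zeta> $ j)"
    by (intro primitive_sum primitive_linear[OF bounded_linear_mult_right] rep'(4)) auto
  then show "primitive (\<lambda>\<zeta>. (M *\<^sub>v u \<zeta>) $ i) (\<lambda>\<zeta>. (M *\<^sub>v g \<zeta>) $ i)"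
    by (rule primitive_cong) (simp_all add: comp[OF rep'(3)] comp[OF L2_carrier[OF rep'(2)]])
  show "AE \<zeta> in half_line. (M *\<^sub>v x \<zeta>) $ i = (M *\<^sub>v u \<zeta>) $ i"
    using rep_ae_eq[OF rep] unfolding ae_eq_def by eventually_elim simp
qed

lemma rep_scaled_vec:
  fixes f :: "real \<Rightarrow> real" and y :: "'f::real_or_complex vec"
  assumes deriv: "\<And>x. (f has_real_derivative f' x) (at x)" "continuous_on UNIV f'"
    and f: "sq_integrable half_line f" and f': "sq_integrable half_line f'" and y: "y \<in> carrier_vec d"
  shows "sobolev_rep d (\<lambda>\<zeta>. of_real (f \<zeta>) \<cdot>\<^sub>v y) (\<lambda>\<zeta>. of_real (f \<zeta>) \<cdot>\<^sub>v y) (\<lambda>\<zeta>. of_real (f' \<zeta>) \<cdot>\<^sub>v y)"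
proof -
  have sq: "sq_integrable half_line (\<lambda>\<zeta>. g \<zeta> *\<^sub>R z)" if "sq_integrable half_line g" for g :: "real \<Rightarrow> real" and z :: 'f
    using that by (auto simp: sq_integrable_def power_mult_distrib)
  have L2: "(\<lambda>\<zeta>. of_real (g \<zeta>) \<cdot>\<^sub>v y) \<in> L2 d" if "sq_integrable half_line g" for g
    by (rule L2I) (use y sq[OF that] in \<open>auto simp: scaleR_conv_of_real[symmetric]\<close>)
  have "primitive f f'"
    using deriv by (intro primitive_C1) (auto simp: has_real_derivative_iff_has_vector_derivative)
  then have "primitive (\<lambda>\<zeta>. f \<zeta> *\<^sub>R z) (\<lambda>\<zeta>. f' \<zeta> *\<^sub>R z)" for z :: 'f
    by (rule primitive_linear[OF bounded_linear_scaleR_left])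
  then show ?thesis
    unfolding sobolev_rep_def using L2[OF f] L2[OF f'] y by (auto simp: scaleR_conv_of_real)
qed

context diagonalised
begin

text \<open>In the coordinates \<open>S u = (v, w)\<close> the equation decouples into \<open>v\<^sub>i' = (\<mu> / \<Lambda>\<^sub>i\<^sub>i) v\<^sub>i - F\<^sub>i / \<Lambda>\<^sub>i\<^sub>i\<close> and the
  analogous equations for \<open>w\<close> with \<open>\<Theta>\<close>. The signs of \<open>\<Lambda>\<close> and \<open>\<Theta>\<close> make the former unstable, so that
  their initial values are determined by square integrability, and the latter stable, so that
  \<open>w(0) = - U v(0)\<close> can be prescribed.\<close>

lemma resolvent_equation:
  assumes B: "B \<in> carrier_mat n2 n2" "invertible_mat B" and U: "U \<in> carrier_mat n2 n1"
    and eq: "WB = B * append_cols U (1\<^sub>m n2) * S" and \<mu>: "0 < \<mu>" and f: "f \<in> L2 d"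
  shows "\<exists>u g. sobolev_rep d u u g \<and> WB *\<^sub>v u 0 = 0\<^sub>v n2 \<and>
    (\<forall>\<zeta>\<ge>0. of_real \<mu> \<cdot>\<^sub>v u \<zeta> - P1 *\<^sub>v g \<zeta> = f \<zeta>)"
proof -
  define F where "F = mult_op (\<lambda>_. S) f"
  have F: "F \<in> L2 d" unfolding F_def by (rule mult_op_L2[OF Linf_const[OF S] f])
  note Fi = L2_component[OF F]
  have "\<forall>i\<in>{..<n1}. \<exists>v. primitive v (\<lambda>x. (\<mu> / \<Lambda> $$ (i, i)) *\<^sub>R v x - (1 / \<Lambda> $$ (i, i)) *\<^sub>R F x $ i) \<and> sq_integrable half_line v"
    using \<Lambda>(3) \<mu> d by (intro ballI resolvent_ode_unstable sq_integrable_scaleR Fi) auto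
  from bchoice[OF this] obtain v where v: "\<And>i. i < n1 \<Longrightarrow>
      primitive (v i) (\<lambda>x. (\<mu> / \<Lambda> $$ (i, i)) *\<^sub>R v i x - (1 / \<Lambda> $$ (i, i)) *\<^sub>R F x $ i)"
    "\<And>i. i < n1 \<Longrightarrow> sq_integrable half_line (v i)" by auto
  define V where "V x = Matrix.vec n1 (\<lambda>i. v i x)" for x
  have V: "V x \<in> carrier_vec n1" for x by (simp add: V_def)
  have "\<forall>i\<in>{..<n2}. \<exists>w. primitive w (\<lambda>x. (\<mu> / \<Theta> $$ (i, i)) *\<^sub>R w x - (1 / \<Theta> $$ (i, i)) *\<^sub>R F x $ (n1 + i)) \<and>
      w 0 = - (U *\<^sub>v V 0) $ i \<and> sq_integrable half_line w"
    using \<Theta>(3) \<mu> d by (intro ballI resolvent_ode_stable sq_integrable_scaleR Fi) (auto simp: divide_pos_neg)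
  from bchoice[OF this] obtain w where w: "\<And>i. i < n2 \<Longrightarrow>
      primitive (w i) (\<lambda>x. (\<mu> / \<Theta> $$ (i, i)) *\<^sub>R w i x - (1 / \<Theta> $$ (i, i)) *\<^sub>R F x $ (n1 + i))"
    "\<And>i. i < n2 \<Longrightarrow> w i 0 = - (U *\<^sub>v V 0) $ i" "\<And>i. i < n2 \<Longrightarrow> sq_integrable half_line (w i)" by auto
  define W where "W x = Matrix.vec n2 (\<lambda>i. w i x)" for x
  have W: "W x \<in> carrier_vec n2" for x by (simp add: W_def)
  define V' where "V' x = Matrix.vec n1 (\<lambda>i. (\<mu> / \<Lambda> $$ (i, i)) *\<^sub>R v i x - (1 / \<Lambda> $$ (i, i)) *\<^sub>R F x $ i)" for x
  define W' where "W' x = Matrix.vec n2 (\<lambda>i. (\<mu> / \<Theta> $$ (i, i)) *\<^sub>R w i x - (1 / \<Theta> $$ (i, i)) *\<^sub>R F x $ (n1 + i))" for x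
  have VW': "V' x \<in> carrier_vec n1" "W' x \<in> carrier_vec n2" for x by (simp_all add: V'_def W'_def)
  let ?y = "\<lambda>x. V x @\<^sub>v W x" and ?y' = "\<lambda>x. V' x @\<^sub>v W' x"
  have yc: "?y x \<in> carrier_vec d" "?y' x \<in> carrier_vec d" for x using V W VW' by (simp_all add: d)
  have y: "sobolev_rep d ?y ?y ?y'"
    unfolding sobolev_rep_def
  proof (intro conjI allI impI yc)
    show "?y \<in> L2 d"
    proof (rule L2I[OF yc(1)])
      fix i assume "i < d"
      then show "sq_integrable half_line (\<lambda>x. ?y x $ i)"
        using v(2)[of i] w(3)[of "i - n1"] by (cases "i < n1") (auto simp: V_def W_def d)
    qed
    show "?y' \<in> L2 d"
    proof (rule L2I[OF yc(2)])
      fix i assume i: "i < d"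
      show "sq_integrable half_line (\<lambda>x. ?y' x $ i)"
      proof (cases "i < n1")
        case True
        then show ?thesis using i by (auto simp: V'_def W'_def intro!: sq_integrable_diff sq_integrable_scaleR v(2) Fi)
      next
        case False
        then show ?thesis using i d
          by (auto simp: V'_def W'_def intro!: sq_integrable_diff sq_integrable_scaleR w(3) Fi)
      qed
    qed
    fix i assume i: "i < d"
    show "primitive (\<lambda>x. ?y x $ i) (\<lambda>x. ?y' x $ i)"
    proof (cases "i < n1")
      case True
      then show ?thesis using v(1)[OF True] by (simp add: V_def W_def V'_def W'_def)
    next
      case False
      then have j: "i - n1 < n2" "n1 + (i - n1) = i" using i d by simp_all
      from w(1)[OF j(1)] show ?thesis using False i j by (simp add: V_def W_def V'_def W'_def)
    qed
  qed auto
  let ?u = "\<lambda>x. mat_adjoint S *\<^sub>v ?y x" and ?g = "\<lambda>x. mat_adjoint S *\<^sub>v ?y' x"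
  have "sobolev_rep d ?u ?u ?g" by (rule rep_mult_mat[OF y carriers(4)])
  moreover have "WB *\<^sub>v ?u 0 = 0\<^sub>v n2"
  proof -
    have "U *\<^sub>v V 0 + W 0 = 0\<^sub>v n2"
      using U by (intro eq_vecI) (auto simp: W_def w(2))
    then show ?thesis using kernel_iff[OF B U eq V W] by simp
  qed
  moreover have "of_real \<mu> \<cdot>\<^sub>v ?u x - P1 *\<^sub>v ?g x = f x" if x: "0 \<le> x" for x
  proof -
    have fx: "f x \<in> carrier_vec d" "F x \<in> carrier_vec d" using L2_carrier f F x by blast+
    have gx: "?g x \<in> carrier_vec d" using carriers(4) yc by simp
    have "P1 *\<^sub>v ?g x = mat_adjoint S *\<^sub>v (block_diag \<Lambda>f \<Theta>f *\<^sub>v ?y' x)"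
      using P1_mult_vec[OF gx] adjoint_S_cancel(2)[OF yc(2)] by simp
    also have "block_diag \<Lambda>f \<Theta>f *\<^sub>v ?y' x = (\<Lambda>f *\<^sub>v V' x) @\<^sub>v (\<Theta>f *\<^sub>v W' x)"
      by (rule block_diag_mult_vec[OF carriers(1,2) VW'])
    also have "\<dots> = of_real \<mu> \<cdot>\<^sub>v ?y x - F x"
    proof (rule eq_vecI)
      fix i assume "i < dim_vec (of_real \<mu> \<cdot>\<^sub>v ?y x - F x)"
      then have i: "i < d" using fx by simp
      show "((\<Lambda>f *\<^sub>v V' x) @\<^sub>v (\<Theta>f *\<^sub>v W' x)) $ i = (of_real \<mu> \<cdot>\<^sub>v ?y x - F x) $ i"
      proof (cases "i < n1")
        case True
        have "(\<Lambda>f *\<^sub>v V' x) $ i = of_real \<mu> * v i x - F x $ i"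
          using diagonal_form(2)[OF \<Lambda>(1,2) VW'(1) True, of x] True \<Lambda>(3)[OF True]
          by (simp add: V'_def scaleR_conv_of_real right_diff_distrib)
        then show ?thesis using True i fx \<Lambda>(1) \<Theta>(1) by (simp add: V_def W_def d)
      next
        case False
        then have j: "i - n1 < n2" using i d by simp
        have "(\<Theta>f *\<^sub>v W' x) $ (i - n1) = of_real \<mu> * w (i - n1) x - F x $ i"
          using diagonal_form(2)[OF \<Theta>(1,2) VW'(2) j, of x] j \<Theta>(3)[OF j] False
          by (simp add: W'_def scaleR_conv_of_real right_diff_distrib)
        then show ?thesis using False i fx \<Lambda>(1) \<Theta>(1) by (simp add: V_def W_def d)
      qed
    qed (use fx \<Lambda>(1) \<Theta>(1) in \<open>simp add: d\<close>)
    finally have "P1 *\<^sub>v ?g x = mat_adjoint S *\<^sub>v (of_real \<mu> \<cdot>\<^sub>v ?y x - F x)" .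
    also have "\<dots> = of_real \<mu> \<cdot>\<^sub>v ?u x - mat_adjoint S *\<^sub>v F x"
      using carriers(4) yc fx by (simp add: mult_minus_distrib_mat_vec mult_mat_vec)
    also have "mat_adjoint S *\<^sub>v F x = f x" unfolding F_def mult_op_def by (rule adjoint_S_cancel(1)[OF fx(1)])
    finally show ?thesis using carriers(4) yc fx by (intro eq_vecI) auto
  qed
  ultimately show ?thesis by blast
qed

end

section \<open>Dissipativity of the port-Hamiltonian operator\<close>

lemma re_L2_inner_add:
  assumes "x \<in> L2 d" "y \<in> L2 d" "z \<in> L2 d"
  shows "re (L2_inner (\<lambda>\<zeta>. x \<zeta> + y \<zeta>) z) = re (L2_inner x z) + re (L2_inner y z)"
  using inner_embed[OF L2_add[OF assms(1,2)] assms(3)] inner_embed[OF assms(1,3)] inner_embed[OF assms(2,3)]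
  by (simp add: embed_add[OF assms(1,2)] inner_add_left)

lemma A_op_rep:
  assumes rep: "sobolev_rep d x u g" and P: "P0 \<in> carrier_mat d d" "P1 \<in> carrier_mat d d"
  shows "A_op d P0 P1 x \<in> L2 d" "ae_eq (A_op d P0 P1 x) (\<lambda>\<zeta>. P0 *\<^sub>v x \<zeta> + P1 *\<^sub>v g \<zeta>)"
proof -
  show "A_op d P0 P1 x \<in> L2 d"
    using L2_add[OF mult_op_L2[OF Linf_const[OF P(1)] sobolev_repD(1)[OF rep]]
        mult_op_L2[OF Linf_const[OF P(2)] rep_weak_deriv(1)[OF rep]]]
    by (simp add: A_op_def mult_op_def)
  show "ae_eq (A_op d P0 P1 x) (\<lambda>\<zeta>. P0 *\<^sub>v x \<zeta> + P1 *\<^sub>v g \<zeta>)"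
    using rep_weak_deriv(2)[OF rep] unfolding ae_eq_def A_op_def by eventually_elim simp
qed

lemma dissipation_identity:
  assumes rep: "sobolev_rep d x u g" and P0: "P0 \<in> carrier_mat d d" and P1: "hermitian_mat d P1"
  shows "re (L2_inner (A_op d P0 P1 x) x) =
    (LINT \<zeta>|half_line. re ((P0 *\<^sub>v x \<zeta>) \<bullet>c x \<zeta>)) - re ((P1 *\<^sub>v u 0) \<bullet>c u 0) / 2"
proof -
  note rep' = sobolev_repD[OF rep]
  have P1c: "P1 \<in> carrier_mat d d" using P1 by (simp add: hermitian_mat_def)
  have L2: "(\<lambda>\<zeta>. P0 *\<^sub>v x \<zeta>) \<in> L2 d" "(\<lambda>\<zeta>. P1 *\<^sub>v g \<zeta>) \<in> L2 d"
    using mult_op_L2[OF Linf_const[OF P0] rep'(1)] mult_op_L2[OF Linf_const[OF P1c] rep'(2)]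
    by (simp_all add: mult_op_def)
  have "re (L2_inner (A_op d P0 P1 x) x) = re (L2_inner (\<lambda>\<zeta>. P0 *\<^sub>v x \<zeta> + P1 *\<^sub>v g \<zeta>) x)"
    by (rule re_L2_inner_cong[OF A_op_rep(1)[OF rep P0 P1c] rep'(1) L2_add[OF L2] rep'(1) A_op_rep(2)[OF rep P0 P1c]])
      (simp add: ae_eq_def)
  also have "\<dots> = re (L2_inner (\<lambda>\<zeta>. P0 *\<^sub>v x \<zeta>) x) + re (L2_inner (\<lambda>\<zeta>. P1 *\<^sub>v g \<zeta>) x)"
    by (rule re_L2_inner_add[OF L2 rep'(1)])
  finally show ?thesis
    by (simp add: re_L2_inner_form(1)[OF L2(1) rep'(1)] integration_by_parts_form[OF rep P1])
qed

lemma A_dom_rep: "x \<in> A_dom d k WB \<Longrightarrow> \<exists>u g. sobolev_rep d x u g \<and> WB *\<^sub>v u 0 = 0\<^sub>v k"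
  unfolding A_dom_def using W12_rep[of x d] rep_trace0[of d x] by force

lemma rep_A_dom: "sobolev_rep d x u g \<Longrightarrow> WB *\<^sub>v u 0 = 0\<^sub>v k \<Longrightarrow> x \<in> A_dom d k WB"
  unfolding A_dom_def using rep_W12[of d x u g] rep_trace0[of d x u g] by simp

lemma form_scale:
  assumes "P \<in> carrier_mat d d" "y \<in> carrier_vec d"
  shows "re ((P *\<^sub>v (of_real a \<cdot>\<^sub>v y)) \<bullet>c (of_real a \<cdot>\<^sub>v y)) = a\<^sup>2 * re ((P *\<^sub>v y) \<bullet>c (y :: 'f::real_or_complex vec))"
proof -
  have "(P *\<^sub>v (of_real a \<cdot>\<^sub>v y)) \<bullet>c (of_real a \<cdot>\<^sub>v y) = of_real a * (of_real a * ((P *\<^sub>v y) \<bullet>c y))"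
    using assms by (simp add: mult_mat_vec conjugate_smult_vec conjugate_of_real)
  also have "\<dots> = a\<^sup>2 *\<^sub>R ((P *\<^sub>v y) \<bullet>c y)" by (simp add: scaleR_conv_of_real power2_eq_square)
  finally show ?thesis by (simp only: re_scaleR)
qed

lemma dissipation_scaled_vec:
  fixes f :: "real \<Rightarrow> real" and y :: "'f::real_or_complex vec"
  assumes deriv: "\<And>x. (f has_real_derivative f' x) (at x)" "continuous_on UNIV f'"
    and f: "sq_integrable half_line f" and f': "sq_integrable half_line f'" and y: "y \<in> carrier_vec d"
    and P0: "P0 \<in> carrier_mat d d" and P1: "hermitian_mat d P1" and WB: "WB \<in> carrier_mat k d"
    and 0: "f 0 = 0 \<or> WB *\<^sub>v y = 0\<^sub>v k"
    and diss: "\<And>x. x \<in> A_dom d k WB \<Longrightarrow> re (L2_inner (A_op d P0 P1 x) x) \<le> 0"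
  shows "(LINT \<zeta>|half_line. (f \<zeta>)\<^sup>2) * re ((P0 *\<^sub>v y) \<bullet>c y) - (f 0)\<^sup>2 * re ((P1 *\<^sub>v y) \<bullet>c y) / 2 \<le> 0"
proof -
  note rep = rep_scaled_vec[OF deriv f f' y]
  have P1c: "P1 \<in> carrier_mat d d" using P1 by (simp add: hermitian_mat_def)
  have "WB *\<^sub>v (of_real (f 0) \<cdot>\<^sub>v y) = of_real (f 0) \<cdot>\<^sub>v (WB *\<^sub>v y)" using WB y by (rule mult_mat_vec)
  also have "\<dots> = 0\<^sub>v k"
  proof (cases "f 0 = 0")
    case False
    with 0 have "WB *\<^sub>v y = 0\<^sub>v k" by simp
    moreover have "of_real (f 0) \<cdot>\<^sub>v 0\<^sub>v k = (0\<^sub>v k :: 'f vec)" by (rule eq_vecI) auto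
    ultimately show ?thesis by simp
  qed (use WB y in \<open>intro eq_vecI; simp\<close>)
  finally have "(\<lambda>\<zeta>. of_real (f \<zeta>) \<cdot>\<^sub>v y) \<in> A_dom d k WB" by (rule rep_A_dom[OF rep])
  from diss[OF this] show ?thesis
    unfolding dissipation_identity[OF rep P0 P1] form_scale[OF P0 y] form_scale[OF P1c y] by simp
qed

text \<open>Write \<open>p\<^sub>0\<close> and \<open>p\<^sub>1\<close> for the values of the forms of \<open>P\<^sub>0\<close> and \<open>P\<^sub>1\<close> at \<open>y\<close>. The functions
  \<open>exp (- n \<zeta>) y\<close> give \<open>p\<^sub>0 / n \<le> p\<^sub>1\<close> for all \<open>n > 0\<close>, hence \<open>0 \<le> p\<^sub>1\<close>. For the condition on \<open>P\<^sub>0\<close> the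
  function \<open>exp (- \<zeta>) - exp (- 2 \<zeta>)\<close> vanishes at 0, so that the boundary term disappears and every
  vector is admissible.\<close>

lemma boundary_form_nonneg_if_dissipative:
  fixes P0 P1 WB :: "'f::real_or_complex mat"
  assumes P0: "P0 \<in> carrier_mat d d" and P1: "hermitian_mat d P1" and WB: "WB \<in> carrier_mat k d"
    and diss: "\<And>x. x \<in> A_dom d k WB \<Longrightarrow> re (L2_inner (A_op d P0 P1 x) x) \<le> 0"
  shows "y \<in> carrier_vec d \<Longrightarrow> WB *\<^sub>v y = 0\<^sub>v k \<Longrightarrow> 0 \<le> re ((P1 *\<^sub>v y) \<bullet>c y)"
    and "v \<in> carrier_vec d \<Longrightarrow> re ((P0 *\<^sub>v v) \<bullet>c v) \<le> 0"
proof -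
  have exp2: "(exp (- n * \<zeta>))\<^sup>2 = exp (- (2 * n) * \<zeta>)" for n \<zeta> :: real
    by (simp add: power2_eq_square flip: exp_add)
  have sq: "sq_integrable half_line (\<lambda>\<zeta>. exp (- n * \<zeta>))" if "0 < n" for n :: real
    unfolding sq_integrable_def
  proof
    show "(\<lambda>\<zeta>. exp (- n * \<zeta>)) \<in> borel_measurable half_line"
      by (intro continuous_imp_measurable_on_sets_lebesgue continuous_intros) simp
    show "integrable half_line (\<lambda>\<zeta>. (norm (exp (- n * \<zeta>)))\<^sup>2)"
      using exp_half_line_0(1)[of "2 * n"] that by (simp only: real_norm_def abs_exp_cancel exp2)
  qed
  have deriv: "((\<lambda>\<zeta>. exp (- n * \<zeta>)) has_real_derivative - n *\<^sub>R exp (- n * x)) (at x)" for n x :: real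
    by (auto intro!: derivative_eq_intros)
  show "0 \<le> re ((P1 *\<^sub>v y) \<bullet>c y)" if y: "y \<in> carrier_vec d" "WB *\<^sub>v y = 0\<^sub>v k"
  proof (rule ccontr)
    let ?p0 = "re ((P0 *\<^sub>v y) \<bullet>c y)" and ?p1 = "re ((P1 *\<^sub>v y) \<bullet>c y)"
    assume neg: "\<not> 0 \<le> ?p1"
    have bound: "?p0 / n \<le> ?p1" if n: "0 < n" for n :: real
    proof -
      have "(LINT \<zeta>|half_line. (exp (- n * \<zeta>))\<^sup>2) * ?p0 - (exp (- n * 0))\<^sup>2 * ?p1 / 2 \<le> 0"
        by (rule dissipation_scaled_vec[OF deriv _ sq[OF n] sq_integrable_scaleR[OF sq[OF n]] y(1) P0 P1 WB _ diss])
          (use y in \<open>auto intro!: continuous_intros\<close>)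
      then show ?thesis
        unfolding exp2 using exp_half_line_0(2)[of "2 * n"] n by simp
    qed
    \<comment> \<open>For this \<open>n\<close> the bound reads \<open>p\<^sub>1 / 2 \<le> p\<^sub>1\<close>.\<close>
    from bound[of 1] neg have "0 < 2 * ?p0 / ?p1" by (simp add: divide_neg_neg)
    from bound[OF this] neg show False using bound[of 1] by (simp add: field_simps)
  qed
  show "re ((P0 *\<^sub>v v) \<bullet>c v) \<le> 0" if v: "v \<in> carrier_vec d"
  proof -
    let ?f = "\<lambda>\<zeta>::real. exp (- 1 * \<zeta>) - exp (- 2 * \<zeta>)"
    have le: "(LINT \<zeta>|half_line. (?f \<zeta>)\<^sup>2) * re ((P0 *\<^sub>v v) \<bullet>c v) - (?f 0)\<^sup>2 * re ((P1 *\<^sub>v v) \<bullet>c v) / 2 \<le> 0"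
    proof (rule dissipation_scaled_vec[OF _ _ _ _ v P0 P1 WB _ diss])
      show "(?f has_real_derivative (- 1) *\<^sub>R exp (- 1 * x) - (- 2) *\<^sub>R exp (- 2 * x)) (at x)" for x
        by (intro DERIV_diff deriv)
      show "sq_integrable half_line ?f" by (intro sq_integrable_diff sq) auto
      show "sq_integrable half_line (\<lambda>x::real. (- 1) *\<^sub>R exp (- 1 * x) - (- 2) *\<^sub>R exp (- 2 * x))"
        by (intro sq_integrable_diff sq_integrable_scaleR sq) auto
    qed (auto intro!: continuous_intros)
    have I: "(LINT \<zeta>|half_line. (?f \<zeta>)\<^sup>2) = 1 / 12"
    proof -
      have "(?f \<zeta>)\<^sup>2 = (exp (- 2 * \<zeta>) - 2 * exp (- 3 * \<zeta>)) + exp (- 4 * \<zeta>)" for \<zeta> :: real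
        unfolding power2_diff exp2 by (simp add: mult.assoc flip: exp_add)
      moreover have "integrable half_line (\<lambda>\<zeta>::real. exp (- 2 * \<zeta>))" "integrable half_line (\<lambda>\<zeta>::real. 2 * exp (- 3 * \<zeta>))"
        "integrable half_line (\<lambda>\<zeta>::real. exp (- 4 * \<zeta>))"
        using exp_half_line_0(1)[of 2] exp_half_line_0(1)[of 3] exp_half_line_0(1)[of 4] by auto
      moreover have "(LINT \<zeta>|half_line. exp (- 2 * \<zeta>)) = 1 / (2::real)" "(LINT \<zeta>|half_line. 2 * exp (- 3 * \<zeta>)) = 2 / (3::real)"
        "(LINT \<zeta>|half_line. exp (- 4 * \<zeta>)) = 1 / (4::real)"
        using exp_half_line_0(2)[of 2] exp_half_line_0(2)[of 3] exp_half_line_0(2)[of 4] by auto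
      ultimately show ?thesis
        by (simp only: Bochner_Integration.integral_add Bochner_Integration.integral_diff Bochner_Integration.integrable_diff)
    qed
    show ?thesis using le unfolding I by simp
  qed
qed

section \<open>Multiplication operators on the Hilbert space\<close>

text \<open>The extension by 0 to the orthogonal complement of \<open>L2 d\<close>.\<close>

definition mul :: "nat \<Rightarrow> (real \<Rightarrow> 'f::real_or_complex mat) \<Rightarrow> 'f hilbert \<Rightarrow> 'f hilbert" where
  "mul d M q = embed d (mult_op M (proj d q))"

lemma mul_embed: "Linf_mat d M \<Longrightarrow> x \<in> L2 d \<Longrightarrow> mul d M (embed d x) = embed d (mult_op M x)"
  unfolding mul_def
proof (subst embed_eq_iff)
  assume M: "Linf_mat d M" and x: "x \<in> L2 d"
  show "ae_eq (mult_op M (proj d (embed d x))) (mult_op M x)"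
    using proj_embed[OF x] unfolding ae_eq_def mult_op_def by eventually_elim simp
qed (auto intro: mult_op_L2 proj_L2)

lemma mul_proj: "Linf_mat d M \<Longrightarrow> mul d M (embed d (proj d q)) = mul d M q"
  by (simp add: mul_embed proj_L2) (simp add: mul_def)

lemma proj_mul: "Linf_mat d M \<Longrightarrow> embed d (proj d (mul d M q)) = mul d M q"
  unfolding mul_def by (intro embed_proj_embed mult_op_L2 proj_L2)

lemma bounded_linear_mul:
  fixes M :: "real \<Rightarrow> 'f::real_or_complex mat"
  assumes M: "Linf_mat d M"
  shows "bounded_linear (mul d M)"
proof -
  obtain K where K: "\<And>x. x \<in> L2 d \<Longrightarrow> norm (embed d (mult_op M x)) \<le> norm (embed d x) * K"
    using mult_op_bounded[OF M] by blast
  have Mc: "M \<zeta> \<in> carrier_mat d d" if "0 \<le> \<zeta>" for \<zeta> using M that by (simp add: Linf_mat_def)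
  show ?thesis
  proof (rule bounded_linear_intro)
    fix q r :: "'f hilbert" and c :: real
    note L2 = proj_L2[of d q] proj_L2[of d r]
    have "mul d M (q + r) = mul d M (embed d (\<lambda>\<zeta>. proj d q \<zeta> + proj d r \<zeta>))"
      using mul_proj[OF M, of "q + r"] by (simp add: embed_proj_add embed_add L2)
    also have "\<dots> = embed d (mult_op M (\<lambda>\<zeta>. proj d q \<zeta> + proj d r \<zeta>))" by (intro mul_embed M L2_add L2)
    also have "\<dots> = embed d (\<lambda>\<zeta>. mult_op M (proj d q) \<zeta> + mult_op M (proj d r) \<zeta>)"
    proof (subst embed_eq_iff)
      show "ae_eq (mult_op M (\<lambda>\<zeta>. proj d q \<zeta> + proj d r \<zeta>)) (\<lambda>\<zeta>. mult_op M (proj d q) \<zeta> + mult_op M (proj d r) \<zeta>)"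
        unfolding ae_eq_def mult_op_def using AE_half_line_nonneg
      proof eventually_elim
        case (elim \<zeta>)
        show ?case by (rule mult_add_distrib_mat_vec[OF Mc[OF elim] L2_carrier[OF L2(1) elim] L2_carrier[OF L2(2) elim]])
      qed
    qed (intro mult_op_L2 M L2_add L2)+
    also have "\<dots> = mul d M q + mul d M r" unfolding mul_def by (intro embed_add mult_op_L2 M L2)
    finally show "mul d M (q + r) = mul d M q + mul d M r" .
    have "mul d M (c *\<^sub>R q) = mul d M (embed d (\<lambda>\<zeta>. of_real c \<cdot>\<^sub>v proj d q \<zeta>))"
      using mul_proj[OF M, of "c *\<^sub>R q"] by (simp add: embed_proj_scaleR embed_scaleR L2)
    also have "\<dots> = embed d (mult_op M (\<lambda>\<zeta>. of_real c \<cdot>\<^sub>v proj d q \<zeta>))" by (intro mul_embed M L2_smult L2)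
    also have "\<dots> = embed d (\<lambda>\<zeta>. of_real c \<cdot>\<^sub>v mult_op M (proj d q) \<zeta>)"
    proof (subst embed_eq_iff)
      show "ae_eq (mult_op M (\<lambda>\<zeta>. of_real c \<cdot>\<^sub>v proj d q \<zeta>)) (\<lambda>\<zeta>. of_real c \<cdot>\<^sub>v mult_op M (proj d q) \<zeta>)"
        unfolding ae_eq_def mult_op_def using AE_half_line_nonneg
      proof eventually_elim
        case (elim \<zeta>)
        show ?case by (rule mult_mat_vec[OF Mc[OF elim] L2_carrier[OF L2(1) elim]])
      qed
    qed (intro mult_op_L2 M L2_smult L2)+
    also have "\<dots> = c *\<^sub>R mul d M q" unfolding mul_def by (intro embed_scaleR mult_op_L2 M L2)
    finally show "mul d M (c *\<^sub>R q) = c *\<^sub>R mul d M q" .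
    have "norm (mul d M q) \<le> norm (embed d (proj d q)) * K" unfolding mul_def by (rule K[OF L2(1)])
    also have "\<dots> \<le> norm (embed d (proj d q)) * \<bar>K\<bar>" by (intro mult_left_mono) auto
    also have "\<dots> \<le> norm q * \<bar>K\<bar>" by (intro mult_right_mono norm_embed_proj) auto
    finally show "norm (mul d M q) \<le> norm q * \<bar>K\<bar>" .
  qed
qed

lemma mul_comp:
  assumes "Linf_mat d M" "Linf_mat d N" "AE \<zeta> in half_line. \<forall>v\<in>carrier_vec d. M \<zeta> *\<^sub>v (N \<zeta> *\<^sub>v v) = L \<zeta> *\<^sub>v v" "Linf_mat d L"
  shows "mul d M (mul d N q) = mul d L q"
proof -
  note L2 = proj_L2[of d q]
  have "mul d M (mul d N q) = embed d (mult_op M (mult_op N (proj d q)))"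
    unfolding mul_def[of d N] by (intro mul_embed mult_op_L2 assms L2)
  also have "\<dots> = embed d (mult_op L (proj d q))"
  proof (subst embed_eq_iff)
    show "ae_eq (mult_op M (mult_op N (proj d q))) (mult_op L (proj d q))"
      unfolding ae_eq_def mult_op_def using assms(3) AE_half_line_nonneg
      by eventually_elim (use L2_carrier[OF L2] in blast)
  qed (intro mult_op_L2 assms L2)+
  finally show ?thesis by (simp add: mul_def)
qed

lemma inner_mul:
  assumes M: "Linf_mat d M"
  shows "inner (mul d M q) r = (LINT \<zeta>|half_line. re ((M \<zeta> *\<^sub>v proj d q \<zeta>) \<bullet>c proj d r \<zeta>))"
proof -
  have L2: "mult_op M (proj d q) \<in> L2 d" by (intro mult_op_L2 M proj_L2)
  have "inner (mul d M q) r = inner (embed d (proj d (mul d M q))) r" by (simp only: proj_mul[OF M])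
  also have "\<dots> = inner (mul d M q) (embed d (proj d r))" by (subst inner_embed_proj) (simp only: proj_mul[OF M])
  also have "\<dots> = re (L2_inner (mult_op M (proj d q)) (proj d r))"
    unfolding mul_def by (intro inner_embed L2 proj_L2)
  also have "\<dots> = (LINT \<zeta>|half_line. re (mult_op M (proj d q) \<zeta> \<bullet>c proj d r \<zeta>))"
    by (rule re_L2_inner_form(1)[OF L2 proj_L2])
  finally show ?thesis by (simp only: mult_op_def)
qed

text \<open>Multiplication by a scalar of the field, since the Hilbert space is a real one. For \<open>a = 1\<close> this
  is the projection onto \<open>L2 d\<close>.\<close>

abbreviation lin :: "nat \<Rightarrow> 'f::real_or_complex \<Rightarrow> 'f hilbert \<Rightarrow> 'f hilbert" where
  "lin d a \<equiv> mul d (\<lambda>_. a \<cdot>\<^sub>m 1\<^sub>m d)"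

lemma Linf_scalar: "Linf_mat d (\<lambda>_. a \<cdot>\<^sub>m 1\<^sub>m d)"
  by (rule Linf_const) simp

lemma scalar_mult_vec: "v \<in> carrier_vec d \<Longrightarrow> (a \<cdot>\<^sub>m 1\<^sub>m d) *\<^sub>v v = a \<cdot>\<^sub>v (v :: 'f::real_or_complex vec)"
  by (intro eq_vecI) auto

lemma lin_embed:
  assumes "x \<in> L2 d"
  shows "lin d a (embed d x) = embed d (\<lambda>\<zeta>. a \<cdot>\<^sub>v x \<zeta>)"
proof -
  have "embed d (mult_op (\<lambda>_. a \<cdot>\<^sub>m 1\<^sub>m d) x) = embed d (\<lambda>\<zeta>. a \<cdot>\<^sub>v x \<zeta>)"
  proof (subst embed_eq_iff)
    show "ae_eq (mult_op (\<lambda>_. a \<cdot>\<^sub>m 1\<^sub>m d) x) (\<lambda>\<zeta>. a \<cdot>\<^sub>v x \<zeta>)"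
      unfolding ae_eq_def mult_op_def using AE_half_line_nonneg
      by eventually_elim (rule scalar_mult_vec[OF L2_carrier[OF assms]])
  qed (intro mult_op_L2 Linf_scalar L2_smult assms)+
  then show ?thesis by (simp only: mul_embed[OF Linf_scalar assms])
qed

lemma lin_of_real: "lin d (of_real c) q = c *\<^sub>R embed d (proj d q)"
  using lin_embed[OF proj_L2[of d q], of "of_real c"] mul_proj[OF Linf_scalar, of d "of_real c" q]
  by (simp add: embed_scaleR proj_L2)

lemma lin_one: "lin d 1 q = embed d (proj d q)"
  using lin_of_real[of d 1 q] by simp

lemma lin_mul:
  assumes M: "Linf_mat d M"
  shows "mul d M (lin d a q) = lin d a (mul d M q)"
proof -
  have L: "Linf_mat d (\<lambda>\<zeta>. a \<cdot>\<^sub>m M \<zeta>)"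
    unfolding Linf_mat_def
  proof (intro conjI allI impI)
    show "a \<cdot>\<^sub>m M \<zeta> \<in> carrier_mat d d" if "0 \<le> \<zeta>" for \<zeta> using M that by (simp add: Linf_mat_def)
    fix i j assume ij: "i < d" "j < d"
    have eq: "(a \<cdot>\<^sub>m M \<zeta>) $$ (i, j) = a * M \<zeta> $$ (i, j)" if "0 \<le> \<zeta>" for \<zeta>
    proof -
      have "M \<zeta> \<in> carrier_mat d d" using M that by (simp add: Linf_mat_def)
      then show ?thesis using ij by simp
    qed
    have "(\<lambda>\<zeta>. a * M \<zeta> $$ (i, j)) \<in> borel_measurable half_line"
      using M ij by (auto simp: Linf_mat_def intro!: borel_measurable_times)
    then show "(\<lambda>\<zeta>. (a \<cdot>\<^sub>m M \<zeta>) $$ (i, j)) \<in> borel_measurable half_line"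
      by (rule measurable_cong[THEN iffD1, rotated]) (simp add: space_restrict_space eq)
    have "\<exists>C. AE \<zeta> in half_line. norm (M \<zeta> $$ (i, j)) \<le> C" using M ij by (simp add: Linf_mat_def)
    then obtain C where "AE \<zeta> in half_line. norm (M \<zeta> $$ (i, j)) \<le> C" by blast
    then have "AE \<zeta> in half_line. norm ((a \<cdot>\<^sub>m M \<zeta>) $$ (i, j)) \<le> norm a * C"
      using AE_half_line_nonneg by eventually_elim (simp add: eq norm_mult mult_left_mono)
    then show "\<exists>C. AE \<zeta> in half_line. norm ((a \<cdot>\<^sub>m M \<zeta>) $$ (i, j)) \<le> C" by blast
  qed
  have Mc: "M \<zeta> \<in> carrier_mat d d" if "0 \<le> \<zeta>" for \<zeta> using M that by (simp add: Linf_mat_def)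
  have "M \<zeta> *\<^sub>v ((a \<cdot>\<^sub>m 1\<^sub>m d) *\<^sub>v v) = (a \<cdot>\<^sub>m M \<zeta>) *\<^sub>v v" "(a \<cdot>\<^sub>m 1\<^sub>m d) *\<^sub>v (M \<zeta> *\<^sub>v v) = (a \<cdot>\<^sub>m M \<zeta>) *\<^sub>v v"
    if "0 \<le> \<zeta>" "v \<in> carrier_vec d" for v \<zeta>
  proof -
    have "(a \<cdot>\<^sub>m M \<zeta>) *\<^sub>v v = a \<cdot>\<^sub>v (M \<zeta> *\<^sub>v v)"
      using Mc[OF that(1)] that(2) by (intro eq_vecI) (auto simp: row_smult)
    then show "M \<zeta> *\<^sub>v ((a \<cdot>\<^sub>m 1\<^sub>m d) *\<^sub>v v) = (a \<cdot>\<^sub>m M \<zeta>) *\<^sub>v v" "(a \<cdot>\<^sub>m 1\<^sub>m d) *\<^sub>v (M \<zeta> *\<^sub>v v) = (a \<cdot>\<^sub>m M \<zeta>) *\<^sub>v v"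
      using Mc[OF that(1)] that(2) by (simp_all add: scalar_mult_vec mult_mat_vec)
  qed
  then have "AE \<zeta> in half_line. \<forall>v\<in>carrier_vec d. M \<zeta> *\<^sub>v ((a \<cdot>\<^sub>m 1\<^sub>m d) *\<^sub>v v) = (a \<cdot>\<^sub>m M \<zeta>) *\<^sub>v v"
    "AE \<zeta> in half_line. \<forall>v\<in>carrier_vec d. (a \<cdot>\<^sub>m 1\<^sub>m d) *\<^sub>v (M \<zeta> *\<^sub>v v) = (a \<cdot>\<^sub>m M \<zeta>) *\<^sub>v v"
    using AE_half_line_nonneg by auto
  from mul_comp[OF M Linf_scalar this(1) L] mul_comp[OF Linf_scalar M this(2) L] show ?thesis by simp
qed

lemma embed_lincomb:
  assumes "x \<in> L2 d" "z \<in> L2 d"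
  shows "embed d (\<lambda>\<zeta>. a \<cdot>\<^sub>v x \<zeta> + z \<zeta>) = lin d a (embed d x) + embed d z"
  by (simp add: embed_add[OF L2_smult[OF assms(1)] assms(2)] lin_embed[OF assms(1)])

section \<open>The weighted inner product\<close>

locale weight =
  fixes d :: nat and H H_inv :: "real \<Rightarrow> 'f::real_or_complex mat"
  assumes H: "Linf_mat d H" "AE \<zeta> in half_line. pos_def_mat d (H \<zeta>)"
    and H_inv: "Linf_mat d H_inv"
      "AE \<zeta> in half_line. inverts_mat (H \<zeta>) (H_inv \<zeta>) \<and> inverts_mat (H_inv \<zeta>) (H \<zeta>)"
begin

text \<open>The extensions of \<open>H\<close> and its inverse by the identity on the orthogonal complement of \<open>L2 d\<close>, which
  are inverse to each other on the whole Hilbert space.\<close>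

definition E :: "'f hilbert \<Rightarrow> 'f hilbert" where
  "E q = mul d H q + (q - embed d (proj d q))"

definition F :: "'f hilbert \<Rightarrow> 'f hilbert" where
  "F q = mul d H_inv q + (q - embed d (proj d q))"

abbreviation weighted_inner :: "(real \<Rightarrow> 'f vec) \<Rightarrow> (real \<Rightarrow> 'f vec) \<Rightarrow> 'f" where
  "weighted_inner \<equiv> \<lambda>x z. L2_inner x (mult_op H z)"

lemma bounded_linear_EF: "bounded_linear E" "bounded_linear F"
  unfolding E_def[abs_def] F_def[abs_def]
  by (intro bounded_linear_add bounded_linear_sub bounded_linear_ident bounded_linear_embed_proj bounded_linear_mul H H_inv)+

lemma E_embed: "x \<in> L2 d \<Longrightarrow> E (embed d x) = embed d (mult_op H x)"
  by (simp add: E_def mul_embed[OF H(1)] embed_proj_embed)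

lemma mult_op_inverse:
  assumes "x \<in> L2 d"
  shows "ae_eq (mult_op H (mult_op H_inv x)) x" "ae_eq (mult_op H_inv (mult_op H x)) x"
proof -
  have cancel: "M *\<^sub>v (N *\<^sub>v v) = v"
    if "inverts_mat M N" "M \<in> carrier_mat d d" "N \<in> carrier_mat d d" "v \<in> carrier_vec d" for M N :: "'f mat" and v
    using that assoc_mult_mat_vec[of M d d N d v] by (simp add: inverts_mat_def)
  have c: "H \<zeta> \<in> carrier_mat d d" "H_inv \<zeta> \<in> carrier_mat d d" if "0 \<le> \<zeta>" for \<zeta>
    using H(1) H_inv(1) that by (simp_all add: Linf_mat_def)
  show "ae_eq (mult_op H (mult_op H_inv x)) x"
    unfolding ae_eq_def mult_op_def using H_inv(2) AE_half_line_nonneg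
    by eventually_elim (use c L2_carrier[OF assms] cancel in blast)
  show "ae_eq (mult_op H_inv (mult_op H x)) x"
    unfolding ae_eq_def mult_op_def using H_inv(2) AE_half_line_nonneg
    by eventually_elim (use c L2_carrier[OF assms] cancel in blast)
qed

lemma mul_inverse: "mul d H (mul d H_inv q) = embed d (proj d q)" "mul d H_inv (mul d H q) = embed d (proj d q)"
proof -
  note L2 = proj_L2[of d q]
  have "mul d H (mul d H_inv q) = embed d (mult_op H (mult_op H_inv (proj d q)))"
    unfolding mul_def[of d H_inv] by (intro mul_embed mult_op_L2 H H_inv L2)
  also have "\<dots> = embed d (proj d q)"
    by (rule embed_eq_iff[THEN iffD2]) (intro mult_op_L2 H H_inv L2 mult_op_inverse)+
  finally show "mul d H (mul d H_inv q) = embed d (proj d q)" .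
  have "mul d H_inv (mul d H q) = embed d (mult_op H_inv (mult_op H (proj d q)))"
    unfolding mul_def[of d H] by (intro mul_embed mult_op_L2 H H_inv L2)
  also have "\<dots> = embed d (proj d q)"
    by (rule embed_eq_iff[THEN iffD2]) (intro mult_op_L2 H H_inv L2 mult_op_inverse)+
  finally show "mul d H_inv (mul d H q) = embed d (proj d q)" .
qed

lemma vanish_on_complement:
  "embed d (proj d (q - embed d (proj d q))) = 0"
  "Linf_mat d M \<Longrightarrow> mul d M (q - embed d (proj d q)) = 0"
proof -
  have idem: "embed d (proj d (embed d (proj d q))) = embed d (proj d q)" by (rule embed_proj_embed[OF proj_L2])
  show *: "embed d (proj d (q - embed d (proj d q))) = 0"
    using bounded_linear.linear[OF bounded_linear_embed_proj, THEN linear_diff, of d q "embed d (proj d q)"] idem by simp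
  assume M: "Linf_mat d M"
  have "mul d M (q - embed d (proj d q)) = mul d M (embed d (proj d (q - embed d (proj d q))))"
    by (simp only: mul_proj[OF M])
  also have "\<dots> = 0" unfolding * by (rule linear_0[OF bounded_linear.linear[OF bounded_linear_mul[OF M]]])
  finally show "mul d M (q - embed d (proj d q)) = 0" .
qed

lemma EF_inverse: "E (F q) = q" "F (E q) = q"
proof -
  have add: "mul d M (q + r) = mul d M q + mul d M r" if "Linf_mat d M" for M :: "real \<Rightarrow> 'f mat" and q r
    by (rule linear_add[OF bounded_linear.linear[OF bounded_linear_mul[OF that]]])
  show "E (F q) = q"
    unfolding E_def F_def
    by (simp add: add H(1) vanish_on_complement H_inv(1) mul_inverse embed_proj_add proj_mul)
  show "F (E q) = q"
    unfolding E_def F_def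
    by (simp add: add H(1) vanish_on_complement H_inv(1) mul_inverse embed_proj_add proj_mul)
qed

lemma E_sym: "inner (E q) r = inner q (E r)"
proof -
  have "inner (mul d H q) r = inner (mul d H r) q"
    unfolding inner_mul[OF H(1)]
  proof (rule integral_cong_AE)
    show "AE \<zeta> in half_line. re ((H \<zeta> *\<^sub>v proj d q \<zeta>) \<bullet>c proj d r \<zeta>) = re ((H \<zeta> *\<^sub>v proj d r \<zeta>) \<bullet>c proj d q \<zeta>)"
      using H(2) AE_half_line_nonneg
    proof eventually_elim
      case (elim \<zeta>)
      then have h: "hermitian_mat d (H \<zeta>)" by (simp add: pos_def_mat_def)
      note c = L2_carrier[OF proj_L2[of d q] elim(2)] L2_carrier[OF proj_L2[of d r] elim(2)]
      have "(H \<zeta> *\<^sub>v proj d q \<zeta>) \<bullet>c proj d r \<zeta> = conjugate ((H \<zeta> *\<^sub>v proj d r \<zeta>) \<bullet>c proj d q \<zeta>)"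
        using hermitian_form[OF h c] scalar_prod_conjugate[of "H \<zeta> *\<^sub>v proj d r \<zeta>" d "proj d q \<zeta>"] h c
          mult_mat_vec_carrier[of "H \<zeta>" d d "proj d r \<zeta>"]
        by (simp add: hermitian_mat_def)
      then show ?case by (simp only: re_conjugate)
    qed
  qed (use re_L2_inner_form(2)[OF mult_op_L2[OF H(1) proj_L2] proj_L2] in \<open>auto simp: mult_op_def\<close>)
  moreover have "inner (embed d (proj d q)) r = inner (embed d (proj d r)) q"
    using inner_embed_proj[of d q r] inner_embed_proj[of d r q] by (simp add: inner_commute)
  ultimately show ?thesis
    unfolding E_def by (simp add: inner_add inner_diff inner_commute)
qed

lemma E_nonneg: "0 \<le> inner q (E q)"
proof -
  have "0 \<le> inner (mul d H q) q"
    unfolding inner_mul[OF H(1)]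
  proof (rule integral_nonneg_AE)
    show "AE \<zeta> in half_line. 0 \<le> re ((H \<zeta> *\<^sub>v proj d q \<zeta>) \<bullet>c proj d q \<zeta>)"
      using H(2) AE_half_line_nonneg
    proof eventually_elim
      case (elim \<zeta>)
      then have h: "hermitian_mat d (H \<zeta>)" by (simp add: pos_def_mat_def)
      note c = L2_carrier[OF proj_L2[of d q] elim(2)]
      show ?case
      proof (cases "proj d q \<zeta> = 0\<^sub>v d")
        case True
        moreover have "H \<zeta> *\<^sub>v 0\<^sub>v d \<in> carrier_vec d"
          using h mult_mat_vec_carrier[of "H \<zeta>" d d "0\<^sub>v d"] by (simp add: hermitian_mat_def)
        ultimately show ?thesis by (simp add: re_def scalar_prod_right_zero[of _ d])
      next
        case False
        then have "0 \<le> (H \<zeta> *\<^sub>v proj d q \<zeta>) \<bullet>c proj d q \<zeta>" using elim c by (simp add: pos_def_mat_def less_imp_le)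
        then show ?thesis using re_nonneg_form_iff[OF h c] by simp
      qed
    qed
  qed
  moreover have "inner (embed d (proj d q)) q \<le> inner q q"
  proof -
    have "inner (embed d (proj d q)) q = (norm (embed d (proj d q)))\<^sup>2"
      using inner_embed_proj[of d q q] by (simp add: power2_norm_eq_inner)
    also have "\<dots> \<le> (norm q)\<^sup>2" by (intro power_mono norm_embed_proj) simp
    finally show ?thesis by (simp add: power2_norm_eq_inner)
  qed
  ultimately show ?thesis unfolding E_def by (simp add: inner_add inner_diff inner_commute)
qed

lemma ip_norm_eq: "x \<in> L2 d \<Longrightarrow> ip_norm weighted_inner x = sqrt (inner (embed d x) (E (embed d x)))"
  unfolding ip_norm_def by (simp add: E_embed inner_embed mult_op_L2[OF H(1)])

end

section \<open>The derivative operator on the Hilbert space\<close>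

text \<open>The operator \<open>P\<^sub>1 \<partial>/\<partial>\<zeta>\<close> with its boundary condition, extended by 0 to the orthogonal complement of
  \<open>L2 d\<close>.\<close>

definition deriv_dom :: "nat \<Rightarrow> nat \<Rightarrow> 'f::real_or_complex mat \<Rightarrow> 'f hilbert set" where
  "deriv_dom d k WB = {q. proj d q \<in> A_dom d k WB}"

definition deriv_op :: "nat \<Rightarrow> 'f::real_or_complex mat \<Rightarrow> 'f hilbert \<Rightarrow> 'f hilbert" where
  "deriv_op d P1 q = embed d (\<lambda>\<zeta>. P1 *\<^sub>v weak_deriv d (proj d q) \<zeta>)"

lemma embed_mult_mat_cong:
  assumes "P \<in> carrier_mat d d" "x \<in> L2 d" "z \<in> L2 d" "ae_eq x z"
  shows "embed d (\<lambda>\<zeta>. P *\<^sub>v x \<zeta>) = embed d (\<lambda>\<zeta>. P *\<^sub>v z \<zeta>)"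
proof -
  have "mul d (\<lambda>_. P) (embed d x) = mul d (\<lambda>_. P) (embed d z)"
    using embed_eq_iff[OF assms(2,3)] assms(4) by simp
  then show ?thesis
    unfolding mul_embed[OF Linf_const[OF assms(1)] assms(2)] mul_embed[OF Linf_const[OF assms(1)] assms(3)]
    by (simp add: mult_op_def)
qed

lemma deriv_domI:
  assumes rep: "sobolev_rep d x u g" and u0: "WB *\<^sub>v u 0 = 0\<^sub>v k" and q: "embed d (proj d q) = embed d x"
    and P1: "P1 \<in> carrier_mat d d"
  shows "q \<in> deriv_dom d k WB" "deriv_op d P1 q = mul d (\<lambda>_. P1) (embed d g)"
proof -
  have "ae_eq (proj d q) x" using q embed_eq_iff[OF proj_L2 sobolev_repD(1)[OF rep]] by blast
  then have rep': "sobolev_rep d (proj d q) u g" by (rule rep_cong[OF rep proj_L2])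
  show "q \<in> deriv_dom d k WB" using rep_A_dom[OF rep' u0] by (simp add: deriv_dom_def)
  show "deriv_op d P1 q = mul d (\<lambda>_. P1) (embed d g)"
    using embed_mult_mat_cong[OF P1 rep_weak_deriv(1)[OF rep'] sobolev_repD(2)[OF rep'] rep_weak_deriv(2)[OF rep']]
    by (simp add: deriv_op_def mul_embed[OF Linf_const[OF P1] sobolev_repD(2)[OF rep]] mult_op_def)
qed

lemma deriv_domE:
  assumes "q \<in> deriv_dom d k WB" "P1 \<in> carrier_mat d d"
  obtains u g where "sobolev_rep d (proj d q) u g" "WB *\<^sub>v u 0 = 0\<^sub>v k" "deriv_op d P1 q = mul d (\<lambda>_. P1) (embed d g)"
proof -
  obtain u g where rep: "sobolev_rep d (proj d q) u g" and u0: "WB *\<^sub>v u 0 = 0\<^sub>v k"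
    using A_dom_rep assms(1) unfolding deriv_dom_def by blast
  from that[OF this deriv_domI(2)[OF this refl assms(2)]] show ?thesis .
qed

lemma deriv_op_lincomb:
  assumes q: "q \<in> deriv_dom d k WB" and r: "r \<in> deriv_dom d k WB" and P1: "P1 \<in> carrier_mat d d"
    and WB: "WB \<in> carrier_mat k d" and s: "embed d (proj d s) = lin d a q + embed d (proj d r)"
  shows "s \<in> deriv_dom d k WB" "deriv_op d P1 s = lin d a (deriv_op d P1 q) + deriv_op d P1 r"
proof -
  obtain u g where q': "sobolev_rep d (proj d q) u g" "WB *\<^sub>v u 0 = 0\<^sub>v k" "deriv_op d P1 q = mul d (\<lambda>_. P1) (embed d g)"
    using deriv_domE[OF q P1] .
  obtain v h where r': "sobolev_rep d (proj d r) v h" "WB *\<^sub>v v 0 = 0\<^sub>v k" "deriv_op d P1 r = mul d (\<lambda>_. P1) (embed d h)"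
    using deriv_domE[OF r P1] .
  have uv: "u 0 \<in> carrier_vec d" "v 0 \<in> carrier_vec d" using sobolev_repD(3) q'(1) r'(1) by blast+
  have s': "embed d (proj d s) = embed d (\<lambda>\<zeta>. a \<cdot>\<^sub>v proj d q \<zeta> + proj d r \<zeta>)"
    using s by (simp only: embed_lincomb[OF proj_L2 proj_L2] mul_proj[OF Linf_scalar])
  have zero: "a \<cdot>\<^sub>v 0\<^sub>v k + 0\<^sub>v k = 0\<^sub>v k" by (rule eq_vecI) auto
  have 0: "WB *\<^sub>v (a \<cdot>\<^sub>v u 0 + v 0) = 0\<^sub>v k"
    using uv zero by (simp add: mult_add_distrib_mat_vec[OF WB] mult_mat_vec[OF WB] q'(2) r'(2))
  show "s \<in> deriv_dom d k WB" by (rule deriv_domI(1)[OF rep_lincomb[OF q'(1) r'(1)] 0 s' P1])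
  have gh: "g \<in> L2 d" "h \<in> L2 d" using sobolev_repD(2) q'(1) r'(1) by blast+
  have "deriv_op d P1 s = mul d (\<lambda>_. P1) (embed d (\<lambda>\<zeta>. a \<cdot>\<^sub>v g \<zeta> + h \<zeta>))"
    by (rule deriv_domI(2)[OF rep_lincomb[OF q'(1) r'(1)] 0 s' P1])
  also have "\<dots> = mul d (\<lambda>_. P1) (lin d a (embed d g)) + mul d (\<lambda>_. P1) (embed d h)"
    unfolding embed_lincomb[OF gh]
    by (rule linear_add[OF bounded_linear.linear[OF bounded_linear_mul[OF Linf_const[OF P1]]]])
  finally show "deriv_op d P1 s = lin d a (deriv_op d P1 q) + deriv_op d P1 r"
    by (simp only: lin_mul[OF Linf_const[OF P1]] q'(3) r'(3))
qed

lemma zero_deriv_dom: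
  fixes P1 WB :: "'f::real_or_complex mat"
  assumes WB: "WB \<in> carrier_mat k d" and P1: "P1 \<in> carrier_mat d d"
  shows "0 \<in> deriv_dom d k WB" "deriv_op d P1 0 = 0"
proof -
  have rep: "sobolev_rep d (\<lambda>\<zeta>::real. of_real 0 \<cdot>\<^sub>v 0\<^sub>v d) (\<lambda>\<zeta>. of_real 0 \<cdot>\<^sub>v 0\<^sub>v d) (\<lambda>\<zeta>. of_real 0 \<cdot>\<^sub>v (0\<^sub>v d :: 'f vec))"
    by (rule rep_scaled_vec) (auto simp: sq_integrable_0)
  note L2 = sobolev_repD(1)[OF rep]
  have z: "of_real 0 \<cdot>\<^sub>v 0\<^sub>v d = (0\<^sub>v d :: 'f vec)" by (rule eq_vecI) auto
  have e0: "embed d (\<lambda>\<zeta>. of_real 0 \<cdot>\<^sub>v (0\<^sub>v d :: 'f vec)) = 0"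
    using embed_scaleR[OF L2, of 0] by (simp add: smult_smult_assoc)
  have p0: "embed d (proj d (0 :: 'f hilbert)) = embed d (\<lambda>\<zeta>. of_real 0 \<cdot>\<^sub>v (0\<^sub>v d :: 'f vec))"
    unfolding e0 by (rule linear_0[OF bounded_linear.linear[OF bounded_linear_embed_proj]])
  have "WB *\<^sub>v (of_real 0 \<cdot>\<^sub>v 0\<^sub>v d) = 0\<^sub>v k" unfolding z using WB by (intro eq_vecI) auto
  note dom = deriv_domI[OF rep this p0 P1]
  show "0 \<in> deriv_dom d k WB" by (rule dom(1))
  have "mul d (\<lambda>_. P1) 0 = 0"
    by (rule linear_0[OF bounded_linear.linear[OF bounded_linear_mul[OF Linf_const[OF P1]]]])
  then show "deriv_op d P1 0 = 0" using dom(2) unfolding e0 by (rule trans[rotated])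
qed

context diagonalised
begin

text \<open>On the orthogonal complement of \<open>L2 d\<close> the operator is 0, so the solution of the resolvent
  equation is there the right hand side divided by \<open>l\<close>.\<close>

lemma dissipative_operator_deriv:
  assumes herm: "hermitian_mat d P1"
    and nonneg: "\<And>y. y \<in> carrier_vec d \<Longrightarrow> WB *\<^sub>v y = 0\<^sub>v k \<Longrightarrow> 0 \<le> re ((P1 *\<^sub>v y) \<bullet>c y)" and k: "k \<le> n2"
  shows "dissipative_operator inner (deriv_dom d k WB) (deriv_op d P1) 1"
proof
  note lincomb = deriv_op_lincomb[OF _ _ P1 WB]
  note zero = zero_deriv_dom[OF WB P1]
  have proj_op: "embed d (proj d (deriv_op d P1 q)) = deriv_op d P1 q" if "q \<in> deriv_dom d k WB" for q
    using deriv_domE[OF that P1] by (metis proj_mul[OF Linf_const[OF P1]])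
  have add: "q + r \<in> deriv_dom d k WB \<and> deriv_op d P1 (q + r) = deriv_op d P1 q + deriv_op d P1 r"
    if "q \<in> deriv_dom d k WB" "r \<in> deriv_dom d k WB" for q r
    using lincomb[OF that, of "q + r" 1] that by (simp add: lin_one embed_proj_add proj_op)
  have scale: "c *\<^sub>R q \<in> deriv_dom d k WB \<and> deriv_op d P1 (c *\<^sub>R q) = c *\<^sub>R deriv_op d P1 q"
    if "q \<in> deriv_dom d k WB" for q and c :: real
  proof -
    have "embed d (proj d (0 :: 'f hilbert)) = 0"
      by (rule linear_0[OF bounded_linear.linear[OF bounded_linear_embed_proj]])
    then show ?thesis
      using lincomb[OF that zero(1), of "c *\<^sub>R q" "of_real c"] that zero
      by (simp add: lin_of_real embed_proj_scaleR proj_op)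
  qed
  show "Real_Vector_Spaces.subspace (deriv_dom d k WB)"
    using add scale zero by (simp add: real_vector.subspace_def)
  show "q \<in> deriv_dom d k WB \<Longrightarrow> r \<in> deriv_dom d k WB \<Longrightarrow> deriv_op d P1 (q + r) = deriv_op d P1 q + deriv_op d P1 r" for q r
    using add by blast
  show "q \<in> deriv_dom d k WB \<Longrightarrow> deriv_op d P1 (c *\<^sub>R q) = c *\<^sub>R deriv_op d P1 q" for q c
    using scale by blast
  show "inner (deriv_op d P1 q) q \<le> 0" if dom: "q \<in> deriv_dom d k WB" for q
  proof -
    obtain u g where q: "sobolev_rep d (proj d q) u g" "WB *\<^sub>v u 0 = 0\<^sub>v k" "deriv_op d P1 q = mul d (\<lambda>_. P1) (embed d g)"
      using deriv_domE[OF dom P1] .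
    note q' = sobolev_repD[OF q(1)]
    have op: "deriv_op d P1 q = embed d (\<lambda>\<zeta>. P1 *\<^sub>v g \<zeta>)"
      unfolding q(3) by (simp add: mul_embed[OF Linf_const[OF P1] q'(2)] mult_op_def)
    have L2: "(\<lambda>\<zeta>. P1 *\<^sub>v g \<zeta>) \<in> L2 d" using mult_op_L2[OF Linf_const[OF P1] q'(2)] by (simp add: mult_op_def)
    have "inner (deriv_op d P1 q) q = inner (deriv_op d P1 q) (embed d (proj d q))"
      using inner_embed_proj[of d "deriv_op d P1 q" q] by (simp add: proj_op[OF dom])
    also have "\<dots> = re (L2_inner (\<lambda>\<zeta>. P1 *\<^sub>v g \<zeta>) (proj d q))"
      unfolding op by (rule inner_embed[OF L2 q'(1)])
    also have "\<dots> = - re ((P1 *\<^sub>v u 0) \<bullet>c u 0) / 2"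
      by (rule integration_by_parts_form[OF q(1) herm])
    also have "\<dots> \<le> 0" using nonneg[OF q'(3) q(2)] by simp
    finally show ?thesis .
  qed
  show "\<exists>x\<in>deriv_dom d k WB. l *\<^sub>R x - deriv_op d P1 x = y" if l: "0 < l" for l y
  proof -
    have kn: "k = n2" by (rule boundary_matrix_of_nonneg_form(1)[OF nonneg k])
    have "\<exists>B U. B \<in> carrier_mat n2 n2 \<and> invertible_mat B \<and> U \<in> carrier_mat n2 n1 \<and>
      WB = B * append_cols U (1\<^sub>m n2) * S \<and> pos_semidef_mat n1 (\<Lambda>f + mat_adjoint U * \<Theta>f * U)"
      by (rule boundary_matrix_of_nonneg_form(2)[OF nonneg k])
    then obtain B U where BU: "B \<in> carrier_mat n2 n2" "invertible_mat B" "U \<in> carrier_mat n2 n1" "WB = B * append_cols U (1\<^sub>m n2) * S"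
      by blast
    obtain u g where rep: "sobolev_rep d u u g" and u0: "WB *\<^sub>v u 0 = 0\<^sub>v n2"
      and eq: "\<forall>\<zeta>\<ge>0. of_real l \<cdot>\<^sub>v u \<zeta> - P1 *\<^sub>v g \<zeta> = proj d y \<zeta>"
      using resolvent_equation[OF BU l proj_L2[of d y]] by blast
    note rep' = sobolev_repD[OF rep]
    define x where "x = embed d u + (1 / l) *\<^sub>R (y - embed d (proj d y))"
    have px: "embed d (proj d x) = embed d u"
      unfolding x_def
      by (simp add: embed_proj_add embed_proj_scaleR embed_proj_embed[OF rep'(1)] embed_proj_embed[OF proj_L2]
          linear_diff[OF bounded_linear.linear[OF bounded_linear_embed_proj]])
    note x = deriv_domI[OF rep u0[folded kn] px P1]
    have L2: "(\<lambda>\<zeta>. P1 *\<^sub>v g \<zeta>) \<in> L2 d" "(\<lambda>\<zeta>. of_real l \<cdot>\<^sub>v u \<zeta>) \<in> L2 d"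
      using mult_op_L2[OF Linf_const[OF P1] rep'(2)] L2_smult[OF rep'(1)] by (simp_all add: mult_op_def)
    have "embed d (proj d y) = embed d (\<lambda>\<zeta>. of_real l \<cdot>\<^sub>v u \<zeta> - P1 *\<^sub>v g \<zeta>)"
    proof (rule embed_eq_iff[THEN iffD2, OF proj_L2 L2_diff[OF L2(2,1)]])
      show "ae_eq (proj d y) (\<lambda>\<zeta>. of_real l \<cdot>\<^sub>v u \<zeta> - P1 *\<^sub>v g \<zeta>)"
        unfolding ae_eq_def using AE_half_line_nonneg by eventually_elim (use eq in simp)
    qed
    also have "\<dots> = l *\<^sub>R embed d u - deriv_op d P1 x"
      unfolding embed_diff[OF L2(2,1)] embed_scaleR[OF rep'(1)] x(2)
      by (simp add: mul_embed[OF Linf_const[OF P1] rep'(2)] mult_op_def)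
    finally have "l *\<^sub>R x - deriv_op d P1 x = y"
      using l by (simp add: x_def algebra_simps)
    with x(1) show ?thesis by blast
  qed
qed (use bounded_bilinear.bounded[OF bounded_bilinear_inner, where 'a1 = "'f hilbert"]
      in \<open>auto simp: inner_commute inner_add_left inner_add_right power2_norm_eq_inner\<close>)

end

section \<open>Generation and dissipativity\<close>

lemma AH_eq_A_mult_op: "AH_op d P0 P1 H z = A_op d P0 P1 (mult_op H z)" "AH_dom d k WB H = {x \<in> L2 d. mult_op H x \<in> A_dom d k WB}"
  by (auto simp: AH_op_def A_op_def AH_dom_def A_dom_def)

lemma A_dom_cong:
  assumes x: "x \<in> A_dom d k WB" and z: "z \<in> L2 d" "ae_eq z x"
    and P: "P0 \<in> carrier_mat d d" "P1 \<in> carrier_mat d d"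
  shows "z \<in> A_dom d k WB" "re (L2_inner (A_op d P0 P1 z) z) = re (L2_inner (A_op d P0 P1 x) x)"
proof -
  obtain u g where rep: "sobolev_rep d x u g" and u0: "WB *\<^sub>v u 0 = 0\<^sub>v k" using A_dom_rep[OF x] by blast
  note rep' = rep_cong[OF rep z]
  show "z \<in> A_dom d k WB" by (rule rep_A_dom[OF rep' u0])
  have "ae_eq (A_op d P0 P1 z) (A_op d P0 P1 x)"
    using A_op_rep(2)[OF rep P] A_op_rep(2)[OF rep' P] z(2) unfolding ae_eq_def by eventually_elim simp
  then show "re (L2_inner (A_op d P0 P1 z) z) = re (L2_inner (A_op d P0 P1 x) x)"
    by (intro re_L2_inner_cong[OF A_op_rep(1)[OF rep' P] z(1) A_op_rep(1)[OF rep P] sobolev_repD(1)[OF rep] _ z(2)])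
qed

lemma embed_deriv_dom:
  assumes y: "y \<in> L2 d" and P: "P0 \<in> carrier_mat d d" "P1 \<in> carrier_mat d d"
  shows "embed d y \<in> deriv_dom d k WB \<longleftrightarrow> y \<in> A_dom d k WB"
    and "y \<in> A_dom d k WB \<Longrightarrow> deriv_op d P1 (embed d y) + mul d (\<lambda>_. P0) (embed d y) = embed d (A_op d P0 P1 y)"
proof -
  have ae: "ae_eq (proj d (embed d y)) y" by (rule proj_embed[OF y])
  then have ae': "ae_eq y (proj d (embed d y))" unfolding ae_eq_def by eventually_elim simp
  show "embed d y \<in> deriv_dom d k WB \<longleftrightarrow> y \<in> A_dom d k WB"
    unfolding deriv_dom_def using A_dom_cong(1)[OF _ proj_L2 ae P] A_dom_cong(1)[OF _ y ae' P] by blast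
  assume "y \<in> A_dom d k WB"
  then obtain u g where rep: "sobolev_rep d y u g" and u0: "WB *\<^sub>v u 0 = 0\<^sub>v k" using A_dom_rep by blast
  note g = sobolev_repD(2)[OF rep]
  have "deriv_op d P1 (embed d y) + mul d (\<lambda>_. P0) (embed d y) = embed d (mult_op (\<lambda>_. P1) g) + embed d (mult_op (\<lambda>_. P0) y)"
    using deriv_domI(2)[OF rep u0 embed_proj_embed[OF y] P(2)]
    by (simp only: mul_embed[OF Linf_const[OF P(2)] g] mul_embed[OF Linf_const[OF P(1)] y])
  also have "\<dots> = embed d (\<lambda>\<zeta>. mult_op (\<lambda>_. P0) y \<zeta> + mult_op (\<lambda>_. P1) g \<zeta>)"
    by (simp add: embed_add[OF mult_op_L2[OF Linf_const[OF P(1)] y] mult_op_L2[OF Linf_const[OF P(2)] g]] add.commute)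
  also have "\<dots> = embed d (A_op d P0 P1 y)"
  proof (rule embed_eq_iff[THEN iffD2])
    show "ae_eq (\<lambda>\<zeta>. mult_op (\<lambda>_. P0) y \<zeta> + mult_op (\<lambda>_. P1) g \<zeta>) (A_op d P0 P1 y)"
      using A_op_rep(2)[OF rep P] unfolding ae_eq_def mult_op_def by eventually_elim simp
  qed (intro L2_add mult_op_L2 Linf_const P y g A_op_rep(1)[OF rep])+
  finally show "deriv_op d P1 (embed d y) + mul d (\<lambda>_. P0) (embed d y) = embed d (A_op d P0 P1 y)" .
qed

context weight
begin

text \<open>The weighted norm is equivalent to the norm of the Hilbert space.\<close>

lemma ip_norm_tendsto_iff:
  assumes w: "\<forall>\<^sub>F t in at_right (0::real). w t \<in> L2 d"
  shows "((\<lambda>t. ip_norm weighted_inner (w t)) \<longlongrightarrow> 0) (at_right 0) \<longleftrightarrow> ((\<lambda>t. embed d (w t)) \<longlongrightarrow> 0) (at_right 0)"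
proof -
  have "\<forall>\<^sub>F t in at_right 0. ip_norm weighted_inner (w t) = sqrt (inner (embed d (w t)) (E (embed d (w t))))"
    using w by eventually_elim (rule ip_norm_eq)
  then have "((\<lambda>t. ip_norm weighted_inner (w t)) \<longlongrightarrow> 0) (at_right 0) \<longleftrightarrow>
      ((\<lambda>t. sqrt (inner (embed d (w t)) (E (embed d (w t))))) \<longlongrightarrow> 0) (at_right 0)"
    by (rule tendsto_cong)
  also have "\<dots> \<longleftrightarrow> ((\<lambda>t. embed d (w t)) \<longlongrightarrow> 0) (at_right 0)"
  proof
    assume lim: "((\<lambda>t. sqrt (inner (embed d (w t)) (E (embed d (w t))))) \<longlongrightarrow> 0) (at_right 0)"
    obtain k where k: "k > 0" "\<forall>q. 1 / k * (norm q)\<^sup>2 \<le> inner q (E q)"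
      using coercive_if_bounded_inverse[OF bounded_linear_EF(1) E_sym E_nonneg bounded_linear_EF(2) EF_inverse(1)] by blast
    show "((\<lambda>t. embed d (w t)) \<longlongrightarrow> 0) (at_right 0)"
    proof (rule Lim_null_comparison)
      have "norm q \<le> sqrt k * sqrt (inner q (E q))" for q
      proof -
        have "(norm q)\<^sup>2 \<le> k * inner q (E q)" using k(1) spec[OF k(2), of q] by (simp add: field_simps)
        then have "norm q \<le> sqrt (k * inner q (E q))" by (rule real_le_rsqrt)
        then show ?thesis by (simp only: real_sqrt_mult)
      qed
      then show "\<forall>\<^sub>F t in at_right 0. norm (embed d (w t)) \<le> sqrt k * sqrt (inner (embed d (w t)) (E (embed d (w t))))" by simp
      show "((\<lambda>t. sqrt k * sqrt (inner (embed d (w t)) (E (embed d (w t))))) \<longlongrightarrow> 0) (at_right 0)"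
        using tendsto_mult_left[OF lim, of "sqrt k"] by simp
    qed
  next
    assume lim: "((\<lambda>t. embed d (w t)) \<longlongrightarrow> 0) (at_right 0)"
    have "((\<lambda>t. sqrt (inner (embed d (w t)) (E (embed d (w t))))) \<longlongrightarrow> sqrt (inner 0 (E 0))) (at_right 0)"
      by (intro tendsto_intros lim bounded_linear.tendsto[OF bounded_linear_EF(1)])
    then show "((\<lambda>t. sqrt (inner (embed d (w t)) (E (embed d (w t))))) \<longlongrightarrow> 0) (at_right 0)" by simp
  qed
  finally show ?thesis .
qed

lemma semigroup_deriv_iff:
  assumes T: "\<And>t. 0 \<le> t \<Longrightarrow> T t x \<in> L2 d" and x: "x \<in> L2 d" and y: "y \<in> L2 d"
  shows "semigroup_deriv weighted_inner T x y \<longleftrightarrow>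
    ((\<lambda>t. (1 / t) *\<^sub>R (embed d (T t x) - embed d x)) \<longlongrightarrow> embed d y) (at_right 0)"
proof -
  let ?w = "\<lambda>t \<zeta>. of_real (1 / t) \<cdot>\<^sub>v (T t x \<zeta> - x \<zeta>) - y \<zeta>"
  have w: "?w t \<in> L2 d" "embed d (?w t) = (1 / t) *\<^sub>R (embed d (T t x) - embed d x) - embed d y" if "0 < t" for t :: real
  proof -
    note Tt = T[OF less_imp_le[OF that]]
    note L = L2_diff[OF Tt x]
    show "?w t \<in> L2 d" by (rule L2_diff[OF L2_smult[OF L] y])
    show "embed d (?w t) = (1 / t) *\<^sub>R (embed d (T t x) - embed d x) - embed d y"
      by (simp only: embed_diff[OF L2_smult[OF L] y] embed_scaleR[OF L] embed_diff[OF Tt x])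
  qed
  have pos: "\<forall>\<^sub>F t in at_right (0::real). 0 < t" by (rule eventually_at_right_less)
  have "semigroup_deriv weighted_inner T x y \<longleftrightarrow> ((\<lambda>t. embed d (?w t)) \<longlongrightarrow> 0) (at_right 0)"
    unfolding semigroup_deriv_def by (rule ip_norm_tendsto_iff) (rule eventually_mono[OF pos w(1)])
  also have "\<dots> \<longleftrightarrow> ((\<lambda>t. (1 / t) *\<^sub>R (embed d (T t x) - embed d x) - embed d y) \<longlongrightarrow> 0) (at_right 0)"
    by (rule tendsto_cong) (rule eventually_mono[OF pos w(2)])
  also have "\<dots> \<longleftrightarrow> ((\<lambda>t. (1 / t) *\<^sub>R (embed d (T t x) - embed d x)) \<longlongrightarrow> embed d y) (at_right 0)"
    by (rule Lim_null[symmetric])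
  finally show ?thesis .
qed

text \<open>Contractivity and \<open>2 b u v \<le> b u u + b v v\<close> give \<open>b (T t x - x) x \<le> 0\<close>. Divide by \<open>t\<close> and let \<open>t\<close>
  tend to 0.\<close>

lemma generator_dissipative:
  assumes T: "contraction_semigroup d weighted_inner T" and A: "is_generator d weighted_inner T D A" and x: "x \<in> D"
  shows "re (L2_inner (A x) (mult_op H x)) \<le> 0"
proof -
  have L2: "x \<in> L2 d" "A x \<in> L2 d" and sd: "semigroup_deriv weighted_inner T x (A x)"
    using A x unfolding is_generator_def by blast+
  have TL2: "T t x \<in> L2 d" if "0 \<le> t" for t
    using T L2(1) that by (simp add: contraction_semigroup_def C0_semigroup_def)
  have lim: "((\<lambda>t. (1 / t) *\<^sub>R (embed d (T t x) - embed d x)) \<longlongrightarrow> embed d (A x)) (at_right 0)"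
    using semigroup_deriv_iff[of T x "A x"] TL2 L2 sd by blast
  let ?b = "\<lambda>q r. inner q (E r)"
  have le: "?b ((1 / t) *\<^sub>R (embed d (T t x) - embed d x)) (embed d x) \<le> 0" if t: "0 < t" for t
  proof -
    note Tt = TL2[OF less_imp_le[OF t]]
    have "ip_norm weighted_inner (T t x) \<le> ip_norm weighted_inner x"
      using T L2(1) t by (simp add: contraction_semigroup_def)
    then have *: "?b (embed d (T t x)) (embed d (T t x)) \<le> ?b (embed d x) (embed d x)"
      by (simp add: ip_norm_eq Tt L2(1))
    have "0 \<le> ?b (embed d (T t x) - embed d x) (embed d (T t x) - embed d x)" by (rule E_nonneg)
    also have "\<dots> = ?b (embed d (T t x)) (embed d (T t x)) - 2 * ?b (embed d (T t x)) (embed d x) + ?b (embed d x) (embed d x)"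
      using E_sym[of "embed d x" "embed d (T t x)"]
      by (simp add: linear_diff[OF bounded_linear.linear[OF bounded_linear_EF(1)]] inner_diff inner_commute)
    finally have "?b (embed d (T t x) - embed d x) (embed d x) \<le> 0"
      using * by (simp add: inner_diff_left)
    then show ?thesis using t by (simp add: divide_nonpos_pos)
  qed
  have "?b (embed d (A x)) (embed d x) \<le> 0"
  proof (rule tendsto_upperbound)
    show "((\<lambda>t. ?b ((1 / t) *\<^sub>R (embed d (T t x) - embed d x)) (embed d x)) \<longlongrightarrow> ?b (embed d (A x)) (embed d x)) (at_right 0)"
      by (intro tendsto_inner lim tendsto_const)
    show "\<forall>\<^sub>F t in at_right 0. ?b ((1 / t) *\<^sub>R (embed d (T t x) - embed d x)) (embed d x) \<le> 0"
      using eventually_at_right_less[of "0::real"] by eventually_elim (rule le)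
  qed simp
  then show ?thesis by (simp add: E_embed L2 inner_embed mult_op_L2[OF H(1)])
qed

end

locale port_hamiltonian =
  diagonalised d k n1 n2 P1 S WB \<Lambda> \<Theta> + weight d H H_inv
  for d k n1 n2 :: nat and P1 S WB :: "'f::real_or_complex mat" and \<Lambda> \<Theta> :: "real mat" and H H_inv :: "real \<Rightarrow> 'f mat"
begin

text \<open>The abstract theorem gives a semigroup of real linear maps on the whole Hilbert space. They commute
  with \<open>lin d a\<close> for every scalar \<open>a\<close>: for \<open>a = 1\<close> this means that they map \<open>L2 d\<close> into itself, and in
  general that they are linear over the field.\<close>

lemma generates_contraction_semigroup:
  assumes herm: "hermitian_mat d P1" and P0: "P0 \<in> carrier_mat d d" and k: "k \<le> n2"
    and P0_diss: "\<And>v. v \<in> carrier_vec d \<Longrightarrow> re ((P0 *\<^sub>v v) \<bullet>c v) \<le> 0"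
    and nonneg: "\<And>y. y \<in> carrier_vec d \<Longrightarrow> WB *\<^sub>v y = 0\<^sub>v k \<Longrightarrow> 0 \<le> re ((P1 *\<^sub>v y) \<bullet>c y)"
  shows "generates_contraction_semigroup d weighted_inner (AH_dom d k WB H) (AH_op d P0 P1 H)"
proof -
  let ?P = "mul d (\<lambda>_. P0)" and ?D = "{q. E q \<in> deriv_dom d k WB}"
  let ?A = "\<lambda>q. deriv_op d P1 (E q) + ?P (E q)"
  have P_diss: "inner (?P q) q \<le> 0" for q
  proof -
    have "0 \<le> (LINT \<zeta>|half_line. - re ((P0 *\<^sub>v proj d q \<zeta>) \<bullet>c proj d q \<zeta>))"
    proof (rule Bochner_Integration.integral_nonneg)
      fix \<zeta> assume "\<zeta> \<in> space half_line"
      then have "proj d q \<zeta> \<in> carrier_vec d" using L2_carrier[OF proj_L2] by (simp add: space_restrict_space)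
      then show "0 \<le> - re ((P0 *\<^sub>v proj d q \<zeta>) \<bullet>c proj d q \<zeta>)" using P0_diss by simp
    qed
    then show ?thesis unfolding inner_mul[OF Linf_const[OF P0]] by simp
  qed
  obtain c where "dissipative_operator (\<lambda>x y. inner x (E y)) ?D ?A c"
    using dissipative_operator_weighted[OF dissipative_operator_deriv[OF herm nonneg k] bounded_linear_EF(1) E_sym E_nonneg
        bounded_linear_EF(2) EF_inverse bounded_linear_mul[OF Linf_const[OF P0]] P_diss] by blast
  then interpret G: dissipative_operator "\<lambda>x y. inner x (E y)" ?D ?A c .
  have T_lin: "G.T t (lin d a q) = lin d a (G.T t q)" if t: "0 \<le> t" for t a q
  proof (rule G.T_commute[OF t bounded_linear_mul[OF Linf_scalar]])
    fix q assume "q \<in> ?D"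
    then have q: "E q \<in> deriv_dom d k WB" by simp
    have "E (lin d a q) = mul d H (lin d a q)" unfolding E_def by (simp only: proj_mul[OF Linf_scalar]) simp
    also have "\<dots> = lin d a (mul d H q + (q - embed d (proj d q)))"
      by (simp add: lin_mul[OF H(1)] linear_add[OF bounded_linear.linear[OF bounded_linear_mul[OF Linf_scalar]]]
          vanish_on_complement(2)[OF Linf_scalar])
    finally have E_lin: "E (lin d a q) = lin d a (E q)" by (simp only: E_def)
    have "embed d (proj d (0 :: 'f hilbert)) = 0"
      by (rule linear_0[OF bounded_linear.linear[OF bounded_linear_embed_proj]])
    then have "embed d (proj d (lin d a (E q))) = lin d a (E q) + embed d (proj d (0 :: 'f hilbert))"
      by (simp only: proj_mul[OF Linf_scalar] add_0_right)
    from deriv_op_lincomb[OF q zero_deriv_dom(1)[OF WB P1] P1 WB this]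
    have dom: "lin d a (E q) \<in> deriv_dom d k WB" "deriv_op d P1 (lin d a (E q)) = lin d a (deriv_op d P1 (E q))"
      by (simp_all add: zero_deriv_dom(2)[OF WB P1])
    show "lin d a q \<in> ?D" using dom(1) by (simp add: E_lin)
    show "?A (lin d a q) = lin d a (?A q)"
      by (simp add: E_lin dom(2) lin_mul[OF Linf_const[OF P0]]
          linear_add[OF bounded_linear.linear[OF bounded_linear_mul[OF Linf_scalar]]])
  qed
  define T where "T t x = proj d (G.T t (embed d x))" for t x
  have TL2: "T t x \<in> L2 d" for t x unfolding T_def by (rule proj_L2)
  have embed_T: "embed d (T t x) = G.T t (embed d x)" if "0 \<le> t" "x \<in> L2 d" for t x
    using T_lin[OF that(1), of 1 "embed d x"] by (simp add: T_def lin_one embed_proj_embed[OF that(2)])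
  have norm_T: "ip_norm weighted_inner (T t x) \<le> ip_norm weighted_inner x" if "0 \<le> t" "x \<in> L2 d" for t x
    using G.T_contraction[OF that(1), of "embed d x"] by (simp add: ip_norm_eq TL2 that embed_T)
  have "C0_semigroup d weighted_inner T"
    unfolding C0_semigroup_def
  proof (intro conjI allI impI ballI)
    fix t :: real and x z :: "real \<Rightarrow> 'f vec" and a :: 'f
    assume t: "0 \<le> t" and x: "x \<in> L2 d" and z: "z \<in> L2 d"
    show "ae_eq (T t x) (T t z)" if "ae_eq x z"
      using embed_eq_iff[OF x z] that by (simp add: T_def ae_eq_def)
    have L: "(\<lambda>\<zeta>. a \<cdot>\<^sub>v x \<zeta> + z \<zeta>) \<in> L2 d" by (rule L2_add[OF L2_smult[OF x] z])
    have "embed d (T t (\<lambda>\<zeta>. a \<cdot>\<^sub>v x \<zeta> + z \<zeta>)) = embed d (\<lambda>\<zeta>. a \<cdot>\<^sub>v T t x \<zeta> + T t z \<zeta>)"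
      by (simp only: embed_T[OF t L] embed_lincomb[OF x z] embed_lincomb[OF TL2 TL2] G.T_add[OF t] T_lin[OF t]
          embed_T[OF t x] embed_T[OF t z])
    then show "ae_eq (T t (\<lambda>\<zeta>. a \<cdot>\<^sub>v x \<zeta> + z \<zeta>)) (\<lambda>\<zeta>. a \<cdot>\<^sub>v T t x \<zeta> + T t z \<zeta>)"
      by (rule embed_eq_iff[OF TL2 L2_add[OF L2_smult[OF TL2] TL2], THEN iffD1])
  next
    fix t :: real assume "0 \<le> t"
    then show "\<exists>C. \<forall>x\<in>L2 d. ip_norm weighted_inner (T t x) \<le> C * ip_norm weighted_inner x"
      using norm_T by (intro exI[of _ 1]) simp
  next
    fix x :: "real \<Rightarrow> 'f vec" assume x: "x \<in> L2 d"
    show "ae_eq (T 0 x) x" using proj_embed[OF x] by (simp add: T_def G.T_0)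
    show "ae_eq (T (s + t) x) (T s (T t x))" if "0 \<le> s" "0 \<le> t" for s t
      using G.T_semigroup[OF that, of "embed d x"] by (simp add: T_def[of _ "T t x"] embed_T[OF that(2) x] T_def[of "s + t"] ae_eq_def)
    show "((\<lambda>t. ip_norm weighted_inner (\<lambda>\<zeta>. T t x \<zeta> - x \<zeta>)) \<longlongrightarrow> 0) (at_right 0)"
    proof (subst ip_norm_tendsto_iff)
      have "((\<lambda>t. G.T t (embed d x) - embed d x) \<longlongrightarrow> 0) (at_right 0)"
        using G.T_tendsto_0 by (rule LIM_zero)
      moreover have "\<forall>\<^sub>F t in at_right 0. embed d (\<lambda>\<zeta>. T t x \<zeta> - x \<zeta>) = G.T t (embed d x) - embed d x"
        using eventually_at_right_less[of "0::real"]
        by eventually_elim (simp add: embed_diff[OF TL2 x] embed_T x)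
      ultimately show "((\<lambda>t. embed d (\<lambda>\<zeta>. T t x \<zeta> - x \<zeta>)) \<longlongrightarrow> 0) (at_right 0)"
        by (subst tendsto_cong)
    qed (simp add: L2_diff TL2 x)
  qed (rule TL2)
  then have "contraction_semigroup d weighted_inner T"
    unfolding contraction_semigroup_def using norm_T by blast
  moreover have "is_generator d weighted_inner T (AH_dom d k WB H) (AH_op d P0 P1 H)"
  proof -
    have deriv: "semigroup_deriv weighted_inner T x y \<longleftrightarrow> ((\<lambda>t. (1 / t) *\<^sub>R (G.T t (embed d x) - embed d x)) \<longlongrightarrow> embed d y) (at_right 0)"
      if x: "x \<in> L2 d" and y: "y \<in> L2 d" for x y
    proof -
      have "\<forall>\<^sub>F t in at_right 0. (1 / t) *\<^sub>R (embed d (T t x) - embed d x) = (1 / t) *\<^sub>R (G.T t (embed d x) - embed d x)"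
        using eventually_at_right_less[of "0::real"] by eventually_elim (simp add: embed_T x)
      then show ?thesis unfolding semigroup_deriv_iff[OF TL2 x y] by (rule tendsto_cong)
    qed
    have dom: "embed d x \<in> ?D \<longleftrightarrow> x \<in> AH_dom d k WB H" if "x \<in> L2 d" for x
      using embed_deriv_dom(1)[OF mult_op_L2[OF H(1) that] P0 P1] that by (simp add: E_embed AH_eq_A_mult_op(2))
    have op: "AH_op d P0 P1 H x \<in> L2 d" "?A (embed d x) = embed d (AH_op d P0 P1 H x)" if x: "x \<in> AH_dom d k WB H" for x
    proof -
      have x': "x \<in> L2 d" "mult_op H x \<in> A_dom d k WB" using x by (auto simp: AH_eq_A_mult_op(2))
      obtain u g where "sobolev_rep d (mult_op H x) u g" using A_dom_rep[OF x'(2)] by blast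
      from A_op_rep(1)[OF this P0 P1] show "AH_op d P0 P1 H x \<in> L2 d" by (simp add: AH_eq_A_mult_op(1))
      show "?A (embed d x) = embed d (AH_op d P0 P1 H x)"
        using embed_deriv_dom(2)[OF mult_op_L2[OF H(1) x'(1)] P0 P1 x'(2)] by (simp add: E_embed[OF x'(1)] AH_eq_A_mult_op(1))
    qed
    have sd: "semigroup_deriv weighted_inner T x (AH_op d P0 P1 H x)" if x: "x \<in> AH_dom d k WB H" for x
    proof -
      have x': "x \<in> L2 d" using x by (simp add: AH_eq_A_mult_op(2))
      show ?thesis
        unfolding deriv[OF x' op(1)[OF x]] op(2)[OF x, symmetric]
        by (rule G.T_derivative) (use dom[OF x'] x in blast)
    qed
    have "AH_dom d k WB H \<subseteq> {x \<in> L2 d. \<exists>y\<in>L2 d. semigroup_deriv weighted_inner T x y}"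
      using op(1) sd by (auto simp: AH_eq_A_mult_op(2))
    moreover have "{x \<in> L2 d. \<exists>y\<in>L2 d. semigroup_deriv weighted_inner T x y} \<subseteq> AH_dom d k WB H"
    proof
      fix x assume "x \<in> {x \<in> L2 d. \<exists>y\<in>L2 d. semigroup_deriv weighted_inner T x y}"
      then obtain y where x: "x \<in> L2 d" and y: "y \<in> L2 d" "semigroup_deriv weighted_inner T x y" by blast
      from G.T_generator[OF y(2)[unfolded deriv[OF x y(1)]]] show "x \<in> AH_dom d k WB H"
        using dom[OF x] by blast
    qed
    ultimately show ?thesis
      unfolding is_generator_def using op(1) sd by (intro conjI equalityI ballI) blast+
  qed
  ultimately show ?thesis unfolding generates_contraction_semigroup_def by blast
qed

text \<open>The vector \<open>z = H\<^sup>-\<^sup>1 x\<close> is in the domain of the generator, and its weighted inner product with the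
  value of the generator is that of \<open>x\<close> with \<open>A x\<close>.\<close>

lemma dissipative_if_generates:
  assumes P: "P0 \<in> carrier_mat d d"
    and gen: "generates_contraction_semigroup d weighted_inner (AH_dom d k WB H) (AH_op d P0 P1 H)" and x: "x \<in> A_dom d k WB"
  shows "re (L2_inner (A_op d P0 P1 x) x) \<le> 0"
proof -
  have x2: "x \<in> L2 d" using x by (auto simp: A_dom_def W12_def)
  let ?z = "mult_op H_inv x"
  have z: "?z \<in> L2 d" "mult_op H ?z \<in> L2 d" by (intro mult_op_L2 H H_inv x2)+
  note Hz = A_dom_cong[OF x z(2) mult_op_inverse(1)[OF x2] P P1]
  have "?z \<in> AH_dom d k WB H" using Hz(1) z by (simp add: AH_eq_A_mult_op(2))
  then have "re (L2_inner (AH_op d P0 P1 H ?z) (mult_op H ?z)) \<le> 0"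
    using gen generator_dissipative unfolding generates_contraction_semigroup_def by blast
  then show ?thesis using Hz(2) by (simp add: AH_eq_A_mult_op(1))
qed

end

theorem theorem2p7:
  fixes d k n1 n2 :: nat
    and P0 P1 S S_inv WB :: "'f::real_or_complex mat"
    and H H_inv :: "real \<Rightarrow> 'f mat"
    and \<Lambda> \<Theta> :: "real mat"
  assumes P1: "hermitian_mat d P1" "invertible_mat P1"
    and P0: "P0 \<in> carrier_mat d d"
    and H: "Linf_mat d H" "AE \<zeta> in half_line. pos_def_mat d (H \<zeta>)"
    and H_inv: "Linf_mat d H_inv"
      "AE \<zeta> in half_line. inverts_mat (H \<zeta>) (H_inv \<zeta>) \<and> inverts_mat (H_inv \<zeta>) (H \<zeta>)"
    and n1: "n1 = num_pos_eigenvalues P1"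
    and n2: "n2 = d - n1" "n2 = num_neg_eigenvalues P1"
    and S: "unitary_mat d S"
    and \<Lambda>: "\<Lambda> \<in> carrier_mat n1 n1" "diagonal_mat \<Lambda>" "pos_def_mat n1 \<Lambda>"
    and \<Theta>: "\<Theta> \<in> carrier_mat n2 n2" "diagonal_mat \<Theta>" "neg_def_mat n2 \<Theta>"
    and factorization:
      "similar_mat_wit P1 (block_diag (map_mat of_real \<Lambda>) (map_mat of_real \<Theta>)) S_inv S"
    and WB: "WB \<in> carrier_mat k d" "k \<le> n2" "vec_space.rank k WB = k"
  shows "all_equivalent
    [generates_contraction_semigroup d (\<lambda>x z. L2_inner x (mult_op H z))
       (AH_dom d k WB H) (AH_op d P0 P1 H),
     \<forall>x\<in>A_dom d k WB. re (L2_inner (A_op d P0 P1 x) x) \<le> 0,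
     neg_semidef_mat d (Re_mat P0) \<and> (\<forall>y\<in>mat_kernel WB. 0 \<le> (P1 *\<^sub>v y) \<bullet>c y),
     neg_semidef_mat d (Re_mat P0) \<and> k = n2 \<and>
       (\<exists>B U. B \<in> carrier_mat n2 n2 \<and> invertible_mat B \<and> U \<in> carrier_mat n2 n1 \<and>
          WB = B * append_cols U (1\<^sub>m n2) * S \<and>
          pos_semidef_mat n1
            (map_mat of_real \<Lambda> + mat_adjoint U * map_mat of_real \<Theta> * U))]"
proof -
  let ?\<Delta> = "block_diag (map_mat of_real \<Lambda>) (map_mat of_real \<Theta>) :: 'f mat"
  have P1c: "P1 \<in> carrier_mat d d" using P1(1) by (simp add: hermitian_mat_def)
  note wit = similar_mat_witD2[OF P1c factorization]
  have Sc: "S \<in> carrier_mat d d" and SS: "mat_adjoint S * S = 1\<^sub>m d" "S * mat_adjoint S = 1\<^sub>m d"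
    using S by (auto simp: unitary_mat_def)
  have "S_inv = S_inv * (S * mat_adjoint S)" using SS(2) wit(6) by simp
  also have "\<dots> = (S_inv * S) * mat_adjoint S"
    by (rule assoc_mult_mat[symmetric, OF wit(6) Sc mat_adjoint_carrier[OF Sc]])
  also have "\<dots> = mat_adjoint S" using wit(1) left_mult_one_mat[OF mat_adjoint_carrier[OF Sc]] by simp
  finally have S_inv: "S_inv = mat_adjoint S" .
  have "d = n1 + n2" using wit(5) \<Lambda>(1) \<Theta>(1) by (auto simp: block_diag_def)
  interpret ph: port_hamiltonian d k n1 n2 P1 S WB \<Lambda> \<Theta> H H_inv
    by unfold_locales
      (fact P1c Sc SS \<Lambda>(1,2) definite_diagonal(1)[OF \<Lambda>(1,2) _ \<Lambda>(3)] \<Theta>(1,2) definite_diagonal(2)[OF \<Theta>(1,2) _ \<Theta>(3)]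
        \<open>d = n1 + n2\<close> wit(3)[unfolded S_inv] WB(1) H H_inv)+
  let ?diss = "\<forall>v\<in>carrier_vec d. re ((P0 *\<^sub>v v) \<bullet>c v) \<le> 0"
  let ?nonneg = "\<forall>y\<in>carrier_vec d. WB *\<^sub>v y = 0\<^sub>v k \<longrightarrow> 0 \<le> re ((P1 *\<^sub>v y) \<bullet>c y)"
  let ?c1 = "generates_contraction_semigroup d (\<lambda>x z. L2_inner x (mult_op H z)) (AH_dom d k WB H) (AH_op d P0 P1 H)"
  let ?c2 = "\<forall>x\<in>A_dom d k WB. re (L2_inner (A_op d P0 P1 x) x) \<le> 0"
  let ?c3 = "neg_semidef_mat d (Re_mat P0) \<and> (\<forall>y\<in>mat_kernel WB. 0 \<le> (P1 *\<^sub>v y) \<bullet>c y)"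
  let ?ex = "\<exists>B U. B \<in> carrier_mat n2 n2 \<and> invertible_mat B \<and> U \<in> carrier_mat n2 n1 \<and>
          WB = B * append_cols U (1\<^sub>m n2) * S \<and>
          pos_semidef_mat n1 (map_mat of_real \<Lambda> + mat_adjoint U * map_mat of_real \<Theta> * U)"
  let ?c4 = "neg_semidef_mat d (Re_mat P0) \<and> k = n2 \<and> ?ex"
  have P0_iff: "neg_semidef_mat d (Re_mat P0) \<longleftrightarrow> ?diss" by (rule neg_semidef_Re_mat_iff[OF P0])
  have "mat_kernel WB = {y \<in> carrier_vec d. WB *\<^sub>v y = 0\<^sub>v k}" using WB(1) by (auto simp: mat_kernel_def)
  then have c3: "?c3 \<longleftrightarrow> ?diss \<and> ?nonneg"
    unfolding P0_iff using re_nonneg_form_iff[OF P1(1)] by auto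
  have 12: "?c2" if ?c1 using ph.dissipative_if_generates[OF P0 that] by blast
  have 23: "?c3" if ?c2
    unfolding c3 using boundary_form_nonneg_if_dissipative[OF P0 P1(1) WB(1)] that by blast
  have 31: "?c1" if ?c3
    using that unfolding c3 by (intro ph.generates_contraction_semigroup[OF P1(1) P0 WB(2)]) blast+
  have 34: "?c4" if ?c3
  proof -
    have nonneg: "\<And>y. y \<in> carrier_vec d \<Longrightarrow> WB *\<^sub>v y = 0\<^sub>v k \<Longrightarrow> 0 \<le> re ((P1 *\<^sub>v y) \<bullet>c y)"
      using that unfolding c3 by blast
    show ?thesis
      by (intro conjI conjunct1[OF that] ph.boundary_matrix_of_nonneg_form(1)[OF nonneg WB(2)] ph.boundary_matrix_of_nonneg_form(2)[OF nonneg WB(2)])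
  qed
  have 43: "?c3" if c4: ?c4
  proof -
    have k: "k = n2" and "?ex" using c4 by blast+
    then obtain B U where BU: "B \<in> carrier_mat n2 n2" "invertible_mat B" "U \<in> carrier_mat n2 n1"
        "WB = B * append_cols U (1\<^sub>m n2) * S"
        "pos_semidef_mat n1 (map_mat of_real \<Lambda> + mat_adjoint U * map_mat of_real \<Theta> * U)"
      by blast
    have ?nonneg using ph.nonneg_form_of_boundary_matrix[OF BU] unfolding k by blast
    moreover have ?diss using c4 P0_iff by blast
    ultimately show ?thesis unfolding c3 by blast
  qed
  have "?c1 \<longleftrightarrow> ?c2" by (rule iffI) (erule 12, erule 31[OF 23])
  moreover have "?c2 \<longleftrightarrow> ?c3" by (rule iffI) (erule 23, erule 12[OF 31])
  moreover have "?c3 \<longleftrightarrow> ?c4" by (rule iffI) (erule 34, erule 43)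
  ultimately show ?thesis unfolding all_equivalent_def by simp
qed

end
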